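(* Let $f\in\mathcal{F}$, $f\colon D\to V$, and let $G_w(z)=f(z)+w$. Suppose that $c_1\in\overline{D}$ is such that $g=G_{c_1}$ has an attracting or parabolic cycle $\mathcal{O}=\{a_0,\dots,a_{q-1}\}$ of period $q$ with multiplier $\kappa\neq0$. Then $c_n=g^{n-1}(c_1)$ is well defined for all $n\ge 1$ and converges to $\mathcal{O}$ as $n\to\infty$, and the following transversality holds: $$\kappa'(c_1)\neq0\ \text{ if }\kappa\neq1,\qquad\text{and}\qquad Q(a_j)\neq0\ \text{ for } a_j\in\mathcal{O}\ \text{ if }\kappa=1.$$
   Context: $\mathcal{F}$ is the collection of holomorphic maps $f\colon D\to V$ where: (1) $D$ is a bounded open set in $\mathbb{C}$ with $0\in\overline{D}$; (2) $V$ is a bounded open set in $\mathbb{C}$; (3) $f\colon D\setminus\{0\}\to V\setminus\{0\}$ is an unbranched covering; (4) $V\supset B(0;\operatorname{diam}(D))\supset D$, where $B(0;r)$ is the open disk of radius $r$ about $0$. The multiplier of $\mathcal{O}$ is $\kappa=(g^q)'(a_0)$. Attracting means $|\kappa|<1$; parabolic means $\kappa$ is a root of unity. If $\kappa\ne1$, then by the implicit function theorem there is a holomorphic function $a_0(w)$ for $w$ near $c_1$ with $a_0(c_1)=a_0$ and $G_w^q(a_0(w))=a_0(w)$; $\kappa(w)$ denotes $(G_w^q)'(a_0(w))$ and $\kappa'(c_1)$ is its derivative in $w$ at $w=c_1$. Further, $Q(z)=\frac{d}{dw}G_w^q(z)\big|_{w=c_1}$. *)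

theory Defs
  imports "HOL-Complex_Analysis.Complex_Analysis"
begin

text \<open>
  Maps are total functions on the complex plane; only their values on \<open>D\<close> matter. The
  library's \<^const>\<open>covering_space\<close> includes surjectivity, and puts no connectedness
  assumption on \<open>D\<close> or \<open>V\<close>. The point \<open>0\<close> may or may not belong to \<open>D\<close>.
\<close>

definition class_F :: "complex set \<Rightarrow> complex set \<Rightarrow> (complex \<Rightarrow> complex) \<Rightarrow> bool" where
  "class_F D V f \<longleftrightarrow>
     f holomorphic_on D \<and> f ` D \<subseteq> V \<and>
     open D \<and> bounded D \<and> 0 \<in> closure D \<and>
     open V \<and> bounded V \<and>
     covering_space (D - {0}) f (V - {0}) \<and>
     ball 0 (diameter D) \<subseteq> V \<and> D \<subseteq> ball 0 (diameter D)"

definition G :: "(complex \<Rightarrow> complex) \<Rightarrow> complex \<Rightarrow> complex \<Rightarrow> complex" where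
  "G f w z = f z + w"

definition is_cycle ::
    "complex set \<Rightarrow> (complex \<Rightarrow> complex) \<Rightarrow> nat \<Rightarrow> (nat \<Rightarrow> complex) \<Rightarrow> bool" where
  "is_cycle D g q a \<longleftrightarrow>
     q \<ge> 1 \<and> inj_on a {..<q} \<and> (\<forall>j<q. a j \<in> D \<and> g (a j) = a (Suc j mod q))"

definition multiplier :: "(complex \<Rightarrow> complex) \<Rightarrow> nat \<Rightarrow> complex \<Rightarrow> complex" where
  "multiplier g q z = deriv (g ^^ q) z"

definition attracting :: "complex \<Rightarrow> bool" where
  "attracting \<kappa> \<longleftrightarrow> norm \<kappa> < 1"

definition parabolic :: "complex \<Rightarrow> bool" where
  "parabolic \<kappa> \<longleftrightarrow> (\<exists>m::nat. m \<ge> 1 \<and> \<kappa> ^ m = 1)"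

text \<open>
  A holomorphic continuation \<open>\<alpha>\<close> of the periodic point \<open>a\<^sub>0\<close>, defined on a neighbourhood \<open>U\<close>
  of \<open>c\<^sub>1\<close>. Requiring the orbit of \<open>\<alpha> w\<close> to stay in \<open>D\<close> expresses that the \<open>q\<close>-th iterate of
  the partial map \<open>z \<mapsto> f z + w\<close> is defined at \<open>\<alpha> w\<close>.
\<close>

definition periodic_continuation ::
    "complex set \<Rightarrow> (complex \<Rightarrow> complex) \<Rightarrow> complex \<Rightarrow> nat \<Rightarrow> complex \<Rightarrow>
     complex set \<Rightarrow> (complex \<Rightarrow> complex) \<Rightarrow> bool" where
  "periodic_continuation D f c1 q a0 U \<alpha> \<longleftrightarrow>
     open U \<and> c1 \<in> U \<and> \<alpha> holomorphic_on U \<and> \<alpha> c1 = a0 \<and>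
     (\<forall>w\<in>U. (\<forall>j<q. (G f w ^^ j) (\<alpha> w) \<in> D) \<and> (G f w ^^ q) (\<alpha> w) = \<alpha> w)"

definition Q :: "(complex \<Rightarrow> complex) \<Rightarrow> complex \<Rightarrow> nat \<Rightarrow> complex \<Rightarrow> complex" where
  "Q f c1 q z = deriv (\<lambda>w. (G f w ^^ q) z) c1"

end

theory Submission imports Defs "HOL-Real_Asymp.Real_Asymp" begin

text \<open>Lifting through the covering \<open>f\<close> turns a holomorphic motion of the orbit of \<open>c\<^sub>1\<close> into another one, and all motions
stay in the bounded domain \<open>D\<close>. If the critical orbit avoided an attracting direction or petal of the cycle, backward lifts
would collapse the petal; hence it converges to the cycle. Write \<open>\<rho>\<^sub>n = 1 / (g\<^sup>n)'(c\<^sub>1)\<close>. First order terms of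
iterated lifts satisfy a convolution equation with kernel \<open>\<rho>\<close> and a bounded solution, while failure of transversality makes
the partial sums of the kernel (twisted by the multiplier) anomalously small. For an attracting cycle a motion along the
linearising coordinate contradicts this. For a parabolic cycle it only follows that the multiplier is \<open>\<kappa>\<close> for all parameters
near \<open>c\<^sub>1\<close>; but the set of parameters in \<open>D\<close> having a cycle with multiplier \<open>\<kappa>\<close> cannot have interior, because at a
boundary point the cycle would have to leave \<open>D\<close>, which lifting a half-plane \<open>d e\<^sup>-\<^sup>z\<close> through \<open>f\<close> and the
diameter bound exclude.\<close>

subsection \<open>Sums of sequences of polynomial growth\<close>

text \<open>Failure of transversality is first put in linear form: along the cycle the recursion x'
  = f' x + 1 has a periodic solution, and for \<kappa> \<noteq> 1 the logarithmic derivative of the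
  multiplier along it vanishes. What follows is a comparison of orders of growth: tangency replaces
  O by o in the partial sums of the twisted kernel at one precise order, which excludes motions
  whose first order term is exact at the next order. For a parabolic cycle the perturbed orbit need
  not stay near the cycle, so it does not provide a motion. The remedy is to correct the return map
  by an affine map once per period so that the multiplier stays \<kappa>; what is tested is then the
  size of the correction, at every order in the parameter. Hence the outcome is not a contradiction
  but a persistent family of cycles, which needs the separate argument in the parameter plane. There
  the orbit could slip out of the domain through an isolated puncture where \<open>f\<close> tends
  to 0, possibly through 0 if it is missing from \<open>D\<close>; the last step therefore works in
  the domain with these punctures filled.\<close>

lemma increments_small:
 fixes B :: "nat => complex"
 assumes q: "q \<ge> 1" and lim: "(%n. (B (n + q) - B n) / of_nat n ^ k) \<longlonglongrightarrow> 0"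
 shows "(%n. B n / of_nat n ^ (k + 1)) \<longlonglongrightarrow> 0"
proof (rule LIMSEQ_I)
 fix e :: real assume e: "e > 0"
 obtain N0 where N0: "!!n. n \<ge> N0 ==> norm ((B (n + q) - B n) / of_nat n ^ k) < e/2"
  using LIMSEQ_D[OF lim, of "e/2"] e by auto
 define N where "N = max N0 1"
 have N: "norm (B (n + q) - B n) \<le> e/2 * real n ^ k" if "n \<ge> N" for n
 proof -
  have "norm (B (n + q) - B n) / real n ^ k < e/2"
   using N0[of n] that by (simp add: N_def norm_divide norm_power)
  moreover have "real n ^ k > 0" using that by (simp add: N_def)
  ultimately show ?thesis by (simp add: field_simps)
 qed
 define C where "C = (\<Sum>i<N+q. norm (B i))"
 have C0: "C \<ge> 0" by (simp add: C_def sum_nonneg)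
 \<comment> \<open>Induction in steps of \<open>q\<close>: the increment e/2 m^k is absorbed because
   m^k (m + 1) \<le> n^(k+1) for n = m + q.\<close>
 have bd: "norm (B n) \<le> C + e/2 * real n ^ (k+1)" for n
 proof (induction n rule: less_induct)
  case (less n)
  show ?case
  proof (cases "n < N + q")
   case True
   have "norm (B n) \<le> C" unfolding C_def
    by (rule member_le_sum) (use True in auto)
   thus ?thesis using e by (smt (verit) zero_le_mult_iff zero_le_power of_nat_0_le_iff half_gt_zero)
  next
   case False
   define m where "m = n - q"
   have m: "n = m + q" "m \<ge> N" "m < n" using False q by (auto simp: m_def)
   have "norm (B n) \<le> norm (B m) + norm (B (m+q) - B m)"
    using m by (metis norm_triangle_sub)
   also have "\<dots> \<le> C + e/2 * real m ^ (k+1) + e/2 * real m ^ k"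
    using less.IH[OF m(3)] N[OF m(2)] by simp
   also have "\<dots> = C + e/2 * (real m ^ k * (real m + 1))" by (simp add: algebra_simps)
   also have "real m ^ k * (real m + 1) \<le> real n ^ k * real n"
    using m q by (intro mult_mono power_mono) auto
   hence "C + e/2 * (real m ^ k * (real m + 1)) \<le> C + e/2 * real n ^ (k+1)"
    using e by (simp add: mult.commute)
   finally show ?thesis .
  qed
 qed
 have "(%n. C / real n ^ (k+1)) \<longlonglongrightarrow> 0"
  by (intro tendsto_divide_0[OF tendsto_const] filterlim_at_top_imp_at_infinity filterlim_pow_at_top)
    (auto intro: filterlim_real_sequentially)
 from LIMSEQ_D[OF this, of "e/2"] obtain M where M: "!!n. n \<ge> M ==> norm (C / real n ^ (k+1)) < e/2"
  using e by (metis diff_zero half_gt_zero)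
 show "\<exists>no. \<forall>n\<ge>no. norm (B n / of_nat n ^ (k + 1) - 0) < e"
 proof (intro exI[of _ "max M 1"] allI impI)
  fix n assume n: "n \<ge> max M 1"
  have p: "real n ^ (k+1) > 0" using n by simp
  have "norm (B n / of_nat n ^ (k + 1)) = norm (B n) / real n ^ (k+1)"
   by (simp add: norm_divide norm_mult norm_power)
  also have "\<dots> \<le> (C + e/2 * real n ^ (k+1)) / real n ^ (k+1)"
   using bd[of n] p by (intro divide_right_mono) auto
  also have "\<dots> = C / real n ^ (k+1) + e/2" using n by (simp add: add_divide_distrib)
  also have "\<dots> < e"
  proof -
  have "C / real n ^ (k+1) \<le> norm (C / real n ^ (k+1))" unfolding real_norm_def by (rule abs_ge_self)
  thus ?thesis using M[of n] n by linarith
  qed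
  finally show "norm (B n / of_nat n ^ (k + 1) - 0) < e" by simp
 qed
qed

text \<open>The largest exponent used below is \<open>\<iota> + 1\<close> with
  \<open>\<iota>\<close> \<le> 1, so three concrete asymptotic computations suffice.\<close>

lemma power_increment_lim:
 assumes "k \<le> 2"
 shows "(%n. ((of_nat (n + q)) ^ (k+1) - of_nat n ^ (k+1)) / (of_nat n ^ k :: complex))
      \<longlonglongrightarrow> of_nat q * of_nat (k+1)"
proof -
 have 0: "(%n. ((real n + q) ^ 1 - real n ^ 1) / (real n ^ 0)) \<longlonglongrightarrow> q" for q :: real
  by real_asymp
 have 1: "(%n. ((real n + q) ^ 2 - real n ^ 2) / (real n ^ 1)) \<longlonglongrightarrow> q * 2" for q :: real
  by real_asymp
 have 2: "(%n. ((real n + q) ^ 3 - real n ^ 3) / (real n ^ 2)) \<longlonglongrightarrow> q * 3" for q :: real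
  by real_asymp
 have k: "k = 0 \<or> k = 1 \<or> k = 2" using assms by linarith
 have "(%n. ((real n + real q) ^ (k+1) - real n ^ (k+1)) / (real n ^ k)) \<longlonglongrightarrow> real q * real (k+1)"
  using k 0[of "real q"] 1[of "real q"] 2[of "real q"] by (elim disjE) (simp_all add: numeral_eq_Suc)
 from tendsto_of_real[OF this, where 'a = complex] show ?thesis by simp
qed

text \<open>A Stolz-Cesaro theorem with step \<open>q\<close>. Subtracting the exact power t
  n^(k+1), whose q-step increments have the same limit, leaves only the case of limit zero.\<close>

lemma stolz_step:
 fixes A :: "nat => complex"
 assumes q: "q \<ge> 1" and k: "k \<le> 2" and lim: "(%n. (A (n + q) - A n) / of_nat n ^ k) \<longlonglongrightarrow> s"
 shows "(%n. A n / of_nat n ^ (k + 1)) \<longlonglongrightarrow> s / (of_nat q * of_nat (k + 1))"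
proof -
 define t where "t = s / (of_nat q * of_nat (k + 1))"
 have ts: "t * (of_nat q * of_nat (k+1)) = s" using q by (simp add: t_def del: of_nat_Suc of_nat_add)
 define B where "B = (%n. A n - t * of_nat n ^ (k+1))"
 have eq: "(B (n + q) - B n) / of_nat n ^ k = (A (n + q) - A n) / of_nat n ^ k
   - t * ((of_nat (n+q) ^ (k+1) - of_nat n ^ (k+1)) / of_nat n ^ k)" for n
  by (simp add: B_def field_simps diff_divide_distrib add_divide_distrib)
 have "(%n. (B (n + q) - B n) / of_nat n ^ k) \<longlonglongrightarrow> s - t * (of_nat q * of_nat (k+1))"
  unfolding eq by (intro tendsto_intros lim power_increment_lim k)
 hence "(%n. B n / of_nat n ^ (k+1)) \<longlonglongrightarrow> 0"
  using ts by (intro increments_small[OF q]) simp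
 hence "(%n. B n / of_nat n ^ (k+1) + t) \<longlonglongrightarrow> 0 + t" by (intro tendsto_intros)
 moreover have "\<forall>\<^sub>F n in sequentially. B n / of_nat n ^ (k+1) + t = A n / of_nat n ^ (k+1)"
  using eventually_gt_at_top[of 0] by eventually_elim (simp add: B_def field_simps)
 ultimately have "(%n. A n / of_nat n ^ (k+1)) \<longlonglongrightarrow> 0 + t"
  by (rule Lim_transform_eventually)
 thus ?thesis by (simp add: t_def)
qed

lemma sum_periodic_shift:
 fixes p :: "nat => complex"
 assumes "!!n. p (n + q) = p n"
 shows "(\<Sum>j<q. p (n + j)) = (\<Sum>j<q. p j)"
proof (induction n)
 case (Suc n)
 have "(\<Sum>j<q. p (Suc n + j)) + p n = (\<Sum>j<Suc q. p (n + j))"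
  by (subst sum.lessThan_Suc_shift) simp
 also have "\<dots> = (\<Sum>j<q. p (n + j)) + p n" using assms by simp
 finally show ?case using Suc by simp
qed simp

text \<open>A sum over \<open>q\<close> consecutive indices forgets the phase of the periodic
  factor, so the q-step increments of the partial sums converge after division by n^k. This is how
  averages over the cycle enter.\<close>

lemma cesaro_periodic:
 fixes a p :: "nat => complex"
 assumes q: "q \<ge> 1" and k: "k \<le> 2" and per: "!!n. p (n + q) = p n"
  and lim: "(%n. a n / of_nat n ^ k - p n) \<longlonglongrightarrow> 0"
 shows "(%M. (\<Sum>n<M. a n) / of_nat M ^ (k + 1)) \<longlonglongrightarrow> (\<Sum>j<q. p j) / (of_nat q * of_nat (k + 1))"
proof (rule stolz_step[OF q k])
 have ratio: "(%n. (of_nat (n + j) / of_nat n) ^ k :: complex) \<longlonglongrightarrow> 1" for j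
 proof -
  have "(%n. (real n + c) / real n) \<longlonglongrightarrow> 1" for c :: real by real_asymp
  from tendsto_of_real[OF this[of "real j"], where 'a = complex]
  have "(%n. of_nat (n + j) / of_nat n :: complex) \<longlonglongrightarrow> 1" by simp
  from tendsto_power[OF this, of k] show ?thesis by simp
 qed
 have pm: "p n = p (n mod q)" for n
 proof (induction n rule: less_induct)
  case (less n)
  show ?case
  proof (cases "n < q")
   case False
   hence "p n = p (n - q)" using per[of "n - q"] by simp
   also have "\<dots> = p ((n - q) mod q)" using less.IH[of "n - q"] False q by simp
   finally show ?thesis using False by (simp add: le_mod_geq)
  qed simp
 qed
 define Kp where "Kp = (\<Sum>j<q. norm (p j))"
 have bp: "norm (p n) \<le> Kp" for n
  unfolding Kp_def using q by (subst pm) (intro member_le_sum, auto)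
 have 1: "(%n. a (n + j) / of_nat n ^ k - p (n + j)) \<longlonglongrightarrow> 0" for j
 proof -
  have A: "(%n. (a (n + j) / of_nat (n + j) ^ k - p (n + j)) * (of_nat (n + j) / of_nat n) ^ k) \<longlonglongrightarrow> 0 * 1"
   by (intro tendsto_mult ratio LIMSEQ_ignore_initial_segment[OF lim])
  have B: "(%n. ((of_nat (n + j) / of_nat n) ^ k - 1) * p (n + j)) \<longlonglongrightarrow> 0"
  proof (rule Lim_null_comparison)
   have "(%n. norm ((of_nat (n + j) / of_nat n) ^ k - 1 :: complex) * Kp) \<longlonglongrightarrow> norm (1 - 1 :: complex) * Kp"
    by (intro tendsto_intros ratio)
   thus "(%n. norm ((of_nat (n + j) / of_nat n) ^ k - 1 :: complex) * Kp) \<longlonglongrightarrow> 0" by simp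
   show "\<forall>\<^sub>F n in sequentially. norm (((of_nat (n + j) / of_nat n) ^ k - 1) * p (n + j))
     \<le> norm ((of_nat (n + j) / of_nat n) ^ k - 1 :: complex) * Kp"
    unfolding norm_mult by (intro always_eventually allI mult_left_mono bp) simp
  qed
  have "\<forall>\<^sub>F n in sequentially. (a (n + j) / of_nat (n + j) ^ k - p (n + j)) * (of_nat (n + j) / of_nat n) ^ k
    + ((of_nat (n + j) / of_nat n) ^ k - 1) * p (n + j) = a (n + j) / of_nat n ^ k - p (n + j)"
   using eventually_gt_at_top[of 0]
   by eventually_elim (simp add: field_simps power_divide del: of_nat_add)
  with tendsto_add[OF A B] show ?thesis
   by (simp add: Lim_transform_eventually)
 qed
 have "(%n. \<Sum>j<q. (a (n + j) / of_nat n ^ k - p (n + j))) \<longlonglongrightarrow> (\<Sum>j<q. 0)"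
  by (intro tendsto_sum 1)
 hence "(%n. (\<Sum>j<q. (a (n + j) / of_nat n ^ k - p (n + j))) + (\<Sum>j<q. p j)) \<longlonglongrightarrow> 0 + (\<Sum>j<q. p j)"
  by (intro tendsto_intros) auto
 moreover have "(\<Sum>j<q. (a (n + j) / of_nat n ^ k - p (n + j))) + (\<Sum>j<q. p j)
   = (sum a {..<n + q} - sum a {..<n}) / of_nat n ^ k" for n
 proof -
  have "sum a {..<n + q} = sum a {..<n} + (\<Sum>j<q. a (n + j))"
   by (induction q) auto
  thus ?thesis using sum_periodic_shift[of p q n, OF per]
   by (simp add: sum_subtractf sum_divide_distrib)
 qed
 ultimately show "(%n. (sum a {..<n + q} - sum a {..<n}) / of_nat n ^ k) \<longlonglongrightarrow> sum p {..<q}" by simp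
qed

text \<open>Summing over n first turns the double sum into a sum of \<open>x i\<close> times partial
  sums of \<open>r\<close>. Cancellation inside the kernel is thereby exploited although
  \<open>x\<close> is only known to be bounded.\<close>

lemma convolution_small:
 fixes r x :: "nat => complex"
 assumes K: "!!i. norm (x i) \<le> K" and k: "(%M. (\<Sum>n<M. r n) / of_nat M ^ k) \<longlonglongrightarrow> 0"
 shows "(%M. (\<Sum>n<M. \<Sum>i\<le>n. r (n - i) * x i) / of_nat M ^ (k + 1)) \<longlonglongrightarrow> 0"
proof -
 define Rs where "Rs = (%M. \<Sum>n<M. r n)"
 have K0: "K \<ge> 0" using K[of 0] norm_ge_zero order_trans by blast
 have eq: "(\<Sum>n<M. \<Sum>i\<le>n. r (n - i) * x i) = (\<Sum>i<M. x i * Rs (M - i))" for M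
 proof (induction M)
  case (Suc M)
  have "(\<Sum>i<Suc M. x i * Rs (Suc M - i)) = (\<Sum>i<M. x i * (Rs (M - i) + r (M - i))) + x M * r 0"
   by (simp add: Rs_def Suc_diff_le)
  also have "\<dots> = (\<Sum>i<M. x i * Rs (M - i)) + (\<Sum>i\<le>M. r (M - i) * x i)"
   by (simp add: ring_distribs sum.distrib mult.commute lessThan_Suc_atMost[symmetric])
  finally show ?case using Suc by simp
 qed simp
 \<comment> \<open>The absolute values are embedded in the complex numbers so that
   \<open>increments_small\<close> applies with step 1.\<close>
 define B where "B = (%M. of_real (\<Sum>j<M. norm (Rs j)) :: complex)"
 have "(%n. (B (n + 1) - B n) / of_nat n ^ k) \<longlonglongrightarrow> 0"
 proof -
  have "(%n. of_real (norm (Rs n / of_nat n ^ k)) :: complex) \<longlonglongrightarrow> of_real (norm (0::complex))"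
   unfolding Rs_def by (intro tendsto_intros k)
  thus ?thesis by (simp add: B_def norm_divide norm_power)
 qed
 hence B: "(%n. B n / of_nat n ^ (k+1)) \<longlonglongrightarrow> 0" by (intro increments_small) auto
 have "(%n. (B (n + 1) - B n) / of_nat n ^ k * (1 / of_nat n)) \<longlonglongrightarrow> 0 * 0"
  by (intro tendsto_mult \<open>(%n. (B (n + 1) - B n) / of_nat n ^ k) \<longlonglongrightarrow> 0\<close> lim_1_over_n)
 from tendsto_add[OF B this]
 have B1: "(%n. B n / of_nat n ^ (k+1) + (B (n + 1) - B n) / of_nat n ^ k * (1 / of_nat n)) \<longlonglongrightarrow> 0" by simp
 have B2: "B n / of_nat n ^ (k+1) + (B (n + 1) - B n) / of_nat n ^ k * (1 / of_nat n) = B (n+1) / of_nat n ^ (k+1)" for n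
  by (cases n) (auto simp: field_simps simp del: of_nat_Suc)
 have fin: "(%n. K * norm (B (n+1) / of_nat n ^ (k+1))) \<longlonglongrightarrow> 0"
  unfolding B2 using tendsto_mult[OF tendsto_const[of K] tendsto_norm[OF B1[unfolded B2]]] by simp
 show ?thesis
 proof (rule Lim_null_comparison[OF _ fin], rule always_eventually, rule allI)
  fix M
  have "norm (\<Sum>i<M. x i * Rs (M - i)) \<le> (\<Sum>i<M. K * norm (Rs (M - i)))"
   by (rule sum_norm_le) (auto simp: norm_mult intro!: mult_right_mono K)
  also have "\<dots> = K * (\<Sum>i<M. norm (Rs (M - i)))" by (simp add: sum_distrib_left)
  also have "(\<Sum>i<M. norm (Rs (M - i))) = (\<Sum>j\<in>{1..M}. norm (Rs j))"
   by (rule sum.reindex_bij_witness[of _ "%j. M - j" "%i. M - i"]) auto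
  also have "\<dots> \<le> (\<Sum>j<M+1. norm (Rs j))" by (rule sum_mono2) auto
  finally have "norm (\<Sum>i<M. x i * Rs (M - i)) \<le> K * (\<Sum>j<M+1. norm (Rs j))"
   using K0 by (simp add: mult_left_mono)
  also have "(\<Sum>j<M+1. norm (Rs j)) = norm (B (M+1))"
   unfolding B_def norm_of_real by (rule abs_of_nonneg[symmetric]) (intro sum_nonneg norm_ge_zero)
  finally have "norm (\<Sum>i<M. x i * Rs (M - i)) \<le> K * norm (B (M+1))" .
  thus "norm ((\<Sum>n<M. \<Sum>i\<le>n. r (n - i) * x i) / of_nat M ^ (k + 1)) \<le> K * norm (B (M+1) / of_nat M ^ (k+1))"
   unfolding eq norm_divide times_divide_eq_right by (rule divide_right_mono) simp
 qed
qed

subsection \<open>Holomorphic functions\<close>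

text \<open>Cauchy's estimate on discs of radius r/3 about points of the ball of half size, which
  fit because r/2 + r/3 < r; this fixes the factor 3.\<close>

lemma bounded_holomorphic_lipschitz:
 assumes hol: "u holomorphic_on ball p r" and r: "r > 0"
  and B: "!!z. z \<in> ball p r ==> norm (u z) \<le> B" and z: "dist p z < r / 2"
 shows "norm (u z - u p) \<le> 3 * B / r * dist p z"
proof -
 have der: "norm (deriv u \<zeta>) \<le> 3 * B / r" if "\<zeta> \<in> ball p (r/2)" for \<zeta>
 proof -
  have sub: "cball \<zeta> (r/3) \<subseteq> ball p r"
  proof
   fix x assume "x \<in> cball \<zeta> (r/3)"
   hence "dist p x \<le> dist p \<zeta> + r/3" using dist_triangle[of p x \<zeta>] by simp
   thus "x \<in> ball p r" using that r by simp
  qed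
  have "norm ((deriv ^^ 1) u \<zeta>) \<le> fact 1 * B / (r/3) ^ 1"
  proof (rule Cauchy_inequality)
   show "u holomorphic_on ball \<zeta> (r/3)"
    using hol sub ball_subset_cball by (meson holomorphic_on_subset order_trans)
   show "continuous_on (cball \<zeta> (r/3)) u"
    using hol sub by (meson holomorphic_on_imp_continuous_on holomorphic_on_subset)
   show "norm (u x) \<le> B" if "norm (\<zeta> - x) = r/3" for x
    by (rule B) (use that sub in \<open>auto simp: subset_iff dist_norm\<close>)
  qed (use r in auto)
  thus ?thesis using r by (simp add: field_simps)
 qed
 have "norm (u z - u p) \<le> 3 * B / r * norm (z - p)"
 proof (rule field_differentiable_bound[where S = "ball p (r/2)" and f' = "deriv u"])
  fix x assume x: "x \<in> ball p (r/2)"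
  have "x \<in> ball p r" using x r by auto
  thus "(u has_field_derivative deriv u x) (at x within ball p (r/2))"
   using hol by (meson has_field_derivative_at_within holomorphic_derivI open_ball)
 qed (use der z r in auto)
 thus ?thesis by (simp add: dist_norm norm_minus_commute)
qed

lemma half_plane_convex: "convex {W. Re W > R}"
 by (rule convex_halfspace_Re_gt)

lemma half_plane_open: "open {W. Re W > R}"
 by (rule open_halfspace_Re_gt)

lemma jointly_continuous_uniform:
 fixes \<Phi> :: "complex => complex => complex"
 assumes cont: "continuous_on (ball w0 s0 \<times> ball z0 r0) (%(w, z). \<Phi> w z)"
  and s0: "s0 > 0" and K: "compact K" "K \<subseteq> ball z0 r0" and e: "e > 0"
 obtains s where "s > 0" "s < s0" "!!w z. w \<in> ball w0 s ==> z \<in> K ==> norm (\<Phi> w z - \<Phi> w0 z) < e"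
proof -
 let ?C = "cball w0 (s0/2) \<times> K"
 have "continuous_on ?C (%(w, z). \<Phi> w z)"
  by (rule continuous_on_subset[OF cont]) (use K s0 in auto)
 moreover have "compact ?C" by (intro compact_Times K compact_cball)
 ultimately have "uniformly_continuous_on ?C (%(w, z). \<Phi> w z)"
  by (rule compact_uniformly_continuous)
 then obtain t where t: "t > 0"
  "!!x y. x \<in> ?C ==> y \<in> ?C ==> dist y x < t ==> dist ((%(w, z). \<Phi> w z) y) ((%(w, z). \<Phi> w z) x) < e"
  unfolding uniformly_continuous_on_def using e by meson
 show thesis
 proof (rule that[of "min t (s0/2)"])
  fix w z assume w: "w \<in> ball w0 (min t (s0/2))" and z: "z \<in> K"
  have "dist ((%(w, z). \<Phi> w z) (w, z)) ((%(w, z). \<Phi> w z) (w0, z)) < e"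
   by (rule t(2)) (use w z s0 in \<open>auto simp: dist_prod_def dist_commute\<close>)
  thus "norm (\<Phi> w z - \<Phi> w0 z) < e" by (simp add: dist_norm)
 qed (use t s0 in auto)
qed

text \<open>The map z - \<Phi> w z / c, with c the derivative at the base point, is a contraction.
  Joint holomorphy is replaced by joint continuity, holomorphy in \<open>z\<close> and the
  substitution property \<open>comp\<close>, which is the form in which iterates of a partially
  defined map come. The Picard iterates of the constant \<open>z0\<close> are then holomorphic in
  \<open>w\<close> and converge uniformly.\<close>

lemma holomorphic_implicit:
 fixes \<Phi> :: "complex => complex => complex"
 assumes s0: "s0 > 0" and r0: "r0 > 0"
  and cont: "continuous_on (ball w0 s0 \<times> ball z0 r0) (%(w, z). \<Phi> w z)"
  and holz: "!!w. w \<in> ball w0 s0 ==> \<Phi> w holomorphic_on ball z0 r0"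
  and comp: "!!\<phi> S. open S ==> S \<subseteq> ball w0 s0 ==> \<phi> holomorphic_on S ==> \<phi> ` S \<subseteq> ball z0 r0
         ==> (%w. \<Phi> w (\<phi> w)) holomorphic_on S"
  and zero: "\<Phi> w0 z0 = 0" and der: "deriv (\<Phi> w0) z0 ~= 0"
 obtains r s \<alpha> where "r > 0" "r < r0" "s > 0" "s \<le> s0" "\<alpha> holomorphic_on ball w0 s"
  "\<alpha> ` ball w0 s \<subseteq> ball z0 r" "\<alpha> w0 = z0"
  "!!w z. w \<in> ball w0 s ==> z \<in> ball z0 r ==> \<Phi> w z = 0 \<longleftrightarrow> z = \<alpha> w"
proof -
 define c where "c = deriv (\<Phi> w0) z0"
 have c: "c ~= 0" using der by (simp add: c_def)
 define N where "N = (%w z. z - \<Phi> w z / c)"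
 have holN: "N w holomorphic_on ball z0 r0" if "w \<in> ball w0 s0" for w
  unfolding N_def using holz[OF that] c by (intro holomorphic_intros) auto
 have w0: "w0 \<in> ball w0 s0" using s0 by simp
 have "continuous_on (ball z0 r0) (deriv (N w0))"
  using holN[OF w0] by (intro holomorphic_on_imp_continuous_on holomorphic_deriv) auto
 moreover have "deriv (N w0) z0 = 0"
 proof -
  have "(\<Phi> w0 has_field_derivative c) (at z0)"
   using holomorphic_derivI[OF holz[OF w0]] r0 by (simp add: c_def)
  hence "(N w0 has_field_derivative 1 - c / c) (at z0)"
   unfolding N_def by (intro derivative_intros DERIV_cdivide)
  thus ?thesis using c by (simp add: DERIV_imp_deriv)
 qed
 ultimately obtain t where t: "t > 0" "!!z. z \<in> ball z0 r0 ==> dist z z0 < t ==> norm (deriv (N w0) z) < 1/4"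
  using continuous_on_iff[of "ball z0 r0" "deriv (N w0)"] r0
  by (metis centre_in_ball dist_norm diff_zero zero_less_divide_1_iff zero_less_numeral)
 \<comment> \<open>The division by 3 keeps the ball of radius 2 \<open>r\<close> inside the domain
   and inside the region of small derivative, so that Cauchy's estimate can use discs of radius
   \<open>r\<close> about all points of the ball of radius \<open>r\<close>.\<close>
 define r where "r = min t r0 / 3"
 have r: "r > 0" "2 * r < r0" "2 * r < t" using t r0 by (auto simp: r_def)
 have sub2: "cball z0 (2*r) \<subseteq> ball z0 r0" using r by auto
 obtain s1 where s1: "s1 > 0" "s1 < s0"
  "!!w z. w \<in> ball w0 s1 ==> z \<in> cball z0 (2*r) ==> norm (\<Phi> w z - \<Phi> w0 z) < norm c * r / 4"
  by (rule jointly_continuous_uniform[OF cont s0 compact_cball sub2, of "norm c * r / 4"]) (use c r in auto)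
 have Nd: "norm (N w z - N w0 z) \<le> r/4" if "w \<in> ball w0 s1" "z \<in> cball z0 (2*r)" for w z
 proof -
  have "norm (N w z - N w0 z) = norm (\<Phi> w z - \<Phi> w0 z) / norm c"
   by (simp add: N_def norm_divide[symmetric] diff_divide_distrib norm_minus_commute)
  also have "\<dots> \<le> r/4" using s1(3)[OF that] c by (simp add: field_simps)
  finally show ?thesis .
 qed
 have derN: "norm (deriv (N w) z) \<le> 1/2" if w: "w \<in> ball w0 s1" and z: "z \<in> cball z0 r" for w z
 proof -
  have ws: "w \<in> ball w0 s0" using w s1 by auto
  have sub: "cball z r \<subseteq> cball z0 (2*r)"
  proof
   fix x assume "x \<in> cball z r"
   thus "x \<in> cball z0 (2*r)" using z dist_triangle[of z0 x z] by simp
  qed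
  have hd: "(%z. N w z - N w0 z) holomorphic_on ball z0 r0"
   by (intro holomorphic_intros holN ws w0)
  have zin: "z \<in> ball z0 r0" using z r by auto
  have "norm ((deriv ^^ 1) (%z. N w z - N w0 z) z) \<le> fact 1 * (r/4) / r ^ 1"
  proof (rule Cauchy_inequality)
   show "(%z. N w z - N w0 z) holomorphic_on ball z r"
    using hd sub sub2 ball_subset_cball by (meson holomorphic_on_subset order_trans)
   show "continuous_on (cball z r) (%z. N w z - N w0 z)"
    using hd sub sub2 by (meson holomorphic_on_imp_continuous_on holomorphic_on_subset order_trans)
   show "norm (N w x - N w0 x) \<le> r/4" if "norm (z - x) = r" for x
    by (rule Nd[OF w]) (use that sub in \<open>auto simp: subset_iff dist_norm\<close>)
  qed (use r in auto)
  moreover have "deriv (%z. N w z - N w0 z) z = deriv (N w) z - deriv (N w0) z"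
   using holN[OF ws] holN[OF w0] zin
   by (intro deriv_diff) (auto simp: holomorphic_on_imp_differentiable_at)
  moreover have "norm (deriv (N w0) z) < 1/4"
   by (rule t(2)) (use zin z r in \<open>auto simp: dist_commute\<close>)
  ultimately show ?thesis using r norm_triangle_sub[of "deriv (N w) z" "deriv (N w0) z"] by simp
 qed
 have lip: "norm (N w z - N w z') \<le> 1/2 * norm (z - z')"
  if w: "w \<in> ball w0 s1" and z: "z \<in> cball z0 r" "z' \<in> cball z0 r" for w z z'
 proof (rule field_differentiable_bound[where S = "cball z0 r" and f' = "deriv (N w)"])
  fix x assume "x \<in> cball z0 r"
  hence "x \<in> ball z0 r0" using r by auto
  thus "(N w has_field_derivative deriv (N w) x) (at x within cball z0 r)"
   using holN[of w] w s1 by (meson has_field_derivative_at_within holomorphic_derivI open_ball subset_ball less_imp_le subsetD)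
 qed (use derN[OF w] z in auto)
 have base: "norm (N w z0 - z0) \<le> r/4" if w: "w \<in> ball w0 s1" for w
 proof -
  have "N w0 z0 = z0" using zero by (simp add: N_def)
  thus ?thesis using Nd[OF w, of z0] r by simp
 qed
 have inb: "norm (N w z - z0) < r" if w: "w \<in> ball w0 s1" and z: "z \<in> cball z0 r" for w z
 proof -
  have "norm (N w z - z0) \<le> norm (N w z - N w z0) + norm (N w z0 - z0)"
   by (metis norm_triangle_sub add.commute diff_add_cancel diff_diff_eq2 norm_triangle_ineq)
  also have "\<dots> \<le> 1/2 * norm (z - z0) + r/4" using lip[OF w z, of z0] base[OF w] r by simp
  also have "\<dots> < r" using z r by (simp add: dist_norm norm_minus_commute)
  finally show ?thesis .
 qed
 have "\<exists>!x. x \<in> cball z0 r \<and> N w x = x" if w: "w \<in> ball w0 s1" for w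
 proof -
  have "\<exists>!x\<in>cball z0 r. N w x = x"
  proof (rule Banach_fix)
   show "complete (cball z0 r)" by (simp add: compact_imp_complete)
   show "N w ` cball z0 r \<subseteq> cball z0 r" using inb[OF w] by (force simp: dist_norm norm_minus_commute)
   show "dist (N w x) (N w y) \<le> (1/2) * dist x y" if "x \<in> cball z0 r" "y \<in> cball z0 r" for x y
    using lip[OF w that] by (simp add: dist_norm)
  qed (use r in auto)
  thus ?thesis by blast
 qed
 then obtain \<alpha> where \<alpha>: "!!w. w \<in> ball w0 s1 ==> \<alpha> w \<in> cball z0 r \<and> N w (\<alpha> w) = \<alpha> w"
  "!!w x. w \<in> ball w0 s1 ==> x \<in> cball z0 r ==> N w x = x ==> x = \<alpha> w"
  by metis
 define ph where "ph = (%k. rec_nat (%w. z0) (%k p w. N w (p w)) k)"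
 have ph0: "ph 0 = (%w. z0)" and phS: "ph (Suc k) = (%w. N w (ph k w))" for k
  by (auto simp: ph_def)
 have phc: "ph k w \<in> cball z0 r" if w: "w \<in> ball w0 s1" for k w
 proof (induction k)
  case (Suc k)
  show ?case using inb[OF w Suc] by (simp add: phS dist_norm norm_minus_commute)
 qed (use r in \<open>simp add: ph0\<close>)
 have phhol: "ph k holomorphic_on ball w0 s1" for k
 proof (induction k)
  case (Suc k)
  have "(%w. \<Phi> w (ph k w)) holomorphic_on ball w0 s1"
  proof (rule comp)
   have "x \<in> ball z0 r0" if "x \<in> cball z0 r" for x using that r by simp
   thus "ph k ` ball w0 s1 \<subseteq> ball z0 r0" using phc by blast
  qed (use Suc s1 in auto)
  thus ?case unfolding phS N_def using c Suc by (intro holomorphic_intros) auto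
 qed (simp add: ph0)
 have phl: "norm (ph k w - \<alpha> w) \<le> 2 * r * (1/2) ^ k" if w: "w \<in> ball w0 s1" for k w
 proof (induction k)
  case 0
  show ?case using \<alpha>(1)[OF w] r by (simp add: ph0 dist_norm)
 next
  case (Suc k)
  have "norm (ph (Suc k) w - \<alpha> w) = norm (N w (ph k w) - N w (\<alpha> w))"
   using \<alpha>(1)[OF w] by (simp add: phS)
  also have "\<dots> \<le> 1/2 * norm (ph k w - \<alpha> w)" by (rule lip[OF w phc[OF w]]) (use \<alpha>(1)[OF w] in auto)
  finally show ?case using Suc by simp
 qed
 have tend: "(%k. 2 * r * (1/2) ^ k) \<longlonglongrightarrow> 0"
  using tendsto_mult[OF tendsto_const[of "2*r"] LIMSEQ_realpow_zero[of "1/2"]] by simp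
 have unif: "uniform_limit (ball w0 s1) ph \<alpha> sequentially"
 proof (rule uniform_limitI)
  fix e :: real assume "e > 0"
  hence "\<forall>\<^sub>F k in sequentially. 2 * r * (1/2) ^ k < e"
   using order_tendstoD(2)[OF tend] by simp
  thus "\<forall>\<^sub>F k in sequentially. \<forall>w\<in>ball w0 s1. dist (ph k w) (\<alpha> w) < e"
  proof eventually_elim
   case (elim k)
   show ?case
   proof
    fix w assume "w \<in> ball w0 s1"
    thus "dist (ph k w) (\<alpha> w) < e" using phl[of w k] elim by (simp add: dist_norm)
   qed
  qed
 qed
 have hola: "\<alpha> holomorphic_on ball w0 s1"
 proof (rule holomorphic_uniform_sequence[OF open_ball phhol])
  fix x assume "x \<in> ball w0 s1"
  then obtain d where "d > 0" "cball x d \<subseteq> ball w0 s1" using open_contains_cball[of "ball w0 s1"] by blast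
  thus "\<exists>d>0. cball x d \<subseteq> ball w0 s1 \<and> uniform_limit (cball x d) ph \<alpha> sequentially"
   using uniform_limit_on_subset[OF unif] by blast
 qed
 have ab: "\<alpha> w \<in> ball z0 r" if w: "w \<in> ball w0 s1" for w
  using inb[OF w, of "\<alpha> w"] \<alpha>(1)[OF w] by (simp add: dist_norm norm_minus_commute)
 have eqv: "\<Phi> w z = 0 \<longleftrightarrow> N w z = z" for w z using c by (simp add: N_def)
 show thesis
 proof (rule that[of r s1 \<alpha>])
  show "\<alpha> w0 = z0" using \<alpha>(2)[of w0 z0] zero s1(1) r(1) eqv[of w0 z0] by simp
  show "\<Phi> w z = 0 \<longleftrightarrow> z = \<alpha> w" if "w \<in> ball w0 s1" "z \<in> ball z0 r" for w z
   unfolding eqv using \<alpha>(1)[OF that(1)] \<alpha>(2)[OF that(1), of z] that(2) by (metis ball_subset_cball subsetD)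
 qed (use r s1 hola ab in auto)
qed

subsection \<open>Asymptotic translations of a half plane\<close>

text \<open>The displacement differs from \<open>L\<close> by a negative power of Re W, so orbits
  drift to the right at linear speed. Cauchy's estimate on a disc of radius Re W / 4 gains one more
  power for the derivative; with \<sigma> > 0 the deviations of T' from 1 become summable along an
  orbit and their product converges to a nonzero limit.\<close>

lemma asymptotic_translation:
 fixes T :: "complex => complex" and L :: complex
 assumes hol: "T holomorphic_on {W. Re W > R}" and R: "R \<ge> 1" and L: "Re L > 0"
  and \<sigma>: "\<sigma> > 0"
  and bd: "!!W. Re W > R ==> norm (T W - W - L) \<le> B * Re W powr (- \<sigma>)"
 obtains R1 where "R1 \<ge> R"
  "!!W. Re W > R1 ==> Re (T W) \<ge> Re W + Re L / 2"
  "!!W k. Re W > R1 ==> Re ((T ^^ k) W) \<ge> Re W + k * (Re L / 2)"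
  "!!W. Re W > R1 ==> (%k. (T ^^ k) W / of_nat k) \<longlonglongrightarrow> L"
  "!!W. Re W > R1 ==> \<exists>\<Lambda>. \<Lambda> ~= 0 \<and> (%k. \<Prod>i<k. deriv T ((T ^^ i) W)) \<longlonglongrightarrow> \<Lambda>"
proof -
 have B0: "B \<ge> 0"
 proof -
  have "0 \<le> B * (R+1) powr (-\<sigma>)"
   using bd[of "of_real (R+1)"] norm_ge_zero order_trans by (metis Re_complex_of_real less_add_one)
  thus ?thesis using R by (simp add: zero_le_mult_iff)
 qed
 have lim0: "((%x::real. B * x powr (-\<sigma>)) \<longlongrightarrow> 0) at_top"
  using tendsto_mult[OF tendsto_const[of B] tendsto_neg_powr[OF _ filterlim_ident]] \<sigma> by simp
 obtain R0 where R0: "!!x. x \<ge> R0 ==> B * x powr (-\<sigma>) < Re L / 2"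
  using order_tendstoD(2)[OF lim0, of "Re L / 2"] L by (auto simp: eventually_at_top_linorder)
 have der: "norm (deriv T W - 1) \<le> 4 * B * 4 powr \<sigma> * Re W powr (- 1 - \<sigma>)" if W: "Re W > 2 * R" for W
 proof -
  define x where "x = Re W"
  have x: "x > 2 * R" "x > 0" using W R by (auto simp: x_def)
  have in1: "Re Z \<ge> x / 2" if "Z \<in> cball W (x/4)" for Z
  proof -
   have "\<bar>Re (W - Z)\<bar> \<le> x/4" using that abs_Re_le_cmod[of "W - Z"] by (simp add: dist_norm)
   hence "Re W - Re Z \<le> x/4" using abs_ge_self[of "Re (W - Z)"] by simp
   thus ?thesis using x unfolding x_def by linarith
  qed
  have in2: "Re Z > R" if "Z \<in> cball W (x/4)" for Z using in1[OF that] x by simp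
  have hE: "(%Z. T Z - Z - L) holomorphic_on {W. Re W > R}" by (intro holomorphic_intros hol)
  have sub: "cball W (x/4) \<subseteq> {W. Re W > R}" using in2 by auto
  have "norm ((deriv ^^ 1) (%Z. T Z - Z - L) W) \<le> fact 1 * (B * (x/2) powr (-\<sigma>)) / (x/4) ^ 1"
  proof (rule Cauchy_inequality)
   show "(%Z. T Z - Z - L) holomorphic_on ball W (x/4)"
    using hE sub ball_subset_cball by (meson holomorphic_on_subset order_trans)
   show "continuous_on (cball W (x/4)) (%Z. T Z - Z - L)"
    using hE sub by (meson holomorphic_on_imp_continuous_on holomorphic_on_subset)
   fix Z assume Z: "norm (W - Z) = x/4"
   hence Zc: "Z \<in> cball W (x/4)" by (simp add: dist_norm)
   have "norm (T Z - Z - L) \<le> B * Re Z powr (-\<sigma>)" by (rule bd[OF in2[OF Zc]])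
   also have "\<dots> \<le> B * (x/2) powr (-\<sigma>)"
    using in1[OF Zc] x \<sigma> B0 by (intro mult_left_mono powr_mono2') auto
   finally show "norm (T Z - Z - L) \<le> B * (x/2) powr (-\<sigma>)" .
  qed (use x in auto)
  moreover have "deriv (%Z. T Z - Z - L) W = deriv T W - 1"
  proof -
   have "(T has_field_derivative deriv T W) (at W)"
    by (rule holomorphic_derivI[OF hol half_plane_open]) (use x R in \<open>auto simp: x_def\<close>)
   hence "((%Z. T Z - Z - L) has_field_derivative deriv T W - 1 - 0) (at W)"
    by (intro derivative_intros)
   thus ?thesis by (simp add: DERIV_imp_deriv)
  qed
  ultimately have "norm (deriv T W - 1) \<le> B * (x/2) powr (-\<sigma>) / (x/4)" by simp
  also have "\<dots> = 4 * B * 2 powr \<sigma> * x powr (- 1 - \<sigma>)"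
   using x by (simp add: powr_divide powr_minus powr_diff field_simps)
  also have "\<dots> \<le> 4 * B * 4 powr \<sigma> * x powr (- 1 - \<sigma>)"
   using \<sigma> B0 by (intro mult_right_mono mult_left_mono powr_mono2) auto
  finally show ?thesis by (simp add: x_def)
 qed
 define B2 where "B2 = 4 * B * 4 powr \<sigma>"
 have B20: "B2 \<ge> 0" using B0 by (simp add: B2_def)
 have lim1: "((%x::real. B2 * x powr (-1-\<sigma>)) \<longlongrightarrow> 0) at_top"
  using tendsto_mult[OF tendsto_const[of B2] tendsto_neg_powr[OF _ filterlim_ident, of "-1-\<sigma>"]] \<sigma> by simp
 obtain R3 where R3: "!!x. x \<ge> R3 ==> B2 * x powr (-1-\<sigma>) < 1/2"
  using order_tendstoD(2)[OF lim1, of "1/2"] by (auto simp: eventually_at_top_linorder)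
 define R1 where "R1 = max (2 * R) (max R0 R3)"
 have R1: "R1 \<ge> 2 * R" "R1 \<ge> R0" "R1 \<ge> R3" "R1 \<ge> R" "R1 \<ge> 1" using R by (auto simp: R1_def)
 have step: "Re (T W) \<ge> Re W + Re L / 2" if "Re W > R1" for W
 proof -
  have "norm (T W - W - L) < Re L / 2" using bd[of W] R0[of "Re W"] that R1 by simp
  thus ?thesis using abs_Re_le_cmod[of "T W - W - L"] by simp
 qed
 have it: "Re ((T ^^ k) W) \<ge> Re W + k * (Re L / 2)" if W: "Re W > R1" for W k
 proof (induction k)
  case (Suc k)
  have "Re ((T ^^ k) W) \<ge> Re W" using Suc L by (smt (verit) zero_le_mult_iff of_nat_0_le_iff half_gt_zero)
  from step[of "(T ^^ k) W"] this W Suc show ?case by (simp add: algebra_simps add_divide_distrib)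
 qed simp
 have itop: "filterlim (%k. Re ((T ^^ k) W)) at_top sequentially" if W: "Re W > R1" for W
 proof (rule filterlim_at_top_mono)
  show "filterlim (%k. Re W + real k * (Re L / 2)) at_top sequentially"
   using L by real_asymp
 qed (use it[OF W] in auto)
 have itR: "Re ((T ^^ k) W) > R1" if W: "Re W > R1" for W k
  using it[OF W, of k] L W by (smt (verit) zero_le_mult_iff of_nat_0_le_iff half_gt_zero)
 show thesis
 proof (rule that[of R1])
  show "(%k. (T ^^ k) W / of_nat k) \<longlonglongrightarrow> L" if W: "Re W > R1" for W
  proof -
   have "(%n. ((T ^^ (n + 1)) W - (T ^^ n) W) / of_nat n ^ 0) \<longlonglongrightarrow> L"
   proof (rule Lim_transform)
    show "(%n. L) \<longlonglongrightarrow> L" by simp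
    have "(%n. T ((T ^^ n) W) - (T ^^ n) W - L) \<longlonglongrightarrow> 0"
    proof (rule Lim_null_comparison)
     show "\<forall>\<^sub>F n in sequentially. norm (T ((T ^^ n) W) - (T ^^ n) W - L) \<le> B * Re ((T ^^ n) W) powr (-\<sigma>)"
      using itR[OF W] R1 by (intro always_eventually allI bd) (metis order_le_less_trans)
     show "(%n. B * Re ((T ^^ n) W) powr (-\<sigma>)) \<longlonglongrightarrow> 0"
      by (rule filterlim_compose[OF lim0 itop[OF W]])
    qed
    thus "(%n. ((T ^^ (n + 1)) W - (T ^^ n) W) / of_nat n ^ 0 - L) \<longlonglongrightarrow> 0" by simp
   qed
   from stolz_step[OF _ _ this] show ?thesis by simp
  qed
  show "\<exists>\<Lambda>. \<Lambda> ~= 0 \<and> (%k. \<Prod>i<k. deriv T ((T ^^ i) W)) \<longlonglongrightarrow> \<Lambda>" if W: "Re W > R1" for W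
  proof -
   let ?f = "%i. deriv T ((T ^^ i) W)"
   have f1: "norm (?f i - 1) \<le> B2 * Re ((T ^^ i) W) powr (-1-\<sigma>)" for i
    unfolding B2_def by (rule der) (use itR[OF W, of i] R1 in linarith)
   have fne: "?f i ~= 0" for i
   proof
    assume "?f i = 0"
    thus False using f1[of i] R3[of "Re ((T ^^ i) W)"] itR[OF W, of i] R1 by simp
   qed
   have "summable (%i. norm (?f i - 1))"
   proof (rule summable_comparison_test_ev)
    have "summable (%i. real i powr (-1-\<sigma>))" using \<sigma> by (subst summable_real_powr_iff) simp
    thus "summable (%i. B2 * (Re L/2) powr (-1-\<sigma>) * real i powr (-1-\<sigma>))" by (rule summable_mult)
    show "\<forall>\<^sub>F i in sequentially. norm (norm (?f i - 1)) \<le> B2 * (Re L/2) powr (-1-\<sigma>) * real i powr (-1-\<sigma>)"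
     using eventually_gt_at_top[of 0]
    proof eventually_elim
     case (elim i)
     have "Re ((T ^^ i) W) powr (-1-\<sigma>) \<le> ((Re L/2) * i) powr (-1-\<sigma>)"
      using it[OF W, of i] elim L W R1 \<sigma> by (intro powr_mono2') (auto simp: mult.commute)
     also have "\<dots> = (Re L/2) powr (-1-\<sigma>) * real i powr (-1-\<sigma>)"
      using L by (subst powr_mult) auto
     finally show ?case using f1[of i] B20
      by (smt (verit) mult_left_mono mult.assoc norm_ge_zero real_norm_def)
    qed
   qed
   hence "convergent_prod ?f"
    by (intro abs_convergent_prod_imp_convergent_prod summable_imp_abs_convergent_prod)
   hence "(%n. \<Prod>i\<le>n. ?f i) \<longlonglongrightarrow> prodinf ?f" "prodinf ?f ~= 0"
    using convergent_prod_LIMSEQ prodinf_nonzero fne by blast+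
   moreover have "(%n. \<Prod>i<Suc n. ?f i) = (%n. \<Prod>i\<le>n. ?f i)" by (simp add: lessThan_Suc_atMost)
   ultimately show ?thesis using filterlim_sequentially_Suc[of "%n. \<Prod>i<n. ?f i"] by metis
  qed
 qed (use R1 step it in auto)
qed

subsection \<open>Lifting families\<close>

text \<open>The dynamical part of the argument sees the covering only through this lifting property.
  A difference of two points of the domain is shorter than \<open>d\<close> by
  \<open>diam_D\<close>, so as long as it does not vanish it can be lifted again; this is what
  allows lifting to be repeated indefinitely.\<close>

locale lifting_family =
 fixes D :: "complex set" and f :: "complex => complex" and d :: real
 assumes open_D: "open D" and hol_f: "f holomorphic_on D"
  and diam_D: "!!x y. x \<in> D ==> y \<in> D ==> norm (x - y) < d"
  and lift: "!!C u z0 x0. convex C ==> open C ==> u holomorphic_on C ==>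
    (!!z. z \<in> C ==> u z ~= 0 \<and> norm (u z) < d) ==> z0 \<in> C ==> x0 \<in> D ==> f x0 = u z0 ==>
    \<exists>v. v holomorphic_on C \<and> v ` C \<subseteq> D \<and> v z0 = x0 \<and> (\<forall>z\<in>C. f (v z) = u z)"
begin

section \<open>Iterates of the partial map, jointly in parameter and point\<close>

abbreviation it :: "complex => nat => complex => complex" where
 "it w n \<equiv> G f w ^^ n"

text \<open>As \<open>f\<close> is a total function, definedness is expressed by the first
  \<open>n\<close> points lying in the domain; the n-th iterate itself may be outside.\<close>

definition orb :: "complex => nat => complex => bool" where
 "orb w n z \<longleftrightarrow> (\<forall>j<n. it w j z \<in> D)"

definition Dit :: "complex => nat => complex => complex" where
 "Dit w n z = (\<Prod>j<n. deriv f (it w j z))"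

lemma it_Suc: "it w (Suc n) z = f (it w n z) + w"
 by (simp add: G_def)

lemma it_Suc2: "it w (Suc n) z = it w n (f z + w)"
 by (simp add: G_def funpow_swap1)

lemma it_add: "it w (m + n) z = it w m (it w n z)"
 by (simp add: funpow_add)

lemma orb_0 [simp]: "orb w 0 z" by (simp add: orb_def)

lemma orb_Suc: "orb w (Suc n) z \<longleftrightarrow> orb w n z \<and> it w n z \<in> D"
 by (auto simp: orb_def less_Suc_eq)

lemma orb_Suc2: "orb w (Suc n) z \<longleftrightarrow> z \<in> D \<and> orb w n (f z + w)"
 by (simp only: orb_def All_less_Suc2 it_Suc2 funpow_0)

lemma orb_mono: "orb w n z ==> m \<le> n ==> orb w m z"
 by (auto simp: orb_def)

lemma orb_add: "orb w (m + n) z \<longleftrightarrow> orb w n z \<and> orb w m (it w n z)"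
 by (induction m) (auto simp: orb_Suc it_add[symmetric] add.commute)

lemma Dit_0 [simp]: "Dit w 0 z = 1" by (simp add: Dit_def)

lemma Dit_Suc: "Dit w (Suc n) z = Dit w n z * deriv f (it w n z)"
 by (simp add: Dit_def)

lemma Dit_add: "Dit w (m + n) z = Dit w n z * Dit w m (it w n z)"
 by (induction m) (auto simp: Dit_Suc it_add)

lemma f_deriv: "z \<in> D ==> (f has_field_derivative deriv f z) (at z)"
 using hol_f open_D by (rule holomorphic_derivI)

lemma f_cont: "continuous_on D f"
 using hol_f by (rule holomorphic_on_imp_continuous_on)

lemma f_isCont: "z \<in> D ==> isCont f z"
 using f_cont open_D continuous_on_eq_continuous_at by blast

lemma hol_f': "deriv f holomorphic_on D"
 using hol_f open_D by (rule holomorphic_deriv)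

lemma f'_isCont: "z \<in> D ==> isCont (deriv f) z"
 using hol_f' open_D continuous_on_eq_continuous_at holomorphic_on_imp_continuous_on by blast

text \<open>If the distance were at least \<open>d\<close>, moving \<open>x\<close> slightly away
  from \<open>c\<close> inside the open domain would make it exceed \<open>d\<close>, which the
  closure of the domain does not allow. Strictness matters because \<open>lift\<close> asks for a
  strict bound.\<close>

lemma diam_closure:
 assumes x: "x \<in> D" and c: "c \<in> closure D"
 shows "norm (x - c) < d"
proof (cases "x = c")
 case True
 thus ?thesis using diam_D[OF x x] by simp
next
 case False
 obtain t where t: "t > 0" "ball x t \<subseteq> D" using open_D x open_contains_ball by blast
 define x' where "x' = x + of_real (t/2) * sgn (x - c)"
 have n: "norm (sgn (x - c)) = 1" using False by (simp add: norm_sgn)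
 have x': "x' \<in> D"
  using t n by (intro subsetD[OF t(2)]) (simp add: x'_def dist_norm norm_mult)
 have "c \<in> cball x' d"
  using closure_minimal[of D "cball x' d"] diam_D[OF x'] c by (force simp: dist_norm)
 moreover have "norm (x' - c) = norm (x - c) + t/2"
 proof -
  have "x' - c = of_real (norm (x - c) + t/2) * sgn (x - c)"
   using False by (simp add: x'_def sgn_div_norm scaleR_conv_of_real field_simps)
  thus ?thesis using n t by (simp only: norm_mult norm_of_real) simp
 qed
 ultimately show ?thesis using t by (simp add: dist_norm)
qed

text \<open>Lifting the identity on a small disc about \<open>f x\<close> gives a holomorphic right
  inverse through \<open>x\<close>, and the chain rule makes the derivative invertible.\<close>

lemma deriv_nonzero:
 assumes x: "x \<in> D" and fx: "f x ~= 0" "norm (f x) < d"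
 shows "deriv f x ~= 0"
proof -
 have "open (ball 0 d - {0 :: complex})" by (intro open_Diff) auto
 then obtain e where e: "e > 0" "ball (f x) e \<subseteq> ball 0 d - {0}"
  using fx open_contains_ball by (metis Diff_iff dist_0_norm mem_ball singletonD)
 have "\<exists>v. v holomorphic_on ball (f x) e \<and> v ` ball (f x) e \<subseteq> D \<and> v (f x) = x \<and> (\<forall>z\<in>ball (f x) e. f (v z) = z)"
 proof (rule lift[where u = "%z. z" and C = "ball (f x) e" and ?x0.0 = x and ?z0.0 = "f x"])
  show "z ~= 0 \<and> norm z < d" if "z \<in> ball (f x) e" for z
   using subsetD[OF e(2) that] by simp
 qed (use e x in auto)
 then obtain v where v: "v holomorphic_on ball (f x) e" "v (f x) = x" "!!z. z\<in>ball (f x) e ==> f (v z) = z"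
  by blast
 have "(v has_field_derivative deriv v (f x)) (at (f x))"
  using v(1) e by (intro holomorphic_derivI) auto
 hence "((%z. f (v z)) has_field_derivative deriv f x * deriv v (f x)) (at (f x))"
  using f_deriv[OF x] v(2) by (metis DERIV_chain2)
 moreover have "((%z. f (v z)) has_field_derivative 1) (at (f x))"
 proof (rule has_field_derivative_transform_within_open[where S = "ball (f x) e"])
  show "((%z. z) has_field_derivative 1) (at (f x))" by simp
 qed (use e v in auto)
 ultimately have "deriv f x * deriv v (f x) = 1" by (rule DERIV_unique)
 thus ?thesis by auto
qed

text \<open>Openness and continuity are proved together: the next set is a preimage of the domain
  under the current iterate, so the induction step uses both.\<close>

lemma orb_open_cont:
 "open {(w, z). orb w n z} \<and> continuous_on {(w, z). orb w n z} (%(w, z). it w n z)"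
proof (induction n)
 case 0
 show ?case by (auto simp: case_prod_unfold intro: continuous_intros)
next
 case (Suc n)
 let ?S = "{(w, z). orb w n z}"
 have eq: "{(w, z). orb w (Suc n) z} = ?S \<inter> (%(w, z). it w n z) -` D"
  by (auto simp: orb_Suc)
 have op: "open {(w, z). orb w (Suc n) z}"
  unfolding eq using Suc open_D by (intro continuous_open_preimage) auto
 have "continuous_on {(w, z). orb w (Suc n) z} (%p. f ((%(w, z). it w n z) p) + fst p)"
  by (intro continuous_intros continuous_on_compose2[OF f_cont] continuous_on_subset[OF conjunct2[OF Suc]])
    (auto simp: orb_Suc)
 thus ?case using op by (simp only: case_prod_unfold it_Suc)
qed

lemma orb_open: "open {(w, z). orb w n z}"
 and it_cont: "continuous_on {(w, z). orb w n z} (%(w, z). it w n z)"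
 using orb_open_cont by auto

lemma orb_open1: "open {z. orb w n z}"
proof -
 have "open ((%z. (w, z)) -` {(w, z). orb w n z})"
  by (intro open_vimage orb_open continuous_intros)
 thus ?thesis by (simp add: vimage_def)
qed

lemma it_tendsto:
 assumes "orb w n z" "(u \<longlongrightarrow> w) F" "(v \<longlongrightarrow> z) F"
 shows "((%x. it (u x) n (v x)) \<longlongrightarrow> it w n z) F"
proof -
 have "isCont (%(w, z). it w n z) (w, z)"
  using it_cont orb_open assms(1) by (simp add: continuous_on_eq_continuous_at)
 from isCont_tendsto_compose[OF this tendsto_Pair[OF assms(2,3)]] show ?thesis by simp
qed

lemma orb_eventually:
 assumes "orb w n z" "(u \<longlongrightarrow> w) F" "(v \<longlongrightarrow> z) F"
 shows "\<forall>\<^sub>F x in F. orb (u x) n (v x)"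
proof -
 have "\<forall>\<^sub>F x in F. (u x, v x) \<in> {(w, z). orb w n z}"
  by (rule topological_tendstoD[OF tendsto_Pair[OF assms(2,3)] orb_open]) (use assms in auto)
 thus ?thesis by simp
qed

lemma it_holomorphic:
 assumes "\<psi> holomorphic_on S" "\<phi> holomorphic_on S" "!!u. u \<in> S ==> orb (\<psi> u) n (\<phi> u)"
 shows "(%u. it (\<psi> u) n (\<phi> u)) holomorphic_on S"
 using assms(3)
proof (induction n)
 case 0
 show ?case using assms by simp
next
 case (Suc n)
 have "(%u. f (it (\<psi> u) n (\<phi> u))) holomorphic_on S"
  using Suc by (intro holomorphic_on_compose_gen[OF _ hol_f, unfolded o_def]) (auto simp: orb_Suc)
 thus ?case using assms unfolding it_Suc by (intro holomorphic_intros)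
qed

lemma Dit_holomorphic:
 assumes "\<psi> holomorphic_on S" "\<phi> holomorphic_on S" "!!u. u \<in> S ==> orb (\<psi> u) n (\<phi> u)"
 shows "(%u. Dit (\<psi> u) n (\<phi> u)) holomorphic_on S"
 unfolding Dit_def
proof (intro holomorphic_on_prod)
 fix j assume j: "j \<in> {..<n}"
 have "(%u. it (\<psi> u) j (\<phi> u)) holomorphic_on S"
  using assms j by (intro it_holomorphic) (auto intro: orb_mono[OF assms(3)])
 thus "(%u. deriv f (it (\<psi> u) j (\<phi> u))) holomorphic_on S"
  using assms(3) j by (intro holomorphic_on_compose_gen[OF _ hol_f', unfolded o_def]) (auto simp: orb_def)
qed

lemma it_deriv: "orb w n z ==> (it w n has_field_derivative Dit w n z) (at z)"
proof (induction n)
 case (Suc n)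
 hence "it w n z \<in> D" "(it w n has_field_derivative Dit w n z) (at z)" by (auto simp: orb_Suc)
 hence "((%z. f (it w n z) + w) has_field_derivative deriv f (it w n z) * Dit w n z + 0) (at z)"
  by (intro derivative_intros DERIV_chain2[OF f_deriv]) auto
 thus ?case by (simp add: Dit_Suc mult.commute G_def[abs_def] o_def)
qed (simp add: id_def)

lemma deriv_it: "orb w n z ==> deriv (it w n) z = Dit w n z"
 by (rule DERIV_imp_deriv[OF it_deriv])

lemma it_holomorphic1: "S \<subseteq> {z. orb w n z} ==> it w n holomorphic_on S"
 by (rule it_holomorphic[of "%_. w" S "%z. z" n]) auto

lemma Dit_cont: "continuous_on {(w, z). orb w n z} (%(w, z). Dit w n z)"
 unfolding Dit_def case_prod_unfold
proof (intro continuous_on_prod)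
 fix j assume j: "j \<in> {..<n}"
 have "continuous_on {p. orb (fst p) n (snd p)} (%p. it (fst p) j (snd p))"
  using j by (intro continuous_on_subset[OF it_cont[of j, unfolded case_prod_unfold]]) (auto intro: orb_mono)
 thus "continuous_on {p. orb (fst p) n (snd p)} (%p. deriv f (it (fst p) j (snd p)))"
  using j by (intro continuous_on_compose2[OF holomorphic_on_imp_continuous_on[OF hol_f']]) (auto simp: orb_def)
qed

lemma Dit_tendsto:
 assumes "orb w n z" "(u \<longlongrightarrow> w) F" "(v \<longlongrightarrow> z) F"
 shows "((%x. Dit (u x) n (v x)) \<longlongrightarrow> Dit w n z) F"
proof -
 have "isCont (%(w, z). Dit w n z) (w, z)"
  using Dit_cont orb_open assms(1) by (simp add: continuous_on_eq_continuous_at)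
 from isCont_tendsto_compose[OF this tendsto_Pair[OF assms(2,3)]] show ?thesis by simp
qed

subsection \<open>Backward lifts and the singular orbit\<close>

text \<open>Pulling back one step means lifting \<open>u z - c\<close>. This is nonzero, because
  \<open>u z = c\<close> would put \<open>\<pi> z\<close> on the forward orbit of \<open>c\<close>,
  which \<open>avoid\<close> excludes before time \<open>M\<close>; and it is shorter than
  \<open>d\<close>, by \<open>bd\<close> at the first step and later because \<open>u\<close> takes
  values in the domain.\<close>

lemma backlift:
 assumes c: "c \<in> closure D" and C: "convex C" "open C" and hol: "\<pi> holomorphic_on C"
  and bd: "!!z. z \<in> C ==> norm (\<pi> z - c) < d"
  and avoid: "!!z n. z \<in> C ==> n < M ==> orb c n c ==> it c n c ~= \<pi> z"
  and z0: "z0 \<in> C"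
 shows "m \<le> M ==> orb c m y0 ==> it c m y0 = \<pi> z0 ==>
  \<exists>u. u holomorphic_on C \<and> u z0 = y0 \<and> (m > 0 \<longrightarrow> u ` C \<subseteq> D) \<and>
    (\<forall>z\<in>C. orb c m (u z) \<and> it c m (u z) = \<pi> z)"
proof (induction m arbitrary: y0)
 case 0
 thus ?case using hol by (intro exI[of _ \<pi>]) auto
next
 case (Suc m)
 define y1 where "y1 = f y0 + c"
 have y0: "y0 \<in> D" and y1: "orb c m y1" "it c m y1 = \<pi> z0"
  using Suc.prems by (simp_all add: orb_Suc2 y1_def it_Suc2[symmetric] del: funpow.simps)
 from Suc.IH[OF _ y1] Suc.prems obtain u where u: "u holomorphic_on C" "u z0 = y1" "m > 0 \<longrightarrow> u ` C \<subseteq> D"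
  "!!z. z \<in> C ==> orb c m (u z) \<and> it c m (u z) = \<pi> z" by auto
 have "\<exists>v. v holomorphic_on C \<and> v ` C \<subseteq> D \<and> v z0 = y0 \<and> (\<forall>z\<in>C. f (v z) = u z - c)"
 proof (rule lift[OF C])
  show "(%z. u z - c) holomorphic_on C" by (intro holomorphic_intros u)
  fix z assume z: "z \<in> C"
  have "u z ~= c"
   using u(4)[OF z] avoid[OF z, of m] Suc.prems by auto
  moreover have "norm (u z - c) < d"
   using u(3) u(4)[OF z] z bd[OF z] diam_closure[OF _ c] by (cases "m = 0") auto
  ultimately show "u z - c ~= 0 \<and> norm (u z - c) < d" by simp
 qed (use z0 y0 u y1_def in auto)
 then obtain v where "v holomorphic_on C" "v ` C \<subseteq> D" "v z0 = y0" "!!z. z\<in>C ==> f (v z) + c = u z"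
  by (metis diff_add_cancel)
 thus ?case using u(4) by (intro exI[of _ v]) (auto simp: orb_Suc2 it_Suc2 simp del: funpow.simps)
qed

lemma bounded_D: "\<exists>B. \<forall>x\<in>D. norm x \<le> B"
proof (cases "D = {}")
 case False
 then obtain x0 where x0: "x0 \<in> D" by auto
 have "norm x \<le> norm x0 + d" if "x \<in> D" for x
  using diam_D[OF that x0] norm_triangle_sub[of x x0] by simp
 thus ?thesis by blast
qed auto

text \<open>If the orbit of \<open>c\<close> missed the image of the half-plane, \<pi> could be
  pulled back n N times along the branch through \<open>\<pi> x\<close>. By the identity theorem
  this branch sends T^n x to \<open>\<pi> x\<close> and T^n y to \<open>\<pi> y\<close>. The two
  arguments are o(n) apart at a depth of order n in the half-plane, while the values lie in a
  bounded set, so Cauchy's estimate forces \<open>\<pi> x = \<pi> y\<close>.\<close>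

lemma reach_half_plane:
 assumes c: "c \<in> closure D" and N: "N \<ge> 1"
  and hol: "\<pi> holomorphic_on {W. Re W > R}" and holT: "T holomorphic_on {W. Re W > R}"
  and orbN: "!!W. Re W > R ==> orb c N (\<pi> W)"
  and semi: "!!W. Re W > R ==> it c N (\<pi> W) = \<pi> (T W)"
  and T: "!!W. Re W > R ==> Re (T W) > R"
  and asym: "!!W. Re W > R ==> (%k. (T ^^ k) W / of_nat k) \<longlonglongrightarrow> L" and L: "Re L > 0"
  and x: "Re x > R" and y: "Re y > R" and ne: "\<pi> x ~= \<pi> y"
 shows "\<exists>n W. Re W > R \<and> orb c n c \<and> it c n c = \<pi> W"
proof (rule ccontr)
 assume neg: "\<not> ?thesis"
 let ?H = "{W. Re W > R}"
 have inD: "\<pi> W \<in> D" if "Re W > R" for W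
  using orbN[OF that] N by (auto simp: orb_def)
 have Tk: "Re ((T ^^ k) W) > R" if "Re W > R" for k W
  using that T by (induction k) auto
 have semik: "orb c (k * N) (\<pi> W) \<and> it c (k * N) (\<pi> W) = \<pi> ((T ^^ k) W)" if "Re W > R" for k W
 proof (induction k)
  case (Suc k)
  thus ?case using orbN[OF Tk[OF that, of k]] semi[OF Tk[OF that, of k]]
   by (simp add: orb_add it_add)
 qed simp
 have holTk: "(%W. (T ^^ k) W) holomorphic_on ?H" for k
 proof (induction k)
  case (Suc k)
  have "T \<circ> (%W. (T ^^ k) W) holomorphic_on ?H"
   by (rule holomorphic_on_compose_gen[OF Suc holT]) (use Tk in auto)
  thus ?case by (simp add: o_def)
 qed simp
 obtain B where B: "!!x. x \<in> D ==> norm x \<le> B" using bounded_D by blast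
 have main: "\<exists>u. u holomorphic_on ?H \<and> u ` ?H \<subseteq> D \<and> u ((T ^^ n) x) = \<pi> x \<and> u ((T ^^ n) y) = \<pi> y"
  if n: "n \<ge> 1" for n
 proof -
  define m where "m = n * N"
  have m: "m > 0" using n N by (simp add: m_def)
  obtain u where u: "u holomorphic_on ?H" "u ((T ^^ n) x) = \<pi> x" "u ` ?H \<subseteq> D"
   "!!z. z \<in> ?H ==> orb c m (u z) \<and> it c m (u z) = \<pi> z"
  proof -
   have "\<exists>u. u holomorphic_on ?H \<and> u ((T ^^ n) x) = \<pi> x \<and> (m > 0 \<longrightarrow> u ` ?H \<subseteq> D) \<and>
    (\<forall>z\<in>?H. orb c m (u z) \<and> it c m (u z) = \<pi> z)"
   proof (rule backlift[OF c half_plane_convex half_plane_open hol])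
    show "norm (\<pi> z - c) < d" if "z \<in> ?H" for z using inD that diam_closure[OF _ c] by simp
    show "it c n c ~= \<pi> z" if "z \<in> ?H" "n < m" "orb c n c" for z n using neg that by auto
    show "orb c m (\<pi> x)" "it c m (\<pi> x) = \<pi> ((T ^^ n) x)" using semik[OF x, of n] by (auto simp: m_def)
   qed (use Tk[OF x] in auto)
   thus ?thesis using m that by blast
  qed
  \<comment> \<open>By \<open>deriv_nonzero\<close> a vanishing factor would require the orbit of
    \<open>\<pi> x\<close> to pass through \<open>c\<close>, and then the orbit of \<open>c\<close>
    would meet the image of the half-plane.\<close>
  have Dne: "Dit c m (\<pi> x) ~= 0"
   unfolding Dit_def prod_zero_iff[OF finite_lessThan]
  proof (rule notI, elim bexE)
   fix j assume j: "j \<in> {..<m}" and z: "deriv f (it c j (\<pi> x)) = 0"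
   have om: "orb c m (\<pi> x)" using semik[OF x, of n] by (simp add: m_def)
   have jD: "it c j (\<pi> x) \<in> D" using om j by (auto simp: orb_def)
   have SD: "it c (Suc j) (\<pi> x) \<in> D"
    using om j semik[OF x, of n] inD[OF Tk[OF x, of n]] by (cases "Suc j = m") (auto simp: orb_def m_def simp del: funpow.simps)
   have fx: "f (it c j (\<pi> x)) = it c (Suc j) (\<pi> x) - c" by (simp add: G_def)
   have "it c (Suc j) (\<pi> x) ~= c"
   proof
    assume a: "it c (Suc j) (\<pi> x) = c"
    have mj: "m = (m - Suc j) + Suc j" using j by simp
    have "orb c (m - Suc j) c" "it c (m - Suc j) c = \<pi> ((T ^^ n) x)"
     using om semik[OF x, of n] mj a by (metis orb_add, metis it_add m_def)
    thus False using neg Tk[OF x] by auto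
   qed
   hence "deriv f (it c j (\<pi> x)) ~= 0"
    using diam_closure[OF SD c] by (intro deriv_nonzero[OF jD]) (auto simp: fx)
   thus False using z by simp
  qed
  \<comment> \<open>\<open>A y\<close> and \<open>\<pi> y\<close> have the same image under
    \<open>it c m\<close> and agree at \<open>x\<close>; local injectivity makes them agree near
    \<open>x\<close>, hence on the whole half-plane.\<close>
  define A where "A = (%y. u ((T ^^ n) y))"
  have hA: "A holomorphic_on ?H"
   unfolding A_def by (rule holomorphic_on_compose_gen[OF holTk u(1), unfolded o_def]) (use Tk in auto)
  have xo: "\<pi> x \<in> {z. orb c m z}" using semik[OF x, of n] by (simp add: m_def)
  obtain r where r: "r > 0" "inj_on (it c m) (ball (\<pi> x) r)"
   using has_complex_derivative_locally_injective[OF it_holomorphic1[OF subset_refl] xo orb_open1]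
    Dne deriv_it[of c m "\<pi> x"] xo by (metis mem_Collect_eq)
  have ev: "\<forall>\<^sub>F y in at x. A y = \<pi> y"
  proof -
   have xin: "x \<in> ?H" using x by simp
   have cA: "(A \<longlongrightarrow> \<pi> x) (at x)" and cpi: "(\<pi> \<longlongrightarrow> \<pi> x) (at x)"
    using hA hol xin half_plane_open u(2)
    by (metis (mono_tags, lifting) A_def continuous_on_eq_continuous_at holomorphic_on_imp_continuous_on isCont_def)+
   have "\<forall>\<^sub>F y in at x. y \<in> ?H" using xin half_plane_open eventually_at_in_open' by blast
   with tendstoD[OF cA r(1)] tendstoD[OF cpi r(1)] show ?thesis
   proof eventually_elim
    case (elim y)
    have "it c m (A y) = it c m (\<pi> y)"
     using u(4)[of "(T ^^ n) y"] semik[of y n] Tk[of y n] elim by (simp add: A_def m_def)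
    thus "A y = \<pi> y" using r(2) elim by (auto simp: inj_on_def dist_commute)
   qed
  qed
  obtain S where S: "open S" "x \<in> S" "!!y. y \<in> S ==> y ~= x ==> A y = \<pi> y"
   using ev by (auto simp: eventually_at_topological)
  have "A y = \<pi> y"
  proof (rule analytic_continuation_open[of "S \<inter> ?H" ?H A \<pi>])
   show "open (S \<inter> ?H)" using S half_plane_open by blast
   show "connected ?H" using half_plane_convex convex_connected by blast
   show "A z = \<pi> z" if "z \<in> S \<inter> ?H" for z
    using that S(3)[of z] u(2) by (cases "z = x") (simp_all add: A_def)
   show "S \<inter> ?H ~= {}" using S(2) x by blast
   show "open ?H" by (rule half_plane_open)
   show "y \<in> ?H" using y by simp
  qed (use hA hol in auto)
  thus ?thesis using u by (intro exI[of _ u]) (auto simp: A_def)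
 qed
 let ?p = "%n. (T ^^ n) x" and ?q = "%n. (T ^^ n) y"
 have l1: "(%n. (Re (?p n) - R) / n) \<longlonglongrightarrow> Re L"
 proof -
  have "(%n. Re (?p n / of_nat n) - R / n) \<longlonglongrightarrow> Re L - 0"
   by (intro tendsto_intros asym[OF x] lim_const_over_n)
  moreover have "Re (?p n / of_nat n) - R / n = (Re (?p n) - R) / n" for n
   by (simp add: diff_divide_distrib)
  ultimately show ?thesis by simp
 qed
 have l2: "(%n. dist (?p n) (?q n) / n) \<longlonglongrightarrow> 0"
 proof -
  have "(%n. norm (?p n / of_nat n - ?q n / of_nat n)) \<longlonglongrightarrow> norm (L - L)"
   by (intro tendsto_intros asym x y)
  thus ?thesis by (simp add: dist_norm diff_divide_distrib[symmetric] norm_divide)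
 qed
 have "(%n. (dist (?p n) (?q n) / n) / ((Re (?p n) - R) / n)) \<longlonglongrightarrow> 0 / Re L"
  by (intro tendsto_divide l1 l2) (use L in auto)
 moreover have "\<forall>\<^sub>F n in sequentially. (dist (?p n) (?q n) / n) / ((Re (?p n) - R) / n) = dist (?p n) (?q n) / (Re (?p n) - R)"
  using eventually_gt_at_top[of 0] by eventually_elim simp
 ultimately have "(%n. dist (?p n) (?q n) / (Re (?p n) - R)) \<longlonglongrightarrow> 0 / Re L"
  by (rule Lim_transform_eventually)
 hence l3: "(%n. dist (?p n) (?q n) / (Re (?p n) - R)) \<longlonglongrightarrow> 0" by simp
 have "(%n. 3 * B * (dist (?p n) (?q n) / (Re (?p n) - R))) \<longlonglongrightarrow> 3 * B * 0"
  by (intro tendsto_intros l3)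
 moreover have "\<forall>\<^sub>F n in sequentially. norm (\<pi> x - \<pi> y) \<le> 3 * B * (dist (?p n) (?q n) / (Re (?p n) - R))"
  using eventually_ge_at_top[of 1] order_tendstoD(2)[OF l3, of "1/2", simplified]
 proof eventually_elim
  case (elim n)
  obtain u where u: "u holomorphic_on ?H" "u ` ?H \<subseteq> D" "u (?p n) = \<pi> x" "u (?q n) = \<pi> y"
   using main[OF elim(1)] by blast
  define r where "r = Re (?p n) - R"
  have r: "r > 0" using Tk[OF x, of n] by (simp add: r_def)
  have sub: "ball (?p n) r \<subseteq> ?H"
  proof
   fix Z assume "Z \<in> ball (?p n) r"
   thus "Z \<in> ?H" using abs_Re_le_cmod[of "?p n - Z"] by (simp add: dist_norm r_def)
  qed
  have "norm (u (?q n) - u (?p n)) \<le> 3 * B / r * dist (?p n) (?q n)"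
  proof (rule bounded_holomorphic_lipschitz[OF holomorphic_on_subset[OF u(1) sub] r])
   show "norm (u z) \<le> B" if "z \<in> ball (?p n) r" for z using that sub u(2) B by blast
   show "dist (?p n) (?q n) < r / 2" using elim(2) r by (simp add: r_def field_simps)
  qed
  thus ?case using u by (simp add: r_def norm_minus_commute)
 qed
 ultimately have "norm (\<pi> x - \<pi> y) \<le> 3 * B * 0"
  by (intro tendsto_lowerbound) auto
 thus False using ne by simp
qed

end

subsection \<open>Local expansions\<close>

lemma holomorphic_bound1:
 assumes hol: "\<phi> holomorphic_on ball 0 e" and e: "e > (0::real)"
 obtains C r where "C \<ge> 0" "r > 0" "r < e" "!!z. norm z < r ==> norm (\<phi> z - \<phi> 0) \<le> C * norm z"
proof -
 have "continuous_on (cball 0 (e/2)) \<phi>"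
  by (rule holomorphic_on_imp_continuous_on[OF holomorphic_on_subset[OF hol]]) (use e in auto)
 hence "compact (\<phi> ` cball 0 (e/2))" by (rule compact_continuous_image) simp
 from compact_imp_bounded[OF this] obtain B where "\<forall>x\<in>\<phi> ` cball 0 (e/2). norm x \<le> B"
  unfolding bounded_iff by blast
 hence B: "!!z. z \<in> cball 0 (e/2) ==> norm (\<phi> z) \<le> B" by blast
 have "norm (\<phi> 0) \<le> B" using B[of 0] e by simp
 hence B0: "B \<ge> 0" by (rule order_trans[OF norm_ge_zero])
 show thesis
 proof (rule that[of "3 * B / (e/2)" "e/4"])
  fix z :: complex assume z: "norm z < e/4"
  have "norm (\<phi> z - \<phi> 0) \<le> 3 * B / (e/2) * dist 0 z"
  proof (rule bounded_holomorphic_lipschitz)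
   show "\<phi> holomorphic_on ball 0 (e/2)" by (rule holomorphic_on_subset[OF hol]) (use e in auto)
   show "norm (\<phi> z) \<le> B" if "z \<in> ball 0 (e/2)" for z using B[of z] that by simp
  qed (use e z in auto)
  thus "norm (\<phi> z - \<phi> 0) \<le> 3 * B / (e/2) * norm z" by simp
 qed (use B0 e in auto)
qed

lemma holomorphic_bound2:
 assumes hol: "\<phi> holomorphic_on ball 0 e" and e: "e > (0::real)"
 obtains C r where "C \<ge> 0" "r > 0" "r < e" "!!z. norm z < r ==> norm (\<phi> z - \<phi> 0 - deriv \<phi> 0 * z) \<le> C * norm z ^ 2"
proof -
 define g where "g = (%z. if z = 0 then deriv \<phi> 0 else (\<phi> z - \<phi> 0) / (z - 0))"
 have "g holomorphic_on ball 0 e"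
  unfolding g_def by (rule pole_lemma_open[OF hol]) auto
 from holomorphic_bound1[OF this e] obtain C r where C: "C \<ge> 0" "r > 0" "r < e"
  "!!z. norm z < r ==> norm (g z - g 0) \<le> C * norm z" by metis
 show thesis
 proof (rule that[OF C(1-3)])
  fix z :: complex assume z: "norm z < r"
  have "\<phi> z - \<phi> 0 - deriv \<phi> 0 * z = (g z - g 0) * z" by (simp add: g_def field_simps)
  thus "norm (\<phi> z - \<phi> 0 - deriv \<phi> 0 * z) \<le> C * norm z ^ 2"
   using mult_right_mono[OF C(4)[OF z], of "norm z"] by (simp add: norm_mult power2_eq_square mult.assoc)
 qed
qed

lemma binomial_remainder:
 obtains C r where "C \<ge> 0" "r > 0" "r < 1"
  "!!x::complex. norm x < r ==> norm (1 / (1 - x) ^ m - 1 - of_nat m * x) \<le> C * norm x ^ 2"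
proof -
 let ?g = "%x::complex. 1 / (1 - x) ^ m"
 have "?g holomorphic_on ball 0 1" by (intro holomorphic_intros) auto
 from holomorphic_bound2[OF this zero_less_one] obtain C r where C: "C \<ge> 0" "r > 0" "r < 1"
  "!!z. norm z < r ==> norm (?g z - ?g 0 - deriv ?g 0 * z) \<le> C * norm z ^ 2" by metis
 have "(?g has_field_derivative of_nat m) (at 0)"
  by (cases m) (auto intro!: derivative_eq_intros)
 hence "deriv ?g 0 = of_nat m" by (rule DERIV_imp_deriv)
 with C show ?thesis using that[of C r] by simp
qed

abbreviation (input) Reinf :: "complex filter" where "Reinf \<equiv> filtercomap Re at_top"

lemma eventually_Reinf: "eventually P Reinf \<longleftrightarrow> (\<exists>R. \<forall>W. Re W > R \<longrightarrow> P W)"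
proof
 assume "eventually P Reinf"
 thus "\<exists>R. \<forall>W. Re W > R \<longrightarrow> P W"
  unfolding eventually_filtercomap eventually_at_top_linorder by (meson less_imp_le)
next
 assume "\<exists>R. \<forall>W. Re W > R \<longrightarrow> P W"
 then obtain R where "!!W. Re W > R ==> P W" by blast
 thus "eventually P Reinf"
  unfolding eventually_filtercomap eventually_at_top_dense by (intro exI[of _ "%x. x > R"]) auto
qed

lemma filterlim_Re_Reinf: "filterlim Re at_top Reinf"
 by (rule filterlim_filtercomap)

lemma Reinf_inverse_powr:
 assumes "\<sigma> > 0" shows "((%W. norm W powr (- \<sigma>)) \<longlongrightarrow> 0) Reinf"
proof (rule tendsto_neg_powr)
 show "- \<sigma> < 0" using assms by simp
 show "filterlim norm at_top (filtercomap Re at_top)"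
  by (rule filterlim_at_top_mono[OF filterlim_Re_Reinf]) (auto simp: complex_Re_le_cmod)
qed

section \<open>No iterate is the identity; half-plane models of a return map\<close>

context lifting_family
begin

text \<open>Where the iterate is the identity it is its own inverse branch. Continuing this branch
  along segments that avoid finitely many points of the orbit of \<open>c\<close> shows that all but
  finitely many points of the disc of radius \<open>d\<close> about \<open>c\<close> lie in the
  domain, which is too much for its diameter.\<close>

lemma no_identity:
 assumes c: "c \<in> closure D" and N: "N \<ge> 1" and W: "open W" "W ~= {}"
  and id: "!!z. z \<in> W ==> orb c N z \<and> it c N z = z"
 shows False
proof -
 define S where "S = (%n. it c n c) ` {..<N}"
 have finS: "finite S" by (simp add: S_def)
 have WD: "W \<subseteq> D"
 proof
  fix z assume "z \<in> W"
  hence "orb c N z" using id by blast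
  from orb_mono[OF this N] show "z \<in> D" by (simp add: orb_def)
 qed
 have key: "y \<in> D" if y: "norm (y - c) < d" "y \<notin> S" for y
 proof -
  have "\<exists>x\<in>W. \<forall>p\<in>S. p \<notin> closed_segment x y"
  proof -
   \<comment> \<open>Im ((x - y) / (p - y)) vanishes exactly when \<open>x\<close> lies on the line
     through \<open>y\<close> and \<open>p\<close>; removing finitely many lines leaves a nonempty
     open set.\<close>
   have "\<exists>W'. open W' \<and> W' ~= {} \<and> W' \<subseteq> W \<and> (\<forall>x\<in>W'. \<forall>p\<in>S. Im ((x - y) / (p - y)) ~= 0)"
    using finS y(2)
   proof (induction S rule: finite_induct)
    case empty
    thus ?case using W by auto
   next
    case (insert p F)
    then obtain W' where W': "open W'" "W' ~= {}" "W' \<subseteq> W" "\<forall>x\<in>W'. \<forall>p\<in>F. Im ((x - y) / (p - y)) ~= 0"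
     by auto
    have py: "p - y ~= 0" using insert.prems by auto
    define W2 where "W2 = W' \<inter> {x. Im ((x - y) / (p - y)) ~= 0}"
    have "open {x. Im ((x - y) / (p - y)) ~= 0}"
     using py by (intro open_Collect_neq continuous_intros) auto
    hence "open W2" unfolding W2_def using W' by blast
    moreover have "W2 ~= {}"
    proof
     assume e: "W2 = {}"
     obtain x t where x: "x \<in> W'" "t > 0" "ball x t \<subseteq> W'"
      using W' open_contains_ball by (metis ex_in_conv)
     define x' where "x' = x + of_real (t / (2 * norm (p - y))) * \<i> * (p - y)"
     have "x' \<in> ball x t" using x py by (simp add: x'_def dist_norm norm_mult norm_divide)
     hence "Im ((x' - y) / (p - y)) = 0" "Im ((x - y) / (p - y)) = 0" using e x by (auto simp: W2_def)
     moreover have "(x' - y) / (p - y) = (x - y) / (p - y) + of_real (t / (2 * norm (p - y))) * \<i>"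
      using py by (simp add: x'_def divide_simps) (simp add: algebra_simps)
     ultimately have "t / (2 * norm (p - y)) = 0" by simp
     thus False using x py by simp
    qed
    ultimately show ?case using W' by (intro exI[of _ W2]) (auto simp: W2_def)
   qed
   then obtain W' where W': "W' ~= {}" "W' \<subseteq> W" "!!x p. x \<in> W' ==> p \<in> S ==> Im ((x - y) / (p - y)) ~= 0" by blast
   then obtain x where x: "x \<in> W'" by auto
   have "p \<notin> closed_segment x y" if p: "p \<in> S" for p
   proof
    assume "p \<in> closed_segment x y"
    then obtain u where u: "p = (1 - u) *\<^sub>R x + u *\<^sub>R y" by (auto simp: closed_segment_def)
    have e: "p - y = of_real (1 - u) * (x - y)" by (simp add: u scaleR_conv_of_real algebra_simps)
    have "p ~= y" using p y(2) by auto
    hence u1: "1 - u ~= 0" "x ~= y" using e by auto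
    have "(x - y) / (p - y) = of_real (1 / (1 - u))" unfolding e using u1 by (simp del: of_real_diff)
    thus False using W'(3)[OF x p] by simp
   qed
   thus ?thesis using x W'(2) by (intro bexI[of _ x]) auto
  qed
  then obtain x where x: "x \<in> W" "!!p. p \<in> S ==> p \<notin> closed_segment x y" by blast
  define K where "K = closed_segment x y"
  have Kb: "K \<subseteq> ball c d - S"
  proof -
   have "x \<in> ball c d" using diam_closure[of x c] x WD c by (auto simp: dist_norm norm_minus_commute)
   moreover have "y \<in> ball c d" using y by (simp add: dist_norm norm_minus_commute)
   ultimately have "K \<subseteq> ball c d" unfolding K_def by (rule closed_segment_subset) auto
   thus ?thesis using x by (auto simp: K_def)
  qed
  have "open (ball c d - S)" using finS by (intro open_Diff finite_imp_closed) auto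
  then obtain e where e: "e > 0" "(\<Union>k\<in>K. ball k e) \<subseteq> ball c d - S"
   using Kb compact_subset_open_imp_ball_epsilon_subset[of K "ball c d - S"] by (auto simp: K_def)
  \<comment> \<open>The tube about the segment, written as a Minkowski sum so that
    \<open>convex_sums\<close> gives its convexity.\<close>
  define C where "C = (\<Union>k\<in>K. \<Union>b\<in>ball 0 e. {k + b})"
  have Ceq: "C = (\<Union>k\<in>K. ball k e)"
  proof -
   have "(\<Union>b\<in>ball 0 e. {k + b}) = ball k e" for k :: complex
   proof (intro equalityI subsetI)
    fix z assume "z \<in> ball k e"
    hence "z - k \<in> ball 0 e" "z = k + (z - k)" by (auto simp: dist_norm norm_minus_commute)
    thus "z \<in> (\<Union>b\<in>ball 0 e. {k + b})" by blast
   qed (auto simp: dist_norm)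
   thus ?thesis by (simp add: C_def)
  qed
  have Cc: "convex C" unfolding C_def K_def by (intro convex_sums) auto
  have Co: "open C" unfolding Ceq by auto
  have CS: "C \<subseteq> ball c d - S" using e Ceq by auto
  have xC: "x \<in> C" "y \<in> C"
   unfolding Ceq K_def using e(1) by (meson UN_I centre_in_ball ends_in_segment)+
  have "\<exists>u. u holomorphic_on C \<and> u x = x \<and> (N > 0 \<longrightarrow> u ` C \<subseteq> D) \<and> (\<forall>z\<in>C. orb c N (u z) \<and> it c N (u z) = z)"
  proof (rule backlift[OF c Cc Co, where \<pi> = "%z. z" and M = N])
   show "norm (z - c) < d" if "z \<in> C" for z using CS that by (auto simp: dist_norm norm_minus_commute)
   show "it c n c ~= z" if "z \<in> C" "n < N" for z n using CS that by (auto simp: S_def)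
  qed (use xC id[OF x(1)] in auto)
  then obtain u where u: "u holomorphic_on C" "u x = x" "u ` C \<subseteq> D" "!!z. z \<in> C ==> it c N (u z) = z"
   using N by auto
  have "isCont u x" using u(1) Co xC continuous_on_eq_continuous_at holomorphic_on_imp_continuous_on by blast
  hence "\<forall>\<^sub>F z in at x. u z \<in> W"
   using topological_tendstoD[of u "u x" "at x" W] W x u(2) by (simp add: isCont_def)
  then obtain T where T: "open T" "x \<in> T" "!!z. z \<in> T ==> z ~= x ==> u z \<in> W"
   by (auto simp: eventually_at_topological)
  have "u y = y"
  proof (rule analytic_continuation_open[of "T \<inter> C" C u "%z. z"])
   show "open (T \<inter> C)" "connected C" using T Co Cc convex_connected by auto
   show "u z = z" if z: "z \<in> T \<inter> C" for z
   proof (cases "z = x")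
    case False
    hence "it c N (u z) = u z" using T(3)[of z] id z by auto
    thus ?thesis using u(4)[of z] z by auto
   qed (use u in auto)
  qed (use T xC Co u in auto)
  thus "y \<in> D" using u(3) xC by force
 qed
 obtain x0 where "x0 \<in> D" using W WD by auto
 hence d0: "d > 0" using diam_D[of x0 x0] by simp
 have near: "\<exists>y\<in>D. norm (y - z) < d/10" if z: "norm (z - c) < d" for z
 proof -
  have "infinite (ball z (min (d/10) (d - norm (z - c))))"
   using d0 z uncountable_ball[of "min (d/10) (d - norm (z - c))" z] countable_finite by auto
  then obtain y where y: "y \<in> ball z (min (d/10) (d - norm (z - c)))" "y \<notin> S"
   using finS by (meson finite_subset subsetI)
  have "norm (y - c) \<le> norm (y - z) + norm (z - c)" by (metis norm_triangle_sub add.commute diff_add_cancel diff_diff_eq2 norm_triangle_ineq)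
  hence "norm (y - c) < d" using y by (simp add: dist_norm norm_minus_commute)
  thus ?thesis using key[of y] y by (intro bexI[of _ y]) (auto simp: dist_norm norm_minus_commute)
 qed
 \<comment> \<open>Two nearly antipodal points of the disc: their distance exceeds 9/5 d - 2/10 d,
   hence \<open>d\<close>.\<close>
 obtain y1 where y1: "y1 \<in> D" "norm (y1 - (c + of_real (9/10 * d))) < d/10"
  using near[of "c + of_real (9/10 * d)"] d0 by (auto simp del: of_real_mult)
 obtain y2 where y2: "y2 \<in> D" "norm (y2 - (c - of_real (9/10 * d))) < d/10"
  using near[of "c - of_real (9/10 * d)"] d0 by (auto simp del: of_real_mult)
 have "norm (complex_of_real (9/5 * d)) \<le> norm (y1 - y2) + norm (y1 - (c + of_real (9/10 * d))) + norm (y2 - (c - of_real (9/10 * d)))"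
 proof -
  have "complex_of_real (9/5 * d) = (y1 - y2) - (y1 - (c + of_real (9/10 * d))) + (y2 - (c - of_real (9/10 * d)))" by simp
  also have "norm \<dots> \<le> norm ((y1 - y2) - (y1 - (c + of_real (9/10 * d)))) + norm (y2 - (c - of_real (9/10 * d)))"
   by (rule norm_triangle_ineq)
  also have "norm ((y1 - y2) - (y1 - (c + of_real (9/10 * d)))) \<le> norm (y1 - y2) + norm (y1 - (c + of_real (9/10 * d)))"
   by (rule norm_triangle_ineq4)
  finally show ?thesis by simp
 qed
 moreover have "norm (complex_of_real (9/5 * d)) = 9/5 * d" using d0 by (simp del: of_real_mult)
 ultimately show False using y1 y2 diam_D[OF y1(1) y2(1)] d0 by linarith
qed

definition model :: "complex => nat => complex => (complex => complex) => (complex => complex) => real => complex => bool" where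
 "model c N a \<pi> T R L \<longleftrightarrow> N \<ge> 1 \<and> Re L > 0 \<and> \<pi> holomorphic_on {W. Re W > R} \<and> T holomorphic_on {W. Re W > R} \<and>
   (\<forall>W. Re W > R \<longrightarrow> orb c N (\<pi> W) \<and> it c N (\<pi> W) = \<pi> (T W) \<and> \<pi> W ~= a \<and>
    Re (T W) \<ge> Re W + Re L / 2 \<and> (%k. (T ^^ k) W / of_nat k) \<longlonglongrightarrow> L \<and>
    (\<exists>\<Lambda>. \<Lambda> ~= 0 \<and> (%k. \<Prod>i<k. deriv T ((T ^^ i) W)) \<longlonglongrightarrow> \<Lambda>)) \<and>
   (\<pi> \<longlongrightarrow> a) Reinf"

lemma modelI:
 assumes "N \<ge> 1" and L: "Re L > 0" and hol: "\<pi> holomorphic_on {W. Re W > R}" "T holomorphic_on {W. Re W > R}"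
  and "!!W. Re W > R ==> orb c N (\<pi> W) \<and> it c N (\<pi> W) = \<pi> (T W) \<and> \<pi> W ~= a"
  and R: "R \<ge> 1" and \<sigma>: "\<sigma> > 0"
  and bd: "!!W. Re W > R ==> norm (T W - W - L) \<le> B * Re W powr (- \<sigma>)"
  and "(\<pi> \<longlongrightarrow> a) Reinf"
 obtains R1 where "R1 \<ge> R" "model c N a \<pi> T R1 L"
proof -
 obtain R1 where R1: "R1 \<ge> R"
  "!!W. Re W > R1 ==> Re (T W) \<ge> Re W + Re L / 2"
  "!!W k. Re W > R1 ==> Re ((T ^^ k) W) \<ge> Re W + k * (Re L / 2)"
  "!!W. Re W > R1 ==> (%k. (T ^^ k) W / of_nat k) \<longlonglongrightarrow> L"
  "!!W. Re W > R1 ==> \<exists>\<Lambda>. \<Lambda> ~= 0 \<and> (%k. \<Prod>i<k. deriv T ((T ^^ i) W)) \<longlonglongrightarrow> \<Lambda>"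
  by (rule asymptotic_translation[OF hol(2) R L \<sigma> bd], assumption, rule that)
 have sub: "{W. Re W > R1} \<subseteq> {W. Re W > R}" using R1 by auto
 show thesis
 proof (rule that[OF R1(1)])
  show "model c N a \<pi> T R1 L"
   unfolding model_def
  proof (intro conjI allI impI)
   fix W assume W: "Re W > R1"
   hence "Re W > R" using R1 by simp
   from assms(5)[OF this] show "orb c N (\<pi> W)" "it c N (\<pi> W) = \<pi> (T W)" "\<pi> W ~= a" by auto
   show "Re W + Re L / 2 \<le> Re (T W)" "(%k. (T ^^ k) W / of_nat k) \<longlonglongrightarrow> L"
    "\<exists>\<Lambda>. \<Lambda> ~= 0 \<and> (%k. \<Prod>i<k. deriv T ((T ^^ i) W)) \<longlonglongrightarrow> \<Lambda>"
    using R1(2,4,5)[OF W] by simp_all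
  next
   show "\<pi> holomorphic_on {W. Re W > R1}" "T holomorphic_on {W. Re W > R1}"
    using holomorphic_on_subset[OF hol(1) sub] holomorphic_on_subset[OF hol(2) sub] .
  qed (fact assms)+
 qed
qed

lemma model_iter:
 assumes "model c N a \<pi> T R L" "Re W > R"
 shows "Re ((T ^^ k) W) \<ge> Re W + k * (Re L / 2)" "Re ((T ^^ k) W) > R"
  "orb c (k * N) (\<pi> W)" "it c (k * N) (\<pi> W) = \<pi> ((T ^^ k) W)"
proof -
 have L: "Re L > 0" using assms by (simp add: model_def)
 have 1: "Re ((T ^^ k) W) \<ge> Re W + k * (Re L / 2) \<and> Re ((T ^^ k) W) > R" for k
 proof (induction k)
  case (Suc k)
  hence "Re (T ((T ^^ k) W)) \<ge> Re ((T ^^ k) W) + Re L / 2" using assms(1) by (simp add: model_def)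
  thus ?case using Suc L by (simp add: algebra_simps add_divide_distrib)
 qed (use assms in simp)
 thus "Re ((T ^^ k) W) \<ge> Re W + k * (Re L / 2)" "Re ((T ^^ k) W) > R" by auto
 have "orb c (k * N) (\<pi> W) \<and> it c (k * N) (\<pi> W) = \<pi> ((T ^^ k) W)"
 proof (induction k)
  case (Suc k)
  have "orb c N (\<pi> ((T ^^ k) W)) \<and> it c N (\<pi> ((T ^^ k) W)) = \<pi> (T ((T ^^ k) W))"
   using 1[of k] assms(1) by (simp add: model_def)
  thus ?case using Suc by (simp add: orb_add it_add)
 qed simp
 thus "orb c (k * N) (\<pi> W)" "it c (k * N) (\<pi> W) = \<pi> ((T ^^ k) W)" by auto
qed

lemma model_Re_top:
 assumes "model c N a \<pi> T R L" "Re W > R"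
 shows "filterlim (%k. Re ((T ^^ k) W)) at_top sequentially"
proof (rule filterlim_at_top_mono)
 have "Re L > 0" using assms by (simp add: model_def)
 thus "filterlim (%k. Re W + real k * (Re L / 2)) at_top sequentially" by real_asymp
qed (use model_iter[OF assms] in auto)

lemma model_lim:
 assumes "model c N a \<pi> T R L" "Re W > R"
 shows "(%k. \<pi> ((T ^^ k) W)) \<longlonglongrightarrow> a"
proof -
 have "filterlim (%k. (T ^^ k) W) Reinf sequentially"
  using model_Re_top[OF assms] by (simp add: filterlim_filtercomap_iff o_def)
 thus ?thesis using assms by (auto simp: model_def intro: filterlim_compose)
qed

text \<open>Two points with different images are found on a single orbit of \<open>T\<close>: their
  images tend to \<open>a\<close> without ever being \<open>a\<close>, so they are not
  constant.\<close>

lemma model_reach: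
 assumes c: "c \<in> closure D" and M: "model c N a \<pi> T R L"
 shows "\<exists>n W. Re W > R \<and> orb c n c \<and> it c n c = \<pi> W"
proof -
 have L: "Re L > 0" and N: "N \<ge> 1" using M by (auto simp: model_def)
 define x where "x = complex_of_real (R + 1)"
 have x: "Re x > R" by (simp add: x_def)
 have "\<exists>k. \<pi> ((T ^^ k) x) ~= \<pi> x"
 proof (rule ccontr)
  assume "\<not> ?thesis"
  hence "(%k. \<pi> x) \<longlonglongrightarrow> a" using model_lim[OF M x] by simp
  hence "\<pi> x = a" by (simp add: LIMSEQ_const_iff)
  thus False using M x by (simp add: model_def)
 qed
 then obtain k where k: "\<pi> ((T ^^ k) x) ~= \<pi> x" by blast
 show ?thesis
 proof (rule reach_half_plane[OF c N _ _ _ _ _ _ L model_iter(2)[OF M x] x k])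
  show "Re (T W) > R" if "Re W > R" for W using M that L by (force simp: model_def)
 qed (use M in \<open>auto simp: model_def\<close>)
qed

end

text \<open>Both points of the difference quotient may move. Later a perturbed orbit is compared
  with another perturbed orbit, so differentiability at a fixed point would not be enough.\<close>

lemma strict_derivative:
 assumes hol: "\<phi> holomorphic_on S" and S: "open S" "a \<in> S" and e: "e > (0::real)"
 obtains r where "r > 0" "ball a r \<subseteq> S"
  "!!u v. u \<in> ball a r ==> v \<in> ball a r ==> norm (\<phi> u - \<phi> v - deriv \<phi> a * (u - v)) \<le> e * norm (u - v)"
proof -
 have "isCont (deriv \<phi>) a"
  using holomorphic_deriv[OF hol S(1)] S continuous_on_eq_continuous_at holomorphic_on_imp_continuous_on by blast
 then obtain r1 where r1: "r1 > 0" "!!x. dist x a < r1 ==> dist (deriv \<phi> x) (deriv \<phi> a) < e"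
  using e unfolding continuous_at_eps_delta by (auto simp: dist_commute)
 obtain r2 where r2: "r2 > 0" "ball a r2 \<subseteq> S" using S open_contains_ball by blast
 define r where "r = min r1 r2"
 show thesis
 proof (rule that[of r])
  show "ball a r \<subseteq> S" using r2 by (auto simp: r_def)
  fix u v assume uv: "u \<in> ball a r" "v \<in> ball a r"
  have "norm ((\<phi> u - deriv \<phi> a * u) - (\<phi> v - deriv \<phi> a * v)) \<le> e * norm (u - v)"
  proof (rule field_differentiable_bound[where S = "ball a r" and f' = "%x. deriv \<phi> x - deriv \<phi> a"])
   fix x assume x: "x \<in> ball a r"
   hence "x \<in> S" using r2 by (auto simp: r_def)
   hence "(\<phi> has_field_derivative deriv \<phi> x) (at x)" using hol S by (intro holomorphic_derivI) auto
   hence "((%z. \<phi> z - deriv \<phi> a * z) has_field_derivative deriv \<phi> x - deriv \<phi> a * 1) (at x)"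
    by (intro derivative_intros DERIV_cmult) auto
   thus "((%z. \<phi> z - deriv \<phi> a * z) has_field_derivative deriv \<phi> x - deriv \<phi> a) (at x within ball a r)"
    by (simp add: has_field_derivative_at_within)
   show "norm (deriv \<phi> x - deriv \<phi> a) \<le> e"
    using r1(2)[of x] x by (simp add: r_def dist_norm norm_minus_commute less_imp_le)
  qed (use uv in auto)
  thus "norm (\<phi> u - \<phi> v - deriv \<phi> a * (u - v)) \<le> e * norm (u - v)" by (simp add: algebra_simps)
 qed (use r1 r2 in \<open>auto simp: r_def\<close>)
qed

lemma strict_derivative_tendsto:
 assumes hol: "\<phi> holomorphic_on S" and S: "open S" "a \<in> S"
  and u: "(u \<longlongrightarrow> a) F" and v: "(v \<longlongrightarrow> a) F" and ne: "\<forall>\<^sub>F x in F. u x ~= v x"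
 shows "((%x. (\<phi> (u x) - \<phi> (v x)) / (u x - v x)) \<longlongrightarrow> deriv \<phi> a) F"
proof (rule tendstoI)
 fix e :: real assume e: "e > 0"
 obtain r where r: "r > 0"
  "!!u v. u \<in> ball a r ==> v \<in> ball a r ==> norm (\<phi> u - \<phi> v - deriv \<phi> a * (u - v)) \<le> e/2 * norm (u - v)"
  using strict_derivative[OF hol S, of "e/2"] e by (metis half_gt_zero)
 show "\<forall>\<^sub>F x in F. dist ((\<phi> (u x) - \<phi> (v x)) / (u x - v x)) (deriv \<phi> a) < e"
  using tendstoD[OF u r(1)] tendstoD[OF v r(1)] ne
 proof eventually_elim
  case (elim x)
  have n: "norm (u x - v x) > 0" using elim by simp
  have "norm (\<phi> (u x) - \<phi> (v x) - deriv \<phi> a * (u x - v x)) \<le> e/2 * norm (u x - v x)"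
   using elim by (intro r(2)) (auto simp: dist_commute)
  hence "norm ((\<phi> (u x) - \<phi> (v x) - deriv \<phi> a * (u x - v x)) / (u x - v x)) \<le> e/2"
   using n by (simp add: norm_divide divide_le_eq)
  moreover have "(\<phi> (u x) - \<phi> (v x) - deriv \<phi> a * (u x - v x)) / (u x - v x)
    = (\<phi> (u x) - \<phi> (v x)) / (u x - v x) - deriv \<phi> a"
   using n by (simp add: diff_divide_distrib)
  ultimately show ?case using e by (simp add: dist_norm)
 qed
qed

text \<open>The differences \<phi> \<circ> \<psi> - \<phi> and \<psi> \<circ> \<phi> - \<phi>
  coincide, and their leading terms are \<kappa> g0 z^M and g0 (\<kappa> z)^M.\<close>

lemma commuting_germ_multiplier:
 assumes \<phi>: "\<phi> holomorphic_on S" "open S" "0 \<in> S" "\<phi> 0 = 0" "deriv \<phi> 0 = \<kappa>" "\<kappa> ~= 0"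
  and g: "(g \<longlongrightarrow> g0) (at 0)" "g0 ~= 0"
  and \<psi>: "\<forall>\<^sub>F z in at 0. \<psi> z - z = z ^ M * g z" and M: "M \<ge> 1"
  and com: "\<forall>\<^sub>F z in at 0. \<phi> (\<psi> z) = \<psi> (\<phi> z)"
 shows "\<kappa> ^ (M - 1) = 1"
proof -
 have id: "((%z::complex. z) \<longlongrightarrow> 0) (at 0)" by (rule tendsto_ident_at)
 have "((%z. z ^ M * g z + z) \<longlongrightarrow> 0 ^ M * g0 + 0) (at 0)" by (intro tendsto_intros g id)
 moreover have "\<forall>\<^sub>F z in at 0. z ^ M * g z + z = \<psi> z" using \<psi> by eventually_elim (simp add: algebra_simps)
 ultimately have "(\<psi> \<longlongrightarrow> 0 ^ M * g0 + 0) (at 0)" by (rule Lim_transform_eventually)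
 moreover have "0 ^ M = (0::complex)" using M by (simp add: zero_power)
 ultimately have psi0: "(\<psi> \<longlongrightarrow> 0) (at 0)" by simp
 have nz: "\<forall>\<^sub>F z in at 0. z ~= (0::complex)" by (simp add: eventually_at_filter)
 have gn: "\<forall>\<^sub>F z in at 0. g z ~= 0" using g by (rule tendsto_imp_eventually_ne)
 have ne: "\<forall>\<^sub>F z in at 0. \<psi> z ~= z" using \<psi> nz gn by eventually_elim auto
 have q1: "((%z. (\<phi> (\<psi> z) - \<phi> z) / (\<psi> z - z)) \<longlongrightarrow> \<kappa>) (at 0)"
  using strict_derivative_tendsto[OF \<phi>(1-3) psi0 id ne] \<phi>(5) by simp
 have A: "((%z. (\<phi> (\<psi> z) - \<phi> z) / (\<psi> z - z) * g z) \<longlongrightarrow> \<kappa> * g0) (at 0)" by (intro tendsto_mult q1 g)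
 have isc: "(\<phi> \<longlongrightarrow> 0) (at 0)"
  using \<phi> holomorphic_on_imp_continuous_on[OF \<phi>(1)] continuous_on_eq_continuous_at[OF \<phi>(2)]
  by (metis isCont_def)
 have q2: "((%z. (\<phi> z - \<phi> 0) / (z - 0)) \<longlongrightarrow> \<kappa>) (at 0)"
  using holomorphic_derivI[OF \<phi>(1-3)] \<phi>(5) by (simp add: has_field_derivative_iff)
 hence q2: "((%z. \<phi> z / z) \<longlongrightarrow> \<kappa>) (at 0)" using \<phi>(4) by simp
 have pnz: "\<forall>\<^sub>F z in at 0. \<phi> z ~= 0"
  using tendsto_imp_eventually_ne[OF q2 \<phi>(6)] by eventually_elim auto
 have at0: "filterlim \<phi> (at 0) (at 0)" using isc pnz by (simp add: filterlim_at)
 have B: "((%z. (\<phi> z / z) ^ M * g (\<phi> z)) \<longlongrightarrow> \<kappa> ^ M * g0) (at 0)"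
  by (intro tendsto_intros q2 filterlim_compose[OF g(1) at0])
 have "\<forall>\<^sub>F z in at 0. (\<phi> (\<psi> z) - \<phi> z) / (\<psi> z - z) * g z = (\<phi> z / z) ^ M * g (\<phi> z)"
  using com nz \<psi> ne gn eventually_compose_filterlim[OF \<psi> at0]
 proof eventually_elim
  case (elim z)
  have "(\<phi> (\<psi> z) - \<phi> z) / (\<psi> z - z) * g z = (\<phi> z) ^ M * g (\<phi> z) / (z ^ M * g z) * g z"
   using elim by simp
  thus ?case using elim by (simp add: power_divide)
 qed
 with A have "((%z. (\<phi> z / z) ^ M * g (\<phi> z)) \<longlongrightarrow> \<kappa> * g0) (at 0)" by (rule Lim_transform_eventually)
 from tendsto_unique[OF _ this B] have "\<kappa> * g0 = \<kappa> ^ M * g0" by simp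
 hence "\<kappa> = \<kappa> ^ M" using g by simp
 also have "\<dots> = \<kappa> * \<kappa> ^ (M - 1)" using M by (simp add: power_eq_if)
 finally show ?thesis using \<phi>(6) by simp
qed

section \<open>Coordinates at attracting and at parabolic cycles\<close>

context lifting_family
begin

text \<open>With z = exp (- W) the return map is a translation by - Ln \<kappa> up to O(exp (- Re
  W)). No linearising coordinate is constructed, since \<open>modelI\<close> tolerates errors of
  power type. The derivative is displayed with denominator 1 to match the shape of the parabolic
  case.\<close>

lemma attracting_model:
 assumes q: "q \<ge> 1" and a: "orb c q a" "it c q a = a" and \<kappa>: "Dit c q a = \<kappa>" "\<kappa> ~= 0" "norm \<kappa> < 1"
 obtains \<pi> T R L where "model c q a \<pi> T R L"
  "!!W. Re W > R ==> (\<pi> has_field_derivative - (\<pi> W - a) / 1) (at W)"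
proof -
 let ?F = "it c q"
 obtain e where e: "e > 0" "ball a e \<subseteq> {z. orb c q z}"
  using orb_open1 a open_contains_ball by (metis mem_Collect_eq)
 have F: "?F holomorphic_on ball a e" by (rule it_holomorphic1[OF e(2)])
 have dF: "deriv ?F a = \<kappa>" using deriv_it[OF a(1)] \<kappa> by simp
 define k where "k = (%z. if z = a then deriv ?F a else (?F z - ?F a) / (z - a))"
 have k: "k holomorphic_on ball a e" unfolding k_def by (rule pole_lemma_open[OF F open_ball])
 have Fk: "?F (a + z) = a + z * k (a + z)" for z
  using a by (simp add: k_def)
 define k0 where "k0 = (%z. k (a + z) / \<kappa>)"
 have k0: "k0 holomorphic_on ball 0 e"
  unfolding k0_def by (intro holomorphic_intros holomorphic_on_compose_gen[OF _ k, unfolded o_def]) (auto simp: \<kappa> dist_norm)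
 have k00: "k0 0 = 1" using dF \<kappa> by (simp add: k0_def k_def)
 obtain C r where C: "C \<ge> 0" "r > 0" "r < e" "!!z. norm z < r ==> norm (k0 z - k0 0) \<le> C * norm z"
  using holomorphic_bound1[OF k0 e(1)] by blast
 define e1 where "e1 = min r (1 / (2 * (C + 1)))"
 have e1: "e1 > 0" "e1 \<le> r" "e1 < e" using C by (auto simp: e1_def)
 have k1: "norm (k0 z - 1) < 1" if "norm z < e1" for z
 proof -
  have "norm (k0 z - 1) \<le> C * norm z" using C(4)[of z] that e1 k00 by simp
  also have "\<dots> \<le> C * (1 / (2 * (C + 1)))" using that C by (intro mult_left_mono) (auto simp: e1_def)
  also have "\<dots> < 1" using C by (simp add: field_simps)
  finally show ?thesis .
 qed
 define \<phi> where "\<phi> = (%z. Ln (k0 z))"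
 have pos: "k0 z \<notin> \<real>\<^sub>\<le>\<^sub>0" "k0 z ~= 0" if "norm z < e1" for z
 proof -
  have "Re (k0 z) > 0" using k1[OF that] abs_Re_le_cmod[of "k0 z - 1"] by simp
  thus "k0 z \<notin> \<real>\<^sub>\<le>\<^sub>0" "k0 z ~= 0" by (auto simp: complex_nonpos_Reals_iff)
 qed
 have phi: "\<phi> holomorphic_on ball 0 e1"
  unfolding \<phi>_def by (intro holomorphic_intros holomorphic_on_subset[OF k0]) (use pos e1 in auto)
 obtain C2 r2 where C2: "C2 \<ge> 0" "r2 > 0" "r2 < e1" "!!z. norm z < r2 ==> norm (\<phi> z - \<phi> 0) \<le> C2 * norm z"
  using holomorphic_bound1[OF phi e1(1)] by blast
 have phi0: "\<phi> 0 = 0" by (simp add: \<phi>_def k00)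
 define R where "R = max 1 (- ln r2)"
 have small: "norm (exp (- W)) < r2" if "Re W > R" for W :: complex
 proof -
  have "- Re W < ln r2" using that by (simp add: R_def)
  hence "exp (- Re W) < exp (ln r2)" by simp
  thus ?thesis using C2 by simp
 qed
 define L where "L = - Ln \<kappa>"
 define \<pi> where "\<pi> = (%W. a + exp (- W))"
 define T where "T = (%W. W + L - \<phi> (exp (- W)))"
 have Tpi: "\<pi> (T W) = ?F (\<pi> W)" if "Re W > R" for W
 proof -
  have z: "norm (exp (- W)) < e1" using small[OF that] C2 by simp
  have "exp (- T W) = exp (- W) * exp (- L) * exp (\<phi> (exp (- W)))"
   by (simp add: T_def exp_add[symmetric] algebra_simps)
  also have "\<dots> = exp (- W) * \<kappa> * k0 (exp (- W))"
   using pos[OF z] \<kappa> by (simp add: L_def \<phi>_def)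
  also have "\<dots> = exp (- W) * k (a + exp (- W))" using \<kappa> by (simp add: k0_def)
  finally show ?thesis using Fk[of "exp (- W)"] by (simp add: \<pi>_def)
 qed
 have "R \<ge> 1" by (simp add: R_def)
 have Lp: "Re L > 0" using \<kappa> by (simp add: L_def)
 have lim: "(\<pi> \<longlongrightarrow> a) Reinf"
 proof -
  have "((%W. exp (- W) :: complex) \<longlongrightarrow> 0) Reinf"
  proof (rule tendsto_norm_zero_cancel)
   have "((%x::real. exp (- x)) \<longlongrightarrow> 0) at_top" by real_asymp
   from filterlim_compose[OF this filterlim_Re_Reinf]
   show "((%W. norm (exp (- W) :: complex)) \<longlongrightarrow> 0) Reinf" by simp
  qed
  from tendsto_add[OF tendsto_const[of a] this] show ?thesis by (simp add: \<pi>_def)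
 qed
 obtain R1 where R1: "R1 \<ge> R" "model c q a \<pi> T R1 L"
 proof (rule modelI[OF q Lp _ _ _ \<open>R \<ge> 1\<close> zero_less_one _ lim])
  show "\<pi> holomorphic_on {W. Re W > R}" unfolding \<pi>_def by (intro holomorphic_intros)
  show "T holomorphic_on {W. Re W > R}"
   unfolding T_def
   by (intro holomorphic_intros holomorphic_on_compose_gen[OF _ phi, unfolded o_def])
     (use small C2 in \<open>force\<close>)
  show "orb c q (\<pi> W) \<and> it c q (\<pi> W) = \<pi> (T W) \<and> \<pi> W ~= a" if W: "Re W > R" for W
  proof -
   have "\<pi> W \<in> ball a e" using small[OF W] C2 e1 by (simp add: \<pi>_def dist_norm)
   thus ?thesis using e Tpi[OF W] by (auto simp: \<pi>_def)
  qed
  show "norm (T W - W - L) \<le> C2 * Re W powr - 1" if W: "Re W > R" for W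
  proof -
   have x: "Re W > 1" using W by (simp add: R_def)
   have "norm (T W - W - L) = norm (\<phi> (exp (- W)))" by (simp add: T_def)
   also have "\<dots> \<le> C2 * norm (exp (- W))" using C2(4)[OF small[OF W]] phi0 by simp
   also have "norm (exp (- W)) \<le> Re W powr - 1"
   proof -
    have "Re W \<le> exp (Re W)" using exp_ge_add_one_self[of "Re W"] by linarith
    thus ?thesis using x unfolding norm_exp_eq_Re by (simp add: powr_minus exp_minus)
   qed
   finally show ?thesis using C2 by (simp add: mult_left_mono)
  qed
 qed auto
 show thesis
 proof (rule that[OF R1(2)])
  show "(\<pi> has_field_derivative - (\<pi> W - a) / 1) (at W)" for W
   unfolding \<pi>_def by (auto intro!: derivative_eq_intros)
 qed
qed

text \<open>This is the Fatou coordinate z = \<beta> W^(-1/m). The normalisation of \<beta> gives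
  z^m h(z) = - \<open>x W\<close>, so z turns into z (1 - x) and W into W (1 - x)^(-m), which is W +
  1 up to a term of order |W|^(-1/m).\<close>

lemma parabolic_model:
 assumes N: "N \<ge> 1" and m: "m \<ge> 1" and e: "e > 0"
  and exp_G: "!!z. norm z < e ==> orb c N (a + z) \<and> it c N (a + z) = a + z * (1 + z ^ m * h z)"
  and h: "h holomorphic_on ball 0 e" "h 0 = A" "A ~= 0" and \<beta>: "A * \<beta> ^ m = - 1 / of_nat m"
 obtains T R where "model c N a (%W. a + \<beta> * exp (- Ln W / of_nat m)) T R 1" "R \<ge> 1"
  "!!W. Re W > R ==> ((%W. a + \<beta> * exp (- Ln W / of_nat m)) has_field_derivative
    - ((a + \<beta> * exp (- Ln W / of_nat m)) - a) / (of_nat m * W)) (at W)"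
proof -
 define z where "z = (%W. \<beta> * exp (- Ln W / of_nat m))"
 define x where "x = (%W. h (z W) / A / (of_nat m * W))"
 define T where "T = (%W. W * (1 / (1 - x W) ^ m))"
 define \<sigma> where "\<sigma> = 1 / real m"
 have sg: "\<sigma> > 0" "\<sigma> \<le> 1" using m by (auto simp: \<sigma>_def)
 have b0: "\<beta> ~= 0" using \<beta> m h by (cases "\<beta> = 0") (auto simp: zero_power)
 have nz: "norm (z W) = norm \<beta> * norm W powr (- \<sigma>)" if "W ~= 0" for W
  using that by (simp add: z_def norm_mult \<sigma>_def powr_def)
 have zm: "z W ^ m = - 1 / (of_nat m * A * W)" if "W ~= 0" for W
 proof -
  have "exp (- Ln W / of_nat m) ^ m = exp (- Ln W)"
   using m by (simp add: exp_of_nat_mult[symmetric])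
  also have "\<dots> = 1 / W" using that by (simp add: exp_minus field_simps)
  finally have "z W ^ m = \<beta> ^ m / W" by (simp add: z_def power_mult_distrib)
  moreover have "\<beta> ^ m = - 1 / (of_nat m * A)" using \<beta> h m by (simp add: field_simps)
  ultimately show ?thesis by simp
 qed
 obtain Ch rh where Ch: "Ch \<ge> 0" "rh > 0" "rh < e" "!!z. norm z < rh ==> norm (h z - h 0) \<le> Ch * norm z"
  using holomorphic_bound1[OF h(1) e] by blast
 obtain Cb rb where Cb: "Cb \<ge> 0" "rb > 0" "rb < 1"
  "!!x::complex. norm x < rb ==> norm (1 / (1 - x) ^ m - 1 - of_nat m * x) \<le> Cb * norm x ^ 2"
  using binomial_remainder by blast
 have "(%x::complex. Ln (1 - x)) holomorphic_on ball 0 1"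
 proof (intro holomorphic_intros)
  fix y :: complex assume "y \<in> ball 0 1"
  hence "Re (1 - y) > 0" using abs_Re_le_cmod[of y] by simp
  thus "1 - y \<notin> \<real>\<^sub>\<le>\<^sub>0" by (auto simp: complex_nonpos_Reals_iff)
 qed
 from holomorphic_bound1[OF this zero_less_one] obtain Cl rl where Cl: "Cl \<ge> 0" "rl > 0" "rl < 1"
  "!!x. norm x < rl ==> norm (Ln (1 - x)) \<le> Cl * norm (x::complex)" by auto
 define K where "K = 1 + Ch * rh / norm A"
 have K: "K \<ge> 1" using Ch by (simp add: K_def)
 have lz: "((%W. norm \<beta> * norm W powr (- \<sigma>)) \<longlongrightarrow> norm \<beta> * 0) Reinf"
  by (intro tendsto_intros Reinf_inverse_powr sg)
 have l1: "((%W. K * norm W powr (- 1)) \<longlongrightarrow> K * 0) Reinf"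
  by (intro tendsto_intros Reinf_inverse_powr) auto
 have "\<forall>\<^sub>F W in Reinf. norm \<beta> * norm W powr (- \<sigma>) < rh \<and> K * norm W powr (- 1) < rb \<and> K * norm W powr (- 1) < rl
   \<and> K * norm W powr (- 1) < 1 / (real m * (Cl + 1))"
  using order_tendstoD(2)[OF lz, of rh] order_tendstoD(2)[OF l1, of rb] order_tendstoD(2)[OF l1, of rl]
   order_tendstoD(2)[OF l1, of "1 / (real m * (Cl + 1))"] Ch Cb Cl m by (simp add: eventually_conj_iff)
 then obtain R0 where R0: "!!W. Re W > R0 ==> norm \<beta> * norm W powr (- \<sigma>) < rh \<and> K * norm W powr (- 1) < rb
   \<and> K * norm W powr (- 1) < rl \<and> K * norm W powr (- 1) < 1 / (real m * (Cl + 1))"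
  unfolding eventually_Reinf by blast
 define R where "R = max 1 R0"
 have R: "R \<ge> 1" by (simp add: R_def)
 have bas: "Re W > 1" "W ~= 0" "norm W > 1" "norm (z W) < rh" "norm (z W) < e" "norm (x W) \<le> K / norm W"
   "norm (x W) < rb" "norm (x W) < rl" "real m * norm (Ln (1 - x W)) < 1" "1 - x W ~= 0"
  if W: "Re W > R" for W
 proof -
  show W1: "Re W > 1" using W by (simp add: R_def)
  hence W0: "W ~= 0" and Wn: "norm W > 1" using complex_Re_le_cmod[of W] by auto
  show "W ~= 0" "norm W > 1" by fact+
  have r0: "norm \<beta> * norm W powr (- \<sigma>) < rh" "K * norm W powr (- 1) < rb"
   "K * norm W powr (- 1) < rl" "K * norm W powr (- 1) < 1 / (real m * (Cl + 1))" using R0[of W] W by (auto simp: R_def)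
  show zr: "norm (z W) < rh" using r0 nz[OF W0] by simp
  thus "norm (z W) < e" using Ch by simp
  have "norm (h (z W)) \<le> norm A + norm (h (z W) - h 0)"
   using norm_triangle_sub[of "h (z W)" "h 0"] h by simp
  also have "\<dots> \<le> norm A + Ch * rh"
   using Ch(4)[OF zr] zr Ch by (smt (verit) mult_left_mono)
  finally have "norm (h (z W) / A) \<le> K"
   using h by (simp add: K_def norm_divide field_simps)
  hence "norm (h (z W) / A) / (real m * norm W) \<le> K / (1 * norm W)"
   using m Wn K by (intro frac_le mult_mono) auto
  thus xK: "norm (x W) \<le> K / norm W" by (simp add: x_def norm_divide norm_mult)
  have pw: "K / norm W = K * norm W powr (- 1)" using Wn by (simp add: powr_minus_divide)
  show xr: "norm (x W) < rb" "norm (x W) < rl" using xK r0(2,3) pw by linarith+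
  have "norm (Ln (1 - x W)) \<le> Cl * norm (x W)" by (rule Cl(4)[OF xr(2)])
  hence "real m * norm (Ln (1 - x W)) \<le> real m * ((Cl + 1) * norm (x W))"
   by (intro mult_left_mono) (auto simp: algebra_simps intro: order_trans)
  also have "\<dots> < 1"
  proof -
   have "norm (x W) < 1 / (real m * (Cl + 1))" using xK r0(4) pw by linarith
   moreover have "real m * (Cl + 1) > 0" using m Cl(1) by simp
   ultimately have "norm (x W) * (real m * (Cl + 1)) < 1" by (simp only: pos_less_divide_eq)
   thus ?thesis by (simp add: algebra_simps)
  qed
  finally show "real m * norm (Ln (1 - x W)) < 1" .
  show "1 - x W ~= 0" using xr Cb by auto
 qed
 let ?H = "{W. Re W > R}"
 have nonpos: "W \<notin> \<real>\<^sub>\<le>\<^sub>0" if "Re W > R" for W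
  using that R by (auto simp: complex_nonpos_Reals_iff)
 have hz: "z holomorphic_on ?H"
  unfolding z_def by (intro holomorphic_intros) (use nonpos m in auto)
 have hx: "x holomorphic_on ?H"
  unfolding x_def
  by (intro holomorphic_intros holomorphic_on_compose_gen[OF hz h(1), unfolded o_def]) (use bas(2,5) h m in auto)
 have hT: "T holomorphic_on ?H" unfolding T_def by (intro holomorphic_intros hx) (use bas(10) in auto)
 have zT: "z (T W) = z W * (1 - x W)" if W: "Re W > R" for W
 proof -
  \<comment> \<open>The principal logarithm is the right branch: the argument of \<open>W\<close> is
    below pi/2 and the correction below 1 in modulus, so the result stays inside (-pi, pi).\<close>
  have "Ln (T W) = Ln W - of_nat m * Ln (1 - x W)"
  proof (rule Ln_unique)
   show "exp (Ln W - of_nat m * Ln (1 - x W)) = T W"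
    using bas(2,10)[OF W] by (simp add: exp_diff exp_of_nat_mult T_def)
   have 1: "\<bar>Im (Ln W)\<bar> < pi / 2" using bas(1,2)[OF W] Re_Ln_pos_lt[of W] by auto
   have "\<bar>Im (of_nat m * Ln (1 - x W))\<bar> \<le> norm (of_nat m * Ln (1 - x W))" by (rule abs_Im_le_cmod)
   hence 2: "\<bar>Im (of_nat m * Ln (1 - x W))\<bar> < 1" using bas(9)[OF W] by (simp add: norm_mult)
   have p: "pi > 2" using pi_gt3 by simp
   show "- pi < Im (Ln W - of_nat m * Ln (1 - x W))" using 1 2 p unfolding minus_complex.simps by linarith
   show "Im (Ln W - of_nat m * Ln (1 - x W)) \<le> pi" using 1 2 p unfolding minus_complex.simps by linarith
  qed
  hence "- Ln (T W) / of_nat m = - Ln W / of_nat m + Ln (1 - x W)" using m by (simp add: field_simps)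
  hence "z (T W) = \<beta> * exp (- Ln W / of_nat m + Ln (1 - x W))" by (simp only: z_def)
  also have "\<dots> = z W * exp (Ln (1 - x W))" by (simp only: exp_add z_def mult.assoc)
  finally show ?thesis using bas(10)[OF W] by simp
 qed
 define B where "B = Cb * K ^ 2 + Ch * norm \<beta> / norm A"
 have bound: "norm (T W - W - 1) \<le> B * Re W powr - \<sigma>" if W: "Re W > R" for W
 proof -
  note b = bas[OF W]
  have "T W - W - 1 = W * (1 / (1 - x W) ^ m - 1 - of_nat m * x W) + (of_nat m * W * x W - 1)"
   by (simp add: T_def algebra_simps)
  also have "of_nat m * W * x W - 1 = (h (z W) - h 0) / A"
   using b m h by (simp add: x_def field_simps)
  finally have "norm (T W - W - 1) \<le> norm W * norm (1 / (1 - x W) ^ m - 1 - of_nat m * x W) + norm (h (z W) - h 0) / norm A"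
   by (metis norm_triangle_ineq norm_mult norm_divide)
  also have "\<dots> \<le> norm W * (Cb * (K / norm W) ^ 2) + Ch * norm (z W) / norm A"
  proof (intro add_mono mult_left_mono divide_right_mono Ch(4) b(4))
   have "norm (x W) ^ 2 \<le> (K / norm W) ^ 2" using b(6) by (intro power_mono) auto
   thus "norm (1 / (1 - x W) ^ m - 1 - of_nat m * x W) \<le> Cb * (K / norm W) ^ 2"
    using Cb(4)[OF b(7)] Cb(1) by (meson mult_left_mono order_trans)
  qed auto
  also have "norm W * (Cb * (K / norm W) ^ 2) = Cb * K ^ 2 * norm W powr (- 1)"
   using b by (simp add: powr_minus_divide power2_eq_square field_simps)
  also have "\<dots> \<le> Cb * K ^ 2 * norm W powr (- \<sigma>)"
   using b sg Cb(1) K by (intro mult_left_mono powr_mono) auto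
  finally have "norm (T W - W - 1) \<le> B * norm W powr (- \<sigma>)"
   using nz[OF b(2)] by (simp add: B_def algebra_simps)
  also have "\<dots> \<le> B * Re W powr - \<sigma>"
   using b sg Cb Ch K complex_Re_le_cmod[of W] by (intro mult_left_mono powr_mono2') (auto simp: B_def)
  finally show ?thesis .
 qed
 have lim: "((%W. a + z W) \<longlongrightarrow> a) Reinf"
 proof -
  have "(z \<longlongrightarrow> 0) Reinf"
  proof (rule tendsto_norm_zero_cancel)
   have "\<forall>\<^sub>F W in Reinf. norm \<beta> * norm W powr (- \<sigma>) = norm (z W)"
    unfolding eventually_Reinf
   proof (intro exI[of _ 0] allI impI)
    fix W :: complex assume "Re W > 0"
    hence "W ~= 0" by auto
    thus "norm \<beta> * norm W powr (- \<sigma>) = norm (z W)" using nz by simp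
   qed
   thus "((%W. norm (z W)) \<longlongrightarrow> 0) Reinf" using lz by (simp add: Lim_transform_eventually)
  qed
  from tendsto_add[OF tendsto_const[of a] this] show ?thesis by simp
 qed
 have L1: "Re (1::complex) > 0" by simp
 obtain R1 where R1: "R1 \<ge> R" "model c N a (%W. a + z W) T R1 1"
 proof (rule modelI[OF N L1 _ hT _ R sg(1) bound lim])
  show "(%W. a + z W) holomorphic_on ?H" by (intro holomorphic_intros hz)
  fix W assume W: "Re W > R"
  have "z W ^ m * h (z W) = - x W"
   using zm[OF bas(2)[OF W]] by (simp add: x_def)
  moreover have "z W ~= 0" using b0 by (simp add: z_def)
  ultimately show "orb c N (a + z W) \<and> it c N (a + z W) = a + z (T W) \<and> a + z W ~= a"
   using exp_G[OF bas(5)[OF W]] zT[OF W] by simp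
 qed auto
 show thesis
 proof (rule that[of T R1])
  show "model c N a (%W. a + \<beta> * exp (- Ln W / of_nat m)) T R1 1" using R1 by (simp add: z_def)
  show "R1 \<ge> 1" using R R1 by simp
  fix W assume W: "Re W > R1"
  hence "Re W > R" using R1 by simp
  thus "((%W. a + \<beta> * exp (- Ln W / of_nat m)) has_field_derivative
    - ((a + \<beta> * exp (- Ln W / of_nat m)) - a) / (of_nat m * W)) (at W)"
   using nonpos[of W] m bas(2)[of W] by (auto intro!: derivative_eq_intros simp: field_simps)
 qed
qed

end

lemma tendsto_residues:
 fixes x :: "nat => 'a :: topological_space"
 assumes N: "N \<ge> 1" and lim: "!!r. r < N ==> (%k. x (n0 + k * N + r)) \<longlonglongrightarrow> l"
 shows "x \<longlonglongrightarrow> l"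
proof (rule topological_tendstoI)
 fix S assume S: "open S" "l \<in> S"
 have "\<forall>r\<in>{..<N}. \<forall>\<^sub>F k in sequentially. x (n0 + k * N + r) \<in> S"
  using topological_tendstoD[OF lim S] by auto
 hence "\<forall>\<^sub>F k in sequentially. \<forall>r\<in>{..<N}. x (n0 + k * N + r) \<in> S"
  by (simp add: eventually_ball_finite)
 then obtain K where K: "!!k r. k \<ge> K ==> r < N ==> x (n0 + k * N + r) \<in> S"
  unfolding eventually_at_top_linorder by auto
 show "\<forall>\<^sub>F n in sequentially. x n \<in> S"
  unfolding eventually_at_top_linorder
 proof (intro exI[of _ "n0 + K * N"] allI impI)
  fix n assume n: "n \<ge> n0 + K * N"
  define t where "t = n - n0"
  have "n = n0 + (t div N) * N + t mod N" using n by (simp add: t_def)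
  moreover have "t div N \<ge> K" using n N by (simp add: t_def less_eq_div_iff_mult_less_eq)
  ultimately show "x n \<in> S" using K[of "t div N" "t mod N"] N by simp
 qed
qed

lemma periodic_add_mult:
 fixes aa :: "nat => 'a"
 assumes "!!n. aa (n + q) = aa n" shows "aa (n + k * q) = aa n"
proof (induction k)
 case (Suc k)
 have "aa (n + Suc k * q) = aa ((n + k * q) + q)" by (simp add: algebra_simps)
 thus ?case using assms Suc by simp
qed simp

lemma periodic_mod:
 fixes aa :: "nat => 'a"
 assumes "!!n. aa (n + q) = aa n" shows "aa n = aa (n mod q)"
 using periodic_add_mult[of aa q "n mod q" "n div q", OF assms] by simp

section \<open>Cycles, their petals and the singular orbit\<close>

context lifting_family
begin

text \<open>The cycle is a sequence on all naturals with exact period \<open>q\<close>, so that a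
  change of base point and the phase relative to the orbit of \<open>c\<close> become shifts of the
  index.\<close>

definition cyc :: "complex => nat => (nat => complex) => complex => bool" where
 "cyc c q aa \<kappa> \<longleftrightarrow> q \<ge> 1 \<and> (\<forall>n. aa n \<in> D) \<and> (\<forall>n. aa (Suc n) = f (aa n) + c) \<and> (\<forall>n. aa (n + q) = aa n) \<and>
   inj_on aa {..<q} \<and> Dit c q (aa 0) = \<kappa>"

lemma cyc_it: "cyc c q aa \<kappa> ==> it c j (aa n) = aa (n + j)"
 by (induction j) (auto simp: cyc_def it_Suc simp del: funpow.simps(2))

lemma cyc_orb: "cyc c q aa \<kappa> ==> orb c j (aa n)"
 by (auto simp: orb_def cyc_it) (simp add: cyc_def)

lemma cyc_per: "cyc c q aa \<kappa> ==> aa (n + q) = aa n" by (simp add: cyc_def)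

lemma cyc_eq_iff: assumes "cyc c q aa \<kappa>" shows "aa i = aa j \<longleftrightarrow> i mod q = j mod q"
proof -
 have q: "q \<ge> 1" and inj: "inj_on aa {..<q}" using assms by (auto simp: cyc_def)
 have "aa i = aa (i mod q)" "aa j = aa (j mod q)" by (rule periodic_mod[of aa q, OF cyc_per[OF assms]])+
 moreover have "i mod q \<in> {..<q}" "j mod q \<in> {..<q}" using q by auto
 ultimately show ?thesis using inj by (metis inj_on_eq_iff)
qed

lemma cyc_range: assumes "cyc c q aa \<kappa>" shows "range aa = aa ` {..<q}" "finite (range aa)"
proof -
 have q: "q \<ge> 1" using assms by (simp add: cyc_def)
 have "aa n \<in> aa ` {..<q}" for n
  using periodic_mod[of aa q n, OF cyc_per[OF assms]] q by (metis imageI lessThan_iff mod_less_divisor less_le_trans zero_less_one)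
 thus "range aa = aa ` {..<q}" by auto
 thus "finite (range aa)" by simp
qed

text \<open>Moving the base point exchanges one factor of the product for the equal factor one
  period later. Cancelling it needs a separate case when it vanishes; then every product over a full
  period vanishes.\<close>

lemma cyc_Dit_shift: assumes "cyc c q aa \<kappa>" shows "Dit c q (aa n) = \<kappa>"
proof (induction n)
 case (Suc n)
 have q: "q \<ge> 1" using assms by (simp add: cyc_def)
 have 1: "Dit c (q + 1) (aa n) = Dit c 1 (aa n) * Dit c q (aa (n + 1))"
  using Dit_add[of c q 1 "aa n"] cyc_it[OF assms, of 1 n] by simp
 have 2: "Dit c (1 + q) (aa n) = Dit c q (aa n) * Dit c 1 (aa (n + q))"
  using Dit_add[of c 1 q "aa n"] cyc_it[OF assms, of q n] by (simp add: add.commute)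
 have 3: "aa (n + q) = aa n" by (rule cyc_per[OF assms])
 show ?case
 proof (cases "Dit c 1 (aa n) = 0")
  case True
  hence d0: "deriv f (aa n) = 0" by (simp add: Dit_def)
  have z: "Dit c q (aa m) = 0" if "m mod q \<le> n mod q \<or> True" for m
  proof -
   obtain j where j: "j < q" "(m + j) mod q = n mod q"
   proof -
    let ?j = "(n + (q - m mod q)) mod q"
    have "(m + ?j) mod q = (m mod q + (n + (q - m mod q))) mod q" by (simp add: mod_simps)
    also have "\<dots> = (n + q) mod q"
     using q by (metis add.left_commute le_add_diff_inverse less_imp_le mod_less_divisor less_le_trans zero_less_one)
    finally show ?thesis using that[of ?j] q by simp
   qed
   hence "it c j (aa m) = aa n" using cyc_it[OF assms] cyc_eq_iff[OF assms] by metis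
   thus ?thesis using j d0 by (auto simp: Dit_def intro!: bexI[of _ j])
  qed
  show ?thesis using z[of "Suc n"] z[of n] Suc by simp
 next
  case False
  have "Dit c 1 (aa n) * Dit c q (aa (n + 1)) = Dit c q (aa n) * Dit c 1 (aa n)"
   using 1 2 3 by (simp add: add.commute)
  thus ?thesis using False Suc by simp
 qed
qed (use assms in \<open>simp add: cyc_def\<close>)

lemma cyc_shift: assumes "cyc c q aa \<kappa>" shows "cyc c q (%n. aa (n + s)) \<kappa>"
proof -
 have q: "q \<ge> 1" using assms by (simp add: cyc_def)
 have "inj_on (%n. aa (n + s)) {..<q}"
 proof (rule inj_onI)
  fix i j assume ij: "i \<in> {..<q}" "j \<in> {..<q}" "aa (i + s) = aa (j + s)"
  hence "(i + s) mod q = (j + s) mod q" using cyc_eq_iff[OF assms] by blast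
  hence "i mod q = j mod q" by (auto simp: nat_mod_eq_iff)
  thus "i = j" using ij by simp
 qed
 moreover have "aa (n + s + q) = aa (n + s)" for n using cyc_per[OF assms] by blast
 hence "aa (n + q + s) = aa (n + s)" for n by (simp add: add.commute add.left_commute)
 ultimately show ?thesis using assms cyc_Dit_shift[OF assms, of s] by (auto simp: cyc_def)
qed

text \<open>Once in the coordinate, the orbit of \<open>c\<close> follows \<pi> along an orbit of
  \<open>T\<close>. Landing on the cycle, or a repetition, would persist at later return times, and
  these approach \<open>aa 0\<close> without reaching it. The shift \<open>ns * (q - 1)\<close>
  represents - ns modulo \<open>q\<close> in the naturals.\<close>

lemma model_orbit:
 assumes c: "c \<in> closure D" and cy: "cyc c q aa \<kappa>" and M: "model c N (aa 0) \<pi> T R L" and dv: "q dvd N"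
 obtains ns Ws where "Re Ws > R" "!!n. orb c n c" "!!k. it c (ns + k * N) c = \<pi> ((T ^^ k) Ws)"
  "!!n. it c n c \<notin> range aa" "inj (%n. it c n c)" "(%n. it c n c - aa (n + ns * (q - 1))) \<longlonglongrightarrow> 0"
proof -
 have q: "q \<ge> 1" using cy by (simp add: cyc_def)
 have N: "N \<ge> 1" using M by (simp add: model_def)
 obtain ns Ws where ns: "Re Ws > R" "orb c ns c" "it c ns c = \<pi> Ws" using model_reach[OF c M] by blast
 note it = model_iter[OF M ns(1)]
 have orbk: "orb c (k * N + ns) c" for k unfolding orb_add using ns it by simp
 have orball: "orb c n c" for n
 proof -
  have "n \<le> n * N + ns" using N by (simp add: trans_le_add1)
  thus ?thesis using orb_mono[OF orbk[of n]] by blast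
 qed
 have val: "it c (ns + k * N) c = \<pi> ((T ^^ k) Ws)" for k
  using it_add[of "k * N" ns c c] ns it(4)[of k] by (simp add: add.commute)
 have lim: "(%k. it c (ns + k * N) c) \<longlonglongrightarrow> aa 0" unfolding val by (rule model_lim[OF M ns(1)])
 have ne: "it c (ns + k * N) c ~= aa 0" for k
  using M it(2)[of k] unfolding val by (simp add: model_def)
 have notin: "it c n c \<notin> range aa" for n
 proof
  assume "it c n c \<in> range aa"
  then obtain j where j: "it c n c = aa j" by auto
  have later: "it c (n + i) c = aa (j + i)" for i
   using it_add[of i n c c] j cyc_it[OF cy, of i j] by (simp add: add.commute)
  have fin: "finite (range aa - {aa 0})" using cyc_range[OF cy] by simp
  hence "open (- (range aa - {aa 0}))" by (intro open_Compl finite_imp_closed)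
  hence "\<forall>\<^sub>F k in sequentially. it c (ns + k * N) c \<in> - (range aa - {aa 0})"
   by (rule topological_tendstoD[OF lim]) simp
  then obtain K where K: "!!k. k \<ge> K ==> it c (ns + k * N) c \<notin> range aa - {aa 0}"
   unfolding eventually_at_top_linorder by auto
  define k where "k = max K n"
  have "n * 1 \<le> k * N" using N by (intro mult_le_mono) (auto simp: k_def)
  hence "ns + k * N \<ge> n" by simp
  hence "it c (ns + k * N) c \<in> range aa" using later[of "ns + k * N - n"] by simp
  thus False using K[of k] ne[of k] by (auto simp: k_def)
 qed
 have inj: "inj (%n. it c n c)"
 proof -
  have "it c i c ~= it c j c" if ij: "i < j" for i j
  proof
   assume e: "it c i c = it c j c"
   define t where "t = j - i"
   have step: "it c (n + t) c = it c n c" if "n \<ge> i" for n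
   proof -
    have "it c (n + t) c = it c (n - i) (it c j c)" using it_add[of "n - i" j c c] that ij by (simp add: t_def)
    also have "\<dots> = it c n c" using e it_add[of "n - i" i c c] that by simp
    finally show ?thesis .
   qed
   have stepk: "it c (n + l * t) c = it c n c" if "n \<ge> i" for n l
   proof (induction l)
    case (Suc l)
    have "it c (n + Suc l * t) c = it c ((n + l * t) + t) c" by (simp add: algebra_simps)
    also have "\<dots> = it c n c" using step[of "n + l * t"] that Suc by simp
    finally show ?case .
   qed simp
   have tp: "t \<ge> 1" using ij by (simp add: t_def)
   have ge: "ns + i * N \<ge> i" using N by (simp add: trans_le_add2)
   have "it c (ns + (i + l * t) * N) c = it c (ns + i * N) c" for l
    using stepk[OF ge, of "l * N"] by (simp add: algebra_simps)
   moreover have "(%l. it c (ns + (i + l * t) * N) c) \<longlonglongrightarrow> aa 0"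
   proof (rule LIMSEQ_subseq_LIMSEQ[OF lim, unfolded o_def, of "%l. i + l * t"])
    show "strict_mono (%l. i + l * t)" using tp by (intro strict_monoI) simp
   qed
   ultimately have "it c (ns + i * N) c = aa 0" by (simp add: LIMSEQ_const_iff)
   thus False using ne by blast
  qed
  thus ?thesis by (intro injI) (metis linorder_neqE_nat)
 qed
 have "(%n. it c n c - aa (n + ns * (q - 1))) \<longlonglongrightarrow> 0"
 proof (rule tendsto_residues[OF N, of _ ns])
  fix r assume "r < N"
  obtain Q where Q: "N = q * Q" using dv by blast
  have "aa (ns + k * N + r + ns * (q - 1)) = aa r" for k
  proof -
   have e: "ns + k * N + r + ns * (q - 1) = r + (ns + k * Q) * q"
   proof -
    have "ns * q = ns + ns * (q - 1)" using q by (cases q) auto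
    thus ?thesis by (simp add: Q algebra_simps)
   qed
   show ?thesis unfolding e by (rule periodic_add_mult[of aa q, OF cyc_per[OF cy]])
  qed
  note A = this
  have "(%k. it c r (it c (ns + k * N) c)) \<longlonglongrightarrow> it c r (aa 0)"
   by (rule it_tendsto[OF cyc_orb[OF cy] tendsto_const lim])
  moreover have "it c (ns + k * N + r) c = it c r (it c (ns + k * N) c)" for k
   using it_add[of r "ns + k * N" c c] by (simp only: add.commute[of "ns + k * N" r])
  ultimately have "(%k. it c (ns + k * N + r) c) \<longlonglongrightarrow> aa r"
   using cyc_it[OF cy, of r 0] by simp
  hence "(%k. it c (ns + k * N + r) c - aa r) \<longlonglongrightarrow> aa r - aa r" by (intro tendsto_intros)
  thus "(%k. it c (ns + k * N + r) c - aa (ns + k * N + r + ns * (q - 1))) \<longlonglongrightarrow> 0"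
   unfolding A by simp
 qed
 thus thesis using that[OF ns(1) orball val notin inj] by blast
qed

text \<open>\<open>no_identity\<close> makes the order of vanishing of the displacement finite, and
  multiplier 1 makes it at least two.\<close>

lemma parabolic_expansion:
 assumes c: "c \<in> closure D" and N: "N \<ge> 1" and a: "orb c N a" "it c N a = a" "Dit c N a = 1"
 obtains m e h where "m \<ge> 1" "e > 0" "h holomorphic_on ball 0 e" "h 0 ~= 0"
  "!!z. norm z < e ==> orb c N (a + z) \<and> it c N (a + z) = a + z * (1 + z ^ m * h z)"
proof -
 obtain e0 where e0: "e0 > 0" "ball a e0 \<subseteq> {z. orb c N z}"
  using orb_open1 a open_contains_ball by (metis mem_Collect_eq)
 define \<phi> where "\<phi> = (%z. it c N (a + z) - (a + z))"
 have hol: "\<phi> holomorphic_on ball 0 e0"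
  unfolding \<phi>_def by (intro holomorphic_intros it_holomorphic[of "%_. c"]) (use subsetD[OF e0(2)] in \<open>auto simp: dist_norm\<close>)
 have p0: "\<phi> 0 = 0" using a by (simp add: \<phi>_def)
 have nc: "\<not> \<phi> constant_on ball 0 e0"
 proof
  assume "\<phi> constant_on ball 0 e0"
  hence z: "\<phi> z = 0" if "z \<in> ball 0 e0" for z
  proof -
   obtain y where y: "!!x. x \<in> ball 0 e0 ==> \<phi> x = y"
    using \<open>\<phi> constant_on ball 0 e0\<close> unfolding constant_on_def by blast
   show ?thesis using y[OF that] y[of 0] p0 e0 by simp
  qed
  show False
  proof (rule no_identity[OF c N, of "ball a e0"])
   fix z assume zz: "z \<in> ball a e0"
   hence "\<phi> (z - a) = 0" by (intro z) (simp add: dist_norm norm_minus_commute)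
   thus "orb c N z \<and> it c N z = z" using subsetD[OF e0(2) zz] by (simp add: \<phi>_def)
  qed (use e0 in auto)
 qed
 have zin: "0 \<in> ball 0 e0" using e0 by simp
 obtain g r n where g: "0 < n" "0 < r" "ball (0::complex) r \<subseteq> ball 0 e0" "g holomorphic_on ball 0 r"
   "!!w. w \<in> ball 0 r ==> \<phi> w = (w - 0) ^ n * g w" "!!w. w \<in> ball 0 r ==> g w ~= 0"
  by (rule holomorphic_factor_zero_nonconstant[OF hol open_ball connected_ball zin p0 nc]) (rule that)
 have "n ~= 1"
 proof
  assume n1: "n = 1"
  have d1: "(\<phi> has_field_derivative 1 - 1) (at 0)"
  proof -
   have "((%z. it c N (a + z)) has_field_derivative Dit c N (a + 0) * 1) (at 0)"
    using a by (intro DERIV_chain2[OF it_deriv]) (auto intro!: derivative_eq_intros)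
   thus ?thesis unfolding \<phi>_def using a by (auto intro!: derivative_eq_intros)
  qed
  have gd: "(g has_field_derivative deriv g 0) (at 0)"
   using g by (intro holomorphic_derivI[OF g(4)]) auto
  have "((%w. w * g w) has_field_derivative g 0) (at 0)"
   using DERIV_mult[OF DERIV_ident gd] by simp
  hence "(\<phi> has_field_derivative g 0) (at 0)"
   using has_field_derivative_transform_within_open[of "%w. w * g w" "g 0" 0 "ball 0 r" \<phi>] g n1 by simp
  hence "g 0 = 0" using DERIV_unique[OF d1] by simp
  thus False using g by simp
 qed
 define m where "m = n - 1"
 have n: "n = Suc m" "m \<ge> 1" using g(1) \<open>n ~= 1\<close> by (auto simp: m_def)
 show thesis
 proof (rule that[OF n(2) g(2) g(4)])
  show "g 0 ~= 0" using g by simp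
  fix z :: complex assume z: "norm z < r"
  hence "\<phi> z = z ^ n * g z" using g(5)[of z] by simp
  hence "it c N (a + z) = a + z * (1 + z ^ m * g z)" by (simp add: \<phi>_def n algebra_simps)
  moreover have "a + z \<in> ball a e0" using z g(3) by (auto simp: dist_norm)
  ultimately show "orb c N (a + z) \<and> it c N (a + z) = a + z * (1 + z ^ m * g z)" using e0 by auto
 qed
qed

text \<open>Each attracting petal must catch the one orbit of \<open>c\<close>. All entry times are
  congruent modulo \<open>q\<close>, because the returns from then on approach \<open>aa 0\<close>.
  Petals entered at times congruent modulo q p would share a point of the orbit, while distinct
  petals are disjoint. So the petals inject into the \<open>p\<close> admissible residue
  classes.\<close>

lemma parabolic_petals:
 assumes c: "c \<in> closure D" and cy: "cyc c q aa \<kappa>" and p: "p \<ge> 1"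
  and m: "m \<ge> 1" and e: "e > 0" and h: "h holomorphic_on ball 0 e" "h 0 ~= 0"
  and ex: "!!z. norm z < e ==> orb c (q * p) (aa 0 + z) \<and> it c (q * p) (aa 0 + z) = aa 0 + z * (1 + z ^ m * h z)"
 shows "m \<le> p"
proof -
 let ?N = "q * p" and ?A = "h 0"
 have q: "q \<ge> 1" using cy by (simp add: cyc_def)
 have N: "?N \<ge> 1" using q p by simp
 define \<beta>0 where "\<beta>0 = exp (Ln (- 1 / (of_nat m * ?A)) / of_nat m)"
 have b0: "\<beta>0 ^ m = - 1 / (of_nat m * ?A)"
  unfolding \<beta>0_def using m h by (simp add: exp_of_nat_mult[symmetric])
 have b00: "\<beta>0 ~= 0" by (simp add: \<beta>0_def)
 \<comment> \<open>The m-th roots of unity enumerate the attracting directions.\<close>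
 define \<beta> where "\<beta> = (%i::nat. \<beta>0 * exp (2 * of_real pi * \<i> * of_nat i / of_nat m))"
 have bm: "?A * \<beta> i ^ m = - 1 / of_nat m" for i
  using m h by (simp add: \<beta>_def power_mult_distrib complex_root_unity b0)
 define \<pi> where "\<pi> = (%i W. aa 0 + \<beta> i * exp (- Ln W / of_nat m))"
 have "\<exists>T R. model c ?N (aa 0) (\<pi> i) T R 1 \<and> R \<ge> 1" for i
 proof -
  obtain T R where "model c ?N (aa 0) (%W. aa 0 + \<beta> i * exp (- Ln W / of_nat m)) T R 1" "R \<ge> 1"
   by (rule parabolic_model[OF N m e ex h(1) refl h(2) bm[of i]], assumption, rule that)
  thus ?thesis unfolding \<pi>_def by blast
 qed
 then obtain T R where M: "!!i. model c ?N (aa 0) (\<pi> i) (T i) (R i) 1" and R1: "!!i. R i \<ge> 1" by metis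
 define Q where "Q = (%i n W. Re W > R i \<and> (\<forall>k. it c (n + k * ?N) c = \<pi> i ((T i ^^ k) W)) \<and>
    (%l. it c l c - aa (l + n * (q - 1))) \<longlonglongrightarrow> 0)"
 have "\<exists>n W. Q i n W" for i
 proof -
  obtain ns Ws where "Re Ws > R i" "!!k. it c (ns + k * ?N) c = \<pi> i ((T i ^^ k) Ws)"
   "(%n. it c n c - aa (n + ns * (q - 1))) \<longlonglongrightarrow> 0"
   by (rule model_orbit[OF c cy M[of i] dvd_triv_left]) (rule that)
  hence "Q i ns Ws" by (simp add: Q_def)
  thus ?thesis by blast
 qed
 then obtain ns Ws where Q: "!!i. Q i (ns i) (Ws i)" by metis
 have W: "!!i. Re (Ws i) > R i"
  and val: "!!i k. it c (ns i + k * ?N) c = \<pi> i ((T i ^^ k) (Ws i))"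
  and lim: "!!i. (%n. it c n c - aa (n + ns i * (q - 1))) \<longlonglongrightarrow> 0"
  using Q unfolding Q_def by blast+
 \<comment> \<open>The coordinate can be recovered from the m-th power of the displacement, in which
   the roots of unity cancel; the displacement itself then determines the root.\<close>
 have disj: "i = j" if "i < m" "j < m" "Re V > R i" "Re V' > R j" "\<pi> i V = \<pi> j V'" for i j V V'
 proof -
  have V: "Re V > 0" "Re V' > 0" using that R1[of i] R1[of j] by linarith+
  hence V0: "V ~= 0" "V' ~= 0" by auto
  have pw: "(\<beta> i * exp (- Ln V / of_nat m)) ^ m = \<beta>0 ^ m / V" if "V ~= 0" for i V
  proof -
   have "exp (- Ln V / of_nat m) ^ m = exp (- Ln V)" using m by (simp add: exp_of_nat_mult[symmetric])
   also have "\<dots> = 1 / V" using that by (simp add: exp_minus field_simps)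
   moreover have "\<beta> i ^ m = \<beta>0 ^ m"
    using m by (simp add: \<beta>_def power_mult_distrib complex_root_unity)
   ultimately show ?thesis by (simp only: power_mult_distrib) simp
  qed
  have e1: "\<beta> i * exp (- Ln V / of_nat m) = \<beta> j * exp (- Ln V' / of_nat m)" using that(5) by (simp add: \<pi>_def)
  hence "\<beta>0 ^ m / V = \<beta>0 ^ m / V'" using pw[OF V0(1), of i] pw[OF V0(2), of j] by simp
  hence "V = V'" using b00 V0 by (simp add: field_simps)
  hence "\<beta> i = \<beta> j" using e1 by simp
  hence "i mod m = j mod m" using b00 m by (simp add: \<beta>_def complex_root_unity_eq)
  thus "i = j" using that by simp
 qed
 have nq: "ns i mod q = ns j mod q" for i j
 proof -
  have l1: "(%k. it c (ns i + k * ?N) c) \<longlonglongrightarrow> aa 0" unfolding val by (rule model_lim[OF M W])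
  have sm: "strict_mono (%k. ns i + k * ?N)" using N by (intro strict_monoI) simp
  have "aa (ns i + k * ?N + ns j * (q - 1)) = aa (ns i + ns j * (q - 1))" for k
  proof -
   have e: "ns i + k * ?N + ns j * (q - 1) = (ns i + ns j * (q - 1)) + (k * p) * q" by (simp add: algebra_simps)
   show ?thesis unfolding e by (rule periodic_add_mult[of aa q, OF cyc_per[OF cy]])
  qed
  with LIMSEQ_subseq_LIMSEQ[OF lim[of j] sm, unfolded o_def]
  have "(%k. it c (ns i + k * ?N) c - aa (ns i + ns j * (q - 1))) \<longlonglongrightarrow> 0" by simp
  hence "(%k. it c (ns i + k * ?N) c) \<longlonglongrightarrow> aa (ns i + ns j * (q - 1))" by (simp add: LIM_zero_iff)
  hence "aa (ns i + ns j * (q - 1)) = aa 0" using l1 LIMSEQ_unique by blast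
  hence z: "(ns i + ns j * (q - 1)) mod q = 0" using cyc_eq_iff[OF cy] by simp
  have "ns i + ns j * q = ns j + (ns i + ns j * (q - 1))" using q by (cases q) auto
  hence "(ns i + ns j * q) mod q = (ns j + (ns i + ns j * (q - 1))) mod q"
   by (rule arg_cong[where f = "%x. x mod q"])
  also have "\<dots> = (ns j + (ns i + ns j * (q - 1)) mod q) mod q" by (simp only: mod_add_right_eq)
  finally show ?thesis unfolding z by simp
 qed
 define g where "g = (%i. (ns i mod ?N) div q)"
 have "inj_on g {..<m}"
 proof (rule inj_onI)
  fix i j assume ij: "i \<in> {..<m}" "j \<in> {..<m}" "g i = g j"
  have "(ns i mod ?N) mod q = (ns j mod ?N) mod q" using nq[of i j] by (simp add: mod_mod_cancel)
  hence "ns i mod ?N = ns j mod ?N" using ij(3) unfolding g_def by (metis mult_div_mod_eq)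
  then obtain k l where "ns i + ?N * k = ns j + ?N * l" by (auto simp: nat_mod_eq_iff)
  hence "it c (ns i + k * ?N) c = it c (ns j + l * ?N) c" by (simp add: mult.commute)
  hence "\<pi> i ((T i ^^ k) (Ws i)) = \<pi> j ((T j ^^ l) (Ws j))" unfolding val .
  thus "i = j" using disj[of i j] ij model_iter(2)[OF M W] by auto
 qed
 moreover have "g ` {..<m} \<subseteq> {..<p}"
 proof -
  have "ns i mod ?N < q * p" for i using N by simp
  hence "g i < p" for i unfolding g_def using q by (simp add: div_less_iff_less_mult mult.commute)
  thus ?thesis by auto
 qed
 ultimately show ?thesis using card_inj_on_le[of g "{..<m}" "{..<p}"] by simp
qed

lemma Dit_mult: assumes "cyc c q aa \<kappa>" shows "Dit c (q * p) (aa n) = \<kappa> ^ p"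
proof (induction p)
 case (Suc p)
 have "Dit c (q * Suc p) (aa n) = Dit c (q * p) (aa n) * Dit c q (aa (n + q * p))"
  using Dit_add[of c q "q * p" "aa n"] cyc_it[OF assms, of "q * p" n] by (simp add: add.commute)
 thus ?case using Suc cyc_Dit_shift[OF assms] by simp
qed simp

text \<open>The number of petals is pinned from two sides: \<open>parabolic_petals\<close> bounds it
  by \<open>p\<close>, and commutation of the return map with its p-th iterate shows that \<kappa>
  raised to it is 1, so minimality of \<open>p\<close> bounds it from below.\<close>

lemma parabolic_cycle_model:
 assumes c: "c \<in> closure D" and cy: "cyc c q aa \<kappa>" and p: "p \<ge> 1" "\<kappa> ^ p = 1"
  and min: "!!k. 1 \<le> k ==> k < p ==> \<kappa> ^ k ~= 1"
 obtains e h \<beta> T R where "e > 0" "h holomorphic_on ball 0 e" "h 0 ~= 0" "h 0 * \<beta> ^ p = - 1 / of_nat p"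
  "!!z. norm z < e ==> orb c (q * p) (aa 0 + z) \<and> it c (q * p) (aa 0 + z) = aa 0 + z * (1 + z ^ p * h z)"
  "model c (q * p) (aa 0) (%W. aa 0 + \<beta> * exp (- Ln W / of_nat p)) T R 1" "R \<ge> 1"
  "!!W. Re W > R ==> ((%W. aa 0 + \<beta> * exp (- Ln W / of_nat p)) has_field_derivative
    - ((aa 0 + \<beta> * exp (- Ln W / of_nat p)) - aa 0) / (of_nat p * W)) (at W)"
proof -
 have q: "q \<ge> 1" using cy by (simp add: cyc_def)
 have N: "q * p \<ge> 1" using q p by simp
 have fixN: "it c (q * p) (aa 0) = aa 0"
  using cyc_it[OF cy, of "q * p" 0] periodic_add_mult[of aa q 0 p, OF cyc_per[OF cy]] by (simp add: mult.commute)
 obtain m e h where mh: "m \<ge> 1" "e > 0" "h holomorphic_on ball 0 e" "h 0 ~= 0"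
  and ex: "!!z. norm z < e ==> orb c (q * p) (aa 0 + z) \<and> it c (q * p) (aa 0 + z) = aa 0 + z * (1 + z ^ m * h z)"
  by (rule parabolic_expansion[OF c N cyc_orb[OF cy] fixN])
   (use Dit_mult[OF cy, of p 0] p in simp, rule that)
 have "m \<le> p" by (rule parabolic_petals[OF c cy p(1) mh(1,2,3,4) ex])
 moreover have "p \<le> m"
 proof -
  define \<phi> where "\<phi> = (%z. it c q (aa 0 + z) - aa 0)"
  define \<psi> where "\<psi> = (%z. it c (q * p) (aa 0 + z) - aa 0)"
  have k0: "\<kappa> ~= 0" using p by (auto simp: zero_power)
  have hol: "\<phi> holomorphic_on ball 0 e"
   unfolding \<phi>_def
  proof (intro holomorphic_intros it_holomorphic[of "%_. c"])
   show "orb c q (aa 0 + u)" if "u \<in> ball 0 e" for u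
    using ex[of u] that p orb_mono[of c "q * p" _ q] by simp
  qed
  have der: "deriv \<phi> 0 = \<kappa>"
  proof (rule DERIV_imp_deriv)
   have "((%z. it c q (aa 0 + z)) has_field_derivative Dit c q (aa 0 + 0) * 1) (at 0)"
    using cyc_orb[OF cy, of q 0] by (intro DERIV_chain2[OF it_deriv]) (auto intro!: derivative_eq_intros)
   thus "(\<phi> has_field_derivative \<kappa>) (at 0)"
    unfolding \<phi>_def using cyc_Dit_shift[OF cy, of 0] by (auto intro!: derivative_eq_intros)
  qed
  have "isCont h 0" using mh continuous_on_eq_continuous_at[OF open_ball] holomorphic_on_imp_continuous_on by (metis centre_in_ball)
  hence hl: "(h \<longlongrightarrow> h 0) (at 0)" by (simp add: isCont_def)
  have "\<kappa> ^ (Suc m - 1) = 1"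
  proof (rule commuting_germ_multiplier[OF hol open_ball _ _ der k0 hl mh(4)])
   show "\<phi> 0 = 0" using cyc_it[OF cy, of q 0] cyc_per[OF cy, of 0] by (simp add: \<phi>_def)
   have "\<forall>\<^sub>F z in at 0. z \<in> ball (0::complex) e" using mh(2) by (intro eventually_at_in_open') auto
   thus "\<forall>\<^sub>F z in at 0. \<psi> z - z = z ^ Suc m * h z"
    by eventually_elim (use ex in \<open>simp add: \<psi>_def algebra_simps\<close>)
   show "\<forall>\<^sub>F z in at 0. \<phi> (\<psi> z) = \<psi> (\<phi> z)"
    by (rule always_eventually) (simp add: \<phi>_def \<psi>_def it_add[symmetric] add.commute)
  qed (use mh in auto)
  thus ?thesis using min[of m] mh(1) by (metis diff_Suc_1 not_less)
 qed
 ultimately have mp: "m = p" by simp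
 define \<beta> where "\<beta> = exp (Ln (- 1 / (of_nat p * h 0)) / of_nat p)"
 have b: "h 0 * \<beta> ^ p = - 1 / of_nat p"
  unfolding \<beta>_def using p mh by (simp add: exp_of_nat_mult[symmetric])
 obtain T R where "model c (q * p) (aa 0) (%W. aa 0 + \<beta> * exp (- Ln W / of_nat p)) T R 1" "R \<ge> 1"
  "!!W. Re W > R ==> ((%W. aa 0 + \<beta> * exp (- Ln W / of_nat p)) has_field_derivative
    - ((aa 0 + \<beta> * exp (- Ln W / of_nat p)) - aa 0) / (of_nat p * W)) (at W)"
  by (rule parabolic_model[OF N p(1) mh(2) ex[unfolded mp] mh(3) refl mh(4) b], assumption, rule that)
 thus thesis using that[OF mh(2,3,4) b ex[unfolded mp]] by blast
qed

definition neutral_or_attr :: "complex => bool" where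
 "neutral_or_attr \<kappa> \<longleftrightarrow> \<kappa> ~= 0 \<and> (norm \<kappa> < 1 \<or> (\<exists>p\<ge>1. \<kappa> ^ p = 1))"

lemma minimal_order:
 assumes "\<exists>p::nat\<ge>1. \<kappa> ^ p = (1::complex)"
 obtains p where "p \<ge> 1" "\<kappa> ^ p = 1" "!!k. 1 \<le> k ==> k < p ==> \<kappa> ^ k ~= 1"
proof -
 let ?P = "%p::nat. p \<ge> 1 \<and> \<kappa> ^ p = 1"
 have "?P (LEAST p. ?P p)" using LeastI_ex[of ?P] assms by blast
 moreover have "\<kappa> ^ k ~= 1" if "1 \<le> k" "k < (LEAST p. ?P p)" for k
  using not_less_Least[OF that(2)] that(1) by blast
 ultimately show thesis using that by blast
qed

text \<open>Both kinds of cycle are brought to \<open>model_orbit\<close>; the shift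
  \<open>s\<close> records the phase of the orbit of \<open>c\<close> relative to the given indexing
  of the cycle.\<close>

lemma singular_orbit:
 assumes c: "c \<in> closure D" and cy: "cyc c q aa \<kappa>" and \<kappa>: "neutral_or_attr \<kappa>"
 obtains s where "!!n. orb c n c" "!!n. it c n c \<notin> range aa" "inj (%n. it c n c)"
  "(%n. it c n c - aa (n + s)) \<longlonglongrightarrow> 0"
proof -
 have q: "q \<ge> 1" using cy by (simp add: cyc_def)
 have fx: "it c q (aa 0) = aa 0" using cyc_it[OF cy, of q 0] cyc_per[OF cy, of 0] by simp
 have "\<exists>N \<pi> T R L. model c N (aa 0) \<pi> T R L \<and> q dvd N"
 proof (cases "norm \<kappa> < 1")
  case True
  obtain \<pi> T R L where "model c q (aa 0) \<pi> T R L"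
   by (rule attracting_model[OF q cyc_orb[OF cy] fx cyc_Dit_shift[OF cy] _ True])
    (use \<kappa> in \<open>simp add: neutral_or_attr_def\<close>, rule that)
  thus ?thesis by (metis dvd_refl)
 next
  case False
  hence "\<exists>p\<ge>1. \<kappa> ^ p = 1" using \<kappa> by (auto simp: neutral_or_attr_def)
  then obtain p where p: "p \<ge> 1" "\<kappa> ^ p = 1" "!!k. 1 \<le> k ==> k < p ==> \<kappa> ^ k ~= 1"
   by (rule minimal_order) (rule that)
  obtain \<beta> T R where "model c (q * p) (aa 0) (%W. aa 0 + \<beta> * exp (- Ln W / of_nat p)) T R 1"
   by (rule parabolic_cycle_model[OF c cy p]) blast
  thus ?thesis by (metis dvd_triv_left)
 qed
 then obtain N \<pi> T R L where M: "model c N (aa 0) \<pi> T R L" "q dvd N" by blast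
 show thesis by (rule model_orbit[OF c cy M]) (rule that)
qed

end

subsection \<open>Motions of the singular orbit\<close>

text \<open>The quotient is given the derivative as its value where the two points coincide, so that
  the factorisation holds for every argument.\<close>

lemma strict_derivative_factor:
 assumes hol: "\<phi> holomorphic_on S" and S: "open S" "a \<in> S"
  and w: "(w \<longlongrightarrow> a) F" and v: "(v \<longlongrightarrow> a) F"
 obtains Qt where "(Qt \<longlongrightarrow> deriv \<phi> a) F" "!!x. \<phi> (w x) - \<phi> (v x) = Qt x * (w x - v x)"
proof -
 define Qt where "Qt = (%x. if w x = v x then deriv \<phi> a else (\<phi> (w x) - \<phi> (v x)) / (w x - v x))"
 have Qt: "(Qt \<longlongrightarrow> deriv \<phi> a) F"
 proof (rule tendstoI)
  fix e :: real assume e: "e > 0"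
  obtain r where r: "r > 0"
   "!!u v. u \<in> ball a r ==> v \<in> ball a r ==> norm (\<phi> u - \<phi> v - deriv \<phi> a * (u - v)) \<le> e/2 * norm (u - v)"
   using strict_derivative[OF hol S, of "e/2"] e by (metis half_gt_zero)
  show "\<forall>\<^sub>F x in F. dist (Qt x) (deriv \<phi> a) < e"
   using tendstoD[OF w r(1)] tendstoD[OF v r(1)]
  proof eventually_elim
   case (elim x)
   show ?case
   proof (cases "w x = v x")
    case False
    hence n: "norm (w x - v x) > 0" by simp
    have "norm (\<phi> (w x) - \<phi> (v x) - deriv \<phi> a * (w x - v x)) \<le> e/2 * norm (w x - v x)"
     using elim by (intro r(2)) (auto simp: dist_commute)
    hence "norm ((\<phi> (w x) - \<phi> (v x) - deriv \<phi> a * (w x - v x)) / (w x - v x)) \<le> e/2"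
     using n by (simp add: norm_divide divide_le_eq)
    moreover have "(\<phi> (w x) - \<phi> (v x) - deriv \<phi> a * (w x - v x)) / (w x - v x) = Qt x - deriv \<phi> a"
     using False by (simp add: diff_divide_distrib Qt_def)
    ultimately show ?thesis using e by (simp add: dist_norm)
   qed (use e in \<open>simp add: Qt_def\<close>)
  qed
 qed
 moreover have "\<phi> (w x) - \<phi> (v x) = Qt x * (w x - v x)" for x by (simp add: Qt_def)
 ultimately show thesis by (rule that)
qed

text \<open>Transfers a leading coefficient from the \<phi>-values back to the points, at the cost
  of dividing by the derivative at their common limit. This is what happens to leading coefficients
  when a motion is lifted.\<close>

lemma strict_derivative_quotient:
 assumes hol: "\<phi> holomorphic_on S" and S: "open S" "a \<in> S" and nz: "deriv \<phi> a ~= 0"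
  and w: "(w \<longlongrightarrow> a) F" and v: "(v \<longlongrightarrow> a) F"
  and lim: "((%x. (\<phi> (w x) - \<phi> (v x)) / s x) \<longlongrightarrow> l) F"
 shows "((%x. (w x - v x) / s x) \<longlongrightarrow> l / deriv \<phi> a) F"
proof -
 obtain Qt where Qt: "(Qt \<longlongrightarrow> deriv \<phi> a) F" and eq: "!!x. \<phi> (w x) - \<phi> (v x) = Qt x * (w x - v x)"
  by (rule strict_derivative_factor[OF hol S w v]) (rule that)
 have "((%x. (\<phi> (w x) - \<phi> (v x)) / s x / Qt x) \<longlongrightarrow> l / deriv \<phi> a) F"
  by (intro tendsto_divide lim Qt nz)
 moreover have "\<forall>\<^sub>F x in F. (\<phi> (w x) - \<phi> (v x)) / s x / Qt x = (w x - v x) / s x"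
  using tendsto_imp_eventually_ne[OF Qt nz] by eventually_elim (simp add: eq)
 ultimately show ?thesis by (rule Lim_transform_eventually)
qed

text \<open>\<psi> u / u^d extends across 0 with the value \<open>x\<close>, and Cauchy's estimate
  on the circle of radius r/2 bounds it. The point is uniformity: only \<open>r\<close>,
  \<open>B\<close> and \<open>d\<close> enter, so one bound serves all iterated lifts.\<close>

lemma coefficient_bound:
 assumes hol: "\<psi> holomorphic_on ball 0 r" and r: "r > (0::real)"
  and lim: "((%u. \<psi> u / u ^ d) \<longlongrightarrow> x) (at 0)" and B: "!!u. u \<in> ball 0 r ==> norm (\<psi> u) \<le> B"
 shows "norm x \<le> B / (r / 2) ^ d"
proof -
 define g where "g = (%u. if u = 0 then x else \<psi> u / u ^ d)"
 have "g holomorphic_on ball 0 r"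
 proof (rule no_isolated_singularity[of "ball 0 r" g "{0}"])
  have h: "(%u. \<psi> u / u ^ d) holomorphic_on ball 0 r - {0}"
   by (intro holomorphic_intros holomorphic_on_subset[OF hol]) auto
  thus h2: "g holomorphic_on ball 0 r - {0}"
   by (rule holomorphic_transform) (simp add: g_def)
  have "isCont g u" if "u \<in> ball 0 r" for u
  proof (cases "u = 0")
   case True
   have "\<forall>\<^sub>F u in at 0. \<psi> u / u ^ d = g u" by (auto simp: eventually_at_filter g_def)
   with lim have "(g \<longlongrightarrow> x) (at 0)" by (rule Lim_transform_eventually)
   thus ?thesis using True by (simp add: isCont_def g_def)
  next
   case False
   have "open (ball 0 r - {0 :: complex})" by (intro open_Diff) auto
   thus ?thesis using False that h2 continuous_on_eq_continuous_at holomorphic_on_imp_continuous_on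
    by (metis Diff_iff singletonD)
  qed
  thus "continuous_on (ball 0 r) g" by (simp add: continuous_at_imp_continuous_on)
 qed auto
 hence gs: "g holomorphic_on cball 0 (r/2)" by (rule holomorphic_on_subset) (use r in auto)
 have "norm ((deriv ^^ 0) g 0) \<le> fact 0 * (B / (r/2) ^ d) / (r/2) ^ 0"
 proof (rule Cauchy_inequality)
  show "g holomorphic_on ball 0 (r/2)" by (rule holomorphic_on_subset[OF gs]) auto
  show "continuous_on (cball 0 (r/2)) g" by (rule holomorphic_on_imp_continuous_on[OF gs])
  fix u :: complex assume u: "norm (0 - u) = r/2"
  hence u0: "u ~= 0" "norm u = r/2" using r by auto
  have "norm (g u) = norm (\<psi> u) / norm u ^ d" using u0(1) by (simp add: g_def norm_divide norm_power)
  also have "\<dots> = norm (\<psi> u) / (r/2) ^ d" by (simp only: u0(2))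
  also have "\<dots> \<le> B / (r/2) ^ d" using B[of u] u0 r by (intro divide_right_mono) auto
  finally show "norm (g u) \<le> B / (r/2) ^ d" .
 qed (use r in auto)
 thus ?thesis by (simp add: g_def)
qed

context lifting_family
begin

text \<open>Injectivity makes \<open>h (Suc n) u - h 0 u\<close> nonzero and values in
  \<open>D\<close> make it shorter than \<open>d\<close>: these are the two conditions for lifting
  it through \<open>f\<close>, and the lift has the same properties.\<close>

definition motion :: "complex => real => (nat => complex => complex) => bool" where
 "motion c r h \<longleftrightarrow> r > 0 \<and> (\<forall>n. h n holomorphic_on ball 0 r) \<and> (\<forall>n. \<forall>u\<in>ball 0 r. h n u \<in> D) \<and>
   (\<forall>u\<in>ball 0 r. inj (%n. h n u)) \<and> (\<forall>n. h n 0 = it c n c)"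

lemma lift_motion:
 assumes M: "motion c r h"
 shows "\<exists>h'. motion c r h' \<and> (\<forall>n. \<forall>u\<in>ball 0 r. f (h' n u) = h (Suc n) u - h 0 u)"
proof -
 have r: "r > 0" and hol: "!!n. h n holomorphic_on ball 0 r" and inD: "!!n u. u\<in>ball 0 r ==> h n u \<in> D"
  and inj: "!!u. u\<in>ball 0 r ==> inj (%n. h n u)" and h0: "!!n. h n 0 = it c n c"
  using M by (auto simp: motion_def)
 have "\<exists>v. v holomorphic_on ball 0 r \<and> v ` ball 0 r \<subseteq> D \<and> v 0 = it c n c \<and> (\<forall>u\<in>ball 0 r. f (v u) = h (Suc n) u - h 0 u)" for n
 proof (rule lift)
  show "(%u. h (Suc n) u - h 0 u) holomorphic_on ball 0 r" by (intro holomorphic_intros hol)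
  fix u assume u: "u \<in> ball (0::complex) r"
  have "h (Suc n) u ~= h 0 u" using inj[OF u] by (auto simp: inj_def)
  thus "h (Suc n) u - h 0 u ~= 0 \<and> norm (h (Suc n) u - h 0 u) < d" using diam_D[OF inD[OF u] inD[OF u]] by simp
 next
  show "it c n c \<in> D" using inD[of 0 n] h0 r by simp
  show "f (it c n c) = h (Suc n) 0 - h 0 0" using h0[of "Suc n"] h0[of 0] by (simp add: it_Suc G_def)
 qed (use r in auto)
 then obtain h' where h': "!!n. h' n holomorphic_on ball 0 r" "!!n. h' n ` ball 0 r \<subseteq> D" "!!n. h' n 0 = it c n c"
  "!!n u. u\<in>ball 0 r ==> f (h' n u) = h (Suc n) u - h 0 u" by metis
 have "inj (%n. h' n u)" if u: "u \<in> ball 0 r" for u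
 proof (rule injI)
  fix n m assume "h' n u = h' m u"
  hence "h (Suc n) u = h (Suc m) u" using h'(4)[OF u, of n] h'(4)[OF u, of m] by simp
  thus "n = m" using inj[OF u] by (auto simp: inj_def)
 qed
 thus ?thesis using h' r by (intro exI[of _ h']) (auto simp: motion_def image_subset_iff)
qed

lemma motion_sequence:
 assumes M: "motion c r h"
 obtains H where "H 0 = h" "!!k. motion c r (H k)"
  "!!k n u. u \<in> ball 0 r ==> f (H (Suc k) n u) = H k (Suc n) u - H k 0 u"
proof -
 define nxt where "nxt = (%h. SOME h'. motion c r h' \<and> (\<forall>n. \<forall>u\<in>ball 0 r. f (h' n u) = h (Suc n) u - h 0 u))"
 have nxt: "motion c r (nxt h) \<and> (\<forall>n. \<forall>u\<in>ball 0 r. f (nxt h n u) = h (Suc n) u - h 0 u)" if "motion c r h" for h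
  unfolding nxt_def by (rule someI_ex[OF lift_motion[OF that]])
 define H where "H = (%k. (nxt ^^ k) h)"
 have MH: "motion c r (H k)" for k
  by (induction k) (use M nxt in \<open>auto simp: H_def\<close>)
 show thesis
 proof (rule that[of H])
  show "H 0 = h" by (simp add: H_def)
  show "motion c r (H k)" for k by (rule MH)
  show "f (H (Suc k) n u) = H k (Suc n) u - H k 0 u" if "u \<in> ball 0 r" for k n u
   using nxt[OF MH[of k]] that by (simp add: H_def)
 qed
qed

text \<open>\<open>cc\<close> is a reference family satisfying the lifting relation exactly near 0.
  Let \<open>Y k n\<close> be the coefficient of u^dg in the k-th lift minus \<open>cc\<close>, and
  c_n the orbit of \<open>c\<close>. Linearising gives Y k (n+1) = f'(c_n) Y (k+1) n + Y k 0.
  Unrolling this in n yields a convolution of 1 / Dit with \<open>x i = Y i 0\<close>, and these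
  numbers are bounded because all lifts stay in the bounded domain.\<close>

lemma motion_convolution:
 assumes M: "motion c r h"
  and cc: "!!n. (cc n \<longlongrightarrow> it c n c) (at 0)"
  and cf: "!!n. \<forall>\<^sub>F u in at 0. f (cc n u) = cc (Suc n) u - cc 0 u"
  and c0: "!!u. cc 0 u = c + b * u"
  and y: "!!n. ((%u. (h n u - cc n u) / u ^ dg) \<longlongrightarrow> y n) (at 0)"
 obtains x K where "!!i. norm (x i) \<le> K" "!!n. y n / Dit c n c = (\<Sum>i\<le>n. x i / Dit c (n - i) c)"
  "!!n. Dit c n c ~= 0"
proof -
 have r: "r > 0" and h0: "!!n. h n 0 = it c n c" and inD: "!!n. it c n c \<in> D" and injC: "inj (%n. it c n c)"
 proof -
  show "r > 0" and 1: "!!n. h n 0 = it c n c" using M by (auto simp: motion_def)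
  thus "it c n c \<in> D" for n using M unfolding motion_def by (metis centre_in_ball)
  have "inj (%n. h n 0)" using M \<open>r > 0\<close> unfolding motion_def by (metis centre_in_ball)
  thus "inj (%n. it c n c)" unfolding 1 .
 qed
 have dnz: "deriv f (it c n c) ~= 0" for n
 proof -
  have fx: "f (it c n c) = it c (Suc n) c - it c 0 c" by (simp add: it_Suc G_def)
  have "it c (Suc n) c ~= it c 0 c" using injC unfolding inj_def by (metis nat.distinct(1))
  thus ?thesis using diam_D[OF inD[of "Suc n"] inD[of 0]] by (intro deriv_nonzero[OF inD]) (auto simp only: fx right_minus_eq)
 qed
 obtain H where H: "H 0 = h" "!!k. motion c r (H k)"
  "!!k n u. u \<in> ball 0 r ==> f (H (Suc k) n u) = H k (Suc n) u - H k 0 u"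
  using motion_sequence[OF M] by metis
 have Hhol: "H k n holomorphic_on ball 0 r" for k n using H(2) by (auto simp: motion_def)
 have Hlim: "(H k n \<longlongrightarrow> it c n c) (at 0)" for k n
 proof -
  have "isCont (H k n) 0"
   using Hhol r continuous_on_eq_continuous_at[OF open_ball] holomorphic_on_imp_continuous_on by (metis centre_in_ball)
  thus ?thesis using H(2)[of k] by (simp add: isCont_def motion_def)
 qed
 have ev: "\<forall>\<^sub>F u in at 0. u \<in> ball (0::complex) r" using r by (intro eventually_at_in_open') auto
 have "\<exists>Y. \<forall>n. ((%u. (H k n u - cc n u) / u ^ dg) \<longlongrightarrow> Y n) (at 0)" for k
 proof (induction k)
  case 0
  show ?case using y H(1) by (intro exI[of _ y]) simp
 next
  case (Suc k)
  then obtain Y where Y: "!!n. ((%u. (H k n u - cc n u) / u ^ dg) \<longlongrightarrow> Y n) (at 0)" by blast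
  have "((%u. (H (Suc k) n u - cc n u) / u ^ dg) \<longlongrightarrow> (Y (Suc n) - Y 0) / deriv f (it c n c)) (at 0)" for n
  proof (rule strict_derivative_quotient[OF hol_f open_D inD dnz Hlim cc])
   have "\<forall>\<^sub>F u in at 0. (H k (Suc n) u - cc (Suc n) u) / u ^ dg - (H k 0 u - cc 0 u) / u ^ dg
      = (f (H (Suc k) n u) - f (cc n u)) / u ^ dg"
    using ev cf[of n] by eventually_elim (simp add: H(3) diff_divide_distrib)
   with tendsto_diff[OF Y[of "Suc n"] Y[of 0]]
   show "((%u. (f (H (Suc k) n u) - f (cc n u)) / u ^ dg) \<longlongrightarrow> Y (Suc n) - Y 0) (at 0)"
    by (rule Lim_transform_eventually)
  qed
  thus ?case by (intro exI[of _ "%n. (Y (Suc n) - Y 0) / deriv f (it c n c)"]) simp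
 qed
 then obtain Y where Y: "!!k n. ((%u. (H k n u - cc n u) / u ^ dg) \<longlongrightarrow> Y k n) (at 0)" by metis
 have rec: "Y k (Suc n) = deriv f (it c n c) * Y (Suc k) n + Y k 0" for k n
 proof -
  have "((%u. (H (Suc k) n u - cc n u) / u ^ dg) \<longlongrightarrow> (Y k (Suc n) - Y k 0) / deriv f (it c n c)) (at 0)"
  proof (rule strict_derivative_quotient[OF hol_f open_D inD dnz Hlim cc])
   have "\<forall>\<^sub>F u in at 0. (H k (Suc n) u - cc (Suc n) u) / u ^ dg - (H k 0 u - cc 0 u) / u ^ dg
      = (f (H (Suc k) n u) - f (cc n u)) / u ^ dg"
    using ev cf[of n] by eventually_elim (simp add: H(3) diff_divide_distrib)
   with tendsto_diff[OF Y[of k "Suc n"] Y[of k 0]]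
   show "((%u. (f (H (Suc k) n u) - f (cc n u)) / u ^ dg) \<longlongrightarrow> Y k (Suc n) - Y k 0) (at 0)"
    by (rule Lim_transform_eventually)
  qed
  hence "Y (Suc k) n = (Y k (Suc n) - Y k 0) / deriv f (it c n c)"
   using Y[of "Suc k" n] tendsto_unique by (metis at_neq_bot)
  thus ?thesis using dnz[of n] by simp
 qed
 have Pnz: "Dit c n c ~= 0" for n using dnz by (simp add: Dit_def)
 have unroll: "Y k n / Dit c n c = (\<Sum>i\<le>n. Y (k + i) 0 / Dit c (n - i) c)" for k n
 proof (induction n arbitrary: k)
  case (Suc n)
  have "Y k (Suc n) / Dit c (Suc n) c = Y (Suc k) n / Dit c n c + Y k 0 / Dit c (Suc n) c"
   using dnz[of n] by (simp add: rec Dit_Suc add_divide_distrib)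
  also have "Y (Suc k) n / Dit c n c = (\<Sum>i\<le>n. Y (Suc k + i) 0 / Dit c (n - i) c)" by (rule Suc.IH)
  also have "\<dots> + Y k 0 / Dit c (Suc n) c = (\<Sum>i\<le>Suc n. Y (k + i) 0 / Dit c (Suc n - i) c)"
   by (subst sum.atMost_Suc_shift) simp
  finally show ?case .
 qed simp
 define K where "K = (d + norm b * r) / (r / 2) ^ dg"
 have bound: "norm (Y k 0) \<le> K" for k
  unfolding K_def
 proof (rule coefficient_bound[OF _ r])
  show "(%u. H k 0 u - (c + b * u)) holomorphic_on ball 0 r" by (intro holomorphic_intros Hhol)
  show "((%u. (H k 0 u - (c + b * u)) / u ^ dg) \<longlongrightarrow> Y k 0) (at 0)" using Y[of k 0] by (simp add: c0)
  fix u assume u: "u \<in> ball (0::complex) r"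
  have "H k 0 u \<in> D" "c \<in> D" using H(2)[of k] u inD[of 0] by (auto simp: motion_def)
  hence "norm (H k 0 u - c) \<le> d" using diam_D by force
  moreover have "norm (b * u) \<le> norm b * r" using u by (simp add: norm_mult mult_left_mono)
  moreover have "norm (H k 0 u - (c + b * u)) \<le> norm (H k 0 u - c) + norm (b * u)"
   using norm_triangle_ineq4[of "H k 0 u - c" "b * u"] by (simp add: algebra_simps)
  ultimately show "norm (H k 0 u - (c + b * u)) \<le> d + norm b * r" by linarith
 qed
 show thesis
 proof (rule that[of "%i. Y i 0" K])
  have "Y 0 n = y n" for n using Y[of 0 n] y[of n] H(1) tendsto_unique by (metis at_neq_bot)
  thus "y n / Dit c n c = (\<Sum>i\<le>n. Y i 0 / Dit c (n - i) c)" for n using unroll[of 0 n] by simp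
 qed (use bound Pnz in auto)
qed

text \<open>Only finitely many indices are not covered by closeness to \<open>A\<close>, and for
  these continuity at u = 0 suffices. An early point and a late point remain distinct because the
  former is at positive distance from \<open>A\<close> when u = 0.\<close>

lemma motion_from_tail:
 assumes orb: "!!n. orb c n c" and inj: "inj (%n. it c n c)" and O: "finite A" "A \<subseteq> D" "!!n. it c n c \<notin> A"
  and r: "r > 0" and hol: "!!n. h n holomorphic_on ball 0 r" and h0: "!!n. h n 0 = it c n c"
  and tail: "!!u. u \<in> ball 0 r ==> inj_on (%n. h n u) {n0..}"
  and near: "!!e. e > 0 ==> \<exists>n1 r1. r1 > 0 \<and> (\<forall>n\<ge>n1. \<forall>u. norm u < r1 \<longrightarrow> (\<exists>a\<in>A. dist (h n u) a < e))"
 obtains r' where "r' \<le> r" "motion c r' h"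
proof -
 have inD: "it c n c \<in> D" for n using orb[of "Suc n"] by (simp add: orb_def)
 have "open (D \<inter> - ((%n. it c n c) ` {..<n0}))"
  using open_D by (intro open_Int open_Compl finite_imp_closed) auto
 moreover have "compact A" "A \<subseteq> D \<inter> - ((%n. it c n c) ` {..<n0})" using O finite_imp_compact by auto
 ultimately obtain e where e: "e > 0" "(\<Union>x\<in>A. ball x e) \<subseteq> D \<inter> - ((%n. it c n c) ` {..<n0})"
  using compact_subset_open_imp_ball_epsilon_subset by metis
 obtain n1 r1 where n1: "r1 > 0" "!!n u. n \<ge> n1 ==> norm u < r1 ==> \<exists>a\<in>A. dist (h n u) a < e/2"
  using near[OF half_gt_zero[OF e(1)]] by blast
 have hlim: "(h n \<longlongrightarrow> it c n c) (nhds 0)" for n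
 proof -
  have "isCont (h n) 0"
   using hol r continuous_on_eq_continuous_at[OF open_ball] holomorphic_on_imp_continuous_on by (metis centre_in_ball)
  hence "(h n \<longlongrightarrow> h n 0) (nhds 0)" using tendsto_at_iff_tendsto_nhds[of "h n" 0] by (simp add: isCont_def)
  thus ?thesis unfolding h0 .
 qed
 have evD: "\<forall>\<^sub>F u in nhds 0. h n u \<in> D" for n
  by (rule topological_tendstoD[OF hlim open_D inD])
 have evA: "\<forall>\<^sub>F u in nhds 0. dist (h n u) (it c n c) < e/2" for n
  by (rule tendstoD[OF hlim]) (use e in simp)
 have evne: "\<forall>\<^sub>F u in nhds 0. h n u ~= h m u" if "n ~= m" for n m
 proof -
  have "it c n c - it c m c ~= 0" using inj that by (auto simp: inj_def)
  from tendsto_imp_eventually_ne[OF tendsto_diff[OF hlim hlim] this] show ?thesis by simp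
 qed
 define good where "good = (%u. (\<forall>n\<in>{..<n1+n0}. h n u \<in> D \<and> dist (h n u) (it c n c) < e/2) \<and>
   (\<forall>n\<in>{..<n1+n0}. \<forall>m\<in>{..<n1+n0}. n ~= m \<longrightarrow> h n u ~= h m u))"
 have "\<forall>\<^sub>F u in nhds 0. good u" unfolding good_def
 proof (intro eventually_conj eventually_ball_finite ballI)
  show "\<forall>\<^sub>F u in nhds 0. n ~= m \<longrightarrow> h n u ~= h m u" for n m
   using evne[of n m] by (cases "n = m") auto
 qed (use evA in \<open>auto intro: evD simp del: less_divide_eq_numeral1\<close>)
 then obtain S where S': "open S" "0 \<in> S" "\<forall>u\<in>S. good u"
  unfolding eventually_nhds by blast
 hence S: "(\<forall>n\<in>{..<n1+n0}. h n u \<in> D \<and> dist (h n u) (it c n c) < e/2) \<and>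
   (\<forall>n\<in>{..<n1+n0}. \<forall>m\<in>{..<n1+n0}. n ~= m \<longrightarrow> h n u ~= h m u)" if "u \<in> S" for u
  using that unfolding good_def by blast
 obtain r2 where r2: "r2 > 0" "ball 0 r2 \<subseteq> S" using openE[OF S'(1,2)] by blast
 define r' where "r' = min r (min r1 r2)"
 have r': "r' > 0" "r' \<le> r" "r' \<le> r1" "r' \<le> r2" using r n1(1) r2(1) by (auto simp: r'_def)
 have far: "\<not> (\<exists>a\<in>A. dist (h n u) a < e/2)" if nu: "n < n0" "u \<in> ball 0 r'" for n u
 proof
  assume "\<exists>a\<in>A. dist (h n u) a < e/2"
  then obtain a where a: "a \<in> A" "dist (h n u) a < e/2" by blast
  have "dist (h n u) (it c n c) < e/2" using S[OF subsetD[OF r2(2)], of u] r' nu by auto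
  hence "dist a (it c n c) < e" using a dist_triangle_half_r[of "h n u" a e "it c n c"] by simp
  hence "it c n c \<in> (\<Union>x\<in>A. ball x e)" using a by auto
  thus False using e(2) nu(1) by blast
 qed
 have ne: "h n u ~= h m u" if u: "u \<in> ball 0 r'" and nm: "n < m" for n m u
 proof (cases "n < n0")
  case True
  show ?thesis
  proof (cases "m < n1 + n0")
   case True
   have "u \<in> S" using u r2 r' by auto
   from conjunct2[OF S[OF this], rule_format, of n m] True nm show ?thesis by simp
  next
   case False
   hence "\<exists>a\<in>A. dist (h m u) a < e/2" using n1(2)[of m u] u r' by auto
   thus ?thesis using far[OF True u] by auto
  qed
 next
  case False
  have "u \<in> ball 0 r" using u r' by auto
  from inj_onD[OF tail[OF this], of n m] show ?thesis using False nm by auto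
 qed
 have "motion c r' h"
  unfolding motion_def
 proof (intro conjI allI ballI)
  show "h n holomorphic_on ball 0 r'" for n by (rule holomorphic_on_subset[OF hol]) (use r' in auto)
  show "h n u \<in> D" if u: "u \<in> ball 0 r'" for n u
  proof (cases "n < n1 + n0")
   case True
   have "u \<in> S" using u r2 r' by auto
   from conjunct1[OF S[OF this], rule_format, of n] True show ?thesis by simp
  next
   case False
   then obtain a where "a \<in> A" "dist (h n u) a < e/2" using n1(2)[of n u] u r' by auto
   hence "a \<in> A" "h n u \<in> ball a e" using e(1) by (auto simp: dist_commute)
   thus ?thesis using e(2) by blast
  qed
  show "inj (%n. h n u)" if "u \<in> ball 0 r'" for u
   using ne[OF that] by (intro injI) (metis linorder_neqE_nat)
 qed (use r' h0 in auto)
 thus thesis using that r' by blast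
qed

end

lemma null_divide_shift:
 fixes x :: "nat => complex"
 assumes "(%n. x n / of_nat n ^ k) \<longlonglongrightarrow> 0" "j \<le> q"
 shows "(%n. x (n + j) / of_nat (n + q) ^ k) \<longlonglongrightarrow> 0"
proof (rule Lim_null_comparison)
 show "(%n. norm (x (n + j) / of_nat (n + j) ^ k)) \<longlonglongrightarrow> 0"
  using LIMSEQ_ignore_initial_segment[OF assms(1), of j] by (rule tendsto_norm_zero)
 show "\<forall>\<^sub>F n in sequentially. norm (x (n + j) / of_nat (n + q) ^ k) \<le> norm (x (n + j) / of_nat (n + j) ^ k)"
  using eventually_gt_at_top[of 0]
 proof eventually_elim
  case (elim n)
  have "real (n + j) ^ k \<le> real (n + q) ^ k" using assms(2) by (intro power_mono) auto
  thus ?case using elim unfolding norm_divide norm_power norm_of_nat by (intro divide_left_mono) auto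
 qed
qed

lemma iterate_has_derivative:
 assumes T: "T holomorphic_on S" "open S" and in_S: "!!j. j < k ==> (T ^^ j) W \<in> S"
 shows "((T ^^ k) has_field_derivative (\<Prod>i<k. deriv T ((T ^^ i) W))) (at W)"
 using in_S
proof (induction k)
 case (Suc k)
 have "(T has_field_derivative deriv T ((T ^^ k) W)) (at ((T ^^ k) W))"
  using T Suc.prems[of k] by (intro holomorphic_derivI[OF T]) auto
 from DERIV_chain[OF this Suc.IH] Suc.prems show ?case by (simp add: mult.commute o_def)
qed (simp add: id_def)

subsection \<open>Asymptotics of the singular orbit\<close>

locale aligned_cycle = lifting_family +
 fixes c :: complex and q :: nat and aa :: "nat => complex" and \<kappa> :: complex
 assumes c: "c \<in> closure D" and cy: "cyc c q aa \<kappa>" and \<kappa>: "neutral_or_attr \<kappa>"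
  and lim: "(%n. it c n c - aa n) \<longlonglongrightarrow> 0"
begin

definition \<rho> :: "nat => complex" where "\<rho> n = 1 / Dit c n c"
definition \<epsilon> :: "nat => complex" where "\<epsilon> n = it c n c - aa n"
text \<open>At an attracting cycle the derivative of the iterate and the displacement from the cycle
  decay at the same geometric rate; the product removes it and leaves growth of order n^\<iota>, in
  the parabolic case as well.\<close>

definition \<tau> :: "nat => complex" where "\<tau> n = \<rho> n * \<epsilon> n"
text \<open>The growth exponent of \<tau>: bounded for an attracting cycle, linear for a parabolic
  one.\<close>

definition \<iota> :: nat where "\<iota> = (if norm \<kappa> < 1 then 0 else 1)"

lemma orb_C: "orb c n c" and C_notin: "it c n c \<notin> range aa" and inj_C: "inj (%n. it c n c)"
 by (rule singular_orbit[OF c cy \<kappa>]; blast)+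

lemma C_neq: "it c n c ~= aa m" using C_notin[of n] by (metis rangeI)

lemma C_in: "it c n c \<in> D" using orb_C[of "Suc n"] by (simp add: orb_def)
lemma aa_in: "aa n \<in> D" and q: "q \<ge> 1" and aa_Suc: "aa (Suc n) = f (aa n) + c" using cy by (auto simp: cyc_def)
lemma \<kappa>0: "\<kappa> ~= 0" using \<kappa> by (simp add: neutral_or_attr_def)
lemma aa_mult: "aa (n + k * q) = aa n" by (rule periodic_add_mult[of aa q, OF cyc_per[OF cy]])

lemma df_C: "deriv f (it c n c) ~= 0"
proof -
 have fx: "f (it c n c) = it c (Suc n) c - it c 0 c" by (simp add: it_Suc G_def)
 have "it c (Suc n) c ~= it c 0 c" using inj_C unfolding inj_def by (metis nat.distinct(1))
 thus ?thesis using diam_D[OF C_in[of "Suc n"] C_in[of 0]] by (intro deriv_nonzero[OF C_in]) (auto simp only: fx right_minus_eq)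
qed

lemma df_aa: "deriv f (aa n) ~= 0"
proof
 assume "deriv f (aa n) = 0"
 hence "Dit c q (aa n) = 0" using q unfolding Dit_def by (intro prod_zero) (auto intro!: bexI[of _ 0])
 thus False using cyc_Dit_shift[OF cy, of n] \<kappa>0 by simp
qed

lemma Dit_C: "Dit c n c ~= 0" using df_C by (simp add: Dit_def)
lemma \<rho>_nz: "\<rho> n ~= 0" using Dit_C by (simp add: \<rho>_def)
lemma \<epsilon>_nz: "\<epsilon> n ~= 0" using C_notin[of n] by (auto simp: \<epsilon>_def)
lemma \<tau>_nz: "\<tau> n ~= 0" using \<rho>_nz \<epsilon>_nz by (simp add: \<tau>_def)

lemma \<rho>_add: "\<rho> n = \<rho> (n + j) * Dit c j (it c n c)"
 using Dit_add[of c j n c] Dit_C[of "n + j"] Dit_C[of n] by (simp add: \<rho>_def add.commute field_simps)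

lemma \<rho>_Suc: "\<rho> n = \<rho> (Suc n) * deriv f (it c n c)"
 using Dit_C[of n] df_C[of n] by (simp add: \<rho>_def Dit_Suc)

lemma orbit_residue:
 assumes "q dvd N" "N \<ge> 1"
 shows "(%k. it c (n0 + k * N + r) c) \<longlonglongrightarrow> aa (n0 + r)"
proof -
 obtain p where p: "N = p * q" using assms by (metis dvd_def mult.commute)
 have sm: "strict_mono (%k. n0 + k * N + r)" using assms by (intro strict_monoI) simp
 have "aa (n0 + k * N + r) = aa (n0 + r)" for k
  using aa_mult[of "n0 + r" "k * p"] by (simp add: p algebra_simps)
 with LIMSEQ_subseq_LIMSEQ[OF lim sm, unfolded o_def] show ?thesis by (simp add: LIM_zero_iff)
qed

lemma residue_lim:
 assumes "!!r. r < q ==> ((%k. it c (k * q + r) c) \<longlonglongrightarrow> aa r) ==> (!!k. aa (k * q + r) = aa r) ==>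
   strict_mono (%k. k * q + r) ==> (%k. x (k * q + r)) \<longlonglongrightarrow> l"
 shows "x \<longlonglongrightarrow> l"
proof (rule tendsto_residues[OF q, of x 0])
 fix r assume "r < q"
 hence "(%k. x (k * q + r)) \<longlonglongrightarrow> l"
 proof (rule assms)
  show "(%k. it c (k * q + r) c) \<longlonglongrightarrow> aa r" using orbit_residue[OF dvd_refl q, of 0 r] by simp
  show "aa (k * q + r) = aa r" for k using aa_mult[of r k] by (simp add: add.commute)
  show "strict_mono (%k. k * q + r)" using q by (intro strict_monoI) simp
 qed
 thus "(%k. x (0 + k * q + r)) \<longlonglongrightarrow> l" by simp
qed

text \<open>One step multiplies \<epsilon> by a difference quotient of \<open>f\<close> and \<rho>
  by the reciprocal of the derivative at the orbit point; quotient and derivative have the same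
  limit, the derivative at the cycle point.\<close>

lemma \<tau>_ratio: "(%n. \<tau> (n + j) / \<tau> n) \<longlonglongrightarrow> 1"
proof (induction j)
 case 0
 show ?case using \<tau>_nz by simp
next
 case (Suc j)
 have 1: "(%n. \<tau> (Suc n) / \<tau> n) \<longlonglongrightarrow> 1"
 proof (rule residue_lim)
  fix r assume r: "(%k. it c (k * q + r) c) \<longlonglongrightarrow> aa r" "!!k. aa (k * q + r) = aa r"
  have "(%k. (f (it c (k * q + r) c) - f (aa r)) / (it c (k * q + r) c - aa r) / deriv f (it c (k * q + r) c))
    \<longlonglongrightarrow> deriv f (aa r) / deriv f (aa r)"
  proof (intro tendsto_divide strict_derivative_tendsto[OF hol_f open_D aa_in] r tendsto_const df_aa)
   show "(%k. deriv f (it c (k * q + r) c)) \<longlonglongrightarrow> deriv f (aa r)"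
    using f'_isCont[OF aa_in] r(1) by (rule isCont_tendsto_compose)
   show "\<forall>\<^sub>F k in sequentially. it c (k * q + r) c ~= aa r" by (simp add: C_neq)
  qed
  also have "(%k. (f (it c (k * q + r) c) - f (aa r)) / (it c (k * q + r) c - aa r) / deriv f (it c (k * q + r) c))
   = (%k. \<tau> (Suc (k * q + r)) / \<tau> (k * q + r))"
  proof
   fix k
   let ?n = "k * q + r"
   have "\<epsilon> (Suc ?n) = f (it c ?n c) - f (aa ?n)" by (simp add: \<epsilon>_def it_Suc aa_Suc G_def)
   hence "\<tau> (Suc ?n) / \<tau> ?n = (f (it c ?n c) - f (aa ?n)) / \<epsilon> ?n / deriv f (it c ?n c)"
    using \<rho>_nz[of "Suc ?n"] unfolding \<tau>_def \<rho>_Suc[of ?n] by simp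
   thus "(f (it c ?n c) - f (aa r)) / (it c ?n c - aa r) / deriv f (it c ?n c) = \<tau> (Suc ?n) / \<tau> ?n"
    by (simp add: \<epsilon>_def r)
  qed
  finally show "(%k. \<tau> (Suc (k * q + r)) / \<tau> (k * q + r)) \<longlonglongrightarrow> 1" using df_aa by simp
 qed
 have "(%n. \<tau> (Suc (n + j)) / \<tau> (n + j)) \<longlonglongrightarrow> 1" using LIMSEQ_ignore_initial_segment[OF 1, of j] by simp
 from tendsto_mult[OF this Suc] show ?case using \<tau>_nz by simp
qed

text \<open>Differentiating the semiconjugacy expresses the derivative of the iterate by \<pi>' at
  both ends and a product of values of T', which converges to a nonzero limit. The shape - (\<pi> W
  - a) / \<theta> of \<pi>' makes the displacement cancel, so \<tau> grows like \<theta> along the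
  orbit of \<open>T\<close>. \<open>\<tau>_ratio\<close> supplies the remaining residues.\<close>

lemma \<tau>_lim_model:
 assumes M: "model c N (aa 0) \<pi> T R L" and dv: "q dvd N"
  and der: "!!W. Re W > R ==> (\<pi> has_field_derivative - (\<pi> W - aa 0) / \<theta> W) (at W)"
  and \<theta>: "!!W. Re W > R ==> \<theta> W ~= 0" "!!W. Re W > R ==> (%k. \<theta> ((T ^^ k) W) / of_nat k ^ i) \<longlonglongrightarrow> \<theta>0" "\<theta>0 ~= 0"
 obtains K ns Ws where "K ~= 0" "(%n. \<tau> n / of_nat n ^ i) \<longlonglongrightarrow> K" "Re Ws > R" "ns mod q = 0"
  "!!k. it c (ns + k * N) c = \<pi> ((T ^^ k) Ws)"
proof -
 have N: "N \<ge> 1" using M by (simp add: model_def)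
 obtain ns Ws where ns: "Re Ws > R" "!!k. it c (ns + k * N) c = \<pi> ((T ^^ k) Ws)"
  by (rule model_orbit[OF c cy M dv]) (rule that)
 have "aa ns = aa 0"
  using orbit_residue[OF dv N, of ns 0] model_lim[OF M ns(1)] LIMSEQ_unique by (simp add: ns(2))
 hence nsq: "ns mod q = 0" using cyc_eq_iff[OF cy] by simp
 have aan: "aa (ns + k * N) = aa 0" for k
  using cyc_eq_iff[OF cy, of "ns + k * N" 0] dv nsq by (simp add: mod_add_eq[symmetric, of ns] dvd_imp_mod_0)
 define W where "W = (%k. (T ^^ k) Ws)"
 have ReW: "Re (W k) > R" for k unfolding W_def by (rule model_iter(2)[OF M ns(1)])
 obtain \<Lambda> where \<Lambda>: "\<Lambda> ~= 0" "(%k. \<Prod>i<k. deriv T (W i)) \<longlonglongrightarrow> \<Lambda>"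
  using M ns(1) unfolding model_def W_def by blast
 define X where "X = \<pi> Ws - aa 0"
 have X: "X ~= 0" using M ns(1) by (simp add: X_def model_def)
 have C0: "it c ns c = \<pi> Ws" using ns(2)[of 0] by simp
 have \<tau>k: "\<tau> (ns + k * N) = X * \<theta> (W k) / (\<theta> Ws * Dit c ns c * (\<Prod>i<k. deriv T (W i)))" for k
 proof -
  have d1: "((%w. it c (k * N) (\<pi> w)) has_field_derivative Dit c (k * N) (\<pi> Ws) * (- (\<pi> Ws - aa 0) / \<theta> Ws)) (at Ws)"
   by (rule DERIV_chain2[OF it_deriv[OF model_iter(3)[OF M ns(1)]] der[OF ns(1)]])
  have d2: "((%w. \<pi> ((T ^^ k) w)) has_field_derivative (- (\<pi> (W k) - aa 0) / \<theta> (W k)) * (\<Prod>i<k. deriv T (W i))) (at Ws)"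
  proof (rule DERIV_chain2[where f = \<pi> and g = "T ^^ k"])
   show "(\<pi> has_field_derivative - (\<pi> (W k) - aa 0) / \<theta> (W k)) (at ((T ^^ k) Ws))"
    using der[OF ReW[of k]] by (simp add: W_def)
   show "((T ^^ k) has_field_derivative (\<Prod>i<k. deriv T (W i))) (at Ws)"
    unfolding W_def
    by (rule iterate_has_derivative[of T "{W. Re W > R}"])
     (use M ReW in \<open>auto simp: model_def half_plane_open W_def\<close>)
  qed
  have "((%w. \<pi> ((T ^^ k) w)) has_field_derivative Dit c (k * N) (\<pi> Ws) * (- (\<pi> Ws - aa 0) / \<theta> Ws)) (at Ws)"
   by (rule has_field_derivative_transform_within_open[OF d1 half_plane_open[of R]])
    (use ns(1) model_iter(4)[OF M] in auto)
  hence eq: "Dit c (k * N) (\<pi> Ws) * (- X / \<theta> Ws) = (- (\<pi> (W k) - aa 0) / \<theta> (W k)) * (\<Prod>i<k. deriv T (W i))"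
   using d2 DERIV_unique unfolding X_def by blast
  have D1: "Dit c (ns + k * N) c = Dit c ns c * Dit c (k * N) (\<pi> Ws)"
   using Dit_add[of c "k * N" ns c] C0 by (simp add: add.commute)
  have nz: "Dit c ns c ~= 0" "Dit c (k * N) (\<pi> Ws) ~= 0" using Dit_C[of "ns + k * N"] unfolding D1 by auto
  have t: "\<theta> Ws ~= 0" "\<theta> (W k) ~= 0" using \<theta>(1)[OF ns(1)] \<theta>(1)[OF ReW] by auto
  have pnz: "(\<Prod>i<k. deriv T (W i)) ~= 0"
  proof
   assume z: "(\<Prod>i<k. deriv T (W i)) = 0"
   show False using eq nz t X unfolding z by simp
  qed
  have tk: "\<tau> (ns + k * N) = (\<pi> (W k) - aa 0) / (Dit c ns c * Dit c (k * N) (\<pi> Ws))"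
   unfolding \<tau>_def \<rho>_def \<epsilon>_def aan ns(2) D1 W_def by simp
  have alg: "Y / (A * E) = X * s / (t * A * P)" if "E * (- X / t) = (- Y / s) * P" "E ~= 0" "s ~= 0" "t ~= 0" "P ~= 0" "A ~= 0"
   for Y A E s t P :: complex
  proof -
   have "Y * P * t = E * X * s" using that by (simp add: field_simps)
   thus ?thesis using that by (simp add: field_simps)
  qed
  show ?thesis unfolding tk by (rule alg[OF eq nz(2) t(2,1) pnz nz(1)])
 qed
 define K0 where "K0 = X * \<theta>0 / (\<theta> Ws * Dit c ns c * \<Lambda>)"
 have K0: "K0 ~= 0" using X \<theta>(3) \<theta>(1)[OF ns(1)] Dit_C \<Lambda> by (simp add: K0_def)
 have l0: "(%k. \<tau> (ns + k * N) / of_nat k ^ i) \<longlonglongrightarrow> K0"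
 proof -
  have l\<theta>: "(%k. \<theta> (W k) / of_nat k ^ i) \<longlonglongrightarrow> \<theta>0" unfolding W_def by (rule \<theta>(2)[OF ns(1)])
  have "(%k. X * (\<theta> (W k) / of_nat k ^ i) / (\<theta> Ws * Dit c ns c * (\<Prod>i<k. deriv T (W i)))) \<longlonglongrightarrow> K0"
   unfolding K0_def
   by (intro tendsto_intros \<Lambda> l\<theta>) (use \<theta>(1)[OF ns(1)] Dit_C \<Lambda> in auto)
  thus ?thesis unfolding \<tau>k by (simp add: mult.commute mult.left_commute)
 qed
 have lim_all: "(%n. \<tau> n / of_nat n ^ i) \<longlonglongrightarrow> K0 * (1 / of_nat N) ^ i"
 proof (rule tendsto_residues[OF N, of _ ns])
  fix r assume r: "r < N"
  have N0: "real N > 0" using N by simp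
  have "(%k. real k / (real ns + real k * real N + real r)) \<longlonglongrightarrow> inverse (real N)" using N0 by real_asymp
  from tendsto_of_real[OF this, where 'a = complex]
  have l1: "(%k. of_nat k / of_nat (ns + k * N + r)) \<longlonglongrightarrow> (1 / of_nat N :: complex)" by (simp add: inverse_eq_divide)
  have sm: "strict_mono (%k. ns + k * N)" using N by (intro strict_monoI) simp
  from LIMSEQ_subseq_LIMSEQ[OF \<tau>_ratio[of r] sm]
  have l2: "(%k. \<tau> (ns + k * N + r) / \<tau> (ns + k * N)) \<longlonglongrightarrow> 1" by (simp add: o_def)
  have "(%k. \<tau> (ns + k * N + r) / \<tau> (ns + k * N) * (\<tau> (ns + k * N) / of_nat k ^ i)
    * (of_nat k / of_nat (ns + k * N + r)) ^ i) \<longlonglongrightarrow> 1 * K0 * (1 / of_nat N) ^ i"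
   by (intro tendsto_intros l0 l1 l2)
  moreover have "\<forall>\<^sub>F k in sequentially. \<tau> (ns + k * N + r) / \<tau> (ns + k * N) * (\<tau> (ns + k * N) / of_nat k ^ i)
    * (of_nat k / of_nat (ns + k * N + r)) ^ i = \<tau> (ns + k * N + r) / of_nat (ns + k * N + r) ^ i"
   using eventually_gt_at_top[of 0] by eventually_elim (use \<tau>_nz in \<open>simp add: power_divide\<close>)
  ultimately have "(%k. \<tau> (ns + k * N + r) / of_nat (ns + k * N + r) ^ i) \<longlonglongrightarrow> 1 * K0 * (1 / of_nat N) ^ i"
   by (rule Lim_transform_eventually)
  thus "(%k. \<tau> (ns + k * N + r) / of_nat (ns + k * N + r) ^ i) \<longlonglongrightarrow> K0 * (1 / of_nat N) ^ i" by simp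
 qed
 have "K0 * (1 / of_nat N) ^ i ~= 0" using K0 N by simp
 thus thesis by (rule that[OF _ lim_all ns(1) nsq ns(2)])
qed

lemma parabolic_W_nonzero: "R \<ge> 1 ==> Re W > R ==> W ~= 0" by auto

lemma \<tau>_lim: obtains K where "K ~= 0" "(%n. \<tau> n / of_nat n ^ \<iota>) \<longlonglongrightarrow> K"
proof (cases "norm \<kappa> < 1")
 case True
 have fx: "it c q (aa 0) = aa 0" using cyc_it[OF cy, of q 0] cyc_per[OF cy, of 0] by simp
 obtain \<pi> T R L where M: "model c q (aa 0) \<pi> T R L" "!!W. Re W > R ==> (\<pi> has_field_derivative - (\<pi> W - aa 0) / 1) (at W)"
  by (rule attracting_model[OF q cyc_orb[OF cy] fx cyc_Dit_shift[OF cy] \<kappa>0 True]) (rule that)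
 show ?thesis
  by (rule \<tau>_lim_model[OF M(1) dvd_refl, of "%_. 1" \<iota> 1]) (use M(2) True that in \<open>auto simp: \<iota>_def\<close>)
next
 case False
 hence "\<exists>p\<ge>1. \<kappa> ^ p = 1" using \<kappa> by (auto simp: neutral_or_attr_def)
 then obtain p where p: "p \<ge> 1" "\<kappa> ^ p = 1" "!!k. 1 \<le> k ==> k < p ==> \<kappa> ^ k ~= 1"
  by (rule minimal_order) (rule that)
 obtain \<beta> T R where M: "model c (q * p) (aa 0) (%W. aa 0 + \<beta> * exp (- Ln W / of_nat p)) T R 1" "R \<ge> 1"
   "!!W. Re W > R ==> ((%W. aa 0 + \<beta> * exp (- Ln W / of_nat p)) has_field_derivative
    - ((aa 0 + \<beta> * exp (- Ln W / of_nat p)) - aa 0) / (of_nat p * W)) (at W)"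
  by (rule parabolic_cycle_model[OF c cy p(1,2)], erule (1) p(3)) (rule that)
 show ?thesis
 proof (rule \<tau>_lim_model[OF M(1) dvd_triv_left, of "%W. of_nat p * W" 1 "of_nat p"])
  fix W assume W: "Re W > R"
  show "of_nat p * W ~= 0" using p parabolic_W_nonzero[OF M(2) W] by simp
  have "(%k. (T ^^ k) W / of_nat k) \<longlonglongrightarrow> 1" using M(1) W by (simp add: model_def)
  from tendsto_mult_left[OF this, of "of_nat p"]
  show "(%k. of_nat p * (T ^^ k) W / of_nat k ^ 1) \<longlonglongrightarrow> of_nat p" by simp
 qed (use M(3) p that False in \<open>auto simp: \<iota>_def\<close>)
qed

text \<open>For \<kappa> = 1 the displacement at the returns is of order 1/n, so \<rho> = \<tau> /
  \<epsilon> has one power of n more than \<tau>.\<close>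

lemma \<rho>_lim:
 assumes "\<kappa> = 1"
 obtains K where "K ~= 0" "(%k. \<rho> (k * q) / of_nat (k * q) ^ 2) \<longlonglongrightarrow> K"
proof -
 have p: "(1::nat) \<ge> 1" "\<kappa> ^ 1 = 1" "!!k. 1 \<le> k ==> k < 1 ==> \<kappa> ^ k ~= 1" using assms by auto
 obtain \<beta> T R h where M: "h * \<beta> ^ 1 = - 1 / of_nat 1"
   "model c (q * 1) (aa 0) (%W. aa 0 + \<beta> * exp (- Ln W / of_nat 1)) T R 1" "R \<ge> 1"
   "!!W. Re W > R ==> ((%W. aa 0 + \<beta> * exp (- Ln W / of_nat 1)) has_field_derivative
    - ((aa 0 + \<beta> * exp (- Ln W / of_nat 1)) - aa 0) / (of_nat 1 * W)) (at W)"
  by (rule parabolic_cycle_model[OF c cy p(1,2)], erule (1) p(3)) (rule that)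
 have b: "\<beta> ~= 0" using M(1) by auto
 have lW: "(%k. (T ^^ k) W / of_nat k) \<longlonglongrightarrow> 1" if "Re W > R" for W using M(2) that by (simp add: model_def)
 obtain K ns Ws where K: "K ~= 0" "(%n. \<tau> n / of_nat n ^ 1) \<longlonglongrightarrow> K" "Re Ws > R" "ns mod q = 0"
  "!!k. it c (ns + k * (q * 1)) c = aa 0 + \<beta> * exp (- Ln ((T ^^ k) Ws) / of_nat 1)"
 proof (rule \<tau>_lim_model[OF M(2) dvd_triv_left M(4), of 1 1])
  fix W assume W: "Re W > R"
  show "of_nat 1 * W ~= 0" using parabolic_W_nonzero[OF M(3) W] by simp
  show "(%k. of_nat 1 * (T ^^ k) W / of_nat k ^ 1) \<longlonglongrightarrow> 1" using lW[OF W] by simp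
 qed (use that in auto)
 obtain l where l: "ns = l * q" using K(4) by (metis mod_0_imp_dvd dvd_def mult.commute)
 define W where "W = (%k. (T ^^ k) Ws)"
 have W0: "W k ~= 0" for k unfolding W_def by (rule parabolic_W_nonzero[OF M(3) model_iter(2)[OF M(2) K(3)]])
 have eps: "\<epsilon> ((k + l) * q) = \<beta> / W k" for k
 proof -
  have i: "(k + l) * q = ns + k * (q * 1)" by (simp add: l algebra_simps)
  have a0: "aa ((k + l) * q) = aa 0" using aa_mult[of 0 "k + l"] by simp
  show ?thesis unfolding \<epsilon>_def a0 unfolding i K(5) using W0[of k] by (simp add: W_def exp_minus field_simps)
 qed
 have \<rho>k: "\<rho> ((k + l) * q) = \<tau> ((k + l) * q) * W k / \<beta>" for k
  using W0[of k] b by (simp add: \<tau>_def eps)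
 have q0: "real q > 0" using q by simp
 have sm: "strict_mono (%k. (k + l) * q)" using q by (intro strict_monoI) simp
 have l1: "(%k. \<tau> ((k + l) * q) / of_nat ((k + l) * q) ^ 1) \<longlonglongrightarrow> K"
  using LIMSEQ_subseq_LIMSEQ[OF K(2) sm] by (simp add: o_def)
 have "(%k. real k / ((real k + real l) * real q)) \<longlonglongrightarrow> inverse (real q)" using q0 by real_asymp
 from tendsto_of_real[OF this, where 'a = complex]
 have l2: "(%k. of_nat k / of_nat ((k + l) * q)) \<longlonglongrightarrow> (1 / of_nat q :: complex)" by (simp add: inverse_eq_divide)
 have "(%k. \<tau> ((k + l) * q) / of_nat ((k + l) * q) ^ 1 * (W k / of_nat k) / \<beta> * (of_nat k / of_nat ((k + l) * q))) \<longlonglongrightarrow> K * 1 / \<beta> * (1 / of_nat q)"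
  unfolding W_def by (intro tendsto_intros l1 lW K b l2)
 moreover have "\<forall>\<^sub>F k in sequentially. \<tau> ((k + l) * q) / of_nat ((k + l) * q) ^ 1 * (W k / of_nat k) / \<beta> * (of_nat k / of_nat ((k + l) * q))
   = \<rho> ((k + l) * q) / of_nat ((k + l) * q) ^ 2"
  using eventually_gt_at_top[of 0] by eventually_elim (simp add: \<rho>k power2_eq_square)
 ultimately have "(%k. \<rho> ((k + l) * q) / of_nat ((k + l) * q) ^ 2) \<longlonglongrightarrow> K * 1 / \<beta> * (1 / of_nat q)"
  by (rule Lim_transform_eventually)
 hence "(%k. \<rho> (k * q) / of_nat (k * q) ^ 2) \<longlonglongrightarrow> K * 1 / \<beta> * (1 / of_nat q)"
  by (rule LIMSEQ_offset)
 moreover have "K * 1 / \<beta> * (1 / of_nat q) ~= 0" using K(1) b q by simp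
 ultimately show thesis by (rule that[rotated])
qed

text \<open>The logarithmic derivative of f' on the cycle; weighted with the variation of the cycle
  it sums to the logarithmic derivative of the multiplier.\<close>

definition bb :: "nat => complex" where "bb n = deriv (deriv f) (aa n) / deriv f (aa n)"

text \<open>Failure of transversality to first order. \<alpha> plays the role of the derivative of
  the cycle in the parameter. For \<kappa> \<noteq> 1 the sum is the logarithmic derivative of the
  multiplier; for \<kappa> = 1 the existence of a periodic solution is itself the degenerate
  case.\<close>

definition tangent :: "(nat => complex) => bool" where
 "tangent \<alpha> \<longleftrightarrow> (\<forall>n. \<alpha> (n + q) = \<alpha> n) \<and> (\<forall>n. \<alpha> (Suc n) = deriv f (aa n) * \<alpha> n + 1) \<and>
   (\<kappa> = 1 \<or> (\<Sum>j<q. bb j * \<alpha> j) = 0)"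

text \<open>A difference over one period, twisted so that the geometric factor 1/\<kappa> per period
  drops out of \<rho>. For y = 1 it is the kernel of the twisted convolution equation; terms of
  negative index count as 0.\<close>

definition \<delta> :: "(nat => complex) => nat => complex" where
 "\<delta> y n = \<rho> n * y n - (if n < q then 0 else \<rho> (n - q) * y (n - q) / \<kappa>)"

text \<open>Summation by parts with the periodic \<alpha> reduces the sum of \<rho> to a boundary
  term and the sum \<open>B\<close>, whose terms contain the difference of f' at orbit and cycle and
  are therefore of order \<tau>. The mean of these terms is a multiple of the sum of
  \<open>bb\<close> times \<alpha>, which vanishes by tangency for \<kappa> \<noteq> 1; for \<kappa>
  = 1 the factor 1 - 1/\<kappa> in front of \<open>B\<close> vanishes instead.\<close>

lemma tangent_sums:
 assumes "tangent \<alpha>"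
 shows "(%M. (\<Sum>n<M. \<delta> (%_. 1) n) / of_nat M ^ (\<iota> + 1)) \<longlonglongrightarrow> 0"
proof -
 have per: "\<alpha> (n + q) = \<alpha> n" and rec: "\<alpha> (Suc n) = deriv f (aa n) * \<alpha> n + 1" for n
  using assms by (auto simp: tangent_def)
 have per': "\<alpha> (k * q + r) = \<alpha> r" for k r using periodic_add_mult[of \<alpha> q r k, OF per] by (simp add: add.commute)
 have aper: "aa (n + q) = aa n" for n by (rule cyc_per[OF cy])
 obtain K where K: "K ~= 0" "(%n. \<tau> n / of_nat n ^ \<iota>) \<longlonglongrightarrow> K" by (rule \<tau>_lim)
 define v where "v = (%n. \<rho> (Suc n) * (deriv f (it c n c) - deriv f (aa n)) * \<alpha> n)"
 define B where "B = (%M. \<Sum>n<M. v n)"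
 define S where "S = (%M. \<Sum>n<M. \<rho> n)"
 have v': "v n = \<tau> n * ((deriv f (it c n c) - deriv f (aa n)) / \<epsilon> n) / deriv f (it c n c) * \<alpha> n" for n
  using \<epsilon>_nz[of n] df_C[of n] by (simp add: v_def \<tau>_def \<rho>_Suc[of n])
 have S: "S M = \<rho> M * (\<alpha> M - 1) + B M - (\<alpha> 0 - 1)" for M
 proof (induction M)
  case (Suc M)
  thus ?case unfolding S_def B_def v_def by (simp add: rec \<rho>_Suc[of M] algebra_simps)
 qed (simp add: S_def B_def \<rho>_def)
 have vres: "(%k. v (k * q + r) / of_nat (k * q + r) ^ \<iota>) \<longlonglongrightarrow> K * bb r * \<alpha> r"
  if r: "(%k. it c (k * q + r) c) \<longlonglongrightarrow> aa r" "!!k. aa (k * q + r) = aa r" "strict_mono (%k. k * q + r)" for r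
 proof -
  have l: "(%k. (deriv f (it c (k * q + r) c) - deriv f (aa r)) / (it c (k * q + r) c - aa r)) \<longlonglongrightarrow> deriv (deriv f) (aa r)"
   by (intro strict_derivative_tendsto[OF hol_f' open_D aa_in] r tendsto_const) (simp add: C_neq)
  have l2: "(%k. deriv f (it c (k * q + r) c)) \<longlonglongrightarrow> deriv f (aa r)"
   using f'_isCont[OF aa_in] r(1) by (rule isCont_tendsto_compose)
  have l3: "(%k. \<tau> (k * q + r) / of_nat (k * q + r) ^ \<iota>) \<longlonglongrightarrow> K"
   using LIMSEQ_subseq_LIMSEQ[OF K(2) r(3)] by (simp add: o_def)
  have "(%k. \<tau> (k * q + r) / of_nat (k * q + r) ^ \<iota> * ((deriv f (it c (k * q + r) c) - deriv f (aa r)) / (it c (k * q + r) c - aa r))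
    / deriv f (it c (k * q + r) c) * \<alpha> r) \<longlonglongrightarrow> K * deriv (deriv f) (aa r) / deriv f (aa r) * \<alpha> r"
   by (intro tendsto_intros l l2 l3 df_aa)
  thus ?thesis by (simp add: v' \<epsilon>_def r per' bb_def mult.commute mult.left_commute)
 qed
 have vlim: "(%n. v n / of_nat n ^ \<iota> - K * bb n * \<alpha> n) \<longlonglongrightarrow> 0"
 proof (rule residue_lim)
  fix r assume r: "(%k. it c (k * q + r) c) \<longlonglongrightarrow> aa r" "!!k. aa (k * q + r) = aa r" "strict_mono (%k. k * q + r)"
  have "bb (k * q + r) = bb r" for k by (simp add: bb_def r)
  thus "(%k. v (k * q + r) / of_nat (k * q + r) ^ \<iota> - K * bb (k * q + r) * \<alpha> (k * q + r)) \<longlonglongrightarrow> 0"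
   using tendsto_diff[OF vres[OF r] tendsto_const[of "K * bb r * \<alpha> r"]] by (simp add: per')
 qed
 have inv0: "(%n. 1 / of_nat n :: complex) \<longlonglongrightarrow> 0" by (rule lim_1_over_n)
 have v0: "(%n. v n / of_nat n ^ (\<iota> + 1)) \<longlonglongrightarrow> 0"
 proof (rule residue_lim)
  fix r assume r: "(%k. it c (k * q + r) c) \<longlonglongrightarrow> aa r" "!!k. aa (k * q + r) = aa r" "strict_mono (%k. k * q + r)"
  have "(%k. v (k * q + r) / of_nat (k * q + r) ^ \<iota> * (1 / of_nat (k * q + r))) \<longlonglongrightarrow> K * bb r * \<alpha> r * 0"
   using LIMSEQ_subseq_LIMSEQ[OF inv0 r(3)] by (intro tendsto_intros vres[OF r]) (simp add: o_def)
  thus "(%k. v (k * q + r) / of_nat (k * q + r) ^ (\<iota> + 1)) \<longlonglongrightarrow> 0" by (simp add: mult.commute)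
 qed
 have \<iota>2: "\<iota> \<le> 2" by (simp add: \<iota>_def)
 have Bper: "K * bb (n + q) * \<alpha> (n + q) = K * bb n * \<alpha> n" for n by (simp add: bb_def aper per)
 have B0: "(%M. (1 - 1 / \<kappa>) * (B M / of_nat M ^ (\<iota> + 1))) \<longlonglongrightarrow> 0"
 proof -
  have "(%M. B M / of_nat M ^ (\<iota> + 1)) \<longlonglongrightarrow> (\<Sum>j<q. K * bb j * \<alpha> j) / (of_nat q * of_nat (\<iota> + 1))"
   unfolding B_def by (rule cesaro_periodic[OF q \<iota>2 Bper vlim])
  from tendsto_mult_left[OF this, of "1 - 1 / \<kappa>"]
  have "(%M. (1 - 1 / \<kappa>) * (B M / of_nat M ^ (\<iota> + 1))) \<longlonglongrightarrow>
   (1 - 1 / \<kappa>) * ((\<Sum>j<q. K * bb j * \<alpha> j) / (of_nat q * of_nat (\<iota> + 1)))" .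
  moreover have "(\<Sum>j<q. K * bb j * \<alpha> j) = K * (\<Sum>j<q. bb j * \<alpha> j)" by (simp add: sum_distrib_left mult.assoc)
  ultimately show ?thesis using assms unfolding tangent_def by auto
 qed
 \<comment> \<open>The difference in brackets is \<rho> (M + q) times (\<kappa> - Dit) / \<kappa>,
   and \<kappa> - Dit is of the order of \<epsilon>; so this boundary term is only of order
   \<tau>.\<close>
 define E where "E = (%M. (\<rho> (M + q) - \<rho> M / \<kappa>) * (\<alpha> M - 1))"
 have E0: "(%M. E M / of_nat M ^ (\<iota> + 1)) \<longlonglongrightarrow> 0"
 proof (rule residue_lim)
  fix r assume r: "(%k. it c (k * q + r) c) \<longlonglongrightarrow> aa r" "!!k. aa (k * q + r) = aa r" "strict_mono (%k. k * q + r)"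
  have oo: "open {z. orb c q z}" "aa r \<in> {z. orb c q z}" using orb_open1 cyc_orb[OF cy] by auto
  have hD: "Dit c q holomorphic_on {z. orb c q z}"
   by (rule Dit_holomorphic[of "%_. c" "{z. orb c q z}" "%z. z" q]) (auto intro: holomorphic_intros)
  have Dr: "Dit c q (aa r) = \<kappa>" by (rule cyc_Dit_shift[OF cy])
  have l: "(%k. (Dit c q (it c (k * q + r) c) - Dit c q (aa r)) / (it c (k * q + r) c - aa r)) \<longlonglongrightarrow> deriv (Dit c q) (aa r)"
   by (intro strict_derivative_tendsto[OF hD oo] r tendsto_const) (simp add: C_neq)
  have l2: "(%k. Dit c q (it c (k * q + r) c)) \<longlonglongrightarrow> \<kappa>"
   unfolding Dr[symmetric] using oo by (intro Dit_tendsto r tendsto_const) auto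
  have l3: "(%k. \<tau> (k * q + r) / of_nat (k * q + r) ^ \<iota>) \<longlonglongrightarrow> K"
   using LIMSEQ_subseq_LIMSEQ[OF K(2) r(3)] by (simp add: o_def)
  have "(%k. - (\<tau> (k * q + r) / of_nat (k * q + r) ^ \<iota>) *
    ((Dit c q (it c (k * q + r) c) - Dit c q (aa r)) / (it c (k * q + r) c - aa r)) / (\<kappa> * Dit c q (it c (k * q + r) c))
    * (\<alpha> r - 1) * (1 / of_nat (k * q + r))) \<longlonglongrightarrow> - K * deriv (Dit c q) (aa r) / (\<kappa> * \<kappa>) * (\<alpha> r - 1) * 0"
   using LIMSEQ_subseq_LIMSEQ[OF inv0 r(3)] \<kappa>0 by (intro tendsto_intros l l2 l3) (auto simp: o_def)
  moreover have "- (\<tau> n / of_nat n ^ \<iota>) * ((Dit c q (it c n c) - Dit c q (aa r)) / (it c n c - aa r)) / (\<kappa> * Dit c q (it c n c))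
    * (\<alpha> r - 1) * (1 / of_nat n) = E n / of_nat n ^ (\<iota> + 1)" if "n = k * q + r" for n k
  proof -
   have n: "aa n = aa r" "\<alpha> n = \<alpha> r" using r that per' by auto
   have dn: "Dit c q (it c n c) ~= 0" using \<rho>_add[of n q] \<rho>_nz[of n] by auto
   have en: "it c n c - aa r = \<epsilon> n" by (simp add: \<epsilon>_def n)
   have t: "\<tau> n = \<rho> (n + q) * Dit c q (it c n c) * \<epsilon> n" unfolding \<tau>_def \<rho>_add[of n q] by simp
   have "- \<tau> n * ((Dit c q (it c n c) - Dit c q (aa r)) / (it c n c - aa r)) / (\<kappa> * Dit c q (it c n c)) * (\<alpha> r - 1) = E n"
    unfolding E_def \<rho>_add[of n q] en t Dr n using dn \<epsilon>_nz[of n] \<kappa>0 by (simp add: field_simps)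
   moreover have "- (t / p) * A / B * C * (1 / m) = (- t * A / B * C) / (p * m)" for t p A B C m :: complex by simp
   ultimately show ?thesis by (simp only: power_add power_one_right)
  qed
  ultimately show "(%k. E (k * q + r) / of_nat (k * q + r) ^ (\<iota> + 1)) \<longlonglongrightarrow> 0" by simp
 qed
 have sumd: "(\<Sum>n<M + q. \<delta> (%_. 1) n) = S (M + q) - S M / \<kappa>" for M
 proof (induction M)
  case 0
  show ?case by (simp add: \<delta>_def S_def)
 next
  case (Suc M)
  thus ?case by (simp add: \<delta>_def S_def add_divide_distrib)
 qed
 have Bq: "B (M + q) - B M = (\<Sum>j<q. v (M + j))" for M
  unfolding B_def by (induction q) auto
 have dec: "(\<Sum>n<M + q. \<delta> (%_. 1) n) = E M + (\<Sum>j<q. v (M + j)) + (1 - 1 / \<kappa>) * B M - (\<alpha> 0 - 1) * (1 - 1 / \<kappa>)" for M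
  unfolding sumd S E_def Bq[symmetric] per by (simp add: algebra_simps diff_divide_distrib add_divide_distrib)
 have "(%M. (E (M + 0) / of_nat (M + q) ^ (\<iota> + 1)) + (\<Sum>j<q. v (M + j) / of_nat (M + q) ^ (\<iota> + 1))
   + ((1 - 1 / \<kappa>) * B (M + 0)) / of_nat (M + q) ^ (\<iota> + 1) - (\<alpha> 0 - 1) * (1 - 1 / \<kappa>) / of_nat (M + q) ^ (\<iota> + 1)) \<longlonglongrightarrow> 0 + (\<Sum>j<q. 0) + 0 - 0"
 proof (intro tendsto_intros tendsto_sum)
  show "(%M. E (M + 0) / of_nat (M + q) ^ (\<iota> + 1)) \<longlonglongrightarrow> 0" by (rule null_divide_shift[OF E0]) simp
  show "(%M. v (M + j) / of_nat (M + q) ^ (\<iota> + 1)) \<longlonglongrightarrow> 0" if "j \<in> {..<q}" for j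
   by (rule null_divide_shift[OF v0]) (use that in simp)
  show "(%M. ((1 - 1 / \<kappa>) * B (M + 0)) / of_nat (M + q) ^ (\<iota> + 1)) \<longlonglongrightarrow> 0"
   by (rule null_divide_shift[of "%M. (1 - 1 / \<kappa>) * B M"]) (use B0 in simp_all)
  have "(%n. ((\<alpha> 0 - 1) * (1 - 1 / \<kappa>)) / of_nat n ^ (\<iota> + 1)) \<longlonglongrightarrow> 0"
   using tendsto_mult_left[OF tendsto_power[OF inv0, of "\<iota> + 1"], of "(\<alpha> 0 - 1) * (1 - 1 / \<kappa>)"] by (simp add: power_divide)
  from null_divide_shift[OF this, of 0 q]
  show "(%M. (\<alpha> 0 - 1) * (1 - 1 / \<kappa>) / of_nat (M + q) ^ (\<iota> + 1)) \<longlonglongrightarrow> 0" by simp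
 qed
 hence "(%M. (\<Sum>n<M + q. \<delta> (%_. 1) n) / of_nat (M + q) ^ (\<iota> + 1)) \<longlonglongrightarrow> 0"
  unfolding dec by (simp add: add_divide_distrib diff_divide_distrib sum_divide_distrib)
 thus ?thesis by (rule LIMSEQ_offset)
qed

text \<open>The twisted difference commutes with convolution, so \<delta> y is the convolution of
  \<delta> 1 with bounded coefficients. Tangency makes its partial sums o(M^(\<iota>+2)), whereas
  terms asymptotic to \<sigma> n^(\<iota>+1) have partial sums asymptotic to \<sigma> M^(\<iota>+2)
  / (\<iota>+2).\<close>

lemma motion_contradiction:
 assumes tg: "tangent \<alpha>" and M: "motion c r h"
  and cc: "!!n. (cc n \<longlongrightarrow> it c n c) (at 0)"
  and cf: "!!n. \<forall>\<^sub>F u in at 0. f (cc n u) = cc (Suc n) u - cc 0 u"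
  and c0: "!!u. cc 0 u = c + b * u"
  and y: "!!n. ((%u. (h n u - cc n u) / u ^ dg) \<longlongrightarrow> y n) (at 0)"
  and \<sigma>: "(%n. \<delta> y n / of_nat n ^ (\<iota> + 1)) \<longlonglongrightarrow> \<sigma>"
 shows "\<sigma> = 0"
proof -
 obtain x K where x: "!!i. norm (x i) \<le> K" "!!n. y n / Dit c n c = (\<Sum>i\<le>n. x i / Dit c (n - i) c)"
  by (rule motion_convolution[OF M cc cf c0 y]) (rule that)
 have x2: "\<rho> n * y n = (\<Sum>i\<le>n. \<rho> (n - i) * x i)" for n using x(2)[of n] by (simp add: \<rho>_def)
 have dy: "\<delta> y n = (\<Sum>i\<le>n. \<delta> (%_. 1) (n - i) * x i)" for n
 proof -
  have "(\<Sum>i\<le>n. (if n - i < q then 0 else \<rho> (n - i - q) / \<kappa>) * x i) = (if n < q then 0 else \<rho> (n - q) * y (n - q) / \<kappa>)"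
  proof (cases "n < q")
   case True
   thus ?thesis by (simp add: less_imp_diff_less)
  next
   case False
   have "(\<Sum>i\<le>n. (if n - i < q then 0 else \<rho> (n - i - q) / \<kappa>) * x i) = (\<Sum>i\<le>n - q. \<rho> (n - q - i) * x i / \<kappa>)"
   proof (rule sum.mono_neutral_cong_right)
    show "\<forall>i\<in>{..n} - {..n - q}. (if n - i < q then 0 else \<rho> (n - i - q) / \<kappa>) * x i = 0" by auto
    fix i assume "i \<in> {..n - q}"
    hence "\<not> n - i < q" "n - i - q = n - q - i" using False q by auto
    thus "(if n - i < q then 0 else \<rho> (n - i - q) / \<kappa>) * x i = \<rho> (n - q - i) * x i / \<kappa>" by simp
   qed auto
   thus ?thesis using False x2[of "n - q"] by (simp add: sum_divide_distrib)
  qed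
  moreover have "(\<Sum>i\<le>n. \<delta> (%_. 1) (n - i) * x i) = (\<Sum>i\<le>n. \<rho> (n - i) * x i)
    - (\<Sum>i\<le>n. (if n - i < q then 0 else \<rho> (n - i - q) / \<kappa>) * x i)"
   by (simp add: \<delta>_def left_diff_distrib sum_subtractf)
  ultimately show ?thesis unfolding \<delta>_def[of y] x2[of n] by simp
 qed
 have "(%M. (\<Sum>n<M. \<Sum>i\<le>n. \<delta> (%_. 1) (n - i) * x i) / of_nat M ^ (\<iota> + 1 + 1)) \<longlonglongrightarrow> 0"
  by (rule convolution_small[OF x(1) tangent_sums[OF tg]])
 hence "(%M. (\<Sum>n<M. \<delta> y n) / of_nat M ^ (\<iota> + 1 + 1)) \<longlonglongrightarrow> 0" unfolding dy .
 moreover have "(%M. (\<Sum>n<M. \<delta> y n) / of_nat M ^ (\<iota> + 1 + 1)) \<longlonglongrightarrow> (\<Sum>j<(1::nat). \<sigma>) / (of_nat 1 * of_nat (\<iota> + 1 + 1))"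
 proof (rule cesaro_periodic)
  show "(%n. \<delta> y n / of_nat n ^ (\<iota> + 1) - \<sigma>) \<longlonglongrightarrow> 0"
   using tendsto_diff[OF \<sigma> tendsto_const[of \<sigma>]] by simp
 qed (auto simp: \<iota>_def)
 ultimately have "0 = (\<Sum>j<(1::nat). \<sigma>) / (of_nat 1 * of_nat (\<iota> + 1 + 1))" using LIMSEQ_unique by blast
 moreover have "(of_nat (\<iota> + 1 + 1) :: complex) ~= 0" by (simp add: \<iota>_def)
 ultimately show ?thesis by (simp del: of_nat_add of_nat_Suc)
qed

end

section \<open>Attracting cycles are never tangent\<close>

context aligned_cycle
begin

lemma cycle_separated:
 obtains s where "s > 0" "!!i j. aa i ~= aa j ==> dist (aa i) (aa j) \<ge> s"
proof -
 define A where "A = insert 1 ((%(x, y). dist x y) ` (range aa \<times> range aa) \<inter> {0<..})"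
 have fin: "finite A" using cyc_range(2)[OF cy] by (simp add: A_def)
 show thesis
 proof (rule that[of "Min A"])
  show "Min A > 0" using fin by (subst Min_gr_iff) (auto simp: A_def)
  show "dist (aa i) (aa j) \<ge> Min A" if "aa i ~= aa j" for i j
  proof (rule Min_le[OF fin])
   have "(aa i, aa j) \<in> range aa \<times> range aa" by simp
   from imageI[OF this, of "%(x, y). dist x y"] show "dist (aa i) (aa j) \<in> A" using that by (simp add: A_def)
  qed
 qed
qed

lemma \<epsilon>_ratio: "(%n. \<epsilon> (n + q) / \<epsilon> n) \<longlonglongrightarrow> \<kappa>"
proof (rule residue_lim)
 fix r assume r: "(%k. it c (k * q + r) c) \<longlonglongrightarrow> aa r" "!!k. aa (k * q + r) = aa r" "strict_mono (%k. k * q + r)"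
 have oo: "open {z. orb c q z}" "aa r \<in> {z. orb c q z}" using orb_open1 cyc_orb[OF cy] by auto
 have "(%k. (it c q (it c (k * q + r) c) - it c q (aa r)) / (it c (k * q + r) c - aa r)) \<longlonglongrightarrow> deriv (it c q) (aa r)"
  by (intro strict_derivative_tendsto[OF it_holomorphic1 oo] r tendsto_const order_refl) (simp add: C_neq)
 moreover have "deriv (it c q) (aa r) = \<kappa>" using deriv_it[OF cyc_orb[OF cy]] cyc_Dit_shift[OF cy] by simp
 moreover have "it c q (aa r) = aa r" using cyc_it[OF cy] cyc_per[OF cy] by simp
 moreover have "it c q (it c n c) = it c (n + q) c" for n using it_add[of q n c c] by (simp add: add.commute)
 moreover have "\<epsilon> (k * q + r + q) = it c (k * q + r + q) c - aa r" for k by (simp add: \<epsilon>_def cyc_per[OF cy] r)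
 ultimately show "(%k. \<epsilon> (k * q + r + q) / \<epsilon> (k * q + r)) \<longlonglongrightarrow> \<kappa>" by (simp add: \<epsilon>_def r)
qed

text \<open>The motion multiplies the n-th displacement from the cycle by exp (n u), a shear in the
  logarithmic coordinate that has no counterpart in the parameter: the reference family is the
  constant orbit, with b = 0. Its first order term is n \<epsilon> n, so \<rho> y = n \<tau> and
  \<delta> y / n tends to K (1 - 1/\<kappa>), which is not 0.\<close>

lemma attracting_not_tangent:
 assumes \<kappa>1: "norm \<kappa> < 1" and tg: "tangent \<alpha>"
 shows False
proof -
 have \<iota>: "\<iota> = 0" using \<kappa>1 by (simp add: \<iota>_def)
 obtain K where K: "K ~= 0" "(%n. \<tau> n) \<longlonglongrightarrow> K" using \<tau>_lim unfolding \<iota> by auto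
 define \<mu> where "\<mu> = (1 + norm \<kappa>) / 2"
 have \<mu>: "norm \<kappa> < \<mu>" "0 < \<mu>" "\<mu> < 1" using \<kappa>1 by (auto simp: \<mu>_def add_pos_nonneg)
 \<comment> \<open>Chosen so that exp (q r) = \<mu>^(-1/2): even after multiplication by exp (n r)
   the displacements contract by sqrt \<mu> per period.\<close>
 define r where "r = - ln \<mu> / (2 * real q)"
 have r: "r > 0" using \<mu> q by (simp add: r_def divide_neg_pos)
 define \<mu>' where "\<mu>' = \<mu> * exp (real q * r)"
 have \<mu>': "0 < \<mu>'" "\<mu>' < 1"
 proof -
  show "0 < \<mu>'" using \<mu> by (simp add: \<mu>'_def)
  have "real q * r = - ln \<mu> / 2" using q by (simp add: r_def)
  hence "\<mu>' = exp (ln \<mu>) * exp (- ln \<mu> / 2)" using \<mu> by (simp add: \<mu>'_def)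
  also have "\<dots> = exp (ln \<mu> / 2)" by (simp only: exp_add[symmetric]) simp
  finally have "\<mu>' = exp (ln \<mu> / 2)" .
  moreover have "ln \<mu> / 2 < 0" using \<mu> by simp
  ultimately show "\<mu>' < 1" by simp
 qed
 define Y where "Y = (%n. norm (\<epsilon> n) * exp (real n * r))"
 have "\<forall>\<^sub>F n in sequentially. norm (\<epsilon> (n + q) / \<epsilon> n) < \<mu>"
  using tendsto_norm[OF \<epsilon>_ratio] \<mu>(1) by (rule order_tendstoD)
 then obtain n1 where "!!n. n \<ge> n1 ==> norm (\<epsilon> (n + q) / \<epsilon> n) < \<mu>"
  unfolding eventually_at_top_linorder by blast
 hence n1: "norm (\<epsilon> (n + q)) \<le> \<mu> * norm (\<epsilon> n)" if "n \<ge> n1" for n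
  using that \<epsilon>_nz[of n] by (simp add: norm_divide divide_less_eq less_imp_le)
 have Yq: "Y (n + q) \<le> \<mu>' * Y n" if "n \<ge> n1" for n
 proof -
  have "Y (n + q) \<le> \<mu> * norm (\<epsilon> n) * exp (real (n + q) * r)"
   unfolding Y_def using n1[OF that] by (intro mult_right_mono) auto
  also have "exp (real (n + q) * r) = exp (real n * r) * exp (real q * r)"
   by (simp add: algebra_simps flip: exp_add)
  finally show ?thesis by (simp add: Y_def \<mu>'_def algebra_simps)
 qed
 have Yk: "Y (n + k * q) \<le> \<mu>' ^ k * Y n" if "n \<ge> n1" for n k
 proof (induction k)
  case (Suc k)
  have "Y (n + Suc k * q) = Y ((n + k * q) + q)" by (simp add: algebra_simps)
  also have "\<dots> \<le> \<mu>' * Y (n + k * q)" by (rule Yq) (use that in simp)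
  also have "\<dots> \<le> \<mu>' * (\<mu>' ^ k * Y n)" using Suc \<mu>' by (intro mult_left_mono) auto
  finally show ?case by (simp add: mult.assoc)
 qed simp
 have Y0: "Y \<longlonglongrightarrow> 0"
 proof (rule tendsto_residues[OF q, of _ n1])
  fix j assume "j < q"
  have "(%k. \<mu>' ^ k * Y (n1 + j)) \<longlonglongrightarrow> 0 * Y (n1 + j)"
   using \<mu>' by (intro tendsto_intros LIMSEQ_realpow_zero) auto
  hence lim0: "(%k. \<mu>' ^ k * Y (n1 + j)) \<longlonglongrightarrow> 0" by simp
  have bd: "norm (Y (n1 + k * q + j)) \<le> \<mu>' ^ k * Y (n1 + j)" for k
  proof -
   have "norm (Y n) = Y n" for n by (simp add: Y_def)
   moreover have "n1 + k * q + j = n1 + j + k * q" by simp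
   ultimately show ?thesis using Yk[of "n1 + j" k] by (simp only:)
  qed
  show "(%k. Y (n1 + k * q + j)) \<longlonglongrightarrow> 0"
   by (rule Lim_null_comparison[OF always_eventually[OF allI[OF bd]] lim0])
 qed
 obtain s where s: "s > 0" "!!i j. aa i ~= aa j ==> dist (aa i) (aa j) \<ge> s" by (rule cycle_separated) (rule that)
 obtain n2 where n2: "!!n. n \<ge> n2 ==> Y n < s / 2"
  using order_tendstoD(2)[OF Y0, of "s / 2"] s(1) unfolding eventually_at_top_linorder by auto
 define n0 where "n0 = max n1 n2"
 define h where "h = (%n u. if n < n0 then it c n c else aa n + \<epsilon> n * exp (of_nat n * u))"
 have nh: "norm (\<epsilon> n * exp (of_nat n * u)) \<le> Y n" if "norm u < r" for n u
 proof -
  have "Re u \<le> r" using that complex_Re_le_cmod[of u] by linarith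
  hence "real n * Re u \<le> real n * r" by (intro mult_left_mono) auto
  thus ?thesis by (simp add: Y_def norm_mult mult_left_mono)
 qed
 \<comment> \<open>Points of different phase are kept apart by the separation of the cycle, points
   of equal phase by the strict decrease of the moved displacement over a period.\<close>
 have tail: "h n u ~= h m u" if u: "u \<in> ball 0 r" and nm: "n0 \<le> n" "n < m" for u n m
 proof
  assume eq: "h n u = h m u"
  have ur: "norm u < r" using u by simp
  have hn: "h n u = aa n + \<epsilon> n * exp (of_nat n * u)" "h m u = aa m + \<epsilon> m * exp (of_nat m * u)"
   using nm by (auto simp: h_def)
  show False
  proof (cases "aa n = aa m")
   case False
   have "aa n - aa m = \<epsilon> m * exp (of_nat m * u) - \<epsilon> n * exp (of_nat n * u)" using eq hn by (simp add: algebra_simps)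
   hence "dist (aa n) (aa m) \<le> norm (\<epsilon> m * exp (of_nat m * u)) + norm (\<epsilon> n * exp (of_nat n * u))"
    by (metis dist_norm norm_triangle_ineq4)
   moreover have "Y n < s / 2" "Y m < s / 2" using n2 nm by (auto simp: n0_def)
   ultimately show False using s(2)[OF False] nh[OF ur, of n] nh[OF ur, of m] by linarith
  next
   case True
   hence "n mod q = m mod q" using cyc_eq_iff[OF cy] by simp
   then obtain k where k: "m = n + k * q" using nm by (metis mod_eq_dvd_iff_nat dvd_def le_add_diff_inverse less_imp_le mult.commute)
   hence k1: "k \<ge> 1" using nm by (cases k) auto
   define v where "v = complex_of_real r"
   have \<epsilon>k: "norm (\<epsilon> (n + k * q)) \<le> \<mu> ^ k * norm (\<epsilon> n)" for k
   proof (induction k)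
    case (Suc k)
    have "norm (\<epsilon> (n + Suc k * q)) = norm (\<epsilon> ((n + k * q) + q))" by (simp add: algebra_simps)
    also have "\<dots> \<le> \<mu> * norm (\<epsilon> (n + k * q))" by (rule n1) (use nm in \<open>simp add: n0_def\<close>)
    also have "\<dots> \<le> \<mu> * (\<mu> ^ k * norm (\<epsilon> n))" using Suc \<mu> by (intro mult_left_mono) auto
    finally show ?case by (simp add: mult.assoc)
   qed simp
   have "norm (\<epsilon> m * exp (of_nat m * u)) = norm (\<epsilon> m) * norm (exp (of_nat n * u)) * norm (exp (of_nat (k * q) * u))"
    by (simp add: k norm_mult algebra_simps flip: exp_add)
   also have "\<dots> \<le> (\<mu> ^ k * norm (\<epsilon> n)) * norm (exp (of_nat n * u)) * exp (real q * r) ^ k"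
   proof (intro mult_mono)
    have "real (k * q) * Re u \<le> real (k * q) * r"
     using ur complex_Re_le_cmod[of u] by (intro mult_left_mono) auto
    also have "\<dots> = of_nat k * (real q * r)" by simp
    finally have "exp (real (k * q) * Re u) \<le> exp (of_nat k * (real q * r))" by simp
    thus "norm (exp (of_nat (k * q) * u)) \<le> exp (real q * r) ^ k"
     by (simp add: exp_of_nat_mult)
   qed (use \<epsilon>k[of k] \<mu> in \<open>auto simp: k\<close>)
   also have "\<dots> = \<mu>' ^ k * norm (\<epsilon> n * exp (of_nat n * u))"
    by (simp add: \<mu>'_def power_mult_distrib norm_mult)
   also have "\<dots> < 1 * norm (\<epsilon> n * exp (of_nat n * u))"
    using \<mu>' k1 \<epsilon>_nz by (intro mult_strict_right_mono) (auto simp: power_Suc_less_one power_less_one_iff)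
   finally show False using eq hn True by simp
  qed
 qed
 obtain r' where mot: "motion c r' h"
 proof (rule motion_from_tail[OF orb_C inj_C cyc_range(2)[OF cy] _ C_notin r, of h n0])
  show "range aa \<subseteq> D" using aa_in by auto
  show "h n holomorphic_on ball 0 r" for n unfolding h_def by (cases "n < n0") (auto intro!: holomorphic_intros)
  show "h n 0 = it c n c" for n by (simp add: h_def \<epsilon>_def)
  show "inj_on (%n. h n u) {n0..}" if "u \<in> ball 0 r" for u
   using tail[OF that] by (intro inj_onI) (metis atLeast_iff linorder_neqE_nat)
  show "\<exists>n1 r1. r1 > 0 \<and> (\<forall>n\<ge>n1. \<forall>u. norm u < r1 \<longrightarrow> (\<exists>a\<in>range aa. dist (h n u) a < e))" if e: "e > 0" for e
  proof -
   obtain n3 where n3: "!!n. n \<ge> n3 ==> Y n < e"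
    using order_tendstoD(2)[OF Y0 e] unfolding eventually_at_top_linorder by auto
   have "dist (h n u) (aa n) < e" if "n \<ge> max n3 n0" "norm u < r" for n u
    using nh[OF that(2), of n] n3[of n] that by (auto simp: h_def dist_norm)
   thus ?thesis using r by blast
  qed
 qed (rule that)
 define y where "y = (%n. if n < n0 then 0 else of_nat n * \<epsilon> n)"
 have "K * (1 - 1 / \<kappa>) = 0"
 proof (rule motion_contradiction[OF tg mot, where cc = "%n _. it c n c" and b = 0 and dg = 1 and y = y])
  show "((%u. (h n u - it c n c) / u ^ 1) \<longlongrightarrow> y n) (at 0)" for n
  proof (cases "n < n0")
   case False
   have "((%u. \<epsilon> n * exp (of_nat n * u)) has_field_derivative \<epsilon> n * (exp (of_nat n * 0) * of_nat n)) (at 0)"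
    by (auto intro!: derivative_eq_intros)
   thus ?thesis using False unfolding has_field_derivative_iff
    by (simp add: h_def y_def \<epsilon>_def algebra_simps)
  qed (simp add: h_def y_def)
  have e1: "(%n. \<tau> (n + q) - of_nat n / of_nat (n + q) * \<tau> n / \<kappa>) \<longlonglongrightarrow> K - 1 * K / \<kappa>"
  proof (intro tendsto_intros K \<kappa>0)
   show "(%n. \<tau> (n + q)) \<longlonglongrightarrow> K" by (rule LIMSEQ_ignore_initial_segment[OF K(2)])
   have "(%n. real n / (real n + real q)) \<longlonglongrightarrow> 1" by real_asymp
   from tendsto_of_real[OF this, where 'a = complex]
   show "(%n. of_nat n / of_nat (n + q) :: complex) \<longlonglongrightarrow> 1" by simp
  qed
  have "\<forall>\<^sub>F n in sequentially. \<tau> (n + q) - of_nat n / of_nat (n + q) * \<tau> n / \<kappa> = \<delta> y (n + q) / of_nat (n + q) ^ (\<iota> + 1)"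
   using eventually_ge_at_top[of n0]
  proof eventually_elim
   case (elim n)
   have nz: "of_nat (n + q) ~= (0 :: complex)" using q by (simp del: of_nat_add)
   have "\<delta> y (n + q) = of_nat (n + q) * \<tau> (n + q) - of_nat n * \<tau> n / \<kappa>"
    using elim by (simp add: \<delta>_def y_def \<tau>_def)
   thus ?case using nz by (simp add: \<iota> diff_divide_distrib del: of_nat_add)
  qed
  with e1 have "(%n. \<delta> y (n + q) / of_nat (n + q) ^ (\<iota> + 1)) \<longlonglongrightarrow> K - 1 * K / \<kappa>"
   by (rule Lim_transform_eventually)
  hence "(%n. \<delta> y n / of_nat n ^ (\<iota> + 1)) \<longlonglongrightarrow> K - 1 * K / \<kappa>" by (rule LIMSEQ_offset)
  thus "(%n. \<delta> y n / of_nat n ^ (\<iota> + 1)) \<longlonglongrightarrow> K * (1 - 1 / \<kappa>)" by (simp add: algebra_simps)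
 qed (auto simp: it_Suc G_def simp del: funpow.simps(2))
 thus False using K(1) \<kappa>0 \<kappa>1 by (auto simp: field_simps)
qed

end

subsection \<open>Prescribing the multiplier\<close>

lemma eventually_nhds_balls:
 assumes "eventually P (nhds (0 :: complex, 0 :: complex))"
 obtains s r where "s > 0" "r > 0" "!!u z. u \<in> ball 0 s ==> z \<in> ball 0 r ==> P (u, z)"
proof -
 obtain S where S: "open S" "(0, 0) \<in> S" "!!x. x \<in> S ==> P x"
  using assms unfolding eventually_nhds by blast
 obtain A B where AB: "open A" "open B" "(0, 0) \<in> A \<times> B" "A \<times> B \<subseteq> S" by (rule open_prod_elim[OF S(1,2)])
 obtain s where s: "s > 0" "ball 0 s \<subseteq> A" using openE[OF AB(1), of 0] AB(3) by auto
 obtain r where r: "r > 0" "ball 0 r \<subseteq> B" using openE[OF AB(2), of 0] AB(3) by auto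
 have "P (u, z)" if "u \<in> ball 0 s" "z \<in> ball 0 r" for u z using that s(2) r(2) AB(4) S(3) by blast
 with s(1) r(1) show thesis by (rule that)
qed

lemma iterates_nbhd:
 fixes \<phi> :: "complex => complex => complex"
 assumes s: "s > 0" and r: "r > 0"
  and cont: "continuous_on (ball 0 s \<times> ball 0 r) (%(u, z). \<phi> u z)"
  and hol: "!!u. u \<in> ball 0 s ==> \<phi> u holomorphic_on ball 0 r"
  and zero: "!!u. u \<in> ball 0 s ==> \<phi> u 0 = 0"
 shows "\<exists>s' r'. 0 < s' \<and> s' \<le> s \<and> 0 < r' \<and> r' \<le> r \<and>
   continuous_on (ball 0 s' \<times> ball 0 r') (%(u, z). (\<phi> u ^^ p) z) \<and>
   (\<forall>u\<in>ball 0 s'. (\<phi> u ^^ p) holomorphic_on ball 0 r' \<and> (\<forall>j\<le>p. \<forall>z\<in>ball 0 r'. (\<phi> u ^^ j) z \<in> ball 0 r))"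
proof (induction p)
 case 0
 have "continuous_on (ball (0::complex) s \<times> ball (0::complex) r) (%(u, z). z)"
  unfolding case_prod_unfold by (intro continuous_intros)
 from this show ?case by - (rule exI[of _ s], rule exI[of _ r], use s r in auto)
next
 case (Suc p)
 then obtain s1 r1 where 1: "0 < s1" "s1 \<le> s" "0 < r1" "r1 \<le> r"
  "continuous_on (ball 0 s1 \<times> ball 0 r1) (%(u, z). (\<phi> u ^^ p) z)"
  "!!u. u \<in> ball 0 s1 ==> (\<phi> u ^^ p) holomorphic_on ball 0 r1"
  "!!u j z. u \<in> ball 0 s1 ==> j \<le> p ==> z \<in> ball 0 r1 ==> (\<phi> u ^^ j) z \<in> ball 0 r"
  by blast
 define g where "g = (%(u, z). \<phi> u ((\<phi> u ^^ p) z))"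
 have gc: "continuous_on (ball 0 s1 \<times> ball 0 r1) g"
 proof -
  have "continuous_on (ball 0 s1 \<times> ball 0 r1) (%x. (fst x, (%(u, z). (\<phi> u ^^ p) z) x))"
   by (intro continuous_intros 1)
  moreover have "(%x. (fst x, (%(u, z). (\<phi> u ^^ p) z) x)) ` (ball 0 s1 \<times> ball 0 r1) \<subseteq> ball 0 s \<times> ball 0 r"
   using 1(2) 1(7)[OF _ order_refl] by (force simp: image_subset_iff)
  ultimately have "continuous_on (ball 0 s1 \<times> ball 0 r1) (%x. (%(u, z). \<phi> u z) (fst x, (%(u, z). (\<phi> u ^^ p) z) x))"
   by (rule continuous_on_compose2[OF cont])
  thus ?thesis by (simp add: g_def case_prod_unfold)
 qed
 have z0: "(\<phi> u ^^ k) 0 = 0" if "u \<in> ball 0 s" for u k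
  using zero[OF that] by (induction k) auto
 have "isCont g (0, 0)"
  using gc 1 by (simp add: continuous_on_eq_continuous_at open_Times)
 moreover have "g (0, 0) = 0" using z0[of 0 p] zero[of 0] s by (simp add: g_def)
 ultimately have "(g \<longlongrightarrow> 0) (nhds (0, 0))"
  using tendsto_at_iff_tendsto_nhds[of g "(0, 0)"] by (simp add: isCont_def)
 hence "\<forall>\<^sub>F x in nhds (0, 0). g x \<in> ball 0 r"
  using r by (intro topological_tendstoD) auto
 then obtain s2 r2 where 2: "s2 > 0" "r2 > 0" "!!u z. u \<in> ball 0 s2 ==> z \<in> ball 0 r2 ==> g (u, z) \<in> ball 0 r"
  by (rule eventually_nhds_balls) (rule that)
 define s' where "s' = min s1 s2"
 define r' where "r' = min r1 r2"
 have sub: "ball (0::complex) s' \<subseteq> ball 0 s1" "ball (0::complex) r' \<subseteq> ball 0 r1" "ball (0::complex) s' \<subseteq> ball 0 s2" "ball (0::complex) r' \<subseteq> ball 0 r2"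
  by (auto simp: s'_def r'_def)
 show ?case
 proof (rule exI[of _ s'], rule exI[of _ r'], intro conjI ballI allI impI)
  show "0 < s'" "s' \<le> s" "0 < r'" "r' \<le> r" using 1 2 by (auto simp: s'_def r'_def)
  have "continuous_on (ball 0 s' \<times> ball 0 r') g"
   by (rule continuous_on_subset[OF gc]) (use sub in blast)
  thus "continuous_on (ball 0 s' \<times> ball 0 r') (%(u, z). (\<phi> u ^^ Suc p) z)" by (simp add: g_def)
  fix u :: complex assume u: "u \<in> ball 0 s'"
  have us: "u \<in> ball 0 s1" "u \<in> ball 0 s" using u sub 1(2) by auto
  have "(%z. \<phi> u ((\<phi> u ^^ p) z)) holomorphic_on ball 0 r'"
  proof (rule holomorphic_on_compose_gen[where f = "\<phi> u ^^ p" and g = "\<phi> u", unfolded o_def])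
   show "(\<phi> u ^^ p) holomorphic_on ball 0 r'" by (rule holomorphic_on_subset[OF 1(6)[OF us(1)] sub(2)])
   show "\<phi> u holomorphic_on ball 0 r" by (rule hol[OF us(2)])
   show "(\<phi> u ^^ p) ` ball 0 r' \<subseteq> ball 0 r" using 1(7)[OF us(1), of p] sub(2) by auto
  qed
  thus "(\<phi> u ^^ Suc p) holomorphic_on ball 0 r'" by (simp add: o_def)
  fix j z assume j: "j \<le> Suc p" and z: "z \<in> ball (0::complex) r'"
  show "(\<phi> u ^^ j) z \<in> ball 0 r"
  proof (cases "j = Suc p")
   case True
   thus ?thesis using 2(3)[OF subsetD[OF sub(3) u] subsetD[OF sub(4) z]] by (simp add: g_def)
  next
   case False
   thus ?thesis using 1(7)[OF us(1) _ subsetD[OF sub(2) z], of j] j by simp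
  qed
 qed
qed

text \<open>In the coordinate W = -1/(p A z^p) the map z (1 + z^p K) becomes W (1 - x)^(-p) with p x
  W = K/A, so W moves by K/A up to an error of order 1/|W|. Tolerances of 1/10 for K/A and 4/10 for
  the error leave a gain of 1/2, uniformly in \<open>K\<close>.\<close>

lemma petal_step:
 fixes A :: complex
 assumes p: "p \<ge> (1::nat)" and A: "A ~= 0"
 obtains R0 where "R0 > 0"
  "!!z K. norm (K - A) \<le> norm A / 10 ==> Re (- 1 / (of_nat p * A * z ^ p)) \<ge> R0 ==>
    Re (- 1 / (of_nat p * A * (z * (1 + z ^ p * K)) ^ p)) \<ge> Re (- 1 / (of_nat p * A * z ^ p)) + 1 / 2"
proof -
 obtain C r where C: "C \<ge> 0" "r > 0" "r < 1"
  "!!x::complex. norm x < r ==> norm (1 / (1 - x) ^ p - 1 - of_nat p * x) \<le> C * norm x ^ 2"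
  by (rule binomial_remainder[of p]) (rule that)
 \<comment> \<open>The term 2/r brings \<open>x\<close> into the range of the binomial estimate, and
   4 C + 1 keeps the error below 4/10.\<close>
 define R0 where "R0 = 2 / r + 4 * C + 1"
 have R0: "R0 > 0" "R0 \<ge> 1" "R0 > 11/10 / r" "R0 \<ge> 4 * C" using C by (auto simp: R0_def field_simps add_pos_nonneg)
 show thesis
 proof (rule that[OF R0(1)])
  fix z K assume K: "norm (K - A) \<le> norm A / 10" and W0: "Re (- 1 / (of_nat p * A * z ^ p)) \<ge> R0"
  define W where "W = - 1 / (of_nat p * A * z ^ p)"
  define x where "x = - (z ^ p * K)"
  define k where "k = K / A"
  have nW: "norm W \<ge> R0" using W0 complex_Re_le_cmod[of W] by (simp add: W_def)
  hence Wn: "norm W > 0" "W ~= 0" using R0 by auto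
  have z: "z ~= 0" using Wn(2) p by (auto simp: W_def zero_power)
  have k1: "norm (k - 1) \<le> 1/10"
  proof -
   have "k - 1 = (K - A) / A" using A by (simp add: k_def diff_divide_distrib)
   thus ?thesis using K A by (simp add: norm_divide divide_le_eq)
  qed
  have kn: "norm k \<le> 11/10" using norm_triangle_ineq[of "k - 1" 1] k1 by simp
  have kR: "Re k \<ge> 9/10" using abs_Re_le_cmod[of "k - 1"] k1 by simp
  have pc: "of_nat p ~= (0 :: complex)" using p by simp
  have px: "of_nat p * x * W = k" using z A pc by (simp add: x_def W_def k_def field_simps)
  have nx: "norm x \<le> 11/10 / norm W"
  proof -
   have "real p * norm x * norm W = norm k" using arg_cong[OF px, of norm] by (simp add: norm_mult)
   moreover have "1 * norm x * norm W \<le> real p * norm x * norm W" using p by (intro mult_right_mono) auto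
   ultimately show ?thesis using kn Wn by (simp add: field_simps)
  qed
  have "11/10 / norm W \<le> 11/10 / R0" using nW mult_pos_pos[OF Wn(1) R0(1)] by (intro divide_left_mono) auto
  also have "\<dots> < r" using R0 C by (simp add: field_simps)
  finally have xr: "norm x < r" using nx by simp
  have eq: "- 1 / (of_nat p * A * (z * (1 + z ^ p * K)) ^ p) - W - k = W * (1 / (1 - x) ^ p - 1 - of_nat p * x)"
  proof -
   have "- 1 / (of_nat p * A * (z * (1 + z ^ p * K)) ^ p) = W * (1 / (1 - x) ^ p)"
    by (simp add: W_def x_def power_mult_distrib)
   thus ?thesis using px by (simp add: algebra_simps)
  qed
  have "norm (- 1 / (of_nat p * A * (z * (1 + z ^ p * K)) ^ p) - W - k) \<le> norm W * (C * norm x ^ 2)"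
   unfolding eq norm_mult using C(4)[OF xr] by (intro mult_left_mono) auto
  also have "\<dots> \<le> norm W * (C * (11/10 / norm W) ^ 2)"
   using nx C by (intro mult_left_mono power_mono) auto
  also have "\<dots> = 121/100 * C / norm W" using Wn by (simp add: power2_eq_square field_simps)
  also have "\<dots> \<le> 121/100 * C / (4 * C + 1)"
  proof (rule divide_left_mono)
   have "4 * C + 1 \<le> R0" using C by (simp add: R0_def)
   thus "4 * C + 1 \<le> norm W" using nW by simp
   show "0 < norm W * (4 * C + 1)" using Wn C by (intro mult_pos_pos) auto
  qed (use C in simp)
  also have "\<dots> \<le> 4/10" using C by (simp add: field_simps)
  finally have "Re (- 1 / (of_nat p * A * (z * (1 + z ^ p * K)) ^ p) - W - k) \<ge> - (4/10)"
   using abs_Re_le_cmod[of "- 1 / (of_nat p * A * (z * (1 + z ^ p * K)) ^ p) - W - k"] by linarith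
  hence "Re (- 1 / (of_nat p * A * (z * (1 + z ^ p * K)) ^ p)) - Re W - Re k \<ge> - (4/10)" by (simp only: minus_complex.sel)
  thus "Re (- 1 / (of_nat p * A * (z * (1 + z ^ p * K)) ^ p)) \<ge> Re (- 1 / (of_nat p * A * z ^ p)) + 1 / 2"
   using kR unfolding W_def[symmetric] by linarith
 qed
qed

lemma petal_coordinate_small:
 fixes A :: complex
 assumes p: "p \<ge> (1::nat)" and A: "A ~= 0" and e: "e > 0"
 obtains R where "R > 0" "!!z. Re (- 1 / (of_nat p * A * z ^ p)) \<ge> R ==> norm z < e"
proof -
 define B where "B = 1 / (real p * norm A * e ^ p)"
 have B: "B > 0" using p A e by (simp add: B_def)
 show thesis
 proof (rule that[of "B + 1"])
  fix z assume "Re (- 1 / (of_nat p * A * z ^ p)) \<ge> B + 1"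
  hence n: "norm (- 1 / (of_nat p * A * z ^ p)) \<ge> B + 1"
   using complex_Re_le_cmod order_trans by blast
  show "norm z < e"
  proof (rule ccontr)
   assume "\<not> norm z < e"
   hence "e ^ p \<le> norm z ^ p" using e by (intro power_mono) auto
   hence "1 / (real p * norm A * norm z ^ p) \<le> B"
    unfolding B_def using p A e by (intro divide_left_mono mult_left_mono mult_pos_pos) (auto intro: zero_less_power order_less_le_trans)
   thus False using n by (simp add: norm_divide norm_mult norm_power)
  qed
 qed (use B in simp)
qed

text \<open>Either the p-th iterate is the identity and K = 0, or commutation with \<phi> forces its
  displacement to vanish to order at least p + 1. Nonvanishing of \<open>K\<close> is not claimed
  here; it comes later from closeness to the unperturbed map.\<close>

lemma parabolic_iterate_factor:
 fixes \<phi> :: "complex => complex"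
 assumes r': "0 < r'" "r' \<le> r" and hol: "\<phi> holomorphic_on ball 0 r" and \<phi>: "\<phi> 0 = 0" "deriv \<phi> 0 = \<kappa>"
  and p: "p \<ge> 1" "\<kappa> ^ p = 1" "!!k. 1 \<le> k ==> k < p ==> \<kappa> ^ k ~= 1"
  and holp: "(\<phi> ^^ p) holomorphic_on ball 0 r'"
 obtains K where "K holomorphic_on ball 0 r'" "!!z. z \<in> ball 0 r' ==> (\<phi> ^^ p) z = z * (1 + z ^ p * K z)"
proof -
 define D where "D = (%z. (\<phi> ^^ p) z - z)"
 have Dh: "D holomorphic_on ball 0 r'" unfolding D_def by (intro holomorphic_intros holp)
 have z0: "(\<phi> ^^ k) 0 = 0" for k using \<phi> by (induction k) auto
 have D0: "D 0 = 0" by (simp add: D_def z0)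
 have k0: "\<kappa> ~= 0" using p by (auto simp: zero_power)
 have zin: "0 \<in> ball 0 r'" "(0::complex) \<in> ball 0 r" using r' by auto
 show thesis
 proof (cases "D constant_on ball 0 r'")
  case True
  then obtain y where y: "!!x. x \<in> ball 0 r' ==> D x = y" unfolding constant_on_def by blast
  hence "(\<phi> ^^ p) z = z" if "z \<in> ball 0 r'" for z using y[OF that] y[OF zin(1)] D0 by (simp add: D_def)
  thus thesis by (intro that[of "%_. 0"]) auto
 next
  case False
  obtain g r2 n where g: "0 < n" "0 < r2" "ball (0::complex) r2 \<subseteq> ball 0 r'" "g holomorphic_on ball 0 r2"
   "!!w. w \<in> ball 0 r2 ==> D w = (w - 0) ^ n * g w" "!!w. w \<in> ball 0 r2 ==> g w ~= 0"
   by (rule holomorphic_factor_zero_nonconstant[OF Dh open_ball connected_ball zin(1) D0 False]) (rule that)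
  have "((\<phi> ^^ p) has_field_derivative (\<Prod>i<p. deriv \<phi> ((\<phi> ^^ i) 0))) (at 0)"
   by (rule iterate_has_derivative[OF hol open_ball]) (use z0 zin in simp)
  hence d1: "(D has_field_derivative 1 - 1) (at 0)"
   unfolding D_def using p by (auto intro!: derivative_eq_intros simp: z0 \<phi>)
  have gd: "(g has_field_derivative deriv g 0) (at 0)"
   using g by (intro holomorphic_derivI[OF g(4)]) auto
  have "n ~= 1"
  proof
   assume n1: "n = 1"
   have "((%w. w * g w) has_field_derivative g 0) (at 0)"
    using DERIV_mult[OF DERIV_ident gd] by simp
   hence "(D has_field_derivative g 0) (at 0)"
    using has_field_derivative_transform_within_open[of "%w. w * g w" "g 0" 0 "ball 0 r2" D] g n1 by simp
   hence "g 0 = 0" using DERIV_unique[OF d1] by simp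
   thus False using g by simp
  qed
  have "\<kappa> ^ (n - 1) = 1"
  proof (rule commuting_germ_multiplier[OF hol open_ball zin(2) \<phi> k0, of g "g 0" "\<phi> ^^ p"])
   show "(g \<longlongrightarrow> g 0) (at 0)" using DERIV_isCont[OF gd] by (simp add: isCont_def)
   show "g 0 ~= 0" using g by simp
   have "\<forall>\<^sub>F z in at 0. z \<in> ball (0::complex) r2" using g(2) by (intro eventually_at_in_open') auto
   thus "\<forall>\<^sub>F z in at 0. (\<phi> ^^ p) z - z = z ^ n * g z"
    by eventually_elim (use g(5) in \<open>simp add: D_def\<close>)
   show "\<forall>\<^sub>F z in at 0. \<phi> ((\<phi> ^^ p) z) = (\<phi> ^^ p) (\<phi> z)"
    by (rule always_eventually) (simp add: funpow_swap1)
  qed (use g in simp)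
  hence np: "p + 1 \<le> n" using p(3)[of "n - 1"] g(1) \<open>n ~= 1\<close> by linarith
  define K where "K = (%z. if z = 0 then 0 ^ (n - (p + 1)) * g 0 else D z / z ^ (p + 1))"
  have pw: "z ^ n = z ^ (p + 1) * z ^ (n - (p + 1))" for z :: complex
   using np by (simp only: power_add[symmetric] le_add_diff_inverse)
  have "K holomorphic_on ball 0 r2"
  proof (rule holomorphic_transform)
   show "(%z. z ^ (n - (p + 1)) * g z) holomorphic_on ball 0 r2" by (intro holomorphic_intros g)
   show "z ^ (n - (p + 1)) * g z = K z" if "z \<in> ball 0 r2" for z
    using g(5)[OF that] pw[of z] by (simp add: K_def)
  qed
  moreover have "K holomorphic_on ball 0 r' - {0}"
  proof (rule holomorphic_transform)
   show "(%z. D z / z ^ (p + 1)) holomorphic_on ball 0 r' - {0}"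
    by (intro holomorphic_intros holomorphic_on_subset[OF Dh]) auto
  qed (simp add: K_def)
  ultimately have "K holomorphic_on ball 0 r2 \<union> (ball 0 r' - {0})"
   by (rule holomorphic_on_Un) (auto intro: open_Diff)
  moreover have "ball 0 r2 \<union> (ball 0 r' - {0}) = ball (0::complex) r'" using g(2,3) by auto
  ultimately have "K holomorphic_on ball 0 r'" by simp
  moreover have "(\<phi> ^^ p) z = z * (1 + z ^ p * K z)" if "z \<in> ball 0 r'" for z
  proof (cases "z = 0")
   case False
   hence "D z = z ^ (p + 1) * K z" by (simp add: K_def)
   thus ?thesis by (simp add: D_def algebra_simps)
  qed (simp add: z0)
  ultimately show thesis by (rule that)
 qed
qed

text \<open>Dynamics with frozen multiplier. Once per period an affine map carries
  \<open>be u\<close> to \<open>al u\<close> with slope \<open>la u\<close>; by \<open>mult\<close>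
  the corrected return map fixes \<open>al u\<close> with multiplier exactly \<kappa>. It therefore
  remains parabolic, and the corrected orbit of c + u can be followed for all times, whereas the
  uncorrected one may leave the petals.\<close>

locale hat_family = aligned_cycle +
 fixes s0 :: real and al be la :: "complex => complex" and p :: nat
 assumes p: "p \<ge> 1" "\<kappa> ^ p = 1" "!!k. 1 \<le> k ==> k < p ==> \<kappa> ^ k ~= 1"
  and s0: "s0 > 0" and hol_al: "al holomorphic_on ball 0 s0" and hol_be: "be holomorphic_on ball 0 s0"
  and hol_la: "la holomorphic_on ball 0 s0"
  and at0: "al 0 = aa 0" "be 0 = aa 0" "la 0 = 1"
  and al_orb: "!!u. u \<in> ball 0 s0 ==> orb (c + u) q (al u)"
  and al_it: "!!u. u \<in> ball 0 s0 ==> it (c + u) q (al u) = be u"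
  and mult: "!!u. u \<in> ball 0 s0 ==> la u * Dit (c + u) q (al u) = \<kappa>"
begin

definition corr :: "complex => complex => complex" where "corr u y = al u + la u * (y - be u)"
definition \<phi> :: "complex => complex => complex" where "\<phi> u z = corr u (it (c + u) q (al u + z)) - al u"

primrec h :: "nat => complex => complex" where
 "h 0 u = c + u"
| "h (Suc n) u = (if q dvd Suc n then corr u (f (h n u) + (c + u)) else f (h n u) + (c + u))"

lemma corr0 [simp]: "corr 0 y = y" by (simp add: corr_def at0)

lemma h_0: "h n 0 = it c n c"
 by (induction n) (auto simp: it_Suc simp del: funpow.simps(2))

lemma h_it: "q dvd n ==> i < q ==> h (n + i) u = it (c + u) i (h n u)"
proof (induction i)
 case (Suc i)
 have "\<not> q dvd Suc (n + i)"
 proof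
  assume "q dvd Suc (n + i)"
  hence "q dvd n + Suc i" by simp
  hence "q dvd Suc i" using Suc.prems(1) by (simp only: dvd_add_right_iff)
  thus False using Suc.prems(2) by (auto dest: dvd_imp_le)
 qed
 thus ?case using Suc by (simp add: it_Suc del: funpow.simps(2))
qed simp

lemma h_phi: "q dvd n ==> h (n + q) u - al u = \<phi> u (h n u - al u)"
proof -
 assume dv: "q dvd n"
 obtain q' where q': "q = Suc q'" using q by (cases q) auto
 have dv': "q dvd n + q" using dv by simp
 have "n + q = Suc (n + q')" by (simp add: q')
 hence "h (n + q) u = corr u (f (h (n + q') u) + (c + u))" using dv' by (simp only: h.simps if_True)
 also have "h (n + q') u = it (c + u) q' (h n u)" using h_it[OF dv, of q'] q' by simp
 finally have "h (n + q) u = corr u (it (c + u) (Suc q') (h n u))" by (simp only: it_Suc)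
 thus ?thesis by (simp only: \<phi>_def q'[symmetric]) simp
qed

lemma h_phi_iter: "q dvd n ==> h (n + k * q) u - al u = (\<phi> u ^^ k) (h n u - al u)"
proof (induction k)
 case (Suc k)
 have "h (n + Suc k * q) u = h ((n + k * q) + q) u" by (simp add: algebra_simps)
 thus ?case using h_phi[of "n + k * q" u] Suc by simp
qed simp

text \<open>The recursion is not autonomous but depends on time only modulo \<open>q\<close>; a
  coincidence at congruent times therefore persists.\<close>

lemma h_det: "n mod q = m mod q ==> h n u = h m u ==> h (n + i) u = h (m + i) u"
proof (induction i)
 case (Suc i)
 have "(Suc (n + i)) mod q = (Suc (m + i)) mod q" using Suc.prems(1) by (metis add_Suc mod_Suc_eq mod_add_left_eq)
 hence "q dvd Suc (n + i) \<longleftrightarrow> q dvd Suc (m + i)" by (simp add: dvd_eq_mod_eq_0)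
 thus ?case using Suc by simp
qed simp

lemma c_lim: "filterlim (%x. c + fst x) (nhds c) (nhds (0 :: complex, 0 :: complex))"
 using tendsto_add[OF tendsto_const[of c] tendsto_fst[OF filterlim_ident[of "nhds (0 :: complex, 0 :: complex)"]]] by simp

lemma al_cont: "isCont al 0"
 using hol_al s0 continuous_on_eq_continuous_at[OF open_ball] holomorphic_on_imp_continuous_on by (metis centre_in_ball)

lemma al_lim: "((%x. al (fst x) + snd x) \<longlongrightarrow> aa 0) (nhds (0, 0))"
proof -
 have 1: "(al \<longlongrightarrow> aa 0) (nhds 0)" using al_cont tendsto_at_iff_tendsto_nhds[of al 0] by (simp add: isCont_def at0)
 have 2: "(fst \<longlongrightarrow> 0) (nhds (0 :: complex, 0 :: complex))" "(snd \<longlongrightarrow> 0) (nhds (0 :: complex, 0 :: complex))"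
  using tendsto_fst[OF filterlim_ident] tendsto_snd[OF filterlim_ident] by auto
 from tendsto_add[OF filterlim_compose[OF 1 2(1)] 2(2)] show ?thesis by simp
qed

lemma phi_nbhd:
 obtains s1 r1 where "0 < s1" "s1 \<le> s0" "0 < r1"
  "!!u z. u \<in> ball 0 s1 ==> z \<in> ball 0 r1 ==> orb (c + u) q (al u + z)"
  "continuous_on (ball 0 s1 \<times> ball 0 r1) (%(u, z). \<phi> u z)"
  "!!u. u \<in> ball 0 s1 ==> \<phi> u holomorphic_on ball 0 r1"
  "!!u. u \<in> ball 0 s1 ==> \<phi> u 0 = 0" "!!u. u \<in> ball 0 s1 ==> deriv (\<phi> u) 0 = \<kappa>"
proof -
 have "\<forall>\<^sub>F x in nhds (0, 0). orb (c + fst x) q (al (fst x) + snd x)"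
  by (rule orb_eventually[OF cyc_orb[OF cy] c_lim al_lim])
 then obtain s r where sr: "s > 0" "r > 0" "!!u z. u \<in> ball 0 s ==> z \<in> ball 0 r ==> orb (c + u) q (al u + z)"
  by (rule eventually_nhds_balls) (use that in auto)
 define s1 where "s1 = min s s0"
 have s1: "0 < s1" "s1 \<le> s0" "s1 \<le> s" using sr s0 by (auto simp: s1_def)
 have sub: "ball (0::complex) s1 \<subseteq> ball 0 s0" "ball (0::complex) s1 \<subseteq> ball 0 s" using s1 by auto
 show thesis
 proof (rule that[OF s1(1,2) sr(2)])
  show o: "orb (c + u) q (al u + z)" if "u \<in> ball 0 s1" "z \<in> ball 0 r" for u z
   using sr(3) that sub by blast
  let ?B = "ball 0 s1 \<times> ball (0::complex) r"
  have alc: "continuous_on ?B (%x. al (fst x))" "continuous_on ?B (%x. la (fst x))" "continuous_on ?B (%x. be (fst x))"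
   using sub(1) by (auto intro!: continuous_on_compose2[OF holomorphic_on_imp_continuous_on[OF hol_al]]
     continuous_on_compose2[OF holomorphic_on_imp_continuous_on[OF hol_la]]
     continuous_on_compose2[OF holomorphic_on_imp_continuous_on[OF hol_be]] continuous_on_fst continuous_on_id)
  have "continuous_on ?B (%x. (%(w, z). it w q z) (c + fst x, al (fst x) + snd x))"
  proof (rule continuous_on_compose2[OF it_cont])
   show "continuous_on ?B (%x. (c + fst x, al (fst x) + snd x))" by (intro continuous_intros alc)
  qed (use o in auto)
  hence ic: "continuous_on ?B (%x. it (c + fst x) q (al (fst x) + snd x))" by simp
  show "continuous_on ?B (%(u, z). \<phi> u z)"
   unfolding \<phi>_def corr_def case_prod_unfold by (intro continuous_intros ic alc)
  fix u :: complex assume u: "u \<in> ball 0 s1"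
  hence u0: "u \<in> ball 0 s0" using sub by blast
  show "\<phi> u holomorphic_on ball 0 r"
   unfolding \<phi>_def[abs_def] corr_def
   by (intro holomorphic_intros it_holomorphic[of "%_. c + u"]) (use o[OF u] in auto)
  show "\<phi> u 0 = 0" by (simp add: \<phi>_def corr_def al_it[OF u0])
  have "((%z. it (c + u) q (al u + z)) has_field_derivative Dit (c + u) q (al u + 0) * 1) (at 0)"
   using al_orb[OF u0] by (intro DERIV_chain2[OF it_deriv]) (auto intro!: derivative_eq_intros)
  hence "(\<phi> u has_field_derivative la u * Dit (c + u) q (al u)) (at 0)"
   unfolding \<phi>_def[abs_def] corr_def by (auto intro!: derivative_eq_intros)
  thus "deriv (\<phi> u) 0 = \<kappa>" using mult[OF u0] by (simp add: DERIV_imp_deriv)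
 qed
qed

lemma phi_0_iter: "(\<phi> 0 ^^ k) z = it c (q * k) (aa 0 + z) - aa 0"
proof (induction k)
 case (Suc k)
 have "it c (q * Suc k) (aa 0 + z) = it c q (it c (q * k) (aa 0 + z))"
  using it_add[of q "q * k" c] by simp
 thus ?case using Suc by (simp add: \<phi>_def at0)
qed simp

abbreviation Wf :: "complex => complex => complex" where "Wf A z \<equiv> - 1 / (of_nat p * A * z ^ p)"

lemma \<epsilon>_ratio_iter: "(%n. \<epsilon> (n + j * q) / \<epsilon> n) \<longlonglongrightarrow> \<kappa> ^ j"
proof (induction j)
 case 0
 show ?case using \<epsilon>_nz by simp
next
 case (Suc j)
 have "(%n. \<epsilon> (n + j * q + q) / \<epsilon> (n + j * q)) \<longlonglongrightarrow> \<kappa>"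
  using LIMSEQ_ignore_initial_segment[OF \<epsilon>_ratio, of "j * q"] .
 from tendsto_mult[OF this Suc] show ?case using \<epsilon>_nz by (simp add: algebra_simps)
qed

text \<open>The coefficient \<open>K\<close> of the perturbed p-th return map is compared with the
  unperturbed \<open>h\<close> on a circle, where division by z^(p+1) is harmless, and the maximum
  principle carries the estimate inside. The two tolerances of |A|/20 add up to the |A|/10 that
  \<open>petal_step\<close> accepts.\<close>

lemma hat_expansion:
 obtains s2 r2 A where "0 < s2" "s2 \<le> s0" "0 < r2" "A ~= 0"
  "!!u z. u \<in> ball 0 s2 ==> z \<in> ball 0 r2 ==> orb (c + u) q (al u + z)"
  "!!u z. u \<in> ball 0 s2 ==> z \<in> ball 0 r2 ==> \<exists>K. norm (K - A) \<le> norm A / 10 \<and> (\<phi> u ^^ p) z = z * (1 + z ^ p * K)"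
  "(%k. Wf A (\<epsilon> (k * q)) / of_nat k) \<longlonglongrightarrow> 1 / of_nat p"
proof -
 obtain e h \<beta> T R where M: "e > 0" "h holomorphic_on ball 0 e" "h 0 ~= 0" "h 0 * \<beta> ^ p = - 1 / of_nat p"
  "!!z. norm z < e ==> orb c (q * p) (aa 0 + z) \<and> it c (q * p) (aa 0 + z) = aa 0 + z * (1 + z ^ p * h z)"
  "model c (q * p) (aa 0) (%W. aa 0 + \<beta> * exp (- Ln W / of_nat p)) T R 1" "R \<ge> 1"
  "!!W. Re W > R ==> ((%W. aa 0 + \<beta> * exp (- Ln W / of_nat p)) has_field_derivative
    - ((aa 0 + \<beta> * exp (- Ln W / of_nat p)) - aa 0) / (of_nat p * W)) (at W)"
  by (rule parabolic_cycle_model[OF c cy p(1,2)], erule (1) p(3)) (rule that)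
 define A where "A = h 0"
 have A: "A ~= 0" using M(3) by (simp add: A_def)
 have pc: "of_nat p ~= (0 :: complex)" using p by simp
 \<comment> \<open>The coordinate of the model advances by about 1 in q p steps, that is in
   \<open>p\<close> returns; hence the limit 1/p.\<close>
 have Wlim: "(%k. Wf A (\<epsilon> (k * q)) / of_nat k) \<longlonglongrightarrow> 1 / of_nat p"
 proof -
  have lW: "(%k. (T ^^ k) W / of_nat k) \<longlonglongrightarrow> 1" if "Re W > R" for W using M(6) that by (simp add: model_def)
  obtain K ns Ws where K: "K ~= 0" "(%n. \<tau> n / of_nat n ^ 1) \<longlonglongrightarrow> K" "Re Ws > R" "ns mod q = 0"
   "!!k. it c (ns + k * (q * p)) c = aa 0 + \<beta> * exp (- Ln ((T ^^ k) Ws) / of_nat p)"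
  proof (rule \<tau>_lim_model[OF M(6) dvd_triv_left M(8), of 1 "of_nat p"])
   fix W assume W: "Re W > R"
   show "of_nat p * W ~= 0" using p parabolic_W_nonzero[OF M(7) W] by simp
   from tendsto_mult_left[OF lW[OF W], of "of_nat p"]
   show "(%k. of_nat p * (T ^^ k) W / of_nat k ^ 1) \<longlonglongrightarrow> of_nat p" by simp
  qed (use that p in auto)
  obtain l where l: "ns = l * q" using K(4) by (metis mod_0_imp_dvd dvd_def mult.commute)
  define W where "W = (%k. (T ^^ k) Ws)"
  have W0: "W k ~= 0" for k unfolding W_def by (rule parabolic_W_nonzero[OF M(7) model_iter(2)[OF M(6) K(3)]])
  have WfW: "Wf A (\<epsilon> (ns + k * (q * p))) = W k" for k
  proof -
   have a0: "aa (ns + k * (q * p)) = aa 0" using aa_mult[of 0 "l + k * p"] by (simp add: l algebra_simps)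
   have "\<epsilon> (ns + k * (q * p)) ^ p = \<beta> ^ p * exp (of_nat p * (- Ln (W k) / of_nat p))"
    unfolding \<epsilon>_def a0 K(5) by (simp add: power_mult_distrib W_def flip: exp_of_nat_mult)
   also have "\<dots> = \<beta> ^ p / W k" using W0[of k] pc by (simp add: exp_minus field_simps)
   finally have e: "\<epsilon> (ns + k * (q * p)) ^ p = \<beta> ^ p / W k" .
   have "of_nat p * A * (\<beta> ^ p / W k) = - 1 / W k" using M(4) pc by (simp add: A_def field_simps)
   thus ?thesis unfolding e using W0[of k] by simp
  qed
  show ?thesis
  proof (rule tendsto_residues[OF p(1), of _ l])
   fix j assume "j < p"
   have sm: "strict_mono (%k. ns + k * (q * p))" using q p by (intro strict_monoI) simp
   have i: "(l + k * p + j) * q = ns + k * (q * p) + j * q" for k by (simp add: l algebra_simps)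
   have "(%k. (\<epsilon> (ns + k * (q * p) + j * q) / \<epsilon> (ns + k * (q * p))) ^ p) \<longlonglongrightarrow> (\<kappa> ^ j) ^ p"
    using LIMSEQ_subseq_LIMSEQ[OF \<epsilon>_ratio_iter[of j] sm] by (intro tendsto_power) (simp add: o_def)
   also have "(\<kappa> ^ j) ^ p = 1" using p(2) by (metis power_mult mult.commute power_one)
   finally have l1: "(%k. (\<epsilon> (ns + k * (q * p) + j * q) / \<epsilon> (ns + k * (q * p))) ^ p) \<longlonglongrightarrow> 1" .
   have p0: "real p > 0" using p by simp
   have "(%k. real k / (real l + real k * real p + real j)) \<longlonglongrightarrow> inverse (real p)" using p0 by real_asymp
   from tendsto_of_real[OF this, where 'a = complex]
   have l2: "(%k. of_nat k / of_nat (l + k * p + j)) \<longlonglongrightarrow> (1 / of_nat p :: complex)" by (simp add: inverse_eq_divide)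
   have lW': "(%k. W k / of_nat k) \<longlonglongrightarrow> 1" unfolding W_def by (rule lW[OF K(3)])
   have "(%k. W k / of_nat k / (\<epsilon> (ns + k * (q * p) + j * q) / \<epsilon> (ns + k * (q * p))) ^ p * (of_nat k / of_nat (l + k * p + j)))
     \<longlonglongrightarrow> 1 / 1 * (1 / of_nat p)"
    by (intro tendsto_intros lW' l1 l2) simp
   moreover have "\<forall>\<^sub>F k in sequentially. W k / of_nat k / (\<epsilon> (ns + k * (q * p) + j * q) / \<epsilon> (ns + k * (q * p))) ^ p * (of_nat k / of_nat (l + k * p + j))
     = Wf A (\<epsilon> ((l + k * p + j) * q)) / of_nat (l + k * p + j)"
    using eventually_gt_at_top[of 0]
   proof eventually_elim
    case (elim k)
    thus ?case unfolding i WfW[symmetric] using \<epsilon>_nz by (simp add: power_divide)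
   qed
   ultimately have "(%k. Wf A (\<epsilon> ((l + k * p + j) * q)) / of_nat (l + k * p + j)) \<longlonglongrightarrow> 1 / 1 * (1 / of_nat p)"
    by (rule Lim_transform_eventually)
   thus "(%k. Wf A (\<epsilon> ((l + k * p + j) * q)) / of_nat (l + k * p + j)) \<longlonglongrightarrow> 1 / of_nat p" by simp
  qed
 qed
 obtain s1 r1 where s1: "0 < s1" "s1 \<le> s0" "0 < r1"
  "!!u z. u \<in> ball 0 s1 ==> z \<in> ball 0 r1 ==> orb (c + u) q (al u + z)"
  "continuous_on (ball 0 s1 \<times> ball 0 r1) (%(u, z). \<phi> u z)"
  "!!u. u \<in> ball 0 s1 ==> \<phi> u holomorphic_on ball 0 r1"
  "!!u. u \<in> ball 0 s1 ==> \<phi> u 0 = 0" "!!u. u \<in> ball 0 s1 ==> deriv (\<phi> u) 0 = \<kappa>"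
  by (rule phi_nbhd) (rule that)
 obtain s' r' where s': "0 < s'" "s' \<le> s1" "0 < r'" "r' \<le> r1"
  "continuous_on (ball 0 s' \<times> ball 0 r') (%(u, z). (\<phi> u ^^ p) z)"
  "!!u. u \<in> ball 0 s' ==> (\<phi> u ^^ p) holomorphic_on ball 0 r'"
  using iterates_nbhd[OF s1(1,3,5,6,7), of p] by blast
 have hc: "isCont h 0" using M continuous_on_eq_continuous_at[OF open_ball] holomorphic_on_imp_continuous_on by (metis centre_in_ball)
 obtain e1 where e1: "e1 > 0" "!!z. dist z 0 < e1 ==> dist (h z) A < norm A / 20"
  using hc A unfolding continuous_at_eps_delta A_def by (metis zero_less_norm_iff divide_pos_pos zero_less_numeral)
 define r2 where "r2 = min (min e r') e1 / 2"
 have r2: "0 < r2" "r2 < e" "r2 < r'" "r2 < e1" using M(1) s'(3) e1(1) by (auto simp: r2_def)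
 have sph: "compact (sphere (0::complex) r2)" "sphere (0::complex) r2 \<subseteq> ball 0 r'" using r2 by auto
 obtain s2 where s2: "s2 > 0" "s2 < s'"
  "!!u z. u \<in> ball 0 s2 ==> z \<in> sphere 0 r2 ==> norm ((\<phi> u ^^ p) z - (\<phi> 0 ^^ p) z) < norm A / 20 * r2 ^ (p + 1)"
  by (rule jointly_continuous_uniform[OF s'(5,1) sph, of "norm A / 20 * r2 ^ (p + 1)"])
   (use A r2 in simp, rule that)
 show thesis
 proof (rule that[OF s2(1) _ r2(1) A _ _ Wlim])
  show "s2 \<le> s0" using s2 s' s1 by simp
  show "orb (c + u) q (al u + z)" if "u \<in> ball 0 s2" "z \<in> ball 0 r2" for u z
   by (rule s1(4)) (use that s2 s' r2 in auto)
  fix u z assume u: "u \<in> ball (0::complex) s2" and z: "z \<in> ball (0::complex) r2"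
  have u': "u \<in> ball 0 s'" "u \<in> ball 0 s1" using u s2 s' by auto
  obtain K where K: "K holomorphic_on ball 0 r'" "!!z. z \<in> ball 0 r' ==> (\<phi> u ^^ p) z = z * (1 + z ^ p * K z)"
   by (rule parabolic_iterate_factor[OF s'(3,4) s1(6)[OF u'(2)] s1(7)[OF u'(2)] s1(8)[OF u'(2)] p(1,2) p(3) s'(6)[OF u'(1)]])
    (assumption+, rule that)
  have bd: "norm (K x - h x) \<le> norm A / 20" if x: "x \<in> sphere 0 r2" for x
  proof -
   have x': "x \<in> ball 0 r'" "norm x < e" "norm x = r2" using x r2 by auto
   have "(\<phi> 0 ^^ p) x = x * (1 + x ^ p * h x)" using M(5)[OF x'(2)] by (simp add: phi_0_iter)
   hence "(\<phi> u ^^ p) x - (\<phi> 0 ^^ p) x = x ^ (p + 1) * (K x - h x)" using K(2)[OF x'(1)] by (simp add: algebra_simps)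
   hence "r2 ^ (p + 1) * norm (K x - h x) < norm A / 20 * r2 ^ (p + 1)"
    using s2(3)[OF u x] x'(3) by (simp add: norm_mult norm_power)
   hence "r2 ^ (p + 1) * norm (K x - h x) < r2 ^ (p + 1) * (norm A / 20)" by (simp only: mult.commute)
   thus ?thesis using r2 by (simp only: mult_less_cancel_left_pos zero_less_power less_imp_le)
  qed
  have "norm ((%x. K x - h x) z) \<le> norm A / 20"
  proof (rule maximum_modulus_frontier[of "%x. K x - h x" "cball 0 r2"])
   have kh: "(%x. K x - h x) holomorphic_on cball 0 r2"
    by (intro holomorphic_intros holomorphic_on_subset[OF K(1)] holomorphic_on_subset[OF M(2)]) (use r2 in auto)
   show "(%x. K x - h x) holomorphic_on interior (cball 0 r2)" by (rule holomorphic_on_subset[OF kh]) (use interior_subset in blast)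
   show "continuous_on (closure (cball 0 r2)) (%x. K x - h x)" using holomorphic_on_imp_continuous_on[OF kh] by simp
  qed (use bd z in \<open>auto simp: frontier_cball\<close>)
  moreover have "norm (h z - A) < norm A / 20" using e1(2)[of z] z r2 by (simp add: dist_norm)
  moreover have "norm (K z - A) \<le> norm (K z - h z) + norm (h z - A)"
   using norm_triangle_ineq[of "K z - h z" "h z - A"] by simp
  ultimately have "norm (K z - A) \<le> norm A / 10" by linarith
  moreover have "(\<phi> u ^^ p) z = z * (1 + z ^ p * K z)" using K(2)[of z] z r2 by simp
  ultimately show "\<exists>K. norm (K - A) \<le> norm A / 10 \<and> (\<phi> u ^^ p) z = z * (1 + z ^ p * K)" by blast
 qed
qed

end

section \<open>The corrected orbit is a motion, and its leading term\<close>

context hat_family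
begin

lemma h_Suc_holomorphic:
 assumes "h n holomorphic_on ball 0 s" "!!u. u \<in> ball 0 s ==> h n u \<in> D" "s \<le> s0"
 shows "h (Suc n) holomorphic_on ball 0 s"
proof -
 have fh: "(%u. f (h n u)) holomorphic_on ball 0 s"
  by (rule holomorphic_on_compose_gen[OF assms(1) hol_f, unfolded o_def]) (use assms(2) in auto)
 have sub: "ball (0::complex) s \<subseteq> ball 0 s0" using assms(3) by auto
 note hs = holomorphic_on_subset[OF hol_al sub] holomorphic_on_subset[OF hol_be sub] holomorphic_on_subset[OF hol_la sub]
 show ?thesis
 proof (cases "q dvd Suc n")
  case True
  have "(%u. corr u (f (h n u) + (c + u))) holomorphic_on ball 0 s"
   unfolding corr_def by (intro holomorphic_intros fh hs)
  thus ?thesis by (rule holomorphic_transform) (use True in simp)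
 next
  case False
  have "(%u. f (h n u) + (c + u)) holomorphic_on ball 0 s" by (intro holomorphic_intros fh)
  thus ?thesis by (rule holomorphic_transform) (use False in simp)
 qed
qed

lemma holomorphic_ball_tendsto:
 assumes "g holomorphic_on ball 0 (s::real)" "s > 0"
 shows "(g \<longlongrightarrow> g 0) (nhds (0::complex))"
proof -
 have "isCont g 0"
  using assms continuous_on_eq_continuous_at[OF open_ball] holomorphic_on_imp_continuous_on by (metis centre_in_ball)
 thus ?thesis using tendsto_at_iff_tendsto_nhds[of g 0] by (simp add: isCont_def)
qed

lemma nhds_ball:
 assumes "\<forall>\<^sub>F u in nhds (0::complex). P u"
 obtains s where "s > 0" "!!u. u \<in> ball 0 s ==> P u"
proof -
 obtain S where S: "open S" "0 \<in> S" "!!u. u \<in> S ==> P u" using assms unfolding eventually_nhds by blast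
 obtain s where "s > 0" "ball 0 s \<subseteq> S" by (rule openE[OF S(1,2)])
 thus thesis using S(3) that by blast
qed

lemma h_initial:
 assumes s2: "0 < s2" "s2 \<le> s0"
 shows "\<exists>s>0. s \<le> s2 \<and> (\<forall>m\<le>n. h m holomorphic_on ball 0 s \<and> (\<forall>u\<in>ball 0 s. h m u \<in> D))"
proof (induction n)
 case 0
 have "c \<in> D" using C_in[of 0] by simp
 then obtain e where e: "e > 0" "ball c e \<subseteq> D" using open_D openE by blast
 have "(%u. c + u) holomorphic_on ball 0 (min e s2)" by (intro holomorphic_intros)
 hence "h 0 holomorphic_on ball 0 (min e s2)" by (rule holomorphic_transform) simp
 moreover have "h 0 u \<in> D" if "u \<in> ball 0 (min e s2)" for u
  using that by (auto intro!: subsetD[OF e(2)] simp: dist_norm)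
 ultimately have "\<forall>m\<le>0. h m holomorphic_on ball 0 (min e s2) \<and> (\<forall>u\<in>ball 0 (min e s2). h m u \<in> D)"
  by (metis le_zero_eq)
 thus ?case using e(1) s2(1) by (intro exI[of _ "min e s2"]) (simp only: min_less_iff_conj min.cobounded2 simp_thms)
next
 case (Suc n)
 then obtain s where s: "s > 0" "s \<le> s2" "!!m. m \<le> n ==> h m holomorphic_on ball 0 s"
  "!!m u. m \<le> n ==> u \<in> ball 0 s ==> h m u \<in> D" by blast
 have hs: "h (Suc n) holomorphic_on ball 0 s"
  by (rule h_Suc_holomorphic[OF s(3)[OF order_refl] s(4)[OF order_refl]]) (use s s2 in auto)
 have "\<forall>\<^sub>F u in nhds 0. h (Suc n) u \<in> D"
  by (rule topological_tendstoD[OF holomorphic_ball_tendsto[OF hs s(1)] open_D]) (use C_in[of "Suc n"] in \<open>simp only: h_0\<close>)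
 then obtain s' where s': "s' > 0" "!!u. u \<in> ball 0 s' ==> h (Suc n) u \<in> D" by (rule nhds_ball) (rule that)
 have sub: "ball (0::complex) (min s s') \<subseteq> ball 0 s" by auto
 have "h m holomorphic_on ball 0 (min s s') \<and> (\<forall>u\<in>ball 0 (min s s'). h m u \<in> D)" if "m \<le> Suc n" for m
 proof (cases "m = Suc n")
  case True
  show ?thesis unfolding True using holomorphic_on_subset[OF hs sub] s'(2) by auto
 next
  case False
  hence "m \<le> n" using that by simp
  from holomorphic_on_subset[OF s(3)[OF this] sub] s(4)[OF this] show ?thesis by auto
 qed
 thus ?case using s(1,2) s'(1) by (intro exI[of _ "min s s'"]) auto
qed

text \<open>At parameter 0 the returns enter the region where the real part of \<open>Wf\<close>
  exceeds \<open>R\<close>. By continuity \<open>p\<close> consecutive returns do so for all small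
  parameters, and \<open>petal_step\<close> pushes every later return further right. This yields
  values in the domain and uniform convergence to the cycle, and the strict growth excludes
  repetitions within one phase.\<close>

lemma hat_motion: obtains r where "motion c r h"
proof -
 obtain s2 r2 A where E: "0 < s2" "s2 \<le> s0" "0 < r2" "A ~= 0"
  "!!u z. u \<in> ball 0 s2 ==> z \<in> ball 0 r2 ==> orb (c + u) q (al u + z)"
  "!!u z. u \<in> ball 0 s2 ==> z \<in> ball 0 r2 ==> \<exists>K. norm (K - A) \<le> norm A / 10 \<and> (\<phi> u ^^ p) z = z * (1 + z ^ p * K)"
  "(%k. Wf A (\<epsilon> (k * q)) / of_nat k) \<longlonglongrightarrow> 1 / of_nat p"
  by (rule hat_expansion) (rule that)
 obtain R0 where R0: "R0 > 0"
  "!!z K. norm (K - A) \<le> norm A / 10 ==> Re (Wf A z) \<ge> R0 ==> Re (Wf A (z * (1 + z ^ p * K))) \<ge> Re (Wf A z) + 1 / 2"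
  by (rule petal_step[OF p(1) E(4)]) (rule that)
 obtain R1 where R1: "R1 > 0" "!!z. Re (Wf A z) \<ge> R1 ==> norm z < r2"
  by (rule petal_coordinate_small[OF p(1) E(4,3)]) (rule that)
 define R where "R = max R0 R1"
 have R: "R > 0" "R \<ge> R0" "R \<ge> R1" using R0 by (auto simp: R_def)
 obtain k0 where k0: "!!k. k \<ge> k0 ==> Re (Wf A (\<epsilon> (k * q))) > R"
 proof -
  have "(%k. Re (Wf A (\<epsilon> (k * q)) / of_nat k)) \<longlonglongrightarrow> Re (1 / of_nat p)" by (rule tendsto_Re[OF E(7)])
  moreover have "Re (1 / of_nat p) > 0" using p by simp
  ultimately have "filterlim (%k. Re (Wf A (\<epsilon> (k * q)) / of_nat k) * real k) at_top sequentially"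
   by (rule filterlim_tendsto_pos_mult_at_top[OF _ _ filterlim_real_sequentially])
  hence "\<forall>\<^sub>F k in sequentially. Re (Wf A (\<epsilon> (k * q)) / of_nat k) * real k > R"
   by (simp only: filterlim_at_top_dense)
  hence "\<forall>\<^sub>F k in sequentially. Re (Wf A (\<epsilon> (k * q))) > R"
   using eventually_gt_at_top[of 0]
  proof eventually_elim
   case (elim k)
   have "Re (x / of_nat k) * real k = Re x" for x using elim(2) by (simp add: Re_divide_of_nat)
   from this[of "Wf A (\<epsilon> (k * q))"] elim(1) show ?case by (simp only:)
  qed
  thus ?thesis unfolding eventually_at_top_linorder using that by blast
 qed
 define n0 where "n0 = k0 * q"
 have aan: "aa (n0 + t * q) = aa 0" for t using aa_mult[of 0 "k0 + t"] by (simp add: n0_def algebra_simps)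
 obtain s3 where s3: "s3 > 0" "s3 \<le> s2" "!!m. m \<le> n0 + p * q ==> h m holomorphic_on ball 0 s3"
  "!!m u. m \<le> n0 + p * q ==> u \<in> ball 0 s3 ==> h m u \<in> D"
  using h_initial[OF E(1,2), of "n0 + p * q"] by blast
 have all: "(al \<longlongrightarrow> aa 0) (nhds 0)" using holomorphic_ball_tendsto[OF hol_al s0] by (simp add: at0)
 have "\<forall>\<^sub>F u in nhds 0. \<forall>j\<in>{..<p}. Re (Wf A (h (n0 + j * q) u - al u)) > R"
 proof (intro eventually_ball_finite ballI)
  fix j assume j: "j \<in> {..<p}"
  have le: "n0 + j * q \<le> n0 + p * q" using j by simp
  have "((%u. Re (Wf A (h (n0 + j * q) u - al u))) \<longlongrightarrow> Re (Wf A (h (n0 + j * q) 0 - aa 0))) (nhds 0)"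
  proof (intro tendsto_intros all holomorphic_ball_tendsto[OF s3(3)[OF le] s3(1)])
   have "h (n0 + j * q) 0 - aa 0 ~= 0" using C_neq by (simp add: h_0)
   thus "of_nat p * A * (h (n0 + j * q) 0 - aa 0) ^ p ~= 0" using p E(4) by simp
  qed
  moreover have "Re (Wf A (h (n0 + j * q) 0 - aa 0)) > R"
   using k0[of "k0 + j"] aan[of j] by (simp add: h_0 \<epsilon>_def n0_def algebra_simps)
  ultimately show "\<forall>\<^sub>F u in nhds 0. Re (Wf A (h (n0 + j * q) u - al u)) > R" by (rule order_tendstoD)
 qed simp
 then obtain s4' where s4': "s4' > 0" "!!u. u \<in> ball 0 s4' ==> \<forall>j\<in>{..<p}. Re (Wf A (h (n0 + j * q) u - al u)) > R"
  by (rule nhds_ball) (rule that)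
 define s4 where "s4 = min s3 s4'"
 have s4: "s4 > 0" "s4 \<le> s3" "s4 \<le> s4'" using s3 s4' by (auto simp: s4_def)
 have n0q: "q dvd n0" by (simp add: n0_def)
 have step: "Re (Wf A (h (n + p * q) u - al u)) \<ge> Re (Wf A (h n u - al u)) + 1/2"
  if u: "u \<in> ball 0 s4" and n: "q dvd n" "Re (Wf A (h n u - al u)) > R" for u n
 proof -
  have u2: "u \<in> ball 0 s2" using u s4 s3 by auto
  have "h n u - al u \<in> ball 0 r2" using R1(2)[of "h n u - al u"] n R by simp
  then obtain K where K: "norm (K - A) \<le> norm A / 10" "(\<phi> u ^^ p) (h n u - al u) = (h n u - al u) * (1 + (h n u - al u) ^ p * K)"
   using E(6)[OF u2] by blast
  show ?thesis unfolding h_phi_iter[OF n(1)] K(2) by (rule R0(2)[OF K(1)]) (use n R in simp)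
 qed
 have grow: "Re (Wf A (h (n + k * (p * q)) u - al u)) \<ge> Re (Wf A (h n u - al u)) + k / 2"
  if u: "u \<in> ball 0 s4" and n: "q dvd n" "Re (Wf A (h n u - al u)) > R" for u n k
 proof (induction k)
  case (Suc k)
  have e: "n + Suc k * (p * q) = (n + k * (p * q)) + p * q" by simp
  have "Re (Wf A (h (n + k * (p * q)) u - al u)) > R" using Suc n(2) by simp
  from step[OF u _ this] n(1) have "Re (Wf A (h (n + Suc k * (p * q)) u - al u)) \<ge> Re (Wf A (h (n + k * (p * q)) u - al u)) + 1/2"
   unfolding e by simp
  thus ?case using Suc by (simp add: field_simps)
 qed simp
 have big: "Re (Wf A (h (n0 + t * q) u - al u)) > R + real (t div p) / 2" if u: "u \<in> ball 0 s4" for u t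
 proof -
  have j: "t mod p < p" using p by simp
  have "u \<in> ball 0 s4'" using u s4 by auto
  from s4'(2)[OF this] j have "Re (Wf A (h (n0 + (t mod p) * q) u - al u)) > R" by blast
  note g = grow[OF u _ this, of "t div p"]
  have "n0 + (t mod p) * q + (t div p) * (p * q) = n0 + t * q"
   by (metis (no_types) add.assoc add_mult_distrib mod_mult_div_eq mult.assoc mult.commute)
  with g n0q \<open>Re (Wf A (h (n0 + (t mod p) * q) u - al u)) > R\<close> show ?thesis by simp
 qed
 have dec: "h (n0 + n) u = it (c + u) (n mod q) (al u + (h (n0 + (n div q) * q) u - al u))" for n u
 proof -
  have "h ((n0 + (n div q) * q) + n mod q) u = it (c + u) (n mod q) (h (n0 + (n div q) * q) u)"
   by (rule h_it) (use n0q q in auto)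
  hence "h (n0 + n) u = it (c + u) (n mod q) (h (n0 + (n div q) * q) u)"
   by (simp only: add.assoc div_mult_mod_eq)
  thus ?thesis by simp
 qed
 have hD: "h n u \<in> D" if u: "u \<in> ball 0 s4" for n u
 proof (cases "n \<le> n0")
  case True
  thus ?thesis using s3(4)[of n u] u s4 by simp
 next
  case False
  define t where "t = (n - n0) div q"
  have "h (n0 + t * q) u - al u \<in> ball 0 r2"
   using R1(2)[of "h (n0 + t * q) u - al u"] big[OF u, of t] R by simp
  have "u \<in> ball 0 s2" using u s4(2) s3(2) by simp
  from E(5)[OF this \<open>h (n0 + t * q) u - al u \<in> ball 0 r2\<close>]
  have "orb (c + u) q (al u + (h (n0 + t * q) u - al u))" .
  hence "it (c + u) ((n - n0) mod q) (al u + (h (n0 + t * q) u - al u)) \<in> D" using q by (simp add: orb_def)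
  thus ?thesis using dec[of "n - n0" u] False by (simp add: t_def)
 qed
 have hhol: "h n holomorphic_on ball 0 s4" for n
 proof (induction n)
  case 0
  show ?case by (auto intro!: holomorphic_intros)
 next
  case (Suc n)
  show ?case by (rule h_Suc_holomorphic[OF Suc hD]) (use s4 s3 E in auto)
 qed
 have near: "\<exists>n1 r1. r1 > 0 \<and> (\<forall>n\<ge>n1. \<forall>u. norm u < r1 \<longrightarrow> dist (h n u) (aa n) < e)" if e: "e > 0" for e
 proof -
  have "\<forall>\<^sub>F x in nhds (0, 0). \<forall>i\<in>{..<q}. dist (it (c + fst x) i (al (fst x) + snd x)) (aa i) < e"
  proof (intro eventually_ball_finite ballI)
   fix i
   have "((%x. it (c + fst x) i (al (fst x) + snd x)) \<longlongrightarrow> it c i (aa 0)) (nhds (0, 0))"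
    by (rule it_tendsto[OF cyc_orb[OF cy] c_lim al_lim])
   hence "((%x. it (c + fst x) i (al (fst x) + snd x)) \<longlongrightarrow> aa i) (nhds (0, 0))"
    using cyc_it[OF cy, of i 0] by simp
   from tendstoD[OF this e] show "\<forall>\<^sub>F x in nhds (0, 0). dist (it (c + fst x) i (al (fst x) + snd x)) (aa i) < e" .
  qed simp
  then obtain s5 r5 where s5: "s5 > 0" "r5 > 0"
   "!!u z. u \<in> ball 0 s5 ==> z \<in> ball 0 r5 ==> \<forall>i\<in>{..<q}. dist (it (c + u) i (al u + z)) (aa i) < e"
   by (rule eventually_nhds_balls) (use that in auto)
  obtain R5 where R5: "R5 > 0" "!!z. Re (Wf A z) \<ge> R5 ==> norm z < r5"
   by (rule petal_coordinate_small[OF p(1) E(4) s5(2)]) (rule that)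
  obtain k1 :: nat where k1: "real k1 \<ge> 2 * R5" using real_arch_simple by blast
  show ?thesis
  proof (intro exI[of _ "n0 + (k1 * p) * q"] exI[of _ "min s4 s5"] conjI allI impI)
   show "min s4 s5 > 0" using s4 s5 by simp
   fix n and u :: complex assume n: "n \<ge> n0 + (k1 * p) * q" and u: "norm u < min s4 s5"
   define t where "t = (n - n0) div q"
   have "t \<ge> k1 * p" unfolding t_def using n q by (simp add: less_eq_div_iff_mult_less_eq)
   hence "t div p \<ge> k1" using p by (simp add: less_eq_div_iff_mult_less_eq)
   hence "real (t div p) \<ge> 2 * R5" using k1 by linarith
   hence "Re (Wf A (h (n0 + t * q) u - al u)) \<ge> R5" using big[of u t] u R by simp
   hence "h (n0 + t * q) u - al u \<in> ball 0 r5" using R5(2) by simp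
   have "u \<in> ball 0 s5" using u by simp
   from s5(3)[OF this \<open>h (n0 + t * q) u - al u \<in> ball 0 r5\<close>]
   have "dist (it (c + u) ((n - n0) mod q) (al u + (h (n0 + t * q) u - al u))) (aa ((n - n0) mod q)) < e"
    by (rule bspec) (use q in simp)
   moreover have "aa ((n - n0) mod q) = aa n"
   proof -
    have "k0 * q \<le> n" using n by (simp add: n0_def)
    hence "(n - k0 * q) mod q = n mod q" by (metis le_add_diff_inverse2 mod_mult_self1)
    thus ?thesis using cyc_eq_iff[OF cy, of "(n - n0) mod q" n] by (simp add: n0_def)
   qed
   ultimately show "dist (h n u) (aa n) < e" using dec[of "n - n0" u] n by (simp add: t_def)
  qed
 qed
 obtain s where s: "s > 0" "!!i j. aa i ~= aa j ==> dist (aa i) (aa j) \<ge> s" by (rule cycle_separated) (rule that)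
 obtain n1 r1 where n1: "r1 > 0" "!!n u. n \<ge> n1 ==> norm u < r1 ==> dist (h n u) (aa n) < s / 2"
  using near[OF half_gt_zero[OF s(1)]] by blast
 define r where "r = min s4 r1"
 have r: "r > 0" "r \<le> s4" "r \<le> r1" using s4 n1 by (auto simp: r_def)
 have ne: "h n u ~= h m u" if u: "u \<in> ball 0 r" and nm: "n \<ge> n0 + n1" "n < m" for n m u
 proof
  assume eq: "h n u = h m u"
  have u4: "u \<in> ball 0 s4" using u r by auto
  have "dist (h n u) (aa n) < s / 2" "dist (h n u) (aa m) < s / 2"
   using n1(2)[of n u] n1(2)[of m u] nm u r eq by auto
  hence "dist (aa n) (aa m) < s" by (metis dist_triangle_half_r)
  hence "aa n = aa m" using s(2)[of n m] by fastforce
  hence md: "n mod q = m mod q" using cyc_eq_iff[OF cy] by simp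
  then obtain l where l: "m = n + l * q" using nm by (metis mod_eq_dvd_iff_nat dvd_def le_add_diff_inverse less_imp_le mult.commute)
  have l1: "l \<ge> 1" using nm l by (cases l) auto
  \<comment> \<open>Waiting \<open>i\<close> steps moves the coincidence to a time divisible by
    \<open>q\<close>, where it contradicts the growth in the petal coordinate.\<close>
  define i where "i = q - n mod q"
  define n' where "n' = n + i"
  have "(n + i) mod q = (n mod q + i) mod q" by (simp add: mod_simps)
  also have "n mod q + i = q" using q by (simp add: i_def less_imp_le)
  finally have dv: "q dvd n'" by (simp add: n'_def mod_0_imp_dvd)
  have per: "h (n' + t * (l * q)) u = h n' u" for t
  proof (induction t)
   case (Suc t)
   have "h (n' + l * q) u = h n' u"
    using h_det[OF md eq, of i] by (simp add: n'_def l algebra_simps)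
   moreover have "(n' + l * q) mod q = n' mod q" by simp
   ultimately have "h (n' + l * q + t * (l * q)) u = h (n' + t * (l * q)) u" by (intro h_det) auto
   thus ?case using Suc by (simp add: algebra_simps)
  qed simp
  have "n' \<ge> n0" using nm by (simp add: n'_def)
  then obtain t where t: "n' = n0 + t * q" using dv n0q
   by (metis dvd_diff_nat dvd_def le_add_diff_inverse mult.commute)
  have "Re (Wf A (h n' u - al u)) > R + real (t div p) / 2" unfolding t by (rule big[OF u4])
  hence "Re (Wf A (h n' u - al u)) > R" by simp
  from grow[OF u4 dv this, of l] per[of p] l1 show False
   by (simp add: mult.commute mult.left_commute)
 qed
 obtain r' where "motion c r' h"
 proof (rule motion_from_tail[OF orb_C inj_C cyc_range(2)[OF cy] _ C_notin r(1), of h "n0 + n1"])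
  show "range aa \<subseteq> D" using aa_in by auto
  show "h n holomorphic_on ball 0 r" for n by (rule holomorphic_on_subset[OF hhol]) (use r in auto)
  show "h n 0 = it c n c" for n by (rule h_0)
  show "inj_on (%n. h n u) {n0 + n1..}" if "u \<in> ball 0 r" for u
   using ne[OF that] by (intro inj_onI) (metis atLeast_iff linorder_neqE_nat)
  show "\<exists>n1 r1. r1 > 0 \<and> (\<forall>n\<ge>n1. \<forall>u. norm u < r1 \<longrightarrow> (\<exists>a\<in>range aa. dist (h n u) a < e))" if e: "e > 0" for e
   using near[OF e] by blast
 qed (rule that)
 thus thesis by (rule that)
qed

text \<open>Each block of \<open>q\<close> consecutive steps contains exactly one
  correction.\<close>

lemma one_multiple:
 fixes w :: "nat => complex"
 assumes "r < q"
 shows "(\<Sum>j<q. if q dvd Suc (k * q + r + j) then w (Suc (k * q + r + j)) else 0) = w ((k + 1) * q)"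
proof -
 have "(if q dvd Suc (k * q + r + j) then w (Suc (k * q + r + j)) else 0) = (if j = q - 1 - r then w ((k + 1) * q) else 0)" if "j < q" for j
 proof (cases "j = q - 1 - r")
  case True
  hence "Suc (k * q + r + j) = (k + 1) * q" using assms by simp
  hence e: "q dvd Suc (k * q + r + j)" "w (Suc (k * q + r + j)) = w ((k + 1) * q)" by (metis dvd_triv_right, simp only:)
  thus ?thesis using True by (simp only: if_True simp_thms)
 next
  case False
  have "\<not> q dvd Suc (k * q + r + j)"
  proof
   assume "q dvd Suc (k * q + r + j)"
   hence "q dvd k * q + Suc (r + j)" by (simp add: add.assoc)
   hence "q dvd Suc (r + j)" by (simp only: dvd_add_right_iff[OF dvd_triv_right])
   then obtain l where l: "Suc (r + j) = q * l" by (elim dvdE)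
   have "q * l < q * 2" using l that assms by linarith
   hence "l < 2" by simp
   moreover have "l ~= 0" using l by (cases l) auto
   ultimately have "l = 1" by linarith
   thus False using l False assms by simp
  qed
  thus ?thesis using False by simp
 qed
 hence "(\<Sum>j<q. if q dvd Suc (k * q + r + j) then w (Suc (k * q + r + j)) else 0) = (\<Sum>j<q. if j = q - 1 - r then w ((k + 1) * q) else 0)"
  by (intro sum.cong) auto
 also have "\<dots> = w ((k + 1) * q)" using assms by (simp add: sum.delta)
 finally show ?thesis .
qed

text \<open>The corrected orbit is compared with the true orbit of c + u, so b = 1. To leading order
  a correction \<eta>0 + \<eta>1 \<epsilon> enters once per period, hence \<open>Z\<close>, which is
  \<rho> y, accumulates \<eta>0 \<rho> + \<eta>1 \<tau> at the multiples of \<open>q\<close>. For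
  \<kappa> = 1 its increment over a period is \<eta>0 \<rho>, of order n^2; otherwise
  \<open>Z\<close> itself is asymptotic to a multiple of \<eta>1 n^2, and the twist by 1/\<kappa>
  does not cancel it. In both cases this is the order \<iota> + 1 = 2 at which tangency forbids a
  nonzero coefficient.\<close>

lemma hat_contradiction:
 assumes tg: "tangent \<alpha>"
  and \<eta>0: "((%u. (al u - be u) / u ^ dg) \<longlongrightarrow> \<eta>0) (at 0)"
  and \<eta>1: "((%u. (la u - 1) / u ^ dg) \<longlongrightarrow> \<eta>1) (at 0)"
  and cs: "\<kappa> ~= 1 \<and> \<eta>0 = 0 \<or> \<kappa> = 1 \<and> \<eta>1 = 0"
 shows "\<eta>0 = 0 \<and> \<eta>1 = 0"
proof -
 obtain r where mot: "motion c r h" by (rule hat_motion) (rule that)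
 have r: "r > 0" and hhol: "!!n. h n holomorphic_on ball 0 r" using mot by (auto simp: motion_def)
 have \<iota>: "\<iota> = 1"
 proof -
  have "norm \<kappa> ^ p = 1" using p(2) by (metis norm_one norm_power)
  hence "norm \<kappa> = 1" using power_eq_imp_eq_base[of "norm \<kappa>" p 1] p(1) by simp
  thus ?thesis by (simp add: \<iota>_def)
 qed
 define cc where "cc = (%n u. it (c + u) n (c + u))"
 define w where "w = (%m. \<eta>0 * \<rho> m + \<eta>1 * \<tau> m)"
 define Z where "Z = (%n. \<Sum>m<n. if q dvd Suc m then w (Suc m) else 0)"
 define y where "y = (%n. Z n / \<rho> n)"
 have y0: "y 0 = 0" by (simp add: y_def Z_def)
 have ySuc: "y (Suc n) = deriv f (it c n c) * y n + (if q dvd Suc n then \<eta>0 + \<eta>1 * \<epsilon> (Suc n) else 0)" for n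
 proof -
  have "y (Suc n) = Z n / \<rho> (Suc n) + (if q dvd Suc n then \<eta>0 + \<eta>1 * \<epsilon> (Suc n) else 0)"
   using \<rho>_nz[of "Suc n"] by (simp add: y_def Z_def w_def \<tau>_def add_divide_distrib)
  moreover have "Z n / \<rho> (Suc n) = deriv f (it c n c) * y n"
   using \<rho>_nz[of "Suc n"] df_C[of n] by (simp add: y_def \<rho>_Suc[of n])
  ultimately show ?thesis by simp
 qed
 have at_le: "at (0::complex) \<le> nhds 0" by (simp add: at_within_def)
 have hl: "(h n \<longlongrightarrow> it c n c) (at 0)" for n
  using tendsto_mono[OF at_le holomorphic_ball_tendsto[OF hhol r]] by (simp only: h_0)
 have cul: "((%u. c + u) \<longlongrightarrow> c) (at 0)"
  using tendsto_add[OF tendsto_const[of c] tendsto_ident_at[of 0 UNIV]] by simp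
 have ccl: "(cc n \<longlongrightarrow> it c n c) (at 0)" for n
  unfolding cc_def by (rule it_tendsto[OF orb_C cul cul])
 have bel: "(be \<longlongrightarrow> aa 0) (at 0)"
  using tendsto_mono[OF at_le holomorphic_ball_tendsto[OF hol_be s0]] by (simp only: at0)
 have yl: "((%u. (h n u - cc n u) / u ^ dg) \<longlongrightarrow> y n) (at 0)" for n
 proof (induction n)
  case 0
  show ?case by (simp add: cc_def y0)
 next
  case (Suc n)
  obtain Qt where Qt: "(Qt \<longlongrightarrow> deriv f (it c n c)) (at 0)" "!!u. f (h n u) - f (cc n u) = Qt u * (h n u - cc n u)"
   by (rule strict_derivative_factor[OF hol_f open_D C_in hl ccl]) (rule that)
  have l1: "((%u. (f (h n u) - f (cc n u)) / u ^ dg) \<longlongrightarrow> deriv f (it c n c) * y n) (at 0)"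
   using tendsto_mult[OF Qt(1) Suc] by (simp add: Qt(2))
  have ccS: "cc (Suc n) u = f (cc n u) + (c + u)" for u by (simp add: cc_def it_Suc del: funpow.simps(2))
  show ?case
  proof (cases "q dvd Suc n")
   case True
   have aaS: "aa (Suc n) = aa 0" using cyc_eq_iff[OF cy, of "Suc n" 0] True by simp
   have fl: "((%u. f (h n u) + (c + u)) \<longlongrightarrow> f (it c n c) + c) (at 0)"
    by (intro tendsto_add cul isCont_tendsto_compose[OF f_isCont[OF C_in] hl])
   have "((%u. (f (h n u) - f (cc n u)) / u ^ dg + ((al u - be u) / u ^ dg + (la u - 1) / u ^ dg * ((f (h n u) + (c + u)) - be u)))
    \<longlongrightarrow> deriv f (it c n c) * y n + (\<eta>0 + \<eta>1 * ((f (it c n c) + c) - aa 0))) (at 0)"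
    by (intro tendsto_add tendsto_mult tendsto_diff l1 \<eta>0 \<eta>1 fl bel)
   also have "deriv f (it c n c) * y n + (\<eta>0 + \<eta>1 * ((f (it c n c) + c) - aa 0)) = y (Suc n)"
    using True by (simp add: ySuc \<epsilon>_def aaS it_Suc del: funpow.simps(2))
   also have "(%u. (f (h n u) - f (cc n u)) / u ^ dg + ((al u - be u) / u ^ dg + (la u - 1) / u ^ dg * ((f (h n u) + (c + u)) - be u)))
     = (%u. (h (Suc n) u - cc (Suc n) u) / u ^ dg)"
   proof
    fix u
    have e: "h (Suc n) u - cc (Suc n) u = (f (h n u) - f (cc n u)) + ((al u - be u) + (la u - 1) * ((f (h n u) + (c + u)) - be u))"
     using True by (simp add: ccS corr_def algebra_simps)
    show "(f (h n u) - f (cc n u)) / u ^ dg + ((al u - be u) / u ^ dg + (la u - 1) / u ^ dg * ((f (h n u) + (c + u)) - be u))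
     = (h (Suc n) u - cc (Suc n) u) / u ^ dg"
     unfolding e by (simp add: add_divide_distrib)
   qed
   finally show ?thesis .
  next
   case False
   have "h (Suc n) u - cc (Suc n) u = f (h n u) - f (cc n u)" for u using False by (simp add: ccS)
   thus ?thesis using l1 False by (simp only: ySuc if_False add_0_right)
  qed
 qed
 have Zy: "\<rho> n * y n = Z n" for n using \<rho>_nz[of n] by (simp add: y_def)
 have dy: "\<delta> y (n + q) = Z (n + q) - Z n / \<kappa>" for n by (simp add: \<delta>_def Zy)
 have Zq: "Z (k * q + r + q) - Z (k * q + r) = w ((k + 1) * q)" if "r < q" for k r
 proof -
  have "Z (m + j) - Z m = (\<Sum>i<j. if q dvd Suc (m + i) then w (Suc (m + i)) else 0)" for m j
   unfolding Z_def by (induction j) auto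
  thus ?thesis using one_multiple[OF that] by simp
 qed
 have q0: "real q > 0" using q by simp
 have contr: "\<sigma> = 0" if "(%n. \<delta> y (n + q) / of_nat (n + q) ^ 2) \<longlonglongrightarrow> \<sigma>" for \<sigma>
 proof (rule motion_contradiction[OF tg mot ccl _ _ yl])
  show "\<forall>\<^sub>F u in at 0. f (cc n u) = cc (Suc n) u - cc 0 u" for n
   by (rule always_eventually) (simp add: cc_def it_Suc del: funpow.simps(2))
  show "cc 0 u = c + 1 * u" for u by (simp add: cc_def)
  have "(%n. \<delta> y n / of_nat n ^ 2) \<longlonglongrightarrow> \<sigma>" using that by (rule LIMSEQ_offset)
  thus "(%n. \<delta> y n / of_nat n ^ (\<iota> + 1)) \<longlonglongrightarrow> \<sigma>" by (simp add: \<iota> numeral_2_eq_2)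
 qed
 show ?thesis
 proof (cases "\<kappa> = 1")
  case True
  hence e1: "\<eta>1 = 0" using cs by simp
  obtain K where K: "K ~= 0" "(%k. \<rho> (k * q) / of_nat (k * q) ^ 2) \<longlonglongrightarrow> K" by (rule \<rho>_lim[OF True]) (rule that)
  have "(%n. \<delta> y (n + q) / of_nat (n + q) ^ 2) \<longlonglongrightarrow> \<eta>0 * K"
  proof (rule tendsto_residues[OF q, of _ 0])
   fix r assume r: "r < q"
   have l1: "(%k. \<rho> ((k + 1) * q) / of_nat ((k + 1) * q) ^ 2) \<longlonglongrightarrow> K"
    using LIMSEQ_ignore_initial_segment[OF K(2), of 1] .
   have "(%k. (real k + 1) * real q / (real k * real q + real r + real q)) \<longlonglongrightarrow> 1" using q0 by real_asymp
   from tendsto_of_real[OF this, where 'a = complex]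
   have l2: "(%k. of_nat ((k + 1) * q) / of_nat (k * q + r + q)) \<longlonglongrightarrow> (1 :: complex)" by (simp add: algebra_simps)
   have "(%k. \<eta>0 * (\<rho> ((k + 1) * q) / of_nat ((k + 1) * q) ^ 2) * (of_nat ((k + 1) * q) / of_nat (k * q + r + q)) ^ 2) \<longlonglongrightarrow> \<eta>0 * K * 1 ^ 2"
    by (intro tendsto_intros l1 l2)
   moreover have "\<eta>0 * (\<rho> ((k + 1) * q) / of_nat ((k + 1) * q) ^ 2) * (of_nat ((k + 1) * q) / of_nat (k * q + r + q)) ^ 2
    = \<delta> y (0 + k * q + r + q) / of_nat (0 + k * q + r + q) ^ 2" for k
   proof -
    have "of_nat ((k + 1) * q) ~= (0 :: complex)" using q by (simp del: of_nat_mult of_nat_add)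
    moreover have "\<delta> y (k * q + r + q) = \<eta>0 * \<rho> ((k + 1) * q)"
     unfolding dy using Zq[OF r, of k] True by (simp add: w_def e1)
    ultimately show ?thesis by (simp add: power_divide del: of_nat_mult of_nat_add)
   qed
   ultimately show "(%k. \<delta> y (0 + k * q + r + q) / of_nat (0 + k * q + r + q) ^ 2) \<longlonglongrightarrow> \<eta>0 * K" by simp
  qed
  from contr[OF this] K e1 show ?thesis by simp
 next
  case False
  hence e0: "\<eta>0 = 0" using cs by simp
  obtain K where K: "K ~= 0" "(%n. \<tau> n / of_nat n ^ 1) \<longlonglongrightarrow> K" by (rule \<tau>_lim) (use that in \<open>simp add: \<iota>\<close>)
  have "(%n. (Z (n + q) - Z n) / of_nat n ^ 1) \<longlonglongrightarrow> \<eta>1 * K"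
  proof (rule tendsto_residues[OF q, of _ 0])
   fix r assume r: "r < q"
   have sm: "strict_mono (%k. (k + 1) * q)" using q by (intro strict_monoI) simp
   have l1: "(%k. \<tau> ((k + 1) * q) / of_nat ((k + 1) * q) ^ 1) \<longlonglongrightarrow> K"
    using LIMSEQ_subseq_LIMSEQ[OF K(2) sm] by (simp only: o_def)
   have "(%k. (real k + 1) * real q / (real k * real q + real r)) \<longlonglongrightarrow> 1" using q0 by real_asymp
   from tendsto_of_real[OF this, where 'a = complex]
   have l2: "(%k. of_nat ((k + 1) * q) / of_nat (k * q + r)) \<longlonglongrightarrow> (1 :: complex)" by (simp add: algebra_simps)
   have "(%k. \<eta>1 * (\<tau> ((k + 1) * q) / of_nat ((k + 1) * q) ^ 1) * (of_nat ((k + 1) * q) / of_nat (k * q + r))) \<longlonglongrightarrow> \<eta>1 * K * 1"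
    by (intro tendsto_intros l1 l2)
   moreover have "\<eta>1 * (\<tau> ((k + 1) * q) / of_nat ((k + 1) * q) ^ 1) * (of_nat ((k + 1) * q) / of_nat (k * q + r))
    = (Z (0 + k * q + r + q) - Z (0 + k * q + r)) / of_nat (0 + k * q + r) ^ 1" for k
   proof -
    have "of_nat ((k + 1) * q) ~= (0 :: complex)" using q by (simp del: of_nat_mult of_nat_add)
    thus ?thesis using Zq[OF r, of k] by (simp add: w_def e0 del: of_nat_mult of_nat_add)
   qed
   ultimately show "(%k. (Z (0 + k * q + r + q) - Z (0 + k * q + r)) / of_nat (0 + k * q + r) ^ 1) \<longlonglongrightarrow> \<eta>1 * K" by (simp only: mult_1_right)
  qed
  from stolz_step[OF q _ this] have Zl: "(%n. Z n / of_nat n ^ 2) \<longlonglongrightarrow> \<eta>1 * K / (of_nat q * 2)" by (simp add: numeral_2_eq_2)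
  define S where "S = \<eta>1 * K / (of_nat q * 2)"
  have "(%n. real n / (real n + real q)) \<longlonglongrightarrow> 1" by real_asymp
  from tendsto_of_real[OF this, where 'a = complex]
  have l2: "(%n. of_nat n / of_nat (n + q)) \<longlonglongrightarrow> (1 :: complex)" by simp
  have "(%n. Z (n + q) / of_nat (n + q) ^ 2 - Z n / of_nat n ^ 2 * (of_nat n / of_nat (n + q)) ^ 2 / \<kappa>) \<longlonglongrightarrow> S - S * 1 ^ 2 / \<kappa>"
   unfolding S_def by (intro tendsto_intros Zl l2 \<kappa>0 LIMSEQ_ignore_initial_segment[OF Zl])
  moreover have "\<forall>\<^sub>F n in sequentially. Z (n + q) / of_nat (n + q) ^ 2 - Z n / of_nat n ^ 2 * (of_nat n / of_nat (n + q)) ^ 2 / \<kappa>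
    = \<delta> y (n + q) / of_nat (n + q) ^ 2"
   using eventually_gt_at_top[of 0] by eventually_elim (simp add: dy power_divide diff_divide_distrib)
  ultimately have "(%n. \<delta> y (n + q) / of_nat (n + q) ^ 2) \<longlonglongrightarrow> S - S * 1 ^ 2 / \<kappa>" by (rule Lim_transform_eventually)
  from contr[OF this] have "S * (\<kappa> - 1) = 0" using \<kappa>0 by (simp add: field_simps)
  hence "S = 0" using False by simp
  thus ?thesis using K(1) e0 q by (simp add: S_def)
 qed
qed

end

subsection \<open>Tangency propagates to all parameters\<close>

lemma nonconstant_order:
 fixes g :: "complex => complex"
 assumes hol: "g holomorphic_on ball 0 s" and s: "s > (0::real)" and g0: "g 0 = 0" and u: "u \<in> ball 0 s" "g u ~= 0"
 obtains n \<eta> where "\<eta> ~= 0" "((%u. g u / u ^ n) \<longlongrightarrow> \<eta>) (at 0)"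
proof -
 have nc: "\<not> g constant_on ball 0 s"
 proof
  assume "g constant_on ball 0 s"
  then obtain y where y: "!!x. x \<in> ball 0 s ==> g x = y" unfolding constant_on_def by blast
  show False using y[OF u(1)] y[of 0] g0 u s by simp
 qed
 have zin: "0 \<in> ball (0::complex) s" using s by simp
 obtain k r n where k: "0 < n" "0 < r" "ball (0::complex) r \<subseteq> ball 0 s" "k holomorphic_on ball 0 r"
   "!!w. w \<in> ball 0 r ==> g w = (w - 0) ^ n * k w" "!!w. w \<in> ball 0 r ==> k w ~= 0"
  by (rule holomorphic_factor_zero_nonconstant[OF hol open_ball connected_ball zin g0 nc]) (rule that)
 have "0 \<in> ball (0::complex) r" using k(2) by simp
 hence "isCont k 0" using k(4) continuous_on_eq_continuous_at[OF open_ball] holomorphic_on_imp_continuous_on by metis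
 hence "(k \<longlongrightarrow> k 0) (at 0)" by (simp add: isCont_def)
 moreover have "\<forall>\<^sub>F u in at 0. k u = g u / u ^ n"
 proof -
  have "\<forall>\<^sub>F u in at 0. u \<in> ball (0::complex) r" using k(2) by (intro eventually_at_in_open') auto
  moreover have "\<forall>\<^sub>F u in at (0::complex). u ~= 0" by (rule eventually_neq_at_within)
  ultimately show ?thesis by eventually_elim (simp add: k(5))
 qed
 ultimately have "((%u. g u / u ^ n) \<longlongrightarrow> k 0) (at 0)" by (rule Lim_transform_eventually)
 moreover have "k 0 ~= 0" using k(2,6) by simp
 ultimately show thesis by (rule that[rotated])
qed

section \<open>Continuation of cycles and of points of derivative one\<close>

context lifting_family
begin

lemma orb_product_nbhd:
 assumes "orb c n a"
 obtains s r where "s > 0" "r > 0" "!!w z. w \<in> ball c s ==> z \<in> ball a r ==> orb w n z"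
proof -
 have "(c, a) \<in> {(w, z). orb w n z}" using assms by simp
 then obtain A B where AB: "open A" "open B" "(c, a) \<in> A \<times> B" "A \<times> B \<subseteq> {(w, z). orb w n z}"
  by (rule open_prod_elim[OF orb_open])
 obtain s where s: "s > 0" "ball c s \<subseteq> A" using openE[OF AB(1), of c] AB(3) by auto
 obtain r where r: "r > 0" "ball a r \<subseteq> B" using openE[OF AB(2), of a] AB(3) by auto
 have "orb w n z" if "w \<in> ball c s" "z \<in> ball a r" for w z using that s(2) r(2) AB(4) by blast
 with s(1) r(1) show thesis by (rule that)
qed

lemma cycle_implicit:
 assumes o: "orb c q a" and fx: "it c q a = a" and d1: "Dit c q a ~= 1"
 obtains r s \<alpha> where "r > 0" "s > 0" "\<alpha> holomorphic_on ball c s" "\<alpha> c = a"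
  "!!w. w \<in> ball c s ==> \<alpha> w \<in> ball a r" "!!w z. w \<in> ball c s ==> z \<in> ball a r ==> orb w q z"
  "!!w z. w \<in> ball c s ==> z \<in> ball a r ==> it w q z = z \<longleftrightarrow> z = \<alpha> w"
proof -
 obtain s0 r0 where sr: "s0 > 0" "r0 > 0" "!!w z. w \<in> ball c s0 ==> z \<in> ball a r0 ==> orb w q z"
  by (rule orb_product_nbhd[OF o]) (rule that)
 let ?\<Phi> = "%w z. it w q z - z"
 have der: "deriv (?\<Phi> c) a ~= 0"
 proof -
  have "(?\<Phi> c has_field_derivative Dit c q a - 1) (at a)" by (intro derivative_intros it_deriv o)
  thus ?thesis using d1 by (simp add: DERIV_imp_deriv)
 qed
 have cont: "continuous_on (ball c s0 \<times> ball a r0) (%(w, z). ?\<Phi> w z)"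
 proof -
  have "continuous_on (ball c s0 \<times> ball a r0) (%(w, z). it w q z)"
   by (rule continuous_on_subset[OF it_cont]) (use sr(3) in auto)
  thus ?thesis unfolding case_prod_unfold by (intro continuous_intros)
 qed
 obtain r s \<alpha> where R: "r > 0" "r < r0" "s > 0" "s \<le> s0" "\<alpha> holomorphic_on ball c s"
  "\<alpha> ` ball c s \<subseteq> ball a r" "\<alpha> c = a" "!!w z. w \<in> ball c s ==> z \<in> ball a r ==> ?\<Phi> w z = 0 \<longleftrightarrow> z = \<alpha> w"
 proof (rule holomorphic_implicit[OF sr(1,2) cont])
  show "?\<Phi> w holomorphic_on ball a r0" if "w \<in> ball c s0" for w
   by (intro holomorphic_intros it_holomorphic1) (use sr(3)[OF that] in auto)
  show "(%w. ?\<Phi> w (\<phi> w)) holomorphic_on S" if S: "open S" "S \<subseteq> ball c s0" "\<phi> holomorphic_on S" "\<phi> ` S \<subseteq> ball a r0" for \<phi> S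
   by (intro holomorphic_intros S it_holomorphic[of "%w. w"]) (use S sr(3) in blast)
 qed (use fx der in auto)
 show thesis
 proof (rule that[OF R(1,3,5,7)])
  show "\<alpha> w \<in> ball a r" if "w \<in> ball c s" for w using R(6) that by blast
  show "orb w q z" if "w \<in> ball c s" "z \<in> ball a r" for w z using sr(3)[of w z] that R by simp
  show "it w q z = z \<longleftrightarrow> z = \<alpha> w" if "w \<in> ball c s" "z \<in> ball a r" for w z using R(8)[OF that] by simp
 qed
qed

text \<open>At multiplier 1 the implicit function theorem does not apply to the periodic point,
  which may split. It does apply to the point at which the derivative of the iterate equals 1,
  provided that derivative has nonzero slope.\<close>

lemma multiplier_implicit:
 assumes o: "orb c q a" and fx: "Dit c q a = 1" and d1: "deriv (Dit c q) a ~= 0"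
 obtains r s \<alpha> where "r > 0" "s > 0" "\<alpha> holomorphic_on ball c s" "\<alpha> c = a"
  "!!w. w \<in> ball c s ==> \<alpha> w \<in> ball a r" "!!w z. w \<in> ball c s ==> z \<in> ball a r ==> orb w q z"
  "!!w z. w \<in> ball c s ==> z \<in> ball a r ==> Dit w q z = 1 \<longleftrightarrow> z = \<alpha> w"
proof -
 obtain s0 r0 where sr: "s0 > 0" "r0 > 0" "!!w z. w \<in> ball c s0 ==> z \<in> ball a r0 ==> orb w q z"
  by (rule orb_product_nbhd[OF o]) (rule that)
 let ?\<Phi> = "%w z. Dit w q z - 1"
 have hD: "Dit w q holomorphic_on {z. orb w q z}" for w
  by (rule Dit_holomorphic[of "%_. w" "{z. orb w q z}" "%z. z" q]) (auto intro: holomorphic_intros)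
 have der: "deriv (?\<Phi> c) a ~= 0"
 proof -
  have "(Dit c q has_field_derivative deriv (Dit c q) a) (at a)"
   by (rule holomorphic_derivI[OF hD orb_open1]) (use o in simp)
  hence "(?\<Phi> c has_field_derivative deriv (Dit c q) a - 0) (at a)" by (intro derivative_intros)
  thus ?thesis using d1 by (simp add: DERIV_imp_deriv)
 qed
 have cont: "continuous_on (ball c s0 \<times> ball a r0) (%(w, z). ?\<Phi> w z)"
 proof -
  have "continuous_on (ball c s0 \<times> ball a r0) (%(w, z). Dit w q z)"
   by (rule continuous_on_subset[OF Dit_cont]) (use sr(3) in auto)
  thus ?thesis unfolding case_prod_unfold by (intro continuous_intros)
 qed
 obtain r s \<alpha> where R: "r > 0" "r < r0" "s > 0" "s \<le> s0" "\<alpha> holomorphic_on ball c s"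
  "\<alpha> ` ball c s \<subseteq> ball a r" "\<alpha> c = a" "!!w z. w \<in> ball c s ==> z \<in> ball a r ==> ?\<Phi> w z = 0 \<longleftrightarrow> z = \<alpha> w"
 proof (rule holomorphic_implicit[OF sr(1,2) cont])
  show "?\<Phi> w holomorphic_on ball a r0" if "w \<in> ball c s0" for w
   by (intro holomorphic_intros holomorphic_on_subset[OF hD]) (use sr(3)[OF that] in auto)
  show "(%w. ?\<Phi> w (\<phi> w)) holomorphic_on S" if S: "open S" "S \<subseteq> ball c s0" "\<phi> holomorphic_on S" "\<phi> ` S \<subseteq> ball a r0" for \<phi> S
   by (intro holomorphic_intros S Dit_holomorphic[of "%w. w"]) (use S sr(3) in blast)
 qed (use fx der in auto)
 show thesis
 proof (rule that[OF R(1,3,5,7)])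
  show "\<alpha> w \<in> ball a r" if "w \<in> ball c s" for w using R(6) that by blast
  show "orb w q z" if "w \<in> ball c s" "z \<in> ball a r" for w z using sr(3)[of w z] that R by simp
  show "Dit w q z = 1 \<longleftrightarrow> z = \<alpha> w" if "w \<in> ball c s" "z \<in> ball a r" for w z using R(8)[OF that] by simp
 qed
qed

text \<open>Distinctness of the first \<open>q\<close> points and membership in the domain are open
  conditions, so the exact period is retained.\<close>

lemma cyc_nearby:
 assumes cy: "cyc c q aa \<kappa>" and \<omega>: "(\<omega> \<longlongrightarrow> c) F" and v: "(v \<longlongrightarrow> aa 0) F"
  and per: "\<forall>\<^sub>F x in F. it (\<omega> x) q (v x) = v x"
 shows "\<forall>\<^sub>F x in F. cyc (\<omega> x) q (%n. it (\<omega> x) n (v x)) (Dit (\<omega> x) q (v x))"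
proof -
 have q: "q \<ge> 1" and inj: "inj_on aa {..<q}" using cy by (auto simp: cyc_def)
 have l: "((%x. it (\<omega> x) i (v x)) \<longlongrightarrow> aa i) F" for i
  using it_tendsto[OF cyc_orb[OF cy, of i 0] \<omega> v] cyc_it[OF cy, of i 0] by simp
 have e2: "\<forall>\<^sub>F x in F. \<forall>i\<in>{..<q}. \<forall>j\<in>{..<q}. i ~= j \<longrightarrow> it (\<omega> x) i (v x) ~= it (\<omega> x) j (v x)"
 proof (intro eventually_ball_finite ballI)
  fix i j assume ij: "i \<in> {..<q}" "j \<in> {..<q}"
  show "\<forall>\<^sub>F x in F. i ~= j \<longrightarrow> it (\<omega> x) i (v x) ~= it (\<omega> x) j (v x)"
  proof (cases "i = j")
   case False
   hence "aa i - aa j ~= 0" using inj ij by (auto dest: inj_onD)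
   from tendsto_imp_eventually_ne[OF tendsto_diff[OF l l] this] show ?thesis by eventually_elim simp
  qed simp
 qed auto
 show ?thesis using orb_eventually[OF cyc_orb[OF cy] \<omega> v, of q] e2 per
 proof eventually_elim
  case (elim x)
  have p: "it (\<omega> x) (n + q) (v x) = it (\<omega> x) n (v x)" for n using elim(3) by (simp add: it_add)
  have "it (\<omega> x) n (v x) \<in> D" for n
  proof -
   have "it (\<omega> x) n (v x) = it (\<omega> x) (n mod q) (v x)"
    by (rule periodic_mod[of "%n. it (\<omega> x) n (v x)" q n]) (rule p)
   moreover have "n mod q < q" using q by simp
   ultimately show ?thesis using elim(1) by (simp add: orb_def)
  qed
  thus ?case using q p elim(2) unfolding cyc_def by (auto simp: it_Suc inj_on_def simp del: funpow.simps(2))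
 qed
qed

text \<open>For \<kappa> = 1 there is a single petal, so the return map is a + z + h(0) z^2 + ...
  with h(0) nonzero, and the slope of its derivative is 2 h(0).\<close>

lemma parabolic_multiplier_simple:
 assumes c: "c \<in> closure D" and cy: "cyc c q aa 1"
 shows "deriv (Dit c q) (aa 0) ~= 0"
proof -
 have p: "(1::nat) \<ge> 1" "(1::complex) ^ 1 = 1" by auto
 obtain e h where M: "e > 0" "h holomorphic_on ball 0 e" "h 0 ~= 0"
  "!!z. norm z < e ==> orb c (q * 1) (aa 0 + z) \<and> it c (q * 1) (aa 0 + z) = aa 0 + z * (1 + z ^ 1 * h z)"
  by (rule parabolic_cycle_model[OF c cy p]) (use that in auto)
 have D: "Dit c q (aa 0 + z) = 1 + 2 * z * h z + z\<^sup>2 * deriv h z" if z: "z \<in> ball 0 e" for z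
 proof -
  have "((%z. it c q (aa 0 + z)) has_field_derivative Dit c q (aa 0 + z) * 1) (at z)"
   using M(4)[of z] z by (intro DERIV_chain2[OF it_deriv]) (auto intro!: derivative_eq_intros)
  moreover have "((%z. it c q (aa 0 + z)) has_field_derivative 1 + 2 * z * h z + z\<^sup>2 * deriv h z) (at z)"
  proof (rule has_field_derivative_transform_within_open[OF _ open_ball z])
   have hd: "(h has_field_derivative deriv h z) (at z)" by (rule holomorphic_derivI[OF M(2) open_ball z])
   show "((%z. aa 0 + z * (1 + z ^ 1 * h z)) has_field_derivative 1 + 2 * z * h z + z\<^sup>2 * deriv h z) (at z)"
    by (auto intro!: derivative_eq_intros hd simp: power2_eq_square algebra_simps)
   show "aa 0 + x * (1 + x ^ 1 * h x) = it c q (aa 0 + x)" if "x \<in> ball 0 e" for x using M(4)[of x] that by simp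
  qed
  ultimately show ?thesis using DERIV_unique by fastforce
 qed
 have z0: "0 \<in> ball (0::complex) e" using M(1) by simp
 have d1: "((%z. Dit c q (aa 0 + z)) has_field_derivative 2 * h 0) (at 0)"
 proof (rule has_field_derivative_transform_within_open[OF _ open_ball z0])
  have hd: "(h has_field_derivative deriv h 0) (at 0)" "(deriv h has_field_derivative deriv (deriv h) 0) (at 0)"
   by (rule holomorphic_derivI[OF M(2) open_ball z0], rule holomorphic_derivI[OF holomorphic_deriv[OF M(2) open_ball] open_ball z0])
  show "((%z. 1 + 2 * z * h z + z\<^sup>2 * deriv h z) has_field_derivative 2 * h 0) (at 0)"
   by (auto intro!: derivative_eq_intros hd)
 qed (simp add: D)
 have hD: "Dit c q holomorphic_on {z. orb c q z}"
  by (rule Dit_holomorphic[of "%_. c" "{z. orb c q z}" "%z. z" q]) (auto intro: holomorphic_intros)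
 have "(Dit c q has_field_derivative deriv (Dit c q) (aa 0)) (at (aa 0 + 0))"
  using holomorphic_derivI[OF hD orb_open1, of "aa 0"] cyc_orb[OF cy, of q 0] by simp
 hence "((%z. Dit c q (aa 0 + z)) has_field_derivative deriv (Dit c q) (aa 0) * 1) (at 0)"
  by (rule DERIV_chain2) (auto intro!: derivative_eq_intros)
 thus ?thesis using d1 DERIV_unique M(3) by fastforce
qed

end

section \<open>From tangency at one parameter to cycles at all nearby ones\<close>

context aligned_cycle
begin

text \<open>One of the two corrections is trivial by the choice of base point. For \<kappa> = 1 it
  is the point of derivative 1, and only a translation is needed; otherwise it is the continued
  periodic point, and only a change of slope is needed. These are the two cases of
  \<open>hat_contradiction\<close>.\<close>

lemma hat_data:
 assumes nattr: "\<not> norm \<kappa> < 1"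
 obtains s0 al be la p where "hat_family D f d c q aa \<kappa> s0 al be la p"
  "\<kappa> ~= 1 \<and> (\<forall>u\<in>ball 0 s0. al u = be u) \<or> \<kappa> = 1 \<and> (\<forall>u\<in>ball 0 s0. la u = 1)"
proof -
 have "\<exists>p\<ge>1. \<kappa> ^ p = 1" using \<kappa> nattr by (auto simp: neutral_or_attr_def)
 then obtain p where p: "p \<ge> 1" "\<kappa> ^ p = 1" "!!k. 1 \<le> k ==> k < p ==> \<kappa> ^ k ~= 1"
  by (rule minimal_order) (rule that)
 have o: "orb c q (aa 0)" and fx: "it c q (aa 0) = aa 0" and Dk: "Dit c q (aa 0) = \<kappa>"
  using cyc_orb[OF cy] cyc_it[OF cy, of q 0] cyc_per[OF cy, of 0] cyc_Dit_shift[OF cy] by auto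
 have shift: "(%u. \<alpha> (c + u)) holomorphic_on ball 0 s" if "\<alpha> holomorphic_on ball c s" for \<alpha> :: "complex => complex" and s
  by (rule holomorphic_on_compose_gen[OF _ that, of "%u. c + u", unfolded o_def])
   (auto intro!: holomorphic_intros simp: dist_norm)
 have inb: "c + u \<in> ball c s" if "u \<in> ball 0 s" for u s using that by (simp add: dist_norm)
 show thesis
 proof (cases "\<kappa> = 1")
  case True
  obtain r s \<alpha> where A: "r > 0" "s > 0" "\<alpha> holomorphic_on ball c s" "\<alpha> c = aa 0"
   "!!w. w \<in> ball c s ==> \<alpha> w \<in> ball (aa 0) r" "!!w z. w \<in> ball c s ==> z \<in> ball (aa 0) r ==> orb w q z"
   "!!w z. w \<in> ball c s ==> z \<in> ball (aa 0) r ==> Dit w q z = 1 \<longleftrightarrow> z = \<alpha> w"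
  proof (rule multiplier_implicit[OF o])
   show "Dit c q (aa 0) = 1" using Dk True by simp
   show "deriv (Dit c q) (aa 0) ~= 0" using parabolic_multiplier_simple[OF c, of q aa] cy True by simp
  qed (rule that)
  have orbu: "orb (c + u) q (\<alpha> (c + u))" if "u \<in> ball 0 s" for u using A(5,6)[OF inb[OF that]] by blast
  have "hat_family D f d c q aa \<kappa> s (%u. \<alpha> (c + u)) (%u. it (c + u) q (\<alpha> (c + u))) (%_. 1) p"
  proof unfold_locales
   show "(%u. it (c + u) q (\<alpha> (c + u))) holomorphic_on ball 0 s"
    by (intro it_holomorphic holomorphic_intros shift[OF A(3)] orbu)
   show "1 * Dit (c + u) q (\<alpha> (c + u)) = \<kappa>" if "u \<in> ball 0 s" for u
    using A(7)[OF inb[OF that] A(5)[OF inb[OF that]]] True by simp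
  qed (use p A orbu shift[OF A(3)] fx in auto)
  thus thesis using that True by blast
 next
  case False
  obtain r s \<alpha> where A: "r > 0" "s > 0" "\<alpha> holomorphic_on ball c s" "\<alpha> c = aa 0"
   "!!w. w \<in> ball c s ==> \<alpha> w \<in> ball (aa 0) r" "!!w z. w \<in> ball c s ==> z \<in> ball (aa 0) r ==> orb w q z"
   "!!w z. w \<in> ball c s ==> z \<in> ball (aa 0) r ==> it w q z = z \<longleftrightarrow> z = \<alpha> w"
   by (rule cycle_implicit[OF o fx]) (use Dk False in simp, rule that)
  have orbu: "orb (c + u) q (\<alpha> (c + u))" if "u \<in> ball 0 s" for u using A(5,6)[OF inb[OF that]] by blast
  have Dh: "(%u. Dit (c + u) q (\<alpha> (c + u))) holomorphic_on ball 0 s"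
   by (intro Dit_holomorphic holomorphic_intros shift[OF A(3)] orbu)
  have "0 \<in> ball (0::complex) s" using A(2) by simp
  hence "isCont (%u. Dit (c + u) q (\<alpha> (c + u))) 0"
   using continuous_on_eq_continuous_at[OF open_ball] holomorphic_on_imp_continuous_on[OF Dh] by blast
  moreover have "Dit (c + 0) q (\<alpha> (c + 0)) ~= 0" using A(4) Dk \<kappa>0 by simp
  ultimately have "\<exists>s'>0. \<forall>u. dist 0 u < s' \<longrightarrow> Dit (c + u) q (\<alpha> (c + u)) ~= 0"
   by (rule continuous_at_avoid)
  then obtain s' where s': "s' > 0" "!!u. dist 0 u < s' ==> Dit (c + u) q (\<alpha> (c + u)) ~= 0" by blast
  define t where "t = min s s'"
  have t: "t > 0" "ball (0::complex) t \<subseteq> ball 0 s" "ball (0::complex) t \<subseteq> ball 0 s'" using A(2) s' by (auto simp: t_def)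
  have "hat_family D f d c q aa \<kappa> t (%u. \<alpha> (c + u)) (%u. \<alpha> (c + u)) (%u. \<kappa> / Dit (c + u) q (\<alpha> (c + u))) p"
  proof unfold_locales
   show "(%u. \<kappa> / Dit (c + u) q (\<alpha> (c + u))) holomorphic_on ball 0 t"
    by (intro holomorphic_intros holomorphic_on_subset[OF Dh t(2)] s'(2)) (use t(3) in auto)
   show "orb (c + u) q (\<alpha> (c + u))" if "u \<in> ball 0 t" for u using orbu that t(2) by blast
   show "it (c + u) q (\<alpha> (c + u)) = \<alpha> (c + u)" if "u \<in> ball 0 t" for u
    using A(7)[OF inb A(5)[OF inb]] that t(2) by blast
   show "\<kappa> / Dit (c + u) q (\<alpha> (c + u)) * Dit (c + u) q (\<alpha> (c + u)) = \<kappa>" if "u \<in> ball 0 t" for u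
    using s'(2)[of u] that t(3) by (simp add: subset_iff)
  qed (use p A t Dk \<kappa>0 holomorphic_on_subset[OF shift[OF A(3)] t(2)] in auto)
  thus thesis using that False by blast
 qed
qed

text \<open>A correction that is not identically trivial has a leading coefficient at some order in
  the parameter, and \<open>hat_contradiction\<close> excludes it whatever the order. Trivial
  corrections mean that the true return map has a fixed point of multiplier \<kappa> at every nearby
  parameter.\<close>

lemma tangent_persists:
 assumes tg: "tangent \<alpha>"
 obtains s where "s > 0" "!!w. w \<in> ball c s ==> \<exists>bb. cyc w q bb \<kappa>"
proof -
 have nattr: "\<not> norm \<kappa> < 1" using attracting_not_tangent[OF _ tg] by blast
 obtain s0 al be la p where H: "hat_family D f d c q aa \<kappa> s0 al be la p"
  and cs: "\<kappa> ~= 1 \<and> (\<forall>u\<in>ball 0 s0. al u = be u) \<or> \<kappa> = 1 \<and> (\<forall>u\<in>ball 0 s0. la u = 1)"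
  by (rule hat_data[OF nattr]) (rule that)
 interpret H: hat_family D f d c q aa \<kappa> s0 al be la p by (rule H)
 have ev: "\<forall>\<^sub>F u in at 0. u \<in> ball (0::complex) s0" using H.s0 by (intro eventually_at_in_open') auto
 have triv: "al u = be u \<and> la u = 1" if u: "u \<in> ball 0 s0" for u
 proof (cases "\<kappa> = 1")
  case True
  hence la: "\<forall>u\<in>ball 0 s0. la u = 1" using cs by blast
  have "al u - be u = 0"
  proof (rule ccontr)
   assume "al u - be u ~= 0"
   with u obtain n \<eta> where n: "\<eta> ~= 0" "((%u. (al u - be u) / u ^ n) \<longlongrightarrow> \<eta>) (at 0)"
    by (rule nonconstant_order[of "%u. al u - be u" s0, rotated 3])
     (auto intro!: holomorphic_intros H.hol_al H.hol_be H.s0 simp: H.at0)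
   have "((%u. (la u - 1) / u ^ n) \<longlongrightarrow> 0) (at 0)"
    using ev la by (intro tendsto_eventually) (auto elim!: eventually_mono)
   from H.hat_contradiction[OF tg n(2) this] n(1) True show False by simp
  qed
  thus ?thesis using la u by simp
 next
  case False
  hence al: "\<forall>u\<in>ball 0 s0. al u = be u" using cs by blast
  have "la u - 1 = 0"
  proof (rule ccontr)
   assume "la u - 1 ~= 0"
   with u obtain n \<eta> where n: "\<eta> ~= 0" "((%u. (la u - 1) / u ^ n) \<longlongrightarrow> \<eta>) (at 0)"
    by (rule nonconstant_order[of "%u. la u - 1" s0, rotated 3])
     (auto intro!: holomorphic_intros H.hol_la H.s0 simp: H.at0)
   have "((%u. (al u - be u) / u ^ n) \<longlongrightarrow> 0) (at 0)"
    using ev al by (intro tendsto_eventually) (auto elim!: eventually_mono)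
   from H.hat_contradiction[OF tg this n(2)] n(1) False show False by simp
  qed
  thus ?thesis using al u by simp
 qed
 have evn: "\<forall>\<^sub>F u in nhds 0. u \<in> ball (0::complex) s0" using H.s0 by (intro eventually_nhds_in_open) auto
 have "\<forall>\<^sub>F u in nhds 0. cyc (c + u) q (%n. it (c + u) n (al u)) (Dit (c + u) q (al u))"
 proof (rule cyc_nearby[OF cy])
  show "((%u. c + u) \<longlongrightarrow> c) (nhds 0)"
   using tendsto_add[OF tendsto_const[of c] filterlim_ident[of "nhds (0::complex)"]] by simp
  show "(al \<longlongrightarrow> aa 0) (nhds 0)" using H.holomorphic_ball_tendsto[OF H.hol_al H.s0] by (simp only: H.at0)
  show "\<forall>\<^sub>F u in nhds 0. it (c + u) q (al u) = al u" using evn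
  proof eventually_elim
   case (elim u)
   show ?case using H.al_it[OF elim] triv[OF elim] by simp
  qed
 qed
 hence "\<forall>\<^sub>F u in nhds 0. \<exists>bb. cyc (c + u) q bb \<kappa>" using evn
 proof eventually_elim
  case (elim u)
  have "Dit (c + u) q (al u) = \<kappa>" using H.mult[OF elim(2)] triv[OF elim(2)] by simp
  thus ?case using elim(1) by auto
 qed
 then obtain s where s: "s > 0" "!!u. u \<in> ball 0 s ==> \<exists>bb. cyc (c + u) q bb \<kappa>" by (rule H.nhds_ball) (rule that)
 show thesis
 proof (rule that[OF s(1)])
  fix w assume "w \<in> ball c s"
  hence "w - c \<in> ball 0 s" by (simp add: dist_norm norm_minus_commute)
  from s(2)[OF this] show "\<exists>bb. cyc w q bb \<kappa>" by simp
 qed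
qed

end

subsection \<open>Limits of neutral cycles\<close>

text \<open>Bloch's lemma on a ball on which the derivative at most doubles. What matters is that
  the resulting radius depends on \<open>R\<close>, \<open>m\<close> and \<open>B\<close>
  alone.\<close>

lemma ball_image_radius:
 assumes R: "R > (0::real)" and m: "m > (0::real)"
 obtains \<rho> where "\<rho> > 0" "!!v p. v holomorphic_on ball p R ==> (!!z. z \<in> ball p R ==> norm (v z) \<le> B) ==>
   m \<le> norm (deriv v p) ==> ball (v p) \<rho> \<subseteq> v ` ball p R"
proof -
 define B' where "B' = max B 1"
 define L where "L = 3 * (3 * B' / (R/2)) / (R/2)"
 have B': "B' \<ge> 1" "B' \<ge> B" by (auto simp: B'_def)
 have L: "L > 0" using R B' by (simp add: L_def)
 \<comment> \<open>Within this radius the derivative changes by at most \<open>m\<close>, hence by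
   at most its modulus at the centre.\<close>
 define r1 where "r1 = min (R / 8) (m / L)"
 have "r1 > 0" using R m L by (simp add: r1_def)
 moreover have "r1 \<le> R / 8" unfolding r1_def by (rule min.cobounded1)
 moreover have "r1 \<le> m / L" unfolding r1_def by (rule min.cobounded2)
 ultimately have r1: "r1 > 0" "r1 \<le> R / 8" "r1 \<le> m / L" .
 have s2: "3 - 2 * sqrt 2 > 0"
 proof -
  have "sqrt 2 < 3 / 2" by (rule real_less_lsqrt) (auto simp: power2_eq_square)
  thus ?thesis by simp
 qed
 show thesis
 proof (rule that[of "(3 - 2 * sqrt 2) * r1 * m"])
  show "(3 - 2 * sqrt 2) * r1 * m > 0" using s2 r1 m by simp
  fix v :: "complex => complex" and p
  assume v: "v holomorphic_on ball p R" and bd: "!!z. z \<in> ball p R ==> norm (v z) \<le> B" and dm: "m \<le> norm (deriv v p)"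
  have der: "norm (deriv v z) \<le> 3 * B' / (R/2)" if z: "z \<in> ball p (R/2)" for z
  proof -
   have sub: "cball z (R/3) \<subseteq> ball p R"
   proof
    fix x assume "x \<in> cball z (R/3)"
    hence "dist p x \<le> dist p z + R/3" using dist_triangle[of p x z] by simp
    thus "x \<in> ball p R" using z R by simp
   qed
   have "norm ((deriv ^^ 1) v z) \<le> fact 1 * B' / (R/3) ^ 1"
   proof (rule Cauchy_inequality)
    show "v holomorphic_on ball z (R/3)" using v sub ball_subset_cball by (meson holomorphic_on_subset order_trans)
    show "continuous_on (cball z (R/3)) v" using v sub by (meson holomorphic_on_imp_continuous_on holomorphic_on_subset)
    fix x assume "norm (z - x) = R/3"
    hence "x \<in> ball p R" using sub by (auto simp: subset_iff dist_norm)
    thus "norm (v x) \<le> B'" using bd B' by (meson order_trans)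
   qed (use R in simp)
   also have "\<dots> \<le> 3 * B' / (R/2)" using R B' by (simp add: field_simps)
   finally show ?thesis by simp
  qed
  have lip: "norm (deriv v z - deriv v p) \<le> L * dist p z" if z: "dist p z < (R/2) / 2" for z
   unfolding L_def
  proof (rule bounded_holomorphic_lipschitz[OF _ _ der z])
   show "deriv v holomorphic_on ball p (R/2)"
    by (rule holomorphic_on_subset[OF holomorphic_deriv[OF v open_ball]]) (use R in auto)
  qed (use R in auto)
  have "ball (v p) ((3 - 2 * sqrt 2) * r1 * norm (deriv v p)) \<subseteq> v ` ball p r1"
  proof (rule Bloch_lemma)
   show "v holomorphic_on cball p r1" by (rule holomorphic_on_subset[OF v]) (use r1 R in auto)
   fix z assume z: "z \<in> ball p r1"
   have "dist p z < (R/2)/2" using z r1 R by simp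
   from lip[OF this] have "norm (deriv v z - deriv v p) \<le> L * dist p z" .
   also have "\<dots> \<le> L * (m / L)" using z r1 L by (intro mult_left_mono) auto
   also have "\<dots> \<le> norm (deriv v p)" using dm L by simp
   finally have "norm (deriv v z - deriv v p) \<le> norm (deriv v p)" .
   thus "norm (deriv v z) \<le> 2 * norm (deriv v p)"
    using norm_triangle_ineq2[of "deriv v z" "deriv v p"] by simp
  qed (rule r1)
  moreover have "ball (v p) ((3 - 2 * sqrt 2) * r1 * m) \<subseteq> ball (v p) ((3 - 2 * sqrt 2) * r1 * norm (deriv v p))"
   using s2 r1 dm by (intro subset_ball mult_left_mono) auto
  moreover have "ball p r1 \<subseteq> ball p R" using r1 R by (intro subset_ball) simp
  ultimately show "ball (v p) ((3 - 2 * sqrt 2) * r1 * m) \<subseteq> v ` ball p R" by blast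
 qed
qed

lemma factor_upper_bound:
 fixes x :: "nat => real"
 assumes "(\<Prod>j<q. x j) = 1" "!!j. j < q ==> x j \<ge> 1 / M" "M \<ge> 1" "i < q"
 shows "x i \<le> M ^ q"
proof -
 have pos: "x j > 0" if "j < q" for j
  using assms(2)[OF that] assms(3) by (meson divide_pos_pos less_le_trans zero_less_one)
 have "(\<Prod>j\<in>{..<q} - {i}. 1 / M) \<le> (\<Prod>j\<in>{..<q} - {i}. x j)"
  by (intro prod_mono) (use assms in auto)
 hence "(1 / M) ^ (q - 1) \<le> (\<Prod>j\<in>{..<q} - {i}. x j)" using assms(4) by simp
 hence "x i * (1 / M) ^ (q - 1) \<le> x i * (\<Prod>j\<in>{..<q} - {i}. x j)" using pos[OF assms(4)] by (intro mult_left_mono) auto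
 also have "\<dots> = 1" using assms(1,4) by (simp add: prod.remove[of "{..<q}" i])
 finally have "x i \<le> M ^ (q - 1)" using assms(3) by (simp add: power_divide field_simps)
 also have "\<dots> \<le> M ^ q" using assms(3) by (intro power_increasing) auto
 finally show ?thesis .
qed

lemma double_zeros_factor:
 fixes H :: "complex => complex"
 assumes hol: "H holomorphic_on S" and S: "open S" and Z: "finite Z" "Z \<subseteq> S"
  and zero: "!!a. a \<in> Z ==> H a = 0 \<and> deriv H a = 0"
 obtains g where "g holomorphic_on S" "!!z. H z = (\<Prod>a\<in>Z. (z - a)\<^sup>2) * g z"
proof -
 have "\<exists>g. g holomorphic_on S \<and> (\<forall>z. H z = (\<Prod>a\<in>Z. (z - a)\<^sup>2) * g z)"
  using Z zero
 proof (induction Z rule: finite_induct)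
  case empty
  show ?case using hol by auto
 next
  case (insert a Z)
  then obtain g where g: "g holomorphic_on S" "!!z. H z = (\<Prod>a\<in>Z. (z - a)\<^sup>2) * g z" by auto
  define P where "P = (%z. \<Prod>a\<in>Z. (z - a)\<^sup>2)"
  have aS: "a \<in> S" using insert by simp
  have Pa: "P a ~= 0" using insert(1,2) by (auto simp: P_def)
  have Ph: "P holomorphic_on UNIV" unfolding P_def by (intro holomorphic_intros)
  have Ha: "H a = 0" "deriv H a = 0" using insert by auto
  have ga: "g a = 0" using Ha(1) g(2)[of a] Pa by (simp add: P_def)
  have gd: "(g has_field_derivative deriv g a) (at a)" by (rule holomorphic_derivI[OF g(1) S aS])
  have "((%z. P z * g z) has_field_derivative deriv P a * g a + deriv g a * P a) (at a)"
   by (intro DERIV_mult holomorphic_derivI[OF Ph] gd) auto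
  moreover have "H = (%z. P z * g z)" using g(2) by (auto simp: P_def)
  ultimately have "deriv H a = deriv P a * g a + deriv g a * P a" by (simp add: DERIV_imp_deriv)
  hence dga: "deriv g a = 0" using Ha(2) ga Pa by simp
  define g1 where "g1 = (%z. if z = a then deriv g a else (g z - g a) / (z - a))"
  have g1: "g1 holomorphic_on S" unfolding g1_def by (rule pole_lemma_open[OF g(1) S])
  define g2 where "g2 = (%z. if z = a then deriv g1 a else (g1 z - g1 a) / (z - a))"
  have g2: "g2 holomorphic_on S" unfolding g2_def by (rule pole_lemma_open[OF g1 S])
  have "g z = (z - a)\<^sup>2 * g2 z" for z
   by (cases "z = a") (auto simp: g2_def g1_def ga dga power2_eq_square)
  hence "H z = (\<Prod>a\<in>insert a Z. (z - a)\<^sup>2) * g2 z" for z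
   using g(2)[of z] insert(1,2) by (simp add: mult.commute mult.left_commute)
  thus ?case using g2 by blast
 qed
 thus thesis using that by blast
qed

text \<open>The double zeros are divided out and the quotient is bounded on the circle of radius
  r/2, where every factor is at least r/4. The bound survives a collision of the zeros, which is how
  it is used for limits of cycles.\<close>

lemma double_zeros_bound:
 fixes H :: "complex => complex"
 assumes r: "r > 0" and hol: "H holomorphic_on ball 0 r" and B: "!!z. z \<in> ball 0 r ==> norm (H z) \<le> B"
  and Z: "finite Z" "Z \<subseteq> ball 0 (r / 4)" and zero: "!!a. a \<in> Z ==> H a = 0 \<and> deriv H a = 0"
  and z: "norm z < r / 2"
 shows "norm (H z) \<le> B * (4 / r) ^ (2 * card Z) * (\<Prod>a\<in>Z. norm (z - a) ^ 2)"
proof -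
 have "Z \<subseteq> ball 0 r" using Z(2) r by auto
 then obtain g where g: "g holomorphic_on ball 0 r" "!!z. H z = (\<Prod>a\<in>Z. (z - a)\<^sup>2) * g z"
  by (rule double_zeros_factor[OF hol open_ball Z(1) _ zero]) (auto intro: that)
 have B0: "B \<ge> 0" using B[of 0] r norm_ge_zero order_trans by (metis centre_in_ball)
 have sph: "norm (g x) \<le> B * (4 / r) ^ (2 * card Z)" if x: "norm x = r / 2" for x
 proof -
  have "(r / 4) ^ (2 * card Z) = (\<Prod>a\<in>Z. (r / 4) ^ 2)" by (simp add: power_mult power_even_eq)
  also have "\<dots> \<le> (\<Prod>a\<in>Z. norm (x - a) ^ 2)"
  proof (intro prod_mono conjI power_mono)
   fix a assume "a \<in> Z"
   hence "norm a < r / 4" using Z(2) by auto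
   thus "r / 4 \<le> norm (x - a)" using norm_triangle_ineq2[of x a] x by simp
  qed (use r in auto)
  finally have P: "(r / 4) ^ (2 * card Z) \<le> norm (\<Prod>a\<in>Z. (x - a)\<^sup>2)" by (simp add: prod_norm[symmetric] norm_power)
  have "(r / 4) ^ (2 * card Z) * norm (g x) \<le> norm (H x)"
   unfolding g(2)[of x] norm_mult by (intro mult_right_mono P) auto
  also have "\<dots> \<le> B" by (rule B) (use x r in simp)
  finally show ?thesis using r by (simp add: power_divide field_simps)
 qed
 have "norm (g z) \<le> B * (4 / r) ^ (2 * card Z)"
 proof (rule maximum_modulus_frontier[of g "cball 0 (r / 2)"])
  have gh: "g holomorphic_on cball 0 (r / 2)" by (rule holomorphic_on_subset[OF g(1)]) (use r in auto)
  show "g holomorphic_on interior (cball 0 (r / 2))" by (rule holomorphic_on_subset[OF gh]) (use interior_subset in blast)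
  show "continuous_on (closure (cball 0 (r / 2))) g" using holomorphic_on_imp_continuous_on[OF gh] by simp
 qed (use sph z in \<open>auto simp: frontier_cball\<close>)
 hence "norm (\<Prod>a\<in>Z. (z - a)\<^sup>2) * norm (g z) \<le> norm (\<Prod>a\<in>Z. (z - a)\<^sup>2) * (B * (4 / r) ^ (2 * card Z))"
  by (intro mult_left_mono) auto
 thus ?thesis unfolding g(2)[of z] norm_mult by (simp add: prod_norm[symmetric] norm_power mult.commute)
qed

section \<open>Limits of cycles remain in the domain\<close>

context lifting_family
begin

text \<open>A limit of cycles of period \<open>q\<close> may have a smaller period, in which case
  the derivative over \<open>q\<close> steps is a power of the true multiplier.\<close>

lemma periodic_cyc:
 assumes A: "!!n. A n \<in> D" "!!n. A (Suc n) = f (A n) + c" "!!n. A (n + q) = A n" and q: "q \<ge> 1"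
 obtains q' l \<kappa>' where "q = q' * l" "l \<ge> 1" "cyc c q' A \<kappa>'" "\<kappa>' ^ l = Dit c q (A 0)"
proof -
 let ?P = "%m. m \<ge> 1 \<and> (\<forall>n. A (n + m) = A n)"
 define q' where "q' = (LEAST m. ?P m)"
 have P: "?P q'" unfolding q'_def by (rule LeastI[of ?P q]) (use q A in simp)
 have least: "\<not> ?P m" if "m < q'" for m using not_less_Least that unfolding q'_def by blast
 have "q mod q' = 0"
 proof (rule ccontr)
  assume "q mod q' ~= 0"
  hence ge: "q mod q' \<ge> 1" by simp
  have "A (n + q mod q') = A n" for n
  proof -
   have "A (n + q mod q' + (q div q') * q') = A (n + q mod q')"
    by (rule periodic_add_mult[of A q']) (use P in blast)
   moreover have "n + q mod q' + (q div q') * q' = n + q" by simp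
   ultimately show ?thesis using A(3) by simp
  qed
  moreover have "q mod q' < q'" using P by simp
  ultimately show False using least ge by blast
 qed
 then obtain l where l: "q = q' * l" by (metis dvd_def mod_0_imp_dvd)
 have l1: "l \<ge> 1" using l q by (cases l) auto
 have "inj_on A {..<q'}"
 proof (rule linorder_inj_onI)
  fix i j assume ij: "i < j" "i \<in> {..<q'}" "j \<in> {..<q'}"
  show "A i ~= A j"
  proof
   assume eq: "A i = A j"
   have fwd: "A (i + m) = A (j + m)" for m by (induction m) (auto simp: eq A(2))
   have "A (n + (j - i)) = A n" for n
   proof -
    have "A (i + (n + (q' - i))) = A (j + (n + (q' - i)))" by (rule fwd)
    moreover have "i + (n + (q' - i)) = n + q'" "j + (n + (q' - i)) = (n + (j - i)) + q'" using ij by auto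
    ultimately show ?thesis using P by metis
   qed
   moreover have "j - i \<ge> 1" "j - i < q'" using ij by auto
   ultimately show False using least by blast
  qed
 qed auto
 hence "cyc c q' A (Dit c q' (A 0))" using P A by (auto simp: cyc_def)
 moreover from Dit_mult[OF this, of l 0] have "Dit c q' (A 0) ^ l = Dit c q (A 0)" by (simp add: l)
 ultimately show thesis using that[OF l l1] by blast
qed

lemma root_of_unity_neutral:
 assumes "\<kappa>' ^ l = \<kappa>" "l \<ge> 1" "\<kappa> ^ p = 1" "p \<ge> (1::nat)"
 shows "neutral_or_attr \<kappa>'"
proof -
 have "\<kappa>' ^ (l * p) = 1" using assms by (simp add: power_mult)
 moreover from this have "\<kappa>' ~= 0" using assms by (auto simp: zero_power)
 moreover have "l * p \<ge> 1" using assms by simp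
 ultimately show ?thesis unfolding neutral_or_attr_def by blast
qed

lemma inverse_branch_bound:
 assumes x: "x \<in> D" and R: "R > 0" and ann: "R \<le> norm (f x)" "norm (f x) + R \<le> d" and B: "!!x. x \<in> D ==> norm x \<le> B"
 obtains v where "v holomorphic_on ball (f x) R" "v ` ball (f x) R \<subseteq> D" "v (f x) = x"
  "deriv v (f x) * deriv f x = 1" "norm (deriv v (f x)) \<le> 2 * B / R"
proof -
 have "\<exists>v. v holomorphic_on ball (f x) R \<and> v ` ball (f x) R \<subseteq> D \<and> v (f x) = x \<and> (\<forall>z\<in>ball (f x) R. f (v z) = z)"
 proof (rule lift)
  fix z assume z: "z \<in> ball (f x) R"
  have "norm (f x) - R < norm z" using z norm_triangle_ineq2[of "f x" z] by (simp add: dist_norm)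
  moreover have "norm z < norm (f x) + R" using z norm_triangle_ineq2[of z "f x"] by (simp add: dist_norm norm_minus_commute)
  ultimately show "z ~= 0 \<and> norm z < d" using ann by auto
 qed (use x R in \<open>auto intro: holomorphic_intros\<close>)
 then obtain v where v: "v holomorphic_on ball (f x) R" "v ` ball (f x) R \<subseteq> D" "v (f x) = x" "!!z. z\<in>ball (f x) R ==> f (v z) = z"
  by blast
 have in0: "f x \<in> ball (f x) R" using R by simp
 have "(v has_field_derivative deriv v (f x)) (at (f x))" by (rule holomorphic_derivI[OF v(1) open_ball in0])
 hence "((%z. f (v z)) has_field_derivative deriv f x * deriv v (f x)) (at (f x))"
  using f_deriv[OF x] v(3) by (metis DERIV_chain2)
 moreover have "((%z. f (v z)) has_field_derivative 1) (at (f x))"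
  by (rule has_field_derivative_transform_within_open[OF DERIV_ident open_ball in0]) (simp add: v(4))
 ultimately have e: "deriv f x * deriv v (f x) = 1" by (rule DERIV_unique)
 have "norm ((deriv ^^ 1) v (f x)) \<le> fact 1 * B / (R/2) ^ 1"
 proof (rule Cauchy_inequality)
  show "v holomorphic_on ball (f x) (R/2)" by (rule holomorphic_on_subset[OF v(1)]) (use R in auto)
  show "continuous_on (cball (f x) (R/2)) v"
   by (rule holomorphic_on_imp_continuous_on[OF holomorphic_on_subset[OF v(1)]]) (use R in auto)
  fix z assume "norm (f x - z) = R/2"
  hence "z \<in> ball (f x) R" using R by (simp add: dist_norm)
  thus "norm (v z) \<le> B" using v(2) B by blast
 qed (use R in simp)
 thus thesis using that[OF v(1-3)] e by (simp add: mult.commute)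
qed

text \<open>The danger is convergence of cycle points to the boundary of the domain. No limit point
  equals \<open>b\<close>, since otherwise \<open>b\<close> would lie on a neutral or attracting
  cycle of its own, against \<open>singular_orbit\<close>; hence the values of \<open>f\<close>
  along the cycles stay in a compact part of the punctured disc. Inverse branches then exist on
  discs of uniform size and bound each derivative from below, and since the multipliers have modulus
  1 also from above. By \<open>ball_image_radius\<close> the domain contains discs of uniform radius
  about the cycle points.\<close>

lemma limit_cycle_in_domain:
 assumes \<kappa>: "\<kappa> ^ p = 1" "p \<ge> 1" and b: "b \<in> D" "orb b q b"
  and w: "w \<longlonglongrightarrow> b" and cy: "!!k. cyc (w k) q (aa k) \<kappa>" and A: "!!n. (%k. aa k n) \<longlonglongrightarrow> A n"
 shows "A n \<in> D" "A (Suc n) = f (A n) + b" "A (n + q) = A n" "Dit b q (A 0) = \<kappa>"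
proof -
 have q: "q \<ge> 1" and inD: "aa k n \<in> D" and rec: "aa k (Suc n) = f (aa k n) + w k" for k n using cy[of k] by (auto simp: cyc_def)
 have k0: "\<kappa> ~= 0" using \<kappa> by (auto simp: zero_power)
 have nk: "norm \<kappa> = 1"
 proof -
  have "norm \<kappa> ^ p = 1" using \<kappa> by (metis norm_one norm_power)
  thus ?thesis using power_eq_imp_eq_base[of "norm \<kappa>" p 1] \<kappa>(2) by simp
 qed
 have Acl: "A n \<in> closure D" for n
  by (rule Lim_in_closed_set[OF closed_closure _ sequentially_bot A[of n]])
   (rule always_eventually, use inD closure_subset in blast)
 have Aper: "A (n + q) = A n" for n
 proof -
  have "aa k (n + q) = aa k n" for k by (rule cyc_per[OF cy])
  thus ?thesis using A[of n] A[of "n + q"] LIMSEQ_unique by simp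
 qed
 have bcl: "b \<in> closure D" using b closure_subset by blast
 have lim_rec: "A (Suc n) = f (A n) + b" if "A n \<in> D" for n
 proof -
  have "(%k. f (aa k n) + w k) \<longlonglongrightarrow> f (A n) + b"
   by (intro tendsto_add w isCont_tendsto_compose[OF f_isCont[OF that] A])
  thus ?thesis using A[of "Suc n"] LIMSEQ_unique by (simp add: rec)
 qed
 have lim_Dit: "Dit b q (A n) = \<kappa>" if o: "orb b q (A n)" for n
 proof -
  have "(%k. Dit (w k) q (aa k n)) \<longlonglongrightarrow> Dit b q (A n)" by (rule Dit_tendsto[OF o w A])
  hence "(%k. \<kappa>) \<longlonglongrightarrow> Dit b q (A n)" by (simp only: cyc_Dit_shift[OF cy])
  thus ?thesis by (simp add: LIMSEQ_const_iff)
 qed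
 have Anb: "A n ~= b" for n
 proof
  assume An: "A n = b"
  have step: "A (n + i) = it b i b" if "i \<le> q" for i using that
  proof (induction i)
   case (Suc i)
   hence "A (n + i) \<in> D" using b(2) by (simp add: orb_def)
   from lim_rec[OF this] Suc show ?case by (simp add: it_Suc del: funpow.simps(2))
  qed (simp add: An)
  have fxb: "it b q b = b" using step[of q] Aper[of n] An by simp
  define Bf where "Bf = (%i. it b i b)"
  have Bper: "Bf (i + q) = Bf i" for i unfolding Bf_def it_add fxb ..
  have BD: "Bf i \<in> D" for i
  proof -
   have "Bf i = Bf (i mod q)" by (rule periodic_mod[of Bf q]) (rule Bper)
   moreover have "i mod q < q" using q by simp
   ultimately show ?thesis using b(2) by (simp add: orb_def Bf_def)
  qed
  have Bs: "Bf (Suc i) = f (Bf i) + b" for i by (simp add: Bf_def it_Suc del: funpow.simps(2))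
  obtain q' l \<kappa>' where c': "q = q' * l" "l \<ge> 1" "cyc b q' Bf \<kappa>'" "\<kappa>' ^ l = Dit b q (Bf 0)"
   by (rule periodic_cyc[OF BD Bs Bper q]) (rule that)
  have "Dit b q (Bf 0) = \<kappa>" using lim_Dit[of n] An b(2) by (simp add: Bf_def)
  hence "neutral_or_attr \<kappa>'" using root_of_unity_neutral[OF _ c'(2) \<kappa>] c'(4) by simp
  hence "it b 0 b \<notin> range Bf" by (rule singular_orbit[OF bcl c'(3)]) blast
  moreover have "Bf 0 \<in> range Bf" by (rule rangeI)
  ultimately show False unfolding Bf_def by contradiction
 qed
 define G where "G = (%j. A (Suc j) - b)"
 have Gn: "0 < norm (G j)" "norm (G j) < d" for j
 proof -
  show "0 < norm (G j)" using Anb by (simp add: G_def)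
  show "norm (G j) < d" using diam_closure[OF b(1) Acl] by (simp add: G_def norm_minus_commute)
 qed
 define R where "R = Min ((%j. min (norm (G j)) (d - norm (G j)) / 2) ` {..<q})"
 have ne: "(%j. min (norm (G j)) (d - norm (G j)) / 2) ` {..<q} ~= {}" using q by (simp add: lessThan_empty_iff)
 have R: "R > 0" unfolding R_def using Gn by (subst Min_gr_iff[OF _ ne]) auto
 have RG: "2 * R \<le> norm (G j)" "norm (G j) + 2 * R \<le> d" if "j < q" for j
 proof -
  have "R \<le> min (norm (G j)) (d - norm (G j)) / 2" unfolding R_def by (rule Min_le) (use that in auto)
  thus "2 * R \<le> norm (G j)" "norm (G j) + 2 * R \<le> d" by auto
 qed
 obtain B where B: "!!x. x \<in> D ==> norm x \<le> B" using bounded_D by blast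
 define M where "M = max 1 (2 * B / R)"
 have M1: "M \<ge> 1" by (simp add: M_def)
 define m where "m = 1 / M ^ q"
 have m: "m > 0" using M1 by (simp add: m_def)
 obtain \<rho> where \<rho>: "\<rho> > 0" "!!v p. v holomorphic_on ball p R ==> (!!z. z \<in> ball p R ==> norm (v z) \<le> B) ==>
   m \<le> norm (deriv v p) ==> ball (v p) \<rho> \<subseteq> v ` ball p R"
 proof (rule ball_image_radius[OF R m, where B = B])
  fix r :: real
  assume r: "0 < r" and im: "!!v p. v holomorphic_on ball p R ==> (!!z. z \<in> ball p R ==> norm (v z) \<le> B) ==>
   m \<le> norm (deriv v p) ==> ball (v p) r \<subseteq> v ` ball p R"
  show thesis
  proof (rule that[of r])
   show "0 < r" by (rule r)
   fix v p assume 1: "v holomorphic_on ball p R" and 2: "!!z. z \<in> ball p R ==> norm (v z) \<le> B"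
    and 3: "m \<le> norm (deriv v p)"
   show "ball (v p) r \<subseteq> v ` ball p R" by (rule im[OF 1 _ 3]) (rule 2)
  qed
 qed
 have fl: "(%k. f (aa k j)) \<longlonglongrightarrow> G j" for j
 proof -
  have "(%k. aa k (Suc j) - w k) \<longlonglongrightarrow> G j" unfolding G_def by (intro tendsto_diff A w)
  thus ?thesis by (simp add: rec)
 qed
 have "\<forall>\<^sub>F k in sequentially. \<forall>j\<in>{..<q}. dist (f (aa k j)) (G j) < R \<and> dist (aa k j) (A j) < \<rho>"
  by (intro eventually_ball_finite ballI eventually_conj tendstoD[OF fl R] tendstoD[OF A \<rho>(1)]) auto
 then obtain k where k: "!!j. j < q ==> dist (f (aa k j)) (G j) < R" "!!j. j < q ==> dist (aa k j) (A j) < \<rho>"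
  unfolding eventually_at_top_linorder by blast
 have ann: "R \<le> norm (f (aa k j))" "norm (f (aa k j)) + R \<le> d" if "j < q" for j
  using RG[OF that] k(1)[OF that] norm_triangle_ineq2[of "G j" "f (aa k j)"] norm_triangle_ineq2[of "f (aa k j)" "G j"]
  by (auto simp: dist_norm norm_minus_commute)
 have lower: "norm (deriv f (aa k j)) \<ge> 1 / M" if j: "j < q" for j
 proof -
  obtain v where v: "deriv v (f (aa k j)) * deriv f (aa k j) = 1" "norm (deriv v (f (aa k j))) \<le> 2 * B / R"
   by (rule inverse_branch_bound[OF inD R ann[OF j] B]) (assumption, rule that)
  have "norm (deriv v (f (aa k j))) * norm (deriv f (aa k j)) = 1" using v(1) by (metis norm_mult norm_one)
  moreover have "norm (deriv v (f (aa k j))) \<le> M" using v(2) by (simp add: M_def)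
  ultimately have "1 \<le> M * norm (deriv f (aa k j))" by (metis mult_right_mono norm_ge_zero)
  thus ?thesis using M1 by (simp add: field_simps)
 qed
 have prd: "(\<Prod>j<q. norm (deriv f (aa k j))) = 1"
 proof -
  have "Dit (w k) q (aa k 0) = (\<Prod>j<q. deriv f (aa k j))"
   unfolding Dit_def using cyc_it[OF cy[of k], of _ 0] by simp
  hence "norm (\<Prod>j<q. deriv f (aa k j)) = 1" using cyc_Dit_shift[OF cy, of k 0] nk by simp
  thus ?thesis by (simp add: prod_norm)
 qed
 have AD0: "A j \<in> D" if j: "j < q" for j
 proof -
  have up: "norm (deriv f (aa k j)) \<le> M ^ q" by (rule factor_upper_bound[OF prd lower M1 j])
  obtain v where v: "v holomorphic_on ball (f (aa k j)) R" "v ` ball (f (aa k j)) R \<subseteq> D" "v (f (aa k j)) = aa k j"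
   "deriv v (f (aa k j)) * deriv f (aa k j) = 1"
   by (rule inverse_branch_bound[OF inD R ann[OF j] B]) (assumption, rule that)
  have "norm (deriv v (f (aa k j))) * norm (deriv f (aa k j)) = 1" using v(4) by (metis norm_mult norm_one)
  hence "1 \<le> norm (deriv v (f (aa k j))) * M ^ q" using up by (metis mult_left_mono norm_ge_zero)
  hence "m \<le> norm (deriv v (f (aa k j)))" using M1 by (simp add: m_def field_simps)
  hence "ball (v (f (aa k j))) \<rho> \<subseteq> v ` ball (f (aa k j)) R"
   by (rule \<rho>(2)[OF v(1), rotated]) (use v(2) B in blast)
  moreover have "A j \<in> ball (v (f (aa k j))) \<rho>" using k(2)[OF j] v(3) by simp
  ultimately show ?thesis using v(2) by blast
 qed
 have AD: "A n \<in> D" for n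
 proof -
  have "A n = A (n mod q)" by (rule periodic_mod[of A q]) (rule Aper)
  moreover have "n mod q < q" using q by simp
  ultimately show ?thesis using AD0 by simp
 qed
 show "A n \<in> D" by (rule AD)
 show "A (Suc n) = f (A n) + b" by (rule lim_rec[OF AD])
 show "A (n + q) = A n" by (rule Aper)
 have "it b j (A 0) = A j" for j by (induction j) (auto simp: lim_rec[OF AD] it_Suc simp del: funpow.simps(2))
 hence "orb b q (A 0)" using AD by (simp add: orb_def)
 thus "Dit b q (A 0) = \<kappa>" by (rule lim_Dit)
qed

end

section \<open>No drop of the period, and openness at limit parameters\<close>

context lifting_family
begin

text \<open>Suppose l > 1 points of each cycle collide at \<open>A 0\<close>. For \<kappa> \<noteq>
  1 this contradicts local uniqueness of the fixed point of the q-th iterate. For \<kappa> = 1 each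
  colliding point is a double zero of the displacement, so the limit vanishes to order 2 l, whereas
  \<open>parabolic_petals\<close> for the shorter cycle bounds the order by l + 1.\<close>

lemma limit_cycle:
 assumes \<kappa>: "\<kappa> ^ p = 1" "p \<ge> 1" and b: "b \<in> D" "orb b q b"
  and w: "w \<longlonglongrightarrow> b" and cy: "!!k. cyc (w k) q (aa k) \<kappa>" and A: "!!n. (%k. aa k n) \<longlonglongrightarrow> A n"
 shows "cyc b q A \<kappa>"
proof -
 note L = limit_cycle_in_domain[OF \<kappa> b w cy A]
 have q: "q \<ge> 1" using cy[of 0] by (simp add: cyc_def)
 have bcl: "b \<in> closure D" using b closure_subset by blast
 obtain q' l \<kappa>' where c': "q = q' * l" "l \<ge> 1" "cyc b q' A \<kappa>'" "\<kappa>' ^ l = Dit b q (A 0)"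
  by (rule periodic_cyc[OF L(1-3) q]) (rule that)
 have q'1: "q' \<ge> 1" using c'(3) by (simp add: cyc_def)
 have itA: "it b j (A n) = A (n + j)" for j n by (rule cyc_it[OF c'(3)])
 have o: "orb b q (A 0)" and fx: "it b q (A 0) = A 0" by (rule cyc_orb[OF c'(3)]) (use itA[of q 0] L(3)[of 0] in simp)
 have "l = 1"
 proof (rule ccontr)
  assume "l ~= 1"
  hence l2: "l \<ge> 2" using c'(2) by simp
  have Aiq: "A (i * q') = A 0" for i using periodic_add_mult[of A q' 0 i, OF cyc_per[OF c'(3)]] by simp
  have dist_aa: "aa k (i * q') ~= aa k (j * q')" if "i < j" "j < l" for i j k
  proof -
   have "i * q' < q" "j * q' < q" "i * q' ~= j * q'" using that c'(1) q'1 by (auto simp: mult.commute)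
   thus ?thesis using cyc_eq_iff[OF cy[of k], of "i * q'" "j * q'"] by simp
  qed
  have fixk: "it (w k) q (aa k n) = aa k n" for k n using cyc_it[OF cy] cyc_per[OF cy] by simp
  show False
  proof (cases "\<kappa> = 1")
   case False
   obtain r s \<alpha> where C: "r > 0" "s > 0" "!!w z. w \<in> ball b s ==> z \<in> ball (A 0) r ==> it w q z = z \<longleftrightarrow> z = \<alpha> w"
    by (rule cycle_implicit[OF o fx]) (use L(4) False in simp, rule that)
   have "(%k. aa k (1 * q')) \<longlonglongrightarrow> A 0" using A[of "1 * q'"] by (simp only: Aiq)
   hence "\<forall>\<^sub>F k in sequentially. dist (w k) b < s \<and> dist (aa k 0) (A 0) < r \<and> dist (aa k (1 * q')) (A 0) < r"
    by (intro eventually_conj tendstoD[OF w C(2)] tendstoD[OF A C(1)] tendstoD[OF _ C(1)])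
   then obtain k where k: "dist (w k) b < s" "dist (aa k 0) (A 0) < r" "dist (aa k (1 * q')) (A 0) < r"
    unfolding eventually_at_top_linorder by blast
   have "aa k 0 = \<alpha> (w k)" "aa k (1 * q') = \<alpha> (w k)"
    using C(3)[of "w k" "aa k 0"] C(3)[of "w k" "aa k (1 * q')"] k fixk by (auto simp: dist_commute)
   thus False using dist_aa[of 0 1 k] l2 by simp
  next
   case True
   obtain m e h where E: "m \<ge> 1" "e > 0" "h holomorphic_on ball 0 e" "h 0 ~= 0"
    "!!z. norm z < e ==> orb b q (A 0 + z) \<and> it b q (A 0 + z) = A 0 + z * (1 + z ^ m * h z)"
    by (rule parabolic_expansion[OF bcl q o fx]) (use L(4) True in simp, rule that)
   have ml: "m \<le> l" by (rule parabolic_petals[OF bcl c'(3,2) E(1-4)]) (use E(5) c'(1) in simp)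
   obtain s0 r0 where sr: "s0 > 0" "r0 > 0" "!!w z. w \<in> ball b s0 ==> z \<in> ball (A 0) r0 ==> orb w q z"
    by (rule orb_product_nbhd[OF o]) (rule that)
   obtain Bd where Bd: "!!x. x \<in> D ==> norm x \<le> Bd" using bounded_D by blast
   define r where "r = min r0 e"
   have r: "r > 0" "r \<le> r0" "r \<le> e" using sr E by (auto simp: r_def)
   define Hk where "Hk = (%w z. it w q (A 0 + z) - (A 0 + z))"
   have inb: "A 0 + z \<in> ball (A 0) r0" if "z \<in> ball 0 r" for z using that r by (simp add: dist_norm)
   have Hhol: "Hk w holomorphic_on ball 0 r" if "w \<in> ball b s0" for w
    unfolding Hk_def by (intro holomorphic_intros it_holomorphic[of "%_. w"]) (use sr(3)[OF that inb] in auto)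
   obtain q0 where q0: "q = Suc q0" using q by (cases q) auto
   obtain F where F: "F > 0" "\<forall>\<^sub>F k in sequentially. \<forall>z\<in>cball 0 (r/2). norm (Hk (w k) z) \<le> F"
   proof -
    define C where "C = cball b (s0/2) \<times> cball (A 0) (r/2)"
    have Csub: "C \<subseteq> {(w, z). orb w q z}" using sr(3) r sr(1,2) by (auto simp: C_def)
    have "compact C" unfolding C_def by (intro compact_Times compact_cball)
    moreover have "continuous_on C (%(w, z). it w q z)" by (rule continuous_on_subset[OF it_cont Csub])
    ultimately have "bounded ((%(w, z). it w q z) ` C)" using compact_continuous_image compact_imp_bounded by blast
    then obtain F0 where F0: "F0 > 0" "!!x. x \<in> (%(w, z). it w q z) ` C ==> norm x \<le> F0" unfolding bounded_pos by blast
    have "\<forall>\<^sub>F k in sequentially. \<forall>z\<in>cball 0 (r/2). norm (Hk (w k) z) \<le> F0 + (norm (A 0) + r)"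
     using tendstoD[OF w half_gt_zero[OF sr(1)]]
    proof eventually_elim
     case (elim k)
     show ?case
     proof
      fix z :: complex assume z: "z \<in> cball 0 (r/2)"
      have "(w k, A 0 + z) \<in> C" using elim z by (auto simp: C_def dist_norm norm_minus_commute)
      hence "norm (it (w k) q (A 0 + z)) \<le> F0" using F0(2) by (metis (no_types, lifting) case_prod_conv imageI)
      moreover have "norm (A 0 + z) \<le> norm (A 0) + r" using norm_triangle_ineq[of "A 0" z] z r by simp
      ultimately show "norm (Hk (w k) z) \<le> F0 + (norm (A 0) + r)"
       unfolding Hk_def using norm_triangle_ineq4[of "it (w k) q (A 0 + z)" "A 0 + z"] by linarith
     qed
    qed
    moreover have "F0 + (norm (A 0) + r) > 0" using F0 r by (simp add: add_pos_nonneg add_nonneg_pos)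
    ultimately show ?thesis using that by blast
   qed
   define Zk where "Zk = (%k. (%i. aa k (i * q') - A 0) ` {..<l})"
   have inj: "inj_on (%i. aa k (i * q') - A 0) {..<l}" for k
    by (rule linorder_inj_onI) (use dist_aa in auto)
   have cardZ: "card (Zk k) = l" for k unfolding Zk_def by (simp add: card_image[OF inj])
   have l0: "(%k. aa k (i * q') - A 0) \<longlonglongrightarrow> 0" for i
    using tendsto_diff[OF A[of "i * q'"] tendsto_const[of "A 0"]] by (simp only: Aiq diff_self)
   have evZ: "\<forall>\<^sub>F k in sequentially. \<forall>i\<in>{..<l}. dist (aa k (i * q') - A 0) 0 < (r/2) / 4"
    by (intro eventually_ball_finite ballI tendstoD[OF l0]) (use r in auto)
   define Ck where "Ck = F * (4 / (r/2)) ^ (2 * l)"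
   have Ck: "Ck > 0" using F(1) r by (simp add: Ck_def)
   have bound: "norm (Hk b z) \<le> Ck * (norm z) ^ (2 * l)" if z: "norm z < (r/2) / 2" for z
   proof (rule tendsto_le[OF trivial_limit_sequentially])
    have zb: "z \<in> ball 0 r" using z r by simp
    have oz: "orb b q (A 0 + z)" by (rule sr(3)) (use inb[OF zb] sr(1) in auto)
    show "(%k. norm (Hk (w k) z)) \<longlonglongrightarrow> norm (Hk b z)"
     unfolding Hk_def by (intro tendsto_intros it_tendsto[OF oz w tendsto_const])
    have "(%k. Ck * (\<Prod>i<l. norm (z - (aa k (i * q') - A 0)) ^ 2)) \<longlonglongrightarrow> Ck * (\<Prod>i<l. norm (z - 0) ^ 2)"
     by (intro tendsto_intros l0)
    thus "(%k. Ck * (\<Prod>i<l. norm (z - (aa k (i * q') - A 0)) ^ 2)) \<longlonglongrightarrow> Ck * norm z ^ (2 * l)"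
     by (simp add: power_mult power_even_eq)
    show "\<forall>\<^sub>F k in sequentially. norm (Hk (w k) z) \<le> Ck * (\<Prod>i<l. norm (z - (aa k (i * q') - A 0)) ^ 2)"
     using F(2) evZ tendstoD[OF w sr(1)]
    proof eventually_elim
     case (elim k)
     have wb: "w k \<in> ball b s0" using elim(3) by (simp add: dist_commute)
     have "norm (Hk (w k) z) \<le> F * (4 / (r/2)) ^ (2 * card (Zk k)) * (\<Prod>a\<in>Zk k. norm (z - a) ^ 2)"
     proof (rule double_zeros_bound)
      show "Hk (w k) holomorphic_on ball 0 (r/2)" by (rule holomorphic_on_subset[OF Hhol[OF wb]]) (use r in auto)
      show "norm (Hk (w k) x) \<le> F" if "x \<in> ball 0 (r/2)" for x using elim(1) that by simp
      show "Zk k \<subseteq> ball 0 ((r/2) / 4)" using elim(2) by (auto simp: Zk_def)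
      show "Hk (w k) a = 0 \<and> deriv (Hk (w k)) a = 0" if ain: "a \<in> Zk k" for a
      proof -
       obtain i where a: "a = aa k (i * q') - A 0" using ain by (auto simp: Zk_def)
       have "((%z. it (w k) q (A 0 + z)) has_field_derivative Dit (w k) q (A 0 + a) * 1) (at a)"
        using cyc_orb[OF cy[of k], of q "i * q'"] by (intro DERIV_chain2[OF it_deriv]) (auto simp: a intro!: derivative_eq_intros)
       hence "(Hk (w k) has_field_derivative 0) (at a)"
        unfolding Hk_def using cyc_Dit_shift[OF cy[of k], of "i * q'"] True by (auto simp: a intro!: derivative_eq_intros)
       thus ?thesis using fixk[of k "i * q'"] by (simp add: Hk_def a DERIV_imp_deriv)
      qed
     qed (use r z in \<open>auto simp: Zk_def\<close>)
     moreover have "(\<Prod>a\<in>Zk k. norm (z - a) ^ 2) = (\<Prod>i<l. norm (z - (aa k (i * q') - A 0)) ^ 2)"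
      unfolding Zk_def by (simp add: prod.reindex[OF inj])
     ultimately show ?case by (simp add: cardZ Ck_def)
    qed
   qed
   \<comment> \<open>The exponent is positive because m + 1 \<le> l + 1 < 2 l; so the estimate
     forces \<open>h 0\<close> to vanish.\<close>
   have hb: "norm (h z) \<le> Ck * norm z ^ (2 * l - (m + 1))" if z: "norm z < (r/2) / 2" "z ~= 0" for z
   proof -
    have ze: "norm z < e" using z r by simp
    have "Hk b z = z ^ (m + 1) * h z" using E(5)[OF ze] by (simp add: Hk_def algebra_simps)
    hence "norm z ^ (m + 1) * norm (h z) \<le> Ck * norm z ^ (2 * l)" using bound[OF z(1)] by (simp add: norm_mult norm_power)
    also have "2 * l = (m + 1) + (2 * l - (m + 1))" using ml l2 by simp
    finally have "norm z ^ (m + 1) * norm (h z) \<le> norm z ^ (m + 1) * (Ck * norm z ^ (2 * l - (m + 1)))"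
     by (simp add: power_add mult.commute mult.left_commute)
    thus ?thesis by (rule mult_left_le_imp_le) (use z(2) in simp)
   qed
   have hc: "(h \<longlongrightarrow> h 0) (at 0)"
   proof -
    have "isCont h 0" using E(2,3) continuous_on_eq_continuous_at[OF open_ball] holomorphic_on_imp_continuous_on by (metis centre_in_ball)
    thus ?thesis by (simp add: isCont_def)
   qed
   have "norm (h 0) \<le> 0"
   proof (rule tendsto_le[of "at (0::complex)"])
    show "((%z. norm (h z)) \<longlongrightarrow> norm (h 0)) (at 0)" by (rule tendsto_norm[OF hc])
    have "((%z::complex. Ck * norm z ^ (2 * l - (m + 1))) \<longlongrightarrow> Ck * norm (0::complex) ^ (2 * l - (m + 1))) (at 0)"
     by (intro tendsto_intros)
    thus "((%z::complex. Ck * norm z ^ (2 * l - (m + 1))) \<longlongrightarrow> 0) (at 0)" using ml l2 by (simp add: zero_power)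
    have "\<forall>\<^sub>F z in at (0::complex). z \<in> ball 0 ((r/2)/2)" using r by (intro eventually_at_in_open') auto
    moreover have "\<forall>\<^sub>F z in at (0::complex). z ~= 0" by (rule eventually_neq_at_within)
    ultimately show "\<forall>\<^sub>F z in at 0. norm (h z) \<le> Ck * norm z ^ (2 * l - (m + 1))"
     by eventually_elim (rule hb, auto)
   qed simp
   thus False using E(4) by simp
  qed
 qed
 thus ?thesis using c' L(4) by simp
qed

lemma convergent_subsequences:
 fixes x :: "nat => nat => complex"
 assumes "!!k n. norm (x k n) \<le> B"
 shows "\<exists>\<sigma>. strict_mono (\<sigma> :: nat => nat) \<and> (\<forall>j<m. \<exists>l. (%k. x (\<sigma> k) j) \<longlonglongrightarrow> l)"
proof (induction m)
 case 0
 show ?case by (intro exI[of _ id]) (simp add: strict_mono_def)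
next
 case (Suc m)
 then obtain \<sigma> where \<sigma>: "strict_mono \<sigma>" "!!j. j < m ==> \<exists>l. (%k. x (\<sigma> k) j) \<longlonglongrightarrow> l" by blast
 have "bounded (range (%k. x (\<sigma> k) m))" using assms by (auto simp: bounded_iff)
 then obtain l \<tau> where \<tau>: "strict_mono (\<tau> :: nat => nat)" "((%k. x (\<sigma> k) m) \<circ> \<tau>) \<longlonglongrightarrow> l"
  using bounded_imp_convergent_subsequence by blast
 have "\<exists>l. (%k. x ((\<sigma> \<circ> \<tau>) k) j) \<longlonglongrightarrow> l" if j: "j < Suc m" for j
 proof (cases "j = m")
  case True
  thus ?thesis using \<tau>(2) by (auto simp: o_def)
 next
  case False
  then obtain l where "(%k. x (\<sigma> k) j) \<longlonglongrightarrow> l" using \<sigma>(2) j by force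
  from LIMSEQ_subseq_LIMSEQ[OF this \<tau>(1)] show ?thesis by (auto simp: o_def)
 qed
 thus ?case using strict_mono_o[OF \<sigma>(1) \<tau>(1)] by blast
qed

definition cycles :: "nat => complex => complex set" where
 "cycles q \<kappa> = {w. \<exists>aa. cyc w q aa \<kappa>}"

text \<open>The limit cycle is continued holomorphically, through the periodicity equation or, for
  \<kappa> = 1, through the equation for the derivative. The other of the two equations holds along
  the sequence of parameters, and the identity theorem spreads it over a disc.\<close>

lemma cycles_interior:
 assumes \<kappa>: "\<kappa> ^ p = 1" "p \<ge> 1" and b: "b \<in> D" "orb b q b"
  and w: "w \<longlonglongrightarrow> b" "!!k. w k \<in> cycles q \<kappa>" "!!k. w k ~= b"
 shows "b \<in> interior (cycles q \<kappa>)"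
proof -
 obtain aa where aa: "!!k. cyc (w k) q (aa k) \<kappa>" using w(2) unfolding cycles_def by (simp add: choice_iff) metis
 have q: "q \<ge> 1" using aa[of 0] by (simp add: cyc_def)
 obtain B where B: "!!x. x \<in> D ==> norm x \<le> B" using bounded_D by blast
 have inD: "aa k n \<in> D" for k n using aa by (simp add: cyc_def)
 obtain \<sigma> where \<sigma>: "strict_mono (\<sigma> :: nat => nat)" "!!j. j < q ==> \<exists>l. (%k. aa (\<sigma> k) j) \<longlonglongrightarrow> l"
  using convergent_subsequences[of aa B q] B inD by blast
 then obtain A0 where A0: "!!j. j < q ==> (%k. aa (\<sigma> k) j) \<longlonglongrightarrow> A0 j" by metis
 define A where "A = (%n. A0 (n mod q))"
 have A: "(%k. aa (\<sigma> k) n) \<longlonglongrightarrow> A n" for n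
 proof -
  have "aa (\<sigma> k) n = aa (\<sigma> k) (n mod q)" for k by (rule periodic_mod[of "aa (\<sigma> k)" q]) (rule cyc_per[OF aa])
  moreover have "n mod q < q" using q by simp
  ultimately show ?thesis using A0 by (simp add: A_def)
 qed
 have ws: "(%k. w (\<sigma> k)) \<longlonglongrightarrow> b" using LIMSEQ_subseq_LIMSEQ[OF w(1) \<sigma>(1)] by (simp add: o_def)
 have cb: "cyc b q A \<kappa>" by (rule limit_cycle[OF \<kappa> b ws aa A])
 have bcl: "b \<in> closure D" using b closure_subset by blast
 have o: "orb b q (A 0)" and fx: "it b q (A 0) = A 0" and Dk: "Dit b q (A 0) = \<kappa>"
  using cyc_orb[OF cb] cyc_it[OF cb, of q 0] cyc_per[OF cb, of 0] cyc_Dit_shift[OF cb] by auto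
 have identity: "g x = 0" if g: "g holomorphic_on ball b s" and z: "!!k. w (\<sigma> k) \<in> ball b s ==> aa (\<sigma> k) 0 \<in> ball (A 0) r ==> g (w (\<sigma> k)) = 0"
  and rs: "r > 0" "s > 0" and x: "x \<in> ball b s" for g :: "complex => complex" and s r x
 proof -
  have "\<forall>\<^sub>F k in sequentially. dist (w (\<sigma> k)) b < s \<and> dist (aa (\<sigma> k) 0) (A 0) < r"
   by (intro eventually_conj tendstoD[OF ws rs(2)] tendstoD[OF A rs(1)])
  then obtain k0 where k0: "!!k. k \<ge> k0 ==> dist (w (\<sigma> k)) b < s \<and> dist (aa (\<sigma> k) 0) (A 0) < r"
   unfolding eventually_at_top_linorder by blast
  define U where "U = (%k. w (\<sigma> (k + k0))) ` UNIV"
  have "b islimpt U"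
   unfolding islimpt_sequential
  proof (intro exI[of _ "%k. w (\<sigma> (k + k0))"] conjI allI)
   show "w (\<sigma> (k + k0)) \<in> U - {b}" for k using w(3) by (auto simp: U_def)
   show "(%k. w (\<sigma> (k + k0))) \<longlonglongrightarrow> b" using LIMSEQ_ignore_initial_segment[OF ws, of k0] .
  qed
  moreover have "U \<subseteq> ball b s" using k0 by (auto simp: U_def dist_commute)
  moreover have "g z = 0" if "z \<in> U" for z using that k0 z by (auto simp: U_def dist_commute)
  ultimately show "g x = 0"
   using analytic_continuation[OF g open_ball connected_ball _ _ _ _ x, of U b] rs by simp
 qed
 have "\<exists>s \<alpha>. s > 0 \<and> \<alpha> holomorphic_on ball b s \<and> \<alpha> b = A 0 \<and> (\<forall>x\<in>ball b s. it x q (\<alpha> x) = \<alpha> x \<and> Dit x q (\<alpha> x) = \<kappa>)"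
 proof (cases "\<kappa> = 1")
  case False
  obtain r s \<alpha> where C: "r > 0" "s > 0" "\<alpha> holomorphic_on ball b s" "\<alpha> b = A 0"
   "!!w. w \<in> ball b s ==> \<alpha> w \<in> ball (A 0) r" "!!w z. w \<in> ball b s ==> z \<in> ball (A 0) r ==> orb w q z"
   "!!w z. w \<in> ball b s ==> z \<in> ball (A 0) r ==> it w q z = z \<longleftrightarrow> z = \<alpha> w"
   by (rule cycle_implicit[OF o fx]) (use Dk False in simp, rule that)
  have gh: "(%x. Dit x q (\<alpha> x) - \<kappa>) holomorphic_on ball b s"
   by (intro holomorphic_intros Dit_holomorphic[of "%x. x"] C(3) C(6)[OF _ C(5)])
  have "Dit x q (\<alpha> x) - \<kappa> = 0" if x: "x \<in> ball b s" for x
  proof (rule identity[OF gh _ C(1,2) x])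
   fix k assume k: "w (\<sigma> k) \<in> ball b s" "aa (\<sigma> k) 0 \<in> ball (A 0) r"
   have "it (w (\<sigma> k)) q (aa (\<sigma> k) 0) = aa (\<sigma> k) 0" using cyc_it[OF aa[of "\<sigma> k"], of q 0] cyc_per[OF aa[of "\<sigma> k"], of 0] by simp
   hence "aa (\<sigma> k) 0 = \<alpha> (w (\<sigma> k))" using C(7)[OF k] by simp
   thus "Dit (w (\<sigma> k)) q (\<alpha> (w (\<sigma> k))) - \<kappa> = 0" using cyc_Dit_shift[OF aa[of "\<sigma> k"], of 0] by simp
  qed
  moreover have "it x q (\<alpha> x) = \<alpha> x" if "x \<in> ball b s" for x using C(7)[OF that C(5)[OF that]] by simp
  ultimately show ?thesis using C(2-4) by (intro exI[of _ s], intro exI[of _ \<alpha>]) simp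
 next
  case True
  have dn: "deriv (Dit b q) (A 0) ~= 0" using parabolic_multiplier_simple[OF bcl, of q A] cb True by simp
  obtain r s \<alpha> where C: "r > 0" "s > 0" "\<alpha> holomorphic_on ball b s" "\<alpha> b = A 0"
   "!!w. w \<in> ball b s ==> \<alpha> w \<in> ball (A 0) r" "!!w z. w \<in> ball b s ==> z \<in> ball (A 0) r ==> orb w q z"
   "!!w z. w \<in> ball b s ==> z \<in> ball (A 0) r ==> Dit w q z = 1 \<longleftrightarrow> z = \<alpha> w"
   by (rule multiplier_implicit[OF o _ dn]) (use Dk True in simp, rule that)
  have gh: "(%x. it x q (\<alpha> x) - \<alpha> x) holomorphic_on ball b s"
   by (intro holomorphic_intros it_holomorphic[of "%x. x"] C(3) C(6)[OF _ C(5)])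
  have "it x q (\<alpha> x) - \<alpha> x = 0" if x: "x \<in> ball b s" for x
  proof (rule identity[OF gh _ C(1,2) x])
   fix k assume k: "w (\<sigma> k) \<in> ball b s" "aa (\<sigma> k) 0 \<in> ball (A 0) r"
   have "Dit (w (\<sigma> k)) q (aa (\<sigma> k) 0) = 1" using cyc_Dit_shift[OF aa[of "\<sigma> k"], of 0] True by simp
   hence "aa (\<sigma> k) 0 = \<alpha> (w (\<sigma> k))" using C(7)[OF k] by simp
   moreover have "it (w (\<sigma> k)) q (aa (\<sigma> k) 0) = aa (\<sigma> k) 0" using cyc_it[OF aa[of "\<sigma> k"], of q 0] cyc_per[OF aa[of "\<sigma> k"], of 0] by simp
   ultimately show "it (w (\<sigma> k)) q (\<alpha> (w (\<sigma> k))) - \<alpha> (w (\<sigma> k)) = 0" by simp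
  qed
  moreover have "Dit x q (\<alpha> x) = \<kappa>" if "x \<in> ball b s" for x using C(7)[OF that C(5)[OF that]] True by simp
  ultimately show ?thesis using C(2-4) by (intro exI[of _ s], intro exI[of _ \<alpha>]) simp
 qed
 then obtain s \<alpha> where S: "s > 0" "\<alpha> holomorphic_on ball b s" "\<alpha> b = A 0"
  "!!x. x \<in> ball b s ==> it x q (\<alpha> x) = \<alpha> x" "!!x. x \<in> ball b s ==> Dit x q (\<alpha> x) = \<kappa>" by blast
 have "isCont \<alpha> b" using S(1,2) continuous_on_eq_continuous_at[OF open_ball] holomorphic_on_imp_continuous_on by (metis centre_in_ball)
 hence al: "(\<alpha> \<longlongrightarrow> A 0) (nhds b)" using tendsto_at_iff_tendsto_nhds[of \<alpha> b] by (simp add: isCont_def S(3))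
 have evb: "\<forall>\<^sub>F x in nhds b. x \<in> ball b s" using S(1) by (intro eventually_nhds_in_open) auto
 have "\<forall>\<^sub>F x in nhds b. cyc x q (%n. it x n (\<alpha> x)) (Dit x q (\<alpha> x))"
  by (rule cyc_nearby[OF cb filterlim_ident al]) (use evb in eventually_elim, use S(4) in simp)
 hence "\<forall>\<^sub>F x in nhds b. x \<in> cycles q \<kappa>" using evb
 proof eventually_elim
  case (elim x)
  thus ?case using S(5)[of x] by (auto simp: cycles_def)
 qed
 thus ?thesis unfolding eventually_nhds by (auto intro: interiorI)
qed

end

subsection \<open>Holomorphic functions on a half-plane\<close>

lemma norm_add_cnj: "norm (z + cnj w) ^ 2 = norm (z - w) ^ 2 + 4 * (Re z * Re w)"
 unfolding cmod_power2 by (simp add: power2_eq_square algebra_simps)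

text \<open>The Schwarz-Pick inequality for self-maps of the right half-plane, squared by means of
  \<open>norm_add_cnj\<close> and weakened until only real parts of \<Lambda> remain. The explicit
  dependence on \<open>z\<close> and \<open>w\<close> is kept because a decay rate will be read off
  from it.\<close>

lemma half_plane_harnack:
 assumes hol: "\<Lambda> holomorphic_on {z. Re z > 0}" and pos: "!!z. Re z > 0 ==> Re (\<Lambda> z) > 0"
  and z: "Re z > 0" and w: "Re w > 0"
 shows "Re (\<Lambda> z) * (Re z * Re w) \<le> norm (z + cnj w) ^ 2 * Re (\<Lambda> w)"
proof -
 have less: "norm (x - y) < norm (x + cnj y)" if "Re x > 0" "Re y > 0" for x y
 proof -
  have "norm (x - y) ^ 2 < norm (x + cnj y) ^ 2" using that by (simp add: norm_add_cnj)
  thus ?thesis by (rule power2_less_imp_less) simp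
 qed
 \<comment> \<open>The Cayley map from the disc to the half-plane that sends 0 to \<open>w\<close>;
   \<open>g\<close> is \<Lambda> in disc coordinates on both sides.\<close>
 define T where "T = (%s. of_real (Re w) * ((1 + s) / (1 - s)) + \<i> * of_real (Im w))"
 define g where "g = (%s. (\<Lambda> (T s) - \<Lambda> w) / (\<Lambda> (T s) + cnj (\<Lambda> w)))"
 have n1: "1 - s ~= 0" if "norm s < 1" for s :: complex using that by auto
 have Tre: "Re (T s) > 0" if s: "norm s < 1" for s
 proof -
  have "(Re s)\<^sup>2 + (Im s)\<^sup>2 < 1" using s by (simp add: cmod_def)
  moreover have "(1 - Re s)\<^sup>2 + (Im s)\<^sup>2 > 0"
   using n1[OF s] by (auto simp: complex_eq_iff sum_power2_gt_zero_iff)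
  ultimately have "Re ((1 + s) / (1 - s)) > 0"
   by (simp add: Re_divide power2_eq_square algebra_simps divide_pos_pos)
  moreover have "Re (of_real x * X + \<i> * of_real y) = x * Re X" for x y X by simp
  ultimately show ?thesis unfolding T_def using w by (simp only: mult_pos_pos)
 qed
 have Th: "T holomorphic_on ball 0 1" unfolding T_def by (intro holomorphic_intros) (use n1 in auto)
 have LT: "(%s. \<Lambda> (T s)) holomorphic_on ball 0 1"
  by (rule holomorphic_on_compose_gen[OF Th hol, unfolded o_def]) (use Tre in auto)
 have den: "\<Lambda> (T s) + cnj (\<Lambda> w) ~= 0" if "norm s < 1" for s
  using less[OF pos[OF Tre[OF that]] pos[OF w]] by auto
 have gh: "g holomorphic_on ball 0 1" unfolding g_def by (intro holomorphic_intros LT) (use den in auto)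
 have "T 0 = w" by (simp add: T_def complex_eq_iff)
 hence g0: "g 0 = 0" by (simp add: g_def)
 have gn: "norm (g s) < 1" if "norm s < 1" for s
  using less[OF pos[OF Tre[OF that]] pos[OF w]] by (simp add: g_def norm_divide divide_less_eq)
 define s0 where "s0 = (z - w) / (z + cnj w)"
 have zw: "z + cnj w ~= 0" using less[OF z w] by auto
 have s0: "norm s0 < 1" using less[OF z w] by (simp add: s0_def norm_divide divide_less_eq)
 have Ts0: "T s0 = z"
 proof -
  have r2: "w + cnj w = of_real (2 * Re w)" by (simp add: complex_add_cnj)
  have i2: "w - cnj w = \<i> * of_real (2 * Im w)" by (simp add: complex_diff_cnj)
  have "1 - s0 = (w + cnj w) / (z + cnj w)" "1 + s0 = (2 * z - (w - cnj w)) / (z + cnj w)"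
   using zw by (auto simp: s0_def field_simps)
  hence "(1 + s0) / (1 - s0) = (2 * z - \<i> * of_real (2 * Im w)) / of_real (2 * Re w)"
   using zw by (simp add: r2 i2)
  thus ?thesis unfolding T_def using w by (simp only:) (simp add: field_simps)
 qed
 have "norm (g s0) \<le> norm s0" by (rule Schwarz_Lemma(1)[OF gh g0 gn s0])
 hence q: "norm (\<Lambda> z - \<Lambda> w) / norm (\<Lambda> z + cnj (\<Lambda> w)) \<le> norm (z - w) / norm (z + cnj w)"
  unfolding g_def Ts0 by (simp add: s0_def norm_divide)
 define N where "N = norm (\<Lambda> z + cnj (\<Lambda> w)) ^ 2"
 define M where "M = norm (z + cnj w) ^ 2"
 define A where "A = Re (\<Lambda> z)"
 define B where "B = Re (\<Lambda> w)"
 have AB: "A > 0" "B > 0" using pos z w by (auto simp: A_def B_def)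
 have M: "M > 0" using zw by (simp add: M_def)
 have dn: "norm (\<Lambda> z + cnj (\<Lambda> w)) > 0" using den[OF s0] by (simp add: Ts0)
 have N: "N \<ge> A ^ 2"
 proof -
  have "A \<le> Re (\<Lambda> z + cnj (\<Lambda> w))" using AB by (simp add: A_def B_def)
  also have "\<dots> \<le> norm (\<Lambda> z + cnj (\<Lambda> w))" by (rule complex_Re_le_cmod)
  finally show ?thesis unfolding N_def using AB by (intro power_mono) auto
 qed
 have "norm (\<Lambda> z - \<Lambda> w) * norm (z + cnj w) \<le> norm (z - w) * norm (\<Lambda> z + cnj (\<Lambda> w))"
  using q dn zw by (simp add: field_simps)
 hence "(norm (\<Lambda> z - \<Lambda> w) * norm (z + cnj w)) ^ 2 \<le> (norm (z - w) * norm (\<Lambda> z + cnj (\<Lambda> w))) ^ 2"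
  by (intro power_mono) auto
 hence "norm (\<Lambda> z - \<Lambda> w) ^ 2 * M \<le> norm (z - w) ^ 2 * N" by (simp add: power_mult_distrib M_def N_def)
 moreover have "norm (\<Lambda> z - \<Lambda> w) ^ 2 = N - 4 * (A * B)" "norm (z - w) ^ 2 = M - 4 * (Re z * Re w)"
  by (auto simp: N_def M_def norm_add_cnj A_def B_def)
 ultimately have "(Re z * Re w) * N \<le> (A * B) * M" by (simp add: algebra_simps)
 moreover have "(Re z * Re w) * A ^ 2 \<le> (Re z * Re w) * N" using N z w by (intro mult_left_mono) auto
 ultimately have "A * (A * (Re z * Re w)) \<le> A * (M * B)" by (simp add: power2_eq_square mult.commute mult.left_commute)
 hence "A * (Re z * Re w) \<le> M * B" using AB by (simp only: mult_le_cancel_left_pos)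
 thus ?thesis by (simp add: A_def B_def M_def)
qed

text \<open>A Phragmen-Lindelof argument. The bound on the square forces \<Delta> to 0 at the
  imaginary axis; division by a linear function of modulus at least 1 makes the bound
  \<open>B\<close> harmless far out, and the maximum principle is applied on a large truncated
  disc.\<close>

lemma half_plane_boundary_zero:
 assumes hol: "\<Delta> holomorphic_on {z. Re z > 0}" and B: "!!z. Re z > 0 ==> norm (\<Delta> z) \<le> B"
  and C: "!!z. Re z > 0 ==> norm (\<Delta> z) ^ 2 \<le> C * Re z" and z0: "Re z0 > 0"
 shows "\<Delta> z0 = 0"
proof -
 have "norm (\<Delta> z0) \<le> 0 + e" if e: "e > 0" for e
 proof -
  define x0 where "x0 = Re z0"
  have B0: "B \<ge> 0" using B[OF z0] norm_ge_zero order_trans by blast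
  have C0: "C \<ge> 0" using C[OF z0] z0 by (metis mult_neg_pos not_less order_trans zero_le_power2 leD)
  define e' where "e' = e / 2"
  have e': "e' > 0" using e by (simp add: e'_def)
  define x1 where "x1 = min (x0 / 2) (e' ^ 2 / (C + 1))"
  have x1: "x1 > 0" "x1 < x0" "x1 \<le> e' ^ 2 / (C + 1)" using z0 e' C0 by (auto simp: x1_def x0_def)
  have Cx: "C * x1 \<le> e' ^ 2"
  proof -
   have "C * x1 \<le> (C + 1) * (e' ^ 2 / (C + 1))" using x1 C0 by (intro mult_mono) auto
   thus ?thesis using C0 by simp
  qed
  define z1 where "z1 = Complex x1 (Im z0)"
  \<comment> \<open>Large enough for the linear denominator to be at least B / e' on the circular
    part of the boundary.\<close>
  define R where "R = x0 * (B / e' + 2) + 1"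
  have x0: "x0 > 0" using z0 by (simp add: x0_def)
  have R: "R > 0" "R > x0" "R / x0 \<ge> B / e' + 1"
  proof -
   have "B / e' \<ge> 0" using B0 e' by simp
   hence "x0 * 1 \<le> x0 * (B / e' + 2)" using x0 by (intro mult_left_mono) auto
   thus "R > 0" "R > x0" unfolding R_def using x0 by linarith+
   have "R / x0 = B / e' + 2 + 1 / x0" using x0 by (simp add: R_def add_divide_distrib)
   thus "R / x0 \<ge> B / e' + 1" using x0 by simp
  qed
  define S where "S = cball z1 R \<inter> {z. Re z \<ge> x1}"
  define Gf where "Gf = (%z. \<Delta> z / (1 + (z - z1) / of_real x0))"
  have Re1: "Re (1 + (z - z1) / of_real x0) \<ge> 1" if "Re z \<ge> x1" for z
   using that x0 by (simp add: z1_def Re_divide_of_real)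
  have n1: "norm (1 + (z - z1) / of_real x0) \<ge> 1" if "Re z \<ge> x1" for z
   using Re1[OF that] complex_Re_le_cmod order_trans by blast
  have pos: "Re z > 0" if "z \<in> S" for z using that x1 by (simp add: S_def)
  have Gh: "Gf holomorphic_on S" unfolding Gf_def
  proof (intro holomorphic_intros holomorphic_on_subset[OF hol])
   show "S \<subseteq> {z. Re z > 0}" using pos by auto
   show "1 + (z - z1) / of_real x0 ~= 0" if "z \<in> S" for z using n1[of z] that by (auto simp: S_def)
  qed (use x0 in auto)
  have cS: "closed S" unfolding S_def by (intro closed_Int closed_cball closed_halfspace_Re_ge)
  have "norm (Gf z0) \<le> e'"
  proof (rule maximum_modulus_frontier[of Gf S])
   show "Gf holomorphic_on interior S" by (rule holomorphic_on_subset[OF Gh interior_subset])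
   show "continuous_on (closure S) Gf" using holomorphic_on_imp_continuous_on[OF Gh] cS by (simp add: closure_closed)
   show "bounded S" unfolding S_def by (intro bounded_Int) auto
   show "z0 \<in> S" using x1 R by (simp add: S_def x0_def z1_def dist_norm complex_norm cmod_def)
   fix z assume z: "z \<in> frontier S"
   hence zS: "z \<in> S" using cS by (simp add: frontier_def closure_closed)
   have "dist z1 z = R \<or> Re z = x1"
   proof (rule ccontr)
    assume "\<not> ?thesis"
    hence "z \<in> ball z1 R \<inter> {z. Re z > x1}" using zS by (auto simp: S_def)
    moreover have "open (ball z1 R \<inter> {z. Re z > x1})" by (intro open_Int open_ball open_halfspace_Re_gt)
    moreover have "ball z1 R \<inter> {z. Re z > x1} \<subseteq> S" by (auto simp: S_def)
    ultimately have "z \<in> interior S" by (meson interiorI)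
    thus False using z by (simp add: frontier_def)
   qed
   thus "norm (Gf z) \<le> e'"
   proof
    assume d: "dist z1 z = R"
    have "norm ((z - z1) / of_real x0) = R / x0" using d x0 by (simp add: norm_divide dist_norm norm_minus_commute)
    hence "norm (1 + (z - z1) / of_real x0) \<ge> B / e'"
     using norm_triangle_ineq2[of "(z - z1) / of_real x0" "- 1"] R(3) by (simp add: add.commute)
    hence "B \<le> e' * norm (1 + (z - z1) / of_real x0)" using e' by (simp add: field_simps)
    moreover have "norm (\<Delta> z) \<le> B" by (rule B[OF pos[OF zS]])
    moreover have "norm (1 + (z - z1) / of_real x0) > 0" using n1[of z] zS by (auto simp: S_def intro: less_le_trans[OF zero_less_one])
    ultimately show ?thesis by (simp add: Gf_def norm_divide divide_le_eq)
   next
    assume r: "Re z = x1"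
    have "norm (\<Delta> z) ^ 2 \<le> e' ^ 2" using C[OF pos[OF zS]] Cx r by simp
    hence "norm (\<Delta> z) \<le> e'" by (rule power2_le_imp_le) (use e' in simp)
    also have "\<dots> \<le> e' * norm (1 + (z - z1) / of_real x0)" using n1[of z] r e' by simp
    finally have "norm (\<Delta> z) \<le> e' * norm (1 + (z - z1) / of_real x0)" .
    moreover have "norm (1 + (z - z1) / of_real x0) > 0" using n1[of z] r by (auto intro: less_le_trans[OF zero_less_one])
    ultimately show ?thesis by (simp add: Gf_def norm_divide divide_le_eq)
   qed
  qed
  moreover have "norm (1 + (z0 - z1) / of_real x0) \<le> 2"
  proof -
   have "z0 - z1 = of_real (x0 - x1)" by (simp add: z1_def complex_eq_iff x0_def)
   hence e: "1 + (z0 - z1) / of_real x0 = of_real (1 + (x0 - x1) / x0)" by simp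
   have "1 + (x0 - x1) / x0 \<ge> 0" using x0 x1 by (intro add_nonneg_nonneg divide_nonneg_nonneg) auto
   hence "norm (1 + (z0 - z1) / of_real x0) = 1 + (x0 - x1) / x0" unfolding e norm_of_real by (rule abs_of_nonneg)
   also have "\<dots> \<le> 2" using x0 x1 by (simp add: field_simps)
   finally show ?thesis .
  qed
  moreover have "\<Delta> z0 = Gf z0 * (1 + (z0 - z1) / of_real x0)"
  proof -
   have "Re z0 \<ge> x1" using x1 by (simp add: x0_def)
   from n1[OF this] have "1 + (z0 - z1) / of_real x0 ~= 0" by auto
   thus ?thesis by (simp add: Gf_def)
  qed
  ultimately have "norm (\<Delta> z0) \<le> e' * 2" by (metis mult_mono norm_ge_zero norm_mult e' less_imp_le)
  thus ?thesis by (simp add: e'_def)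
 qed
 hence "norm (\<Delta> z0) \<le> 0" by (rule field_le_epsilon)
 thus ?thesis by simp
qed

subsection \<open>No persistent family of neutral cycles\<close>

text \<open>The orbit of a boundary parameter could leave the domain through an isolated puncture at
  which \<open>f\<close> tends to 0, and the argument below leads to exactly such a point. Filling
  these points beforehand turns that into a contradiction.\<close>

locale puncture_complete = lifting_family +
 assumes complete: "!!e r. r > 0 ==> ball e r - {e} \<subseteq> D ==> (f \<longlongrightarrow> 0) (at e) ==> e \<in> D"

text \<open>The cycles themselves are forgotten here. What remains of them is an infinite injective
  orbit over \<open>Om\<close> and an exit from the domain within fewer than \<open>q\<close> steps
  over its frontier.\<close>

locale escaping = puncture_complete +
 fixes Om :: "complex set" and q :: nat
 assumes open_Om: "open Om" and Om_ne: "Om ~= {}" and orb_Om: "!!w n. w \<in> Om ==> orb w n w"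
  and inj_Om: "!!w. w \<in> Om ==> inj (%n. it w n w)"
  and front: "!!b. b \<in> frontier Om ==> \<exists>i<q. orb b i b \<and> it b i b \<notin> D"
begin

lemma Om_in: "w \<in> Om ==> it w n w \<in> D" using orb_Om[of w "Suc n"] by (simp add: orb_def)
lemma Om_D: "w \<in> Om ==> w \<in> D" using Om_in[of w 0] by simp
lemma Om_next: assumes "w \<in> Om" shows "f (it w n w) = it w (Suc n) w - w" "f (it w n w) ~= 0" "norm (f (it w n w)) < d"
proof -
 show e: "f (it w n w) = it w (Suc n) w - w" by (simp add: it_Suc del: funpow.simps(2))
 have "it w (Suc n) w ~= it w 0 w" using inj_Om[OF assms] by (metis injD nat.distinct(1))
 thus "f (it w n w) ~= 0" unfolding e by simp
 show "norm (f (it w n w)) < d" unfolding e by (rule diam_D[OF Om_in[OF assms] Om_D[OF assms]])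
qed

lemma d_pos: "d > 0"
proof -
 obtain w where "w \<in> Om" using Om_ne by blast
 from diam_D[OF Om_D[OF this] Om_D[OF this]] show ?thesis by simp
qed

text \<open>d exp (- z) is the universal covering of the punctured disc of radius \<open>d\<close>;
  a single lift thus shows all inverse branches of \<open>f\<close> reachable from
  \<open>x\<close>.\<close>

lemma half_plane_lift:
 assumes x: "x \<in> D" "f x ~= 0" "norm (f x) < d"
 obtains \<Phi> \<zeta>0 where "\<Phi> holomorphic_on {z. Re z > 0}" "!!z. Re z > 0 ==> \<Phi> z \<in> D"
  "!!z. Re z > 0 ==> f (\<Phi> z) = of_real d * exp (- z)" "Re \<zeta>0 = - ln (norm (f x) / d)" "Re \<zeta>0 > 0" "\<Phi> \<zeta>0 = x"
proof -
 define \<zeta>0 where "\<zeta>0 = - Ln (f x / of_real d)"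
 have nz: "f x / of_real d ~= 0" using x d_pos by simp
 have ex: "of_real d * exp (- \<zeta>0) = f x" using nz d_pos by (simp add: \<zeta>0_def)
 have Re0: "Re \<zeta>0 = - ln (norm (f x) / d)" using nz d_pos by (simp add: \<zeta>0_def norm_divide)
 have "norm (f x) / d < 1" "norm (f x) / d > 0" using x d_pos by auto
 hence pos: "Re \<zeta>0 > 0" unfolding Re0 by simp
 have "\<exists>v. v holomorphic_on {z. Re z > 0} \<and> v ` {z. Re z > 0} \<subseteq> D \<and> v \<zeta>0 = x \<and> (\<forall>z\<in>{z. Re z > 0}. f (v z) = of_real d * exp (- z))"
 proof (rule lift[OF half_plane_convex half_plane_open])
  show "(%z. of_real d * exp (- z)) holomorphic_on {z. Re z > 0}" by (intro holomorphic_intros)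
  show "of_real d * exp (- z) ~= 0 \<and> norm (of_real d * exp (- z)) < d" if "z \<in> {z. Re z > 0}" for z
   using that d_pos by (simp add: norm_mult)
 qed (use x pos ex in auto)
 then obtain v where "v holomorphic_on {z. Re z > 0}" "!!z. Re z > 0 ==> v z \<in> D" "v \<zeta>0 = x" "!!z. Re z > 0 ==> f (v z) = of_real d * exp (- z)"
  by blast
 thus thesis using that[of v \<zeta>0] Re0 pos by blast
qed

lemma exp_half_turn: "exp (- (z + \<i> * of_real pi)) = - exp (- z)"
 by (simp add: exp_diff exp_minus field_simps flip: minus_add_distrib) (simp add: exp_add)

text \<open>If the frontier avoided the domain, a half-plane lift through a point of
  \<open>Om\<close> would stay in \<open>Om\<close>, and every \<Phi> z would be a parameter whose
  next orbit point is \<Phi> z + v z. A half turn changes the sign of v. The parallelogram law for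
  two distances below \<open>d\<close> forces \<Phi> (z + i pi) = \<Phi> z + v z in the limit Re z =
  0, where |v| tends to \<open>d\<close>, and hence everywhere. Then the orbit points of index 1 and
  2 are \<Phi> z + v and \<Phi> z - v, whose distance 2 |v| is too large.\<close>

lemma frontier_meets_D: "\<exists>b\<in>frontier Om. b \<in> D"
proof (rule ccontr)
 assume "\<not> ?thesis"
 hence nf: "!!b. b \<in> frontier Om ==> b \<notin> D" by blast
 obtain w0 where w0: "w0 \<in> Om" using Om_ne by blast
 have n0: "f w0 ~= 0" "norm (f w0) < d" using Om_next[OF w0, of 0] by auto
 obtain \<Phi> \<zeta>0 where P: "\<Phi> holomorphic_on {z. Re z > 0}" "!!z. Re z > 0 ==> \<Phi> z \<in> D"
  "!!z. Re z > 0 ==> f (\<Phi> z) = of_real d * exp (- z)" "Re \<zeta>0 > 0" "\<Phi> \<zeta>0 = w0"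
  by (rule half_plane_lift[OF Om_D[OF w0] n0]) (rule that)
 have PO: "\<Phi> z \<in> Om" if z: "Re z > 0" for z
 proof (rule ccontr)
  assume nO: "\<Phi> z \<notin> Om"
  have "connected (\<Phi> ` {z. Re z > 0})"
   by (intro connected_continuous_image holomorphic_on_imp_continuous_on[OF P(1)] convex_connected half_plane_convex)
  moreover have "\<Phi> ` {z. Re z > 0} \<inter> Om ~= {}" using P(4,5) w0 by auto
  moreover have "\<Phi> ` {z. Re z > 0} - Om ~= {}" using z nO by auto
  ultimately have "\<Phi> ` {z. Re z > 0} \<inter> frontier Om ~= {}" by (rule connected_Int_frontier)
  thus False using nf P(2) by auto
 qed
 define v where "v = (%z :: complex. complex_of_real d * exp (- z))"
 have fP: "f (\<Phi> z) = v z" if "Re z > 0" for z using P(3)[OF that] by (simp add: v_def)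
 have vpi: "v (z + \<i> * of_real pi) = - v z" for z unfolding v_def exp_half_turn by simp
 have step: "\<Phi> z + v z \<in> D" if z: "Re z > 0" for z
  using Om_in[OF PO[OF z], of 1] by (simp add: G_def fP[OF z] add.commute)
 define \<Delta> where "\<Delta> = (%z. \<Phi> (z + \<i> * of_real pi) - \<Phi> z - v z)"
 have shR: "Re (z + \<i> * of_real pi) = Re z" for z by simp
 have vn: "norm (v z) = d * exp (- Re z)" for z using d_pos by (simp add: v_def norm_mult)
 have D2: "norm (\<Delta> z) ^ 2 \<le> d ^ 2 - (norm (v z)) ^ 2" if z: "Re z > 0" for z
 proof -
  have z': "Re (z + \<i> * of_real pi) > 0" using z by simp
  define X where "X = \<Phi> (z + \<i> * of_real pi) - \<Phi> z"
  have "norm X < d" unfolding X_def by (rule diam_D[OF P(2)[OF z'] P(2)[OF z]])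
  moreover have "norm (X - 2 * v z) < d"
   using diam_D[OF step[OF z'] step[OF z]] unfolding vpi X_def by (simp add: algebra_simps)
  ultimately have "norm X ^ 2 \<le> d ^ 2" "norm (X - 2 * v z) ^ 2 \<le> d ^ 2" by (auto intro!: power_mono)
  moreover have "norm X ^ 2 + norm (X - 2 * v z) ^ 2 = 2 * norm (X - v z) ^ 2 + 2 * norm (v z) ^ 2"
   unfolding cmod_power2 by (simp add: power2_eq_square algebra_simps)
  ultimately show ?thesis by (simp add: \<Delta>_def X_def)
 qed
 have zero: "\<Delta> z = 0" if z: "Re z > 0" for z
 proof (rule half_plane_boundary_zero[OF _ _ _ z])
  have "(%z. \<Phi> (z + \<i> * of_real pi)) holomorphic_on {z. Re z > 0}"
   by (rule holomorphic_on_compose_gen[OF _ P(1), of "%z. z + \<i> * of_real pi", unfolded o_def]) (auto intro!: holomorphic_intros)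
  thus "\<Delta> holomorphic_on {z. Re z > 0}" unfolding \<Delta>_def v_def by (intro holomorphic_intros P(1))
  show "norm (\<Delta> z) \<le> d" if "Re z > 0" for z
  proof -
   have "norm (\<Delta> z) ^ 2 \<le> d ^ 2" using D2[OF that] by (smt (verit) zero_le_power2)
   thus ?thesis by (rule power2_le_imp_le) (use d_pos in simp)
  qed
  show "norm (\<Delta> z) ^ 2 \<le> (2 * d ^ 2) * Re z" if "Re z > 0" for z
  proof -
   have "(norm (v z)) ^ 2 = d ^ 2 * exp (- (2 * Re z))" unfolding vn
    by (simp add: power_mult_distrib power2_eq_square flip: exp_add)
   moreover have "d ^ 2 * exp (- (2 * Re z)) \<ge> d ^ 2 * (1 + - (2 * Re z))"
    by (intro mult_left_mono exp_ge_add_one_self) simp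
   ultimately show ?thesis using D2[OF that] by (simp add: algebra_simps)
  qed
 qed
 \<comment> \<open>At real part 1/2 the distance 2 |v| = 2 d exp (-1/2) is already at least
   \<open>d\<close>, because exp (-1/2) is at least 1/2.\<close>
 define z where "z = complex_of_real (1 / 2)"
 have z: "Re z > 0" "Re (z + \<i> * of_real pi) > 0" by (auto simp: z_def)
 define y where "y = \<Phi> z"
 have yO: "y \<in> Om" unfolding y_def by (rule PO[OF z(1)])
 have y1: "it y (Suc 0) y = y + v z" by (simp add: G_def y_def fP[OF z(1)] add.commute)
 have "\<Phi> (z + \<i> * of_real pi) = y + v z" using zero[OF z(1)] by (simp add: \<Delta>_def y_def algebra_simps)
 hence fy: "f (y + v z) = - v z" using fP[OF z(2)] vpi[of z] by simp
 have "it y (Suc (Suc 0)) y = f (it y (Suc 0) y) + y" by (rule it_Suc)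
 hence y2: "it y (Suc (Suc 0)) y = y - v z" unfolding y1 fy by simp
 have "norm (it y (Suc 0) y - it y (Suc (Suc 0)) y) < d" by (rule diam_D[OF Om_in[OF yO] Om_in[OF yO]])
 hence "norm (2 * v z) < d" unfolding y1 y2 by simp
 hence "2 * (d * exp (- (1/2))) < d" unfolding norm_mult vn by (simp add: z_def)
 moreover have "d * (1 + - (1/2)) \<le> d * exp (- (1/2))" using d_pos by (intro mult_left_mono exp_ge_add_one_self) simp
 ultimately show False by simp
qed

end

section \<open>Exit through the boundary of the domain\<close>

context escaping
begin

definition exit_index :: "complex => nat" where "exit_index b = (LEAST j. it b j b \<notin> D)"

lemma exit_index:
 assumes b: "b \<in> frontier Om"
 shows "exit_index b < q" "orb b (exit_index b) b" "it b (exit_index b) b \<notin> D"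
proof -
 obtain i where i: "i < q" "it b i b \<notin> D" using front[OF b] by blast
 show "it b (exit_index b) b \<notin> D" unfolding exit_index_def by (rule LeastI[of "%j. it b j b \<notin> D", OF i(2)])
 show "exit_index b < q" unfolding exit_index_def using Least_le[of "%j. it b j b \<notin> D", OF i(2)] i(1) by simp
 show "orb b (exit_index b) b" unfolding orb_def exit_index_def using not_less_Least by blast
qed

text \<open>With the latest exit time over the whole frontier, nearby frontier parameters exit at
  the same time: not earlier, as their orbit survives \<open>i\<close> steps, and not later, by
  maximality. So the i-th iterate sends the frontier near \<open>b\<close> outside the domain. That
  \<open>i\<close> is at least 1 is the content of \<open>frontier_meets_D\<close>.\<close>

lemma maximal_exit:
 obtains b i where "b \<in> frontier Om" "i \<ge> 1" "orb b i b" "it b i b \<notin> D"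
  "!!b'. b' \<in> frontier Om ==> orb b' i b' ==> it b' i b' \<notin> D"
proof -
 obtain b0 where b0: "b0 \<in> frontier Om" "b0 \<in> D" using frontier_meets_D by blast
 define I where "I = exit_index ` frontier Om"
 have fin: "finite I" by (rule finite_subset[of _ "{..<q}"]) (use exit_index(1) in \<open>auto simp: I_def\<close>)
 have ne: "I ~= {}" using b0 by (auto simp: I_def)
 obtain b where b: "b \<in> frontier Om" "exit_index b = Max I" using Max_in[OF fin ne] by (auto simp: I_def)
 have le: "exit_index b' \<le> exit_index b" if "b' \<in> frontier Om" for b'
  unfolding b(2) by (rule Max_ge[OF fin]) (use that in \<open>simp add: I_def\<close>)
 have "exit_index b0 ~= 0" using exit_index(3)[OF b0(1)] b0(2) by (intro notI) simp
 hence ge: "exit_index b \<ge> 1" using le[OF b0(1)] by simp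
 show thesis
 proof (rule that[OF b(1) ge exit_index(2,3)[OF b(1)]])
  fix b' assume b': "b' \<in> frontier Om" "orb b' (exit_index b) b'"
  have "\<not> exit_index b' < exit_index b" using exit_index(3)[OF b'(1)] b'(2) by (auto simp: orb_def)
  hence "exit_index b' = exit_index b" using le[OF b'(1)] by simp
  thus "it b' (exit_index b) b' \<notin> D" using exit_index(3)[OF b'(1)] by simp
 qed
qed

text \<open>Turns a comparison of logarithms into a power law. The square on the right is what makes
  an extension by 0 differentiable.\<close>

lemma power_decay:
 fixes a t C :: real
 assumes a: "0 < a" "a < 1" and t: "0 < t" and C: "- ln t \<le> C * (- ln a)" and N: "2 * C \<le> real N"
 shows "a ^ N \<le> t ^ 2"
proof -
 have la: "- ln a > 0" using a by simp
 have "2 * (- ln t) \<le> (2 * C) * (- ln a)" using C by simp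
 also have "\<dots> \<le> real N * (- ln a)" using N la by (intro mult_right_mono) auto
 finally have "real N * ln a \<le> 2 * ln t" by simp
 hence "exp (real N * ln a) \<le> exp (2 * ln t)" by simp
 moreover have "exp (real N * ln a) = a ^ N" using a by (simp only: exp_of_nat_mult exp_ln)
 moreover have "exp (2 * ln t) = t ^ 2" using exp_of_nat_mult[of 2 "ln t"] t by simp
 ultimately show ?thesis by simp
qed

text \<open>\<Phi> omits \<open>e\<close>, so (\<Phi> - e) / d has a logarithm, and its real part is
  negative because all distances to \<open>e\<close> are below \<open>d\<close>. Harnack's
  inequality compares it at \<open>z0\<close> with its value at \<open>z1\<close>, where \<Phi> is
  far from \<open>e\<close>.\<close>

lemma decay_at_exit:
 assumes e: "e \<in> closure D" "e \<notin> D" and P: "\<Phi> holomorphic_on {z. Re z > 0}" "!!z. Re z > 0 ==> \<Phi> z \<in> D"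
  and z: "Re z0 > 0" "Re z1 > 0" and \<rho>: "\<rho> > 0" "\<rho> \<le> norm (\<Phi> z1 - e)"
 shows "- ln (norm (\<Phi> z0 - e) / d) * (Re z0 * Re z1) \<le> norm (z0 + cnj z1) ^ 2 * ln (d / \<rho>)"
proof -
 define u where "u = (%z. (\<Phi> z - e) / of_real d)"
 have uh: "u holomorphic_on {z. Re z > 0}" unfolding u_def by (intro holomorphic_intros P) (use d_pos in auto)
 have unz: "u z ~= 0" if "z \<in> {z. Re z > 0}" for z using P(2)[of z] that e(2) d_pos by (auto simp: u_def)
 have ctr: "contractible {z. Re z > 0}" by (rule convex_imp_contractible[OF half_plane_convex])
 obtain g where g: "g holomorphic_on {z. Re z > 0}" "!!z. z \<in> {z. Re z > 0} ==> u z = exp (g z)"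
  by (rule contractible_imp_holomorphic_log[OF uh ctr unz]) (assumption, rule that)
 have un: "norm (u z) = norm (\<Phi> z - e) / d" for z using d_pos by (simp add: u_def norm_divide)
 have Reg: "Re (g z) = ln (norm (\<Phi> z - e) / d)" if "Re z > 0" for z
  using g(2)[of z] that un[of z] by (metis ln_exp mem_Collect_eq norm_exp_eq_Re)
 have "Re (- g z0) * (Re z0 * Re z1) \<le> norm (z0 + cnj z1) ^ 2 * Re (- g z1)"
 proof (rule half_plane_harnack[OF _ _ z])
  show "(%z. - g z) holomorphic_on {z. Re z > 0}" by (intro holomorphic_intros g)
  fix z :: complex assume z: "Re z > 0"
  have "norm (\<Phi> z - e) < d" by (rule diam_closure[OF P(2)[OF z] e(1)])
  moreover have "norm (\<Phi> z - e) > 0" using P(2)[OF z] e(2) by auto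
  ultimately have "ln (norm (\<Phi> z - e) / d) < 0" using d_pos by (intro ln_less_zero) auto
  thus "Re (- g z) > 0" using Reg[OF z] by simp
 qed
 also have "\<dots> \<le> norm (z0 + cnj z1) ^ 2 * ln (d / \<rho>)"
 proof (rule mult_left_mono)
  have np: "norm (\<Phi> z1 - e) > 0" using \<rho> by linarith
  have "- ln (norm (\<Phi> z1 - e) / d) = ln (d / norm (\<Phi> z1 - e))" using np d_pos by (simp add: ln_div)
  also have "\<dots> \<le> ln (d / \<rho>)" using np \<rho> d_pos by (subst ln_le_cancel_iff) (auto intro!: divide_left_mono)
  finally show "Re (- g z1) \<le> ln (d / \<rho>)" using Reg[OF z(2)] by simp
 qed simp
 finally show ?thesis using Reg[OF z(1)] by simp
qed

text \<open>Near \<open>b\<close>, let C be the orbit point that exits and F = f(C). A suitable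
  power of F, extended by 0 outside \<open>Om\<close>, is holomorphic, because |F|^N is at most
  quadratic in the distance to the frontier; this is an extension in the spirit of Rado. Hence
  \<open>b\<close> is an isolated frontier point, the open map C makes a punctured disc about e = C
  b part of the domain, and f tends to 0 at \<open>e\<close>: such a puncture belongs to the domain
  by \<open>complete\<close>.\<close>

lemma escape_impossible: False
proof -
 obtain b i where b: "b \<in> frontier Om" "i \<ge> 1" "orb b i b" "it b i b \<notin> D"
  and mx: "!!b'. b' \<in> frontier Om ==> orb b' i b' ==> it b' i b' \<notin> D"
  by (rule maximal_exit) (rule that)
 define e where "e = it b i b"
 define C where "C = (%w. it w i w)"
 define F where "F = (%w. f (C w))"
 have Cb: "C b = e" by (simp add: C_def e_def)
 have "\<forall>\<^sub>F w in nhds b. orb w i w" by (rule orb_eventually[OF b(3) filterlim_ident filterlim_ident])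
 then obtain S where S: "open S" "b \<in> S" "!!w. w \<in> S ==> orb w i w" unfolding eventually_nhds by blast
 obtain \<delta>0 where \<delta>0: "\<delta>0 > 0" "ball b \<delta>0 \<subseteq> S" by (rule openE[OF S(1,2)])
 have orb0: "orb w i w" if "w \<in> ball b \<delta>0" for w using S(3) \<delta>0(2) that by blast
 have bD: "b \<in> D" using b(2,3) by (auto simp: orb_def)
 have hC: "C holomorphic_on ball b \<delta>0" unfolding C_def
  by (rule it_holomorphic[of "%w. w" _ "%w. w"]) (auto intro: holomorphic_intros orb0)
 have cC: "continuous_on (ball b \<delta>0) C" by (rule holomorphic_on_imp_continuous_on[OF hC])
 have CO: "C w \<in> D" if "w \<in> Om" for w unfolding C_def by (rule Om_in[OF that])
 have Cfr: "C b' \<notin> D" if "b' \<in> frontier Om" "b' \<in> ball b \<delta>0" for b'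
  unfolding C_def by (rule mx[OF that(1) orb0[OF that(2)]])
 have Cfr_cl: "C b' \<in> closure D" if b': "b' \<in> frontier Om" "b' \<in> ball b \<delta>0" for b'
 proof -
  have "b' \<in> closure Om" using b'(1) by (simp add: frontier_def)
  then obtain x where x: "!!n. x n \<in> Om" "x \<longlonglongrightarrow> b'" unfolding closure_sequential by blast
  have "isCont C b'" using cC b'(2) continuous_on_eq_continuous_at[OF open_ball] by blast
  hence l: "(%n. C (x n)) \<longlonglongrightarrow> C b'" using x(2) by (rule isCont_tendsto_compose)
  show ?thesis
   by (rule Lim_in_closed_set[OF closed_closure _ sequentially_bot l])
    (rule always_eventually, use CO x(1) closure_subset in blast)
 qed
 have fr_nO: "b' \<notin> Om" if "b' \<in> frontier Om" for b'
  using that open_Om by (simp add: frontier_def interior_open)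
 have near: "\<exists>w\<in>Om. w \<in> ball b r" if "r > 0" for r
 proof -
  have "b \<in> closure Om" using b(1) by (simp add: frontier_def)
  thus ?thesis using that by (auto simp: closure_approachable dist_commute)
 qed
 obtain wa where wa: "wa \<in> Om" "wa \<in> ball b \<delta>0" using near[OF \<delta>0(1)] by blast
 have wae: "C wa ~= e" using CO[OF wa(1)] b(4) by (auto simp: e_def)
 have b0: "b \<in> ball b \<delta>0" using \<delta>0 by simp
 have nc: "\<not> C constant_on ball b \<delta>0"
 proof
  assume "C constant_on ball b \<delta>0"
  then obtain y where "!!x. x \<in> ball b \<delta>0 ==> C x = y" unfolding constant_on_def by blast
  thus False using wa(2) b0 wae Cb by metis
 qed
 have Copen: "open (C ` U)" if "open U" "U \<subseteq> ball b \<delta>0" for U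
  by (rule open_mapping_thm[OF hC open_ball connected_ball that nc])
 have Ce: "(%w. C w - e) holomorphic_on ball b \<delta>0" by (intro holomorphic_intros hC)
 obtain r1 where r1: "r1 > 0" "!!z. z \<in> ball b r1 - {b} ==> C z - e ~= 0"
  by (rule isolated_zeros[OF Ce open_ball connected_ball b0 _ wa(2)]) (use Cb wae in auto)
 define \<delta>1 where "\<delta>1 = min (min r1 \<delta>0) (d / 4) / 2"
 have \<delta>1: "\<delta>1 > 0" "\<delta>1 < r1" "\<delta>1 < \<delta>0" "\<delta>1 < d / 4" using r1 \<delta>0 d_pos by (auto simp: \<delta>1_def)
 have sub10: "cball b \<delta>1 \<subseteq> ball b \<delta>0" using \<delta>1 by auto
 have "\<exists>x\<in>sphere b \<delta>1. \<forall>y\<in>sphere b \<delta>1. norm (C x - e) \<le> norm (C y - e)"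
 proof (rule continuous_attains_inf)
  show "sphere b \<delta>1 ~= {}" using \<delta>1 by (simp add: sphere_eq_empty)
  show "continuous_on (sphere b \<delta>1) (%x. norm (C x - e))"
   by (intro continuous_intros continuous_on_subset[OF cC]) (use sub10 in auto)
 qed simp
 then obtain xs0 where xs0: "xs0 \<in> sphere b \<delta>1" "!!y. y \<in> sphere b \<delta>1 ==> norm (C xs0 - e) \<le> norm (C y - e)" by blast
 define \<rho> where "\<rho> = norm (C xs0 - e)"
 have \<rho>: "\<rho> > 0" using r1(2)[of xs0] xs0(1) \<delta>1 by (auto simp: \<rho>_def)
 \<comment> \<open>Inside the disc of radius \<rho> about \<open>e\<close>, a boundary point of the
   image of \<open>Om\<close> can only be the image of a frontier parameter, and those images lie
   outside the domain. A connected part of the domain in that disc therefore cannot leave the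
   image.\<close>
 have follow: "P \<subseteq> C ` (Om \<inter> ball b \<delta>1)"
  if P: "connected P" "P \<subseteq> D" "P \<subseteq> ball e \<rho>" and w0: "w0 \<in> Om \<inter> ball b \<delta>1" "C w0 \<in> P" for P w0
 proof (rule ccontr)
  assume n: "\<not> P \<subseteq> C ` (Om \<inter> ball b \<delta>1)"
  let ?Q = "C ` (Om \<inter> ball b \<delta>1)"
  have oQ: "open ?Q" by (rule Copen) (use open_Om sub10 in auto)
  have "P \<inter> ?Q ~= {}" "P - ?Q ~= {}" using w0 n by auto
  hence "P \<inter> frontier ?Q ~= {}" by (rule connected_Int_frontier[OF P(1)])
  then obtain y where y: "y \<in> P" "y \<in> frontier ?Q" by blast
  have yc: "y \<in> closure ?Q" "y \<notin> ?Q" using y(2) oQ by (auto simp: frontier_def interior_open)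
  have "compact (C ` (closure Om \<inter> cball b \<delta>1))"
   by (intro compact_continuous_image continuous_on_subset[OF cC] closed_Int_compact) (use sub10 in auto)
  moreover have "?Q \<subseteq> C ` (closure Om \<inter> cball b \<delta>1)" using closure_subset[of Om] by auto
  ultimately have "closure ?Q \<subseteq> C ` (closure Om \<inter> cball b \<delta>1)" by (intro closure_minimal compact_imp_closed)
  then obtain w where w: "w \<in> closure Om" "w \<in> cball b \<delta>1" "y = C w" using yc(1) by blast
  have "dist b w ~= \<delta>1"
  proof
   assume "dist b w = \<delta>1"
   hence "\<rho> \<le> norm (C w - e)" unfolding \<rho>_def by (intro xs0(2)) simp
   thus False using P(3) y(1) w(3) by (auto simp: dist_norm norm_minus_commute subset_iff)
  qed
  hence wb: "w \<in> ball b \<delta>1" using w(2) by auto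
  hence "w \<notin> Om" using yc(2) w(3) by blast
  hence "w \<in> frontier Om" using w(1) open_Om by (simp add: frontier_def interior_open)
  from Cfr[OF this] wb \<delta>1 have "C w \<notin> D" by auto
  thus False using P(2) y(1) w(3) by blast
 qed
 obtain \<eta>0 where \<eta>0: "\<eta>0 > 0" "ball b \<eta>0 \<subseteq> D" by (rule openE[OF open_D bD])
 define \<eta> where "\<eta> = min (\<eta>0 / 2) (d / 2)"
 have \<eta>: "\<eta> > 0" "2 * \<eta> \<le> \<eta>0" "\<eta> < d" using \<eta>0 d_pos by (auto simp: \<eta>_def)
 \<comment> \<open>The bound 1/10 makes |v| at least 9/10 d at real part \<open>xs\<close>; the
   logarithmic bound keeps every \<zeta>0 at or to the right of \<open>xs\<close>.\<close>
 define xs where "xs = min (1 / 10) (- ln (1 - \<eta> / d))"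
 have xs: "xs > 0" "xs \<le> 1 / 10" "xs \<le> - ln (1 - \<eta> / d)" using \<eta> d_pos by (auto simp: xs_def)
 have "isCont C b" using cC b0 continuous_on_eq_continuous_at[OF open_ball] by blast
 then obtain \<delta>' where \<delta>': "\<delta>' > 0" "!!w. dist w b < \<delta>' ==> dist (C w) e < \<rho> / 2"
  using \<rho> unfolding continuous_at_eps_delta Cb by (metis half_gt_zero)
 define \<delta>2 where "\<delta>2 = min (min \<delta>' \<eta>) (\<delta>1 / 8)"
 have \<delta>2: "\<delta>2 > 0" "\<delta>2 \<le> \<delta>'" "\<delta>2 \<le> \<eta>" "\<delta>2 \<le> \<delta>1 / 8" using \<delta>' \<eta> \<delta>1 by (auto simp: \<delta>2_def)
 define L where "L = ln (d / (\<rho> / 2))"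
 define Cx where "Cx = (4 + 16 / xs ^ 2) * L / xs"
 obtain N :: nat where N: "2 * Cx \<le> real N" using real_arch_simple by blast
 have Fw: "F w = it w (Suc i) w - w" "F w ~= 0" "norm (F w) < d" if "w \<in> Om" for w
  unfolding F_def C_def by (rule Om_next[OF that])+
 \<comment> \<open>Since \<open>b\<close> is an interior point of the domain, the point
   \<open>p\<close> obtained by prolonging the segment from the next orbit point to \<open>w\<close>
   by \<eta> is still in the domain; its distance to that orbit point is |F w| + \<eta>.\<close>
 have Fsmall: "norm (F w) < d - \<eta>" if w: "w \<in> Om" "w \<in> ball b \<delta>2" for w
 proof -
  define y where "y = it w (Suc i) w"
  define t where "t = norm (y - w)"
  have t: "t > 0" using Fw[OF w(1)] by (simp add: t_def y_def)
  define p where "p = w - of_real (\<eta> / t) * (y - w)"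
  have np: "norm (of_real (\<eta> / t) * (y - w)) = \<eta>"
   unfolding norm_mult norm_of_real t_def[symmetric] using t \<eta> by simp
  have "dist b p \<le> dist b w + dist w p" by (rule dist_triangle)
  also have "dist w p = \<eta>" using np by (simp add: p_def dist_norm)
  finally have "p \<in> D" using w(2) \<delta>2(3) \<eta>(2) by (intro subsetD[OF \<eta>0(2)]) simp
  moreover have "y \<in> D" unfolding y_def by (rule Om_in[OF w(1)])
  ultimately have "norm (y - p) < d" by (intro diam_D)
  moreover have "y - p = of_real (1 + \<eta> / t) * (y - w)" by (simp add: p_def algebra_simps)
  moreover have "norm (of_real (1 + \<eta> / t) * (y - w)) = t + \<eta>"
  proof -
   have "1 + \<eta> / t > 0" using t \<eta> by (simp add: add_pos_pos)
   hence "norm (of_real (1 + \<eta> / t) * (y - w)) = (1 + \<eta> / t) * t" unfolding norm_mult t_def norm_of_real by simp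
   thus ?thesis using t by (simp add: distrib_right)
  qed
  ultimately show ?thesis using Fw(1)[OF w(1)] by (simp add: t_def y_def)
 qed
 \<comment> \<open>The lift through \<open>C w\<close> is compared at \<zeta>0, where it equals
   \<open>C w\<close>, and at a point of a rectangle of height pi where it is at least \<rho> away
   from \<open>e\<close>. Harnack then bounds - ln |C w - C b'| by a constant times - ln |F w|, both
   normalised by \<open>d\<close>, so |F w| is at most a power of |C w - C b'|.\<close>
 have decay: "(norm (F w) / d) ^ N \<le> (norm (C w - C b') / d) ^ 2"
  if w: "w \<in> Om" "w \<in> ball b \<delta>2" and b': "b' \<in> frontier Om" "b' \<in> ball b \<delta>2" for w b'
 proof -
  have b'0: "b' \<in> ball b \<delta>0" using b'(2) \<delta>2 \<delta>1 by auto
  have w1: "w \<in> ball b \<delta>1" using w(2) \<delta>2 \<delta>1 by auto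
  obtain \<Phi> \<zeta>0 where P: "\<Phi> holomorphic_on {z. Re z > 0}" "!!z. Re z > 0 ==> \<Phi> z \<in> D"
   "!!z. Re z > 0 ==> f (\<Phi> z) = of_real d * exp (- z)" "Re \<zeta>0 = - ln (norm (f (C w)) / d)" "Re \<zeta>0 > 0" "\<Phi> \<zeta>0 = C w"
   by (rule half_plane_lift[OF CO[OF w(1)] Fw(2,3)[OF w(1), unfolded F_def]]) (rule that)
  define x0 where "x0 = Re \<zeta>0"
  have x0F: "x0 = - ln (norm (F w) / d)" using P(4) by (simp add: x0_def F_def)
  have x0: "x0 \<ge> xs"
  proof -
   have "norm (F w) / d \<le> 1 - \<eta> / d" using Fsmall[OF w] d_pos by (simp add: field_simps)
   hence "ln (norm (F w) / d) \<le> ln (1 - \<eta> / d)" using Fw(2)[OF w(1)] d_pos \<eta>(3) by (subst ln_le_cancel_iff) auto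
   thus ?thesis using xs(3) x0F by simp
  qed
  define Bx where "Bx = {z. xs \<le> Re z} \<inter> {z. Re z \<le> x0} \<inter> ({z. Im \<zeta>0 \<le> Im z} \<inter> {z. Im z \<le> Im \<zeta>0 + pi})"
  have cvx: "convex Bx" unfolding Bx_def
   by (intro convex_Int convex_halfspace_Re_ge convex_halfspace_Re_le convex_halfspace_Im_ge convex_halfspace_Im_le)
  have Bpos: "Re z > 0" if "z \<in> Bx" for z using that xs(1) by (simp add: Bx_def)
  have z0B: "\<zeta>0 \<in> Bx" using x0 by (simp add: Bx_def x0_def)
  define zs where "zs = Complex xs (Im \<zeta>0)"
  have zsB: "zs \<in> Bx" "zs + \<i> * of_real pi \<in> Bx" using x0 by (auto simp: Bx_def zs_def)
  \<comment> \<open>Otherwise \<open>follow\<close> realises the whole rectangle by parameters near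
    \<open>b\<close>. Its two left corners differ by a half turn, so two parameters less than d/2
    apart would have next orbit points separated by 2 v up to an error of d/2, which exceeds the
    diameter.\<close>
  have "\<exists>\<zeta>1\<in>Bx. \<rho> \<le> norm (\<Phi> \<zeta>1 - e)"
  proof (rule ccontr)
   assume "\<not> ?thesis"
   hence PB: "\<Phi> ` Bx \<subseteq> ball e \<rho>" by (force simp: dist_norm norm_minus_commute)
   have con: "connected (\<Phi> ` Bx)"
    by (intro connected_continuous_image convex_connected[OF cvx] continuous_on_subset[OF holomorphic_on_imp_continuous_on[OF P(1)]])
     (use Bpos in auto)
   have PD: "\<Phi> ` Bx \<subseteq> D" using P(2) Bpos by auto
   have "C w \<in> \<Phi> ` Bx" using z0B P(6) by (metis imageI)
   hence sub: "\<Phi> ` Bx \<subseteq> C ` (Om \<inter> ball b \<delta>1)" by (intro follow[OF con PD PB]) (use w(1) w1 in auto)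
   obtain w1 w2 where ww: "w1 \<in> Om" "w1 \<in> ball b \<delta>1" "C w1 = \<Phi> zs" "w2 \<in> Om" "w2 \<in> ball b \<delta>1" "C w2 = \<Phi> (zs + \<i> * of_real pi)"
    using subsetD[OF sub imageI[OF zsB(1)]] subsetD[OF sub imageI[OF zsB(2)]] by (elim imageE IntE) metis
   define v where "v = of_real d * exp (- zs)"
   have "F w1 = v" "F w2 = - v"
    unfolding F_def ww(3,6) v_def P(3)[OF Bpos[OF zsB(1)]] P(3)[OF Bpos[OF zsB(2)]] exp_half_turn by simp_all
   hence i1: "it w1 (Suc i) w1 = w1 + v" "it w2 (Suc i) w2 = w2 - v" using Fw(1)[OF ww(1)] Fw(1)[OF ww(4)] by (auto simp: algebra_simps)
   have e2: "it w1 (Suc i) w1 - it w2 (Suc i) w2 = 2 * v - (w2 - w1)" unfolding i1 by simp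
   have "norm (2 * v - (w2 - w1)) < d" using diam_D[OF Om_in[OF ww(1), of "Suc i"] Om_in[OF ww(4), of "Suc i"]] by (simp only: e2)
   moreover have "norm (2 * v) - norm (w2 - w1) \<le> norm (2 * v - (w2 - w1))" by (rule norm_triangle_ineq2)
   moreover have "norm (w2 - w1) < d / 2"
   proof -
    have "dist w2 w1 \<le> dist w2 b + dist w1 b" by (rule dist_triangle2)
    thus ?thesis using ww(2,5) \<delta>1(4) by (simp add: dist_norm norm_minus_commute)
   qed
   moreover have "norm (2 * v) = 2 * (d * exp (- xs))" using d_pos by (simp add: v_def zs_def norm_mult)
   moreover have "d * exp (- xs) \<ge> d * (1 + - xs)" using d_pos by (intro mult_left_mono exp_ge_add_one_self) simp
   moreover have "d * (1 + - xs) \<ge> d * (9 / 10)" using d_pos xs(2) by (intro mult_left_mono) auto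
   ultimately show False using d_pos by linarith
  qed
  then obtain \<zeta>1 where z1: "\<zeta>1 \<in> Bx" "\<rho> \<le> norm (\<Phi> \<zeta>1 - e)" by blast
  define e' where "e' = C b'"
  have e': "e' \<in> closure D" "e' \<notin> D" unfolding e'_def by (rule Cfr_cl[OF b'(1) b'0], rule Cfr[OF b'(1) b'0])
  have "dist e' e < \<rho> / 2" unfolding e'_def by (rule \<delta>'(2)) (use b'(2) \<delta>2 in \<open>auto simp: dist_commute\<close>)
  hence ee: "\<rho> / 2 \<le> norm (\<Phi> \<zeta>1 - e')"
   using z1(2) norm_triangle_ineq[of "\<Phi> \<zeta>1 - e'" "e' - e"] by (simp add: dist_norm)
  define t where "t = norm (C w - e') / d"
  have t: "t > 0" "t < 1"
  proof -
   have "C w ~= e'" using CO[OF w(1)] e'(2) by blast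
   thus "t > 0" unfolding t_def using d_pos by (intro divide_pos_pos) auto
   show "t < 1" using diam_closure[OF CO[OF w(1)] e'(1)] d_pos by (simp add: t_def)
  qed
  have Lpos: "L > 0"
  proof -
   have "\<rho> / 2 < d" using ee diam_closure[OF P(2)[OF Bpos[OF z1(1)]] e'(1)] by linarith
   thus ?thesis unfolding L_def using \<rho> d_pos by simp
  qed
  have lt: "- ln t > 0" using t by simp
  have "- ln t * (x0 * Re \<zeta>1) \<le> norm (\<zeta>0 + cnj \<zeta>1) ^ 2 * L"
   using decay_at_exit[OF e' P(1,2) P(5) Bpos[OF z1(1)] _ ee] \<rho> by (simp add: P(6) t_def L_def x0_def)
  also have "\<dots> \<le> (4 * x0 ^ 2 + 16) * L"
  proof (rule mult_right_mono)
   have "(Re \<zeta>0 + Re \<zeta>1) ^ 2 \<le> (2 * x0) ^ 2"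
    using z1(1) Bpos[OF z1(1)] xs(1) x0 by (intro power_mono) (auto simp: Bx_def x0_def)
   moreover have "(Im \<zeta>0 - Im \<zeta>1) ^ 2 \<le> 4 ^ 2"
   proof -
    have "\<bar>Im \<zeta>0 - Im \<zeta>1\<bar> \<le> 4" using z1(1) pi_less_4 by (auto simp: Bx_def)
    hence "\<bar>Im \<zeta>0 - Im \<zeta>1\<bar> ^ 2 \<le> 4 ^ 2" by (intro power_mono) auto
    thus ?thesis by simp
   qed
   ultimately show "norm (\<zeta>0 + cnj \<zeta>1) ^ 2 \<le> 4 * x0 ^ 2 + 16" by (simp add: cmod_power2 power_mult_distrib)
  qed (use Lpos in simp)
  also have "\<dots> \<le> (x0 ^ 2 * (4 + 16 / xs ^ 2)) * L"
  proof (rule mult_right_mono)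
   have "xs ^ 2 \<le> x0 ^ 2" using x0 xs by (intro power_mono) auto
   hence "16 \<le> x0 ^ 2 * (16 / xs ^ 2)" using xs by (simp add: field_simps)
   thus "4 * x0 ^ 2 + 16 \<le> x0 ^ 2 * (4 + 16 / xs ^ 2)" by (simp add: distrib_left)
  qed (use Lpos in simp)
  finally have m1: "- ln t * (x0 * Re \<zeta>1) \<le> (x0 ^ 2 * (4 + 16 / xs ^ 2)) * L" .
  have x0p: "x0 > 0" using x0 xs by simp
  have "- ln t * (x0 * xs) \<le> - ln t * (x0 * Re \<zeta>1)"
   using lt x0p z1(1) by (intro mult_left_mono) (auto simp: Bx_def)
  hence "x0 * (- ln t * xs) \<le> x0 * (x0 * ((4 + 16 / xs ^ 2) * L))" using m1 by (simp add: power2_eq_square mult.commute mult.left_commute)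
  hence "- ln t * xs \<le> x0 * ((4 + 16 / xs ^ 2) * L)" using x0p by (simp only: mult_le_cancel_left_pos)
  hence "- ln t \<le> Cx * x0" using xs(1) by (simp add: Cx_def field_simps)
  hence "- ln t \<le> Cx * (- ln (norm (F w) / d))" by (simp only: x0F)
  from power_decay[OF _ _ t(1) this N] show ?thesis using Fw(2,3)[OF w(1)] d_pos by (simp add: t_def e'_def)
 qed
 have "compact (C ` cball b \<delta>1)" by (intro compact_continuous_image continuous_on_subset[OF cC sub10]) simp
 then obtain Bc where Bc: "!!w. w \<in> cball b \<delta>1 ==> norm (C w) \<le> Bc"
  using compact_imp_bounded bounded_iff by (metis imageI)
 define K2 where "K2 = d ^ N * (3 * Bc / (\<delta>1 / 2) / d) ^ 2"
 have decay2: "norm (F w) ^ N \<le> K2 * dist b' w ^ 2"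
  if w: "w \<in> Om" "w \<in> ball b \<delta>2" and b': "b' \<in> frontier Om" "b' \<in> ball b \<delta>2" for w b'
 proof -
  have db: "ball b' (\<delta>1 / 2) \<subseteq> ball b \<delta>1"
  proof
   fix x assume "x \<in> ball b' (\<delta>1 / 2)"
   thus "x \<in> ball b \<delta>1" using dist_triangle[of b x b'] b'(2) \<delta>2(4) \<delta>1(1) by auto
  qed
  have lip: "norm (C w - C b') \<le> 3 * Bc / (\<delta>1 / 2) * dist b' w"
  proof (rule bounded_holomorphic_lipschitz)
   show "C holomorphic_on ball b' (\<delta>1 / 2)" by (rule holomorphic_on_subset[OF hC]) (use db \<delta>1 in auto)
   show "norm (C z) \<le> Bc" if "z \<in> ball b' (\<delta>1 / 2)" for z using Bc[of z] db that by auto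
   show "dist b' w < \<delta>1 / 2 / 2" using dist_triangle[of b' w b] w(2) b'(2) \<delta>2(4) by (auto simp: dist_commute)
  qed (use \<delta>1 in simp)
  have "norm (F w) ^ N = d ^ N * (norm (F w) / d) ^ N" using d_pos by (simp add: power_divide)
  also have "\<dots> \<le> d ^ N * (norm (C w - C b') / d) ^ 2" using decay[OF w b'] d_pos by (intro mult_left_mono) auto
  also have "\<dots> \<le> d ^ N * (3 * Bc / (\<delta>1 / 2) * dist b' w / d) ^ 2"
   using lip d_pos by (intro mult_left_mono power_mono divide_right_mono) auto
  also have "\<dots> = K2 * dist b' w ^ 2" by (simp add: K2_def power_mult_distrib power_divide)
  finally show ?thesis .
 qed
 have K2: "K2 \<ge> 0" using d_pos by (simp add: K2_def)
 define \<delta>3 where "\<delta>3 = \<delta>2 / 3"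
 have \<delta>3: "\<delta>3 > 0" "\<delta>3 < \<delta>2" "\<delta>3 < \<delta>0" using \<delta>2 \<delta>1 by (auto simp: \<delta>3_def)
 \<comment> \<open>At every point outside \<open>Om\<close>, on the frontier or not, the quadratic
   bound gives the extension the derivative 0.\<close>
 define \<phi> where "\<phi> = (%w. if w \<in> Om then F w ^ N else 0)"
 have \<phi>b: "norm (\<phi> w) \<le> K2 * dist w z ^ 2" if wz: "z \<notin> Om" "z \<in> ball b \<delta>3" "w \<in> ball b \<delta>3" for w z
 proof (cases "w \<in> Om")
  case True
  have "closed_segment w z \<inter> Om ~= {}" "closed_segment w z - Om ~= {}" using True wz by auto
  hence "closed_segment w z \<inter> frontier Om ~= {}" by (rule connected_Int_frontier[OF connected_segment(1)])
  then obtain b' where b': "b' \<in> closed_segment w z" "b' \<in> frontier Om" by blast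
  have "closed_segment w z \<subseteq> ball b \<delta>3" by (rule closed_segment_subset[OF wz(3,2) convex_ball])
  hence b'2: "b' \<in> ball b \<delta>2" using b'(1) \<delta>3 by auto
  have "norm (\<phi> w) = norm (F w) ^ N" using True by (simp add: \<phi>_def norm_power)
  also have "\<dots> \<le> K2 * dist b' w ^ 2" by (rule decay2[OF True _ b'(2) b'2]) (use wz(3) \<delta>3 in auto)
  also have "\<dots> \<le> K2 * dist w z ^ 2"
   using K2 dist_in_closed_segment[OF b'(1)] by (intro mult_left_mono power_mono) (auto simp: dist_commute)
  finally show ?thesis .
 qed (use K2 in \<open>simp add: \<phi>_def\<close>)
 have \<phi>h: "\<phi> holomorphic_on ball b \<delta>3"
  unfolding holomorphic_on_open[OF open_ball]
 proof
  fix z assume z: "z \<in> ball b \<delta>3"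
  show "\<exists>f'. (\<phi> has_field_derivative f') (at z)"
  proof (cases "z \<in> Om")
   case True
   have o: "open (Om \<inter> ball b \<delta>0)" by (intro open_Int open_Om open_ball)
   have "F holomorphic_on Om \<inter> ball b \<delta>0" unfolding F_def
    by (rule holomorphic_on_compose_gen[OF holomorphic_on_subset[OF hC] hol_f, unfolded o_def]) (use CO in auto)
   hence "(%w. F w ^ N) holomorphic_on Om \<inter> ball b \<delta>0" by (intro holomorphic_intros)
   hence "\<phi> holomorphic_on Om \<inter> ball b \<delta>0" by (rule holomorphic_transform) (simp add: \<phi>_def)
   from holomorphic_derivI[OF this o, of z] True z \<delta>3 show ?thesis by auto
  next
   case False
   have "((%w. (\<phi> w - \<phi> z) / (w - z)) \<longlongrightarrow> 0) (at z)"
   proof (rule Lim_null_comparison)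
    have "\<forall>\<^sub>F w in at z. w \<in> ball b \<delta>3" using z by (intro eventually_at_in_open') auto
    moreover have "\<forall>\<^sub>F w in at z. w ~= z" by (rule eventually_neq_at_within)
    ultimately show "\<forall>\<^sub>F w in at z. norm ((\<phi> w - \<phi> z) / (w - z)) \<le> K2 * norm (w - z)"
    proof eventually_elim
     case (elim w)
     have "norm (\<phi> w) \<le> K2 * norm (w - z) * norm (w - z)"
      using \<phi>b[OF False z elim(1)] by (simp add: dist_norm power2_eq_square mult.assoc)
     thus ?case using elim(2) False by (simp add: \<phi>_def norm_divide divide_le_eq)
    qed
    have "((%w. K2 * norm (w - z)) \<longlongrightarrow> K2 * norm (z - z)) (at z)" by (intro tendsto_intros)
    thus "((%w. K2 * norm (w - z)) \<longlongrightarrow> 0) (at z)" by simp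
   qed
   thus ?thesis unfolding has_field_derivative_iff by blast
  qed
 qed
 obtain wb where wb: "wb \<in> Om" "wb \<in> ball b \<delta>3" using near[OF \<delta>3(1)] by blast
 have b3: "b \<in> ball b \<delta>3" using \<delta>3 by simp
 have bnO: "b \<notin> Om" by (rule fr_nO[OF b(1)])
 have \<phi>0: "\<phi> b = 0" using bnO by (simp add: \<phi>_def)
 have \<phi>w: "\<phi> wb ~= 0" using wb(1) Fw(2)[OF wb(1)] by (simp add: \<phi>_def)
 obtain r where r: "r > 0" "ball b r \<subseteq> ball b \<delta>3" "!!z. z \<in> ball b r - {b} ==> \<phi> z ~= 0"
  by (rule isolated_zeros[OF \<phi>h open_ball connected_ball b3 \<phi>0 wb(2) \<phi>w]) (rule that)
 have rO: "z \<in> Om" if "z \<in> ball b r" "z ~= b" for z using r(3)[of z] that by (auto simp: \<phi>_def split: if_splits)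
 have eI: "\<exists>\<rho>'>0. ball e \<rho>' \<subseteq> C ` ball b s" if s: "0 < s" "s \<le> r" for s
 proof -
  have "ball b s \<subseteq> ball b r" using s by (intro subset_ball) simp
  also have "\<dots> \<subseteq> ball b \<delta>3" by (rule r(2))
  also have "\<dots> \<subseteq> ball b \<delta>0" using \<delta>3 by (intro subset_ball) simp
  finally have "ball b s \<subseteq> ball b \<delta>0" .
  hence "open (C ` ball b s)" by (intro Copen open_ball)
  moreover have "e \<in> C ` ball b s" using Cb s(1) by (intro image_eqI[of _ _ b]) auto
  ultimately show ?thesis using openE by blast
 qed
 have "e \<in> D"
 proof -
  obtain \<rho>' where \<rho>': "\<rho>' > 0" "ball e \<rho>' \<subseteq> C ` ball b r" using eI[OF r(1) order_refl] by blast
  have sub: "ball e \<rho>' - {e} \<subseteq> D"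
  proof
   fix y assume y: "y \<in> ball e \<rho>' - {e}"
   then obtain w where w: "w \<in> ball b r" "y = C w" using \<rho>'(2) by blast
   have "w ~= b" using y w(2) Cb by auto
   thus "y \<in> D" using CO[OF rO[OF w(1)]] w(2) by simp
  qed
  have "(f \<longlongrightarrow> 0) (at e)"
  proof (rule tendstoI)
   fix \<epsilon> :: real assume \<epsilon>: "\<epsilon> > 0"
   have "isCont \<phi> b" using holomorphic_on_imp_continuous_on[OF \<phi>h] b3 continuous_on_eq_continuous_at[OF open_ball] by blast
   then obtain s0 where s0: "s0 > 0" "!!w. dist w b < s0 ==> dist (\<phi> w) 0 < \<epsilon> ^ N"
    using \<epsilon> unfolding continuous_at_eps_delta \<phi>0 by (metis zero_less_power)
   define s where "s = min s0 r"
   have s: "0 < s" "s \<le> r" "s \<le> s0" using s0 r by (auto simp: s_def)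
   obtain \<rho>2 where \<rho>2: "\<rho>2 > 0" "ball e \<rho>2 \<subseteq> C ` ball b s" using eI[OF s(1,2)] by blast
   have "\<forall>\<^sub>F y in at e. y \<in> ball e \<rho>2" using \<rho>2(1) by (intro eventually_at_in_open') auto
   moreover have "\<forall>\<^sub>F y in at e. y ~= e" by (rule eventually_neq_at_within)
   ultimately show "\<forall>\<^sub>F y in at e. dist (f y) 0 < \<epsilon>"
   proof eventually_elim
    case (elim y)
    then obtain w where w: "w \<in> ball b s" "y = C w" using \<rho>2(2) by blast
    have wnb: "w ~= b" using elim(2) w(2) Cb by auto
    have wr: "w \<in> ball b r" using w(1) s by auto
    have "norm (F w) ^ N < \<epsilon> ^ N"
     using s0(2)[of w] w(1) s rO[OF wr wnb] by (simp add: \<phi>_def norm_power dist_commute)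
    hence "norm (F w) < \<epsilon>" by (rule power_less_imp_less_base) (use \<epsilon> in simp)
    thus ?case by (simp add: w(2) F_def)
   qed
  qed
  from complete[OF \<rho>'(1) sub this] show ?thesis .
 qed
 thus False using b(4) by (simp add: e_def)
qed

end

context puncture_complete
begin

text \<open>\<open>Om\<close> is the part of the interior of the parameter set that lies in the
  domain. If the orbit of a frontier parameter survived \<open>q\<close> steps, the cycles would
  converge to a cycle and \<open>cycles_interior\<close> would make the parameter interior. So the
  orbit exits, and \<open>escape_impossible\<close> applies.\<close>

theorem no_persistent_cycles:
 assumes c: "c \<in> closure D" and q: "q \<ge> 1" and \<kappa>: "\<kappa> ^ p = 1" "p \<ge> (1::nat)" and s: "s > 0" "ball c s \<subseteq> cycles q \<kappa>"
 shows False
proof -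
 define Om where "Om = interior (cycles q \<kappa>) \<inter> D"
 have neu: "neutral_or_attr \<kappa>" using root_of_unity_neutral[of \<kappa> 1 \<kappa> p] \<kappa> by simp
 have sing: "(\<forall>n. orb w n w) \<and> inj (%n. it w n w)" if wc: "w \<in> closure D" "w \<in> cycles q \<kappa>" for w
 proof -
  obtain aa where "cyc w q aa \<kappa>" using wc(2) by (auto simp: cycles_def)
  from wc(1) this neu show ?thesis by (rule singular_orbit) blast
 qed
 have Om: "w \<in> closure D" "w \<in> cycles q \<kappa>" if "w \<in> Om" for w
  using that closure_subset[of D] interior_subset[of "cycles q \<kappa>"] by (auto simp: Om_def)
 have cint: "c \<in> interior (cycles q \<kappa>)" using s by (intro interiorI[OF open_ball]) auto
 hence "c \<in> cycles q \<kappa>" using interior_subset by blast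
 hence "orb c 1 c" using sing[OF c] by blast
 hence cO: "c \<in> Om" using cint by (simp add: Om_def orb_def)
 have "escaping D f d Om q"
 proof unfold_locales
  show oO: "open Om" unfolding Om_def by (intro open_Int open_interior open_D)
  show "Om ~= {}" using cO by blast
  show "orb w n w" if "w \<in> Om" for w n using sing[OF Om[OF that]] by blast
  show "inj (%n. it w n w)" if "w \<in> Om" for w using sing[OF Om[OF that]] by blast
  fix b assume b: "b \<in> frontier Om"
  have bO: "b \<notin> Om" and bc: "b \<in> closure Om" using b oO by (auto simp: frontier_def interior_open)
  have nq: "\<not> orb b q b"
  proof
   assume o: "orb b q b"
   hence bD: "b \<in> D" using q by (auto simp: orb_def)
   obtain x where x: "!!n. x n \<in> Om" "x \<longlonglongrightarrow> b" using bc unfolding closure_sequential by blast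
   have "b \<in> interior (cycles q \<kappa>)"
    by (rule cycles_interior[OF \<kappa> bD o x(2)]) (use Om(2)[OF x(1)] x(1) bO in \<open>blast, metis\<close>)
   thus False using bO bD by (simp add: Om_def)
  qed
  define i where "i = (LEAST j. it b j b \<notin> D)"
  obtain j where j: "j < q" "it b j b \<notin> D" using nq by (auto simp: orb_def)
  have "it b i b \<notin> D" unfolding i_def by (rule LeastI[of "%j. it b j b \<notin> D", OF j(2)])
  moreover have "i < q" unfolding i_def using Least_le[of "%j. it b j b \<notin> D", OF j(2)] j(1) by simp
  moreover have "orb b i b" unfolding orb_def i_def using not_less_Least by blast
  ultimately show "\<exists>i<q. orb b i b \<and> it b i b \<notin> D" by blast
 qed
 then interpret escaping D f d Om q .
 show False by (rule escape_impossible)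
qed

end

subsection \<open>Dependence on the parameter\<close>

context lifting_family
begin

text \<open>The velocity, as the parameter moves, of the n-th iterate of a point with initial
  velocity \<beta>. Along a cycle this is the recursion in \<open>tangent\<close>.\<close>

primrec pder :: "complex => complex => complex => nat => complex" where
 "pder c z \<beta> 0 = \<beta>"
| "pder c z \<beta> (Suc n) = deriv f (it c n z) * pder c z \<beta> n + 1"

lemma it_param_deriv:
 assumes "orb c n (\<alpha> c)" "(\<alpha> has_field_derivative \<beta>) (at c)"
 shows "((%w. it w n (\<alpha> w)) has_field_derivative pder c (\<alpha> c) \<beta> n) (at c)"
 using assms(1)
proof (induction n)
 case (Suc n)
 hence o: "orb c n (\<alpha> c)" "it c n (\<alpha> c) \<in> D" by (auto simp: orb_Suc)
 have "((%w. f (it w n (\<alpha> w)) + w) has_field_derivative deriv f (it c n (\<alpha> c)) * pder c (\<alpha> c) \<beta> n + 1) (at c)"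
  by (intro DERIV_add DERIV_ident DERIV_chain2[where f = f] f_deriv o Suc.IH)
 thus ?case by (simp only: it_Suc pder.simps)
qed (use assms(2) in simp)

text \<open>The product rule in logarithmic form, so that on a cycle the sum becomes the one in
  \<open>tangent\<close>.\<close>

lemma Dit_param_deriv:
 assumes "orb c n (\<alpha> c)" "(\<alpha> has_field_derivative \<beta>) (at c)" "!!j. deriv f (it c j (\<alpha> c)) ~= 0"
 shows "((%w. Dit w n (\<alpha> w)) has_field_derivative
  Dit c n (\<alpha> c) * (\<Sum>j<n. deriv (deriv f) (it c j (\<alpha> c)) / deriv f (it c j (\<alpha> c)) * pder c (\<alpha> c) \<beta> j)) (at c)"
 using assms(1)
proof (induction n)
 case (Suc n)
 hence o: "orb c n (\<alpha> c)" "it c n (\<alpha> c) \<in> D" by (auto simp: orb_Suc)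
 have d2: "(deriv f has_field_derivative deriv (deriv f) (it c n (\<alpha> c))) (at (it c n (\<alpha> c)))"
  by (rule holomorphic_derivI[OF hol_f' open_D o(2)])
 note d = DERIV_mult[OF Suc.IH[OF o(1)] DERIV_chain2[OF d2 it_param_deriv[OF o(1) assms(2)]]]
 show ?case unfolding Dit_Suc
  by (rule DERIV_cong[OF d]) (use assms(3)[of n] in \<open>simp add: field_simps\<close>)
qed simp

lemma pder_periodic:
 assumes cy: "cyc c q aa \<kappa>" and p: "pder c (aa m) \<beta> q = \<beta>"
 shows "pder c (aa m) \<beta> (n + q) = pder c (aa m) \<beta> n"
proof (induction n)
 case (Suc n)
 have "it c (n + q) (aa m) = it c n (aa m)"
  using cyc_it[OF cy, of _ m] cyc_per[OF cy, of "m + n"] by (simp add: add.assoc)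
 thus ?case using Suc by simp
qed (use p in simp)

text \<open>The orbit of \<open>c\<close> may be out of phase with the given indexing. All data are
  shifted by the phase \<open>s\<close>; the sum over a period is unaffected.\<close>

lemma tangent_cycle_persists:
 assumes c: "c \<in> closure D" and cy: "cyc c q aa \<kappa>" and \<kappa>: "neutral_or_attr \<kappa>"
  and \<beta>: "!!n. \<beta> (n + q) = \<beta> n" "!!n. \<beta> (Suc n) = deriv f (aa n) * \<beta> n + 1"
  and tg: "\<kappa> = 1 \<or> (\<Sum>j<q. deriv (deriv f) (aa j) / deriv f (aa j) * \<beta> j) = 0"
 shows "\<exists>s>0. ball c s \<subseteq> cycles q \<kappa>" "\<not> norm \<kappa> < 1"
proof -
 obtain s where s: "(%n. it c n c - aa (n + s)) \<longlonglongrightarrow> 0" by (rule singular_orbit[OF c cy \<kappa>]) (rule that)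
 interpret A: aligned_cycle D f d c q "%n. aa (n + s)" \<kappa>
  by unfold_locales (use c cyc_shift[OF cy, of s] \<kappa> s in auto)
 have aper: "aa (n + q) = aa n" for n by (rule cyc_per[OF cy])
 have "A.tangent (%n. \<beta> (n + s))"
  unfolding A.tangent_def
 proof (intro conjI allI)
  show "\<beta> (n + q + s) = \<beta> (n + s)" for n using \<beta>(1)[of "n + s"] by (simp add: add.commute add.left_commute)
  show "\<beta> (Suc n + s) = deriv f (aa (n + s)) * \<beta> (n + s) + 1" for n using \<beta>(2)[of "n + s"] by simp
  have "(\<Sum>j<q. A.bb j * \<beta> (j + s)) = (\<Sum>j<q. (%j. deriv (deriv f) (aa j) / deriv f (aa j) * \<beta> j) (s + j))"
   unfolding A.bb_def by (intro sum.cong) (auto simp: add.commute)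
  also have "\<dots> = (\<Sum>j<q. deriv (deriv f) (aa j) / deriv f (aa j) * \<beta> j)"
   by (rule sum_periodic_shift) (simp add: aper \<beta>(1))
  finally show "\<kappa> = 1 \<or> (\<Sum>j<q. A.bb j * \<beta> (j + s)) = 0" using tg by auto
 qed
 note tan = this
 obtain r where "r > 0" "!!w. w \<in> ball c r ==> \<exists>bb. cyc w q bb \<kappa>" by (rule A.tangent_persists[OF tan]) (rule that)
 thus "\<exists>s>0. ball c s \<subseteq> cycles q \<kappa>" unfolding cycles_def by blast
 show "\<not> norm \<kappa> < 1" using A.attracting_not_tangent[OF _ tan] by blast
qed

end

subsection \<open>Coverings\<close>

lemma open_diameter_strict:
 fixes S :: "complex set"
 assumes S: "open S" and d: "d > 0" and le: "!!x y. x \<in> S ==> y \<in> S ==> norm (x - y) \<le> d" and x: "x \<in> S" and y: "y \<in> S"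
 shows "norm (x - y) < d"
proof (cases "x = y")
 case False
 obtain e where e: "e > 0" "ball x e \<subseteq> S" using openE[OF S x] by blast
 define t where "t = norm (x - y)"
 have t: "t > 0" using False by (simp add: t_def)
 define p where "p = x + of_real (e / 2 / t) * (x - y)"
 have "norm (of_real (e / 2 / t) * (x - y)) = e / 2"
  unfolding norm_mult norm_of_real t_def[symmetric] using t e by simp
 hence "p \<in> S" using e by (intro subsetD[OF e(2)]) (simp add: p_def dist_norm)
 hence "norm (p - y) \<le> d" using le y by blast
 moreover have "p - y = of_real (1 + e / 2 / t) * (x - y)" by (simp add: p_def algebra_simps)
 moreover have "norm (of_real (1 + e / 2 / t) * (x - y)) = t + e / 2"
 proof -
  have "1 + e / 2 / t > 0" using t e by (simp add: add_pos_pos)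
  hence "norm (of_real (1 + e / 2 / t) * (x - y)) = (1 + e / 2 / t) * t" unfolding norm_mult t_def norm_of_real by simp
  thus ?thesis using t by (simp add: distrib_right)
 qed
 ultimately show ?thesis using e by (simp add: t_def)
qed (use d in simp)

lemma covering_convex_lift:
 fixes f :: "complex => complex" and u :: "complex => complex"
 assumes cov: "covering_space E f B" and C: "convex C" and u: "continuous_on C u" "u ` C \<subseteq> B"
  and z: "z0 \<in> C" "x0 \<in> E" "f x0 = u z0"
 obtains g where "continuous_on C g" "g ` C \<subseteq> E" "g z0 = x0" "!!y. y \<in> C ==> f (g y) = u y"
proof -
 obtain g where "continuous_on C g" "g \<in> C \<rightarrow> E" "g z0 = x0" "!!y. y \<in> C ==> f (g y) = u y"
  by (rule covering_space_lift_strong[OF cov z(2,1) convex_imp_simply_connected[OF C] convex_imp_locally_path_connected[OF C] u(1) _ z(3)[symmetric]])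
   (use u(2) in \<open>auto intro: that\<close>)
 thus thesis using that by (auto simp: image_subset_iff_funcset)
qed

locale class_F_map =
 fixes D V :: "complex set" and f :: "complex => complex"
 assumes F: "class_F D V f" and ne: "D ~= {}"
begin

abbreviation dm :: real where "dm \<equiv> diameter D"

lemma hol: "f holomorphic_on D" and opD: "open D" and bdD: "bounded D" and opV: "open V"
 and cov: "covering_space (D - {0}) f (V - {0})" and ballV: "ball 0 dm \<subseteq> V" and fD: "f ` D \<subseteq> V"
 using F by (auto simp: class_F_def)

lemma dist_le: "x \<in> D ==> y \<in> D ==> norm (x - y) \<le> dm"
 using diameter_bounded_bound[OF bdD, of x y] by (simp add: dist_norm)

lemma dm_pos: "dm > 0"
proof -
 obtain x where x: "x \<in> D" using ne by blast
 obtain e where e: "e > 0" "ball x e \<subseteq> D" using openE[OF opD x] by blast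
 have "x + of_real (e / 2) \<in> D" using e by (intro subsetD[OF e(2)]) (simp add: dist_norm)
 from dist_le[OF this x] e show ?thesis by simp
qed

lemma f_nonzero: "x \<in> D ==> x ~= 0 ==> f x ~= 0"
 using covering_space_imp_surjective[OF cov] by blast

lemma small_ball: assumes "y \<in> V" "y ~= 0" obtains r where "r > 0" "ball y r \<subseteq> V - {0}"
proof -
 have "open (V - {0})" using opV by (rule open_delete)
 thus thesis using openE[of "V - {0}" y] assms that by blast
qed

text \<open>A section of the covering over a small disc has open image by invariance of domain, and
  \<open>f\<close> is injective on that image.\<close>

lemma deriv_f_nonzero:
 assumes x: "x \<in> D" "x ~= 0" shows "deriv f x ~= 0"
proof -
 have fx: "f x \<in> V" "f x ~= 0" using x f_nonzero fD by auto
 obtain r where r: "r > 0" "ball (f x) r \<subseteq> V - {0}" by (rule small_ball[OF fx])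
 obtain v where v: "continuous_on (ball (f x) r) v" "v ` ball (f x) r \<subseteq> D - {0}" "v (f x) = x" "!!y. y \<in> ball (f x) r ==> f (v y) = y"
  by (rule covering_convex_lift[OF cov convex_ball continuous_on_id, of "f x" r "f x" x]) (use r x in \<open>auto intro: that\<close>)
 have inj: "inj_on v (ball (f x) r)" by (rule inj_on_inverseI[of _ f]) (rule v(4))
 have "open (v ` ball (f x) r)" by (rule invariance_of_domain[OF v(1) open_ball inj])
 moreover have "inj_on f (v ` ball (f x) r)" by (rule inj_onI) (use v(4) in auto)
 moreover have "x \<in> v ` ball (f x) r" using v(3) r(1) by (metis centre_in_ball imageI)
 moreover have "f holomorphic_on v ` ball (f x) r" by (rule holomorphic_on_subset[OF hol]) (use v(2) in auto)
 ultimately show ?thesis using holomorphic_injective_imp_regular by blast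
qed

text \<open>Were \<open>f 0\<close> nonzero, a section over a disc about it would, by uniqueness of
  lifts, invert \<open>f\<close> on a punctured neighbourhood of 0. By continuity its value at
  \<open>f 0\<close> would be 0, but it maps into \<open>D - {0}\<close>.\<close>

lemma f_zero: assumes D0: "0 \<in> D" shows "f 0 = 0"
proof (rule ccontr)
 assume y0: "f 0 ~= 0"
 have y0V: "f 0 \<in> V" using D0 fD by auto
 obtain r where r: "r > 0" "ball (f 0) r \<subseteq> V - {0}" by (rule small_ball[OF y0V y0])
 have "continuous_on D f" by (rule holomorphic_on_imp_continuous_on[OF hol])
 hence "open (f -` ball (f 0) r \<inter> D)" using continuous_on_open_vimage[OF opD] by blast
 moreover have "0 \<in> f -` ball (f 0) r \<inter> D" using r D0 by simp
 ultimately obtain s where s: "s > 0" "ball 0 s \<subseteq> f -` ball (f 0) r \<inter> D" by (rule openE)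
 define P where "P = ball (0::complex) s - {0}"
 have conP: "connected P" unfolding P_def by (rule connected_open_delete) auto
 define x1 where "x1 = complex_of_real (s / 2)"
 have x1: "x1 \<in> P" using s(1) by (simp add: P_def x1_def)
 have PD: "P \<subseteq> D - {0}" "f ` P \<subseteq> ball (f 0) r" using s(2) by (auto simp: P_def)
 obtain v where v: "continuous_on (ball (f 0) r) v" "v ` ball (f 0) r \<subseteq> D - {0}" "v (f x1) = x1" "!!y. y \<in> ball (f 0) r ==> f (v y) = y"
  by (rule covering_convex_lift[OF cov convex_ball continuous_on_id, of "f 0" r "f x1" x1]) (use r x1 PD in \<open>auto intro: that\<close>)
 have fP: "continuous_on P f" by (rule continuous_on_subset[OF holomorphic_on_imp_continuous_on[OF hol]]) (use PD in auto)
 have vf: "v (f x) = x" if x: "x \<in> P" for x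
 proof (rule covering_space_lift_unique[where a = x1 and T = P and f = f and ?g1.0 = "%x. v (f x)" and ?g2.0 = "%x. x", OF cov])
  show "v (f x1) = x1" by (rule v(3))
  show "continuous_on P f" by (rule fP)
  show "f \<in> P \<rightarrow> V - {0}" using PD r(2) by auto
  show "continuous_on P (%x. v (f x))" by (rule continuous_on_compose2[OF v(1) fP PD(2)])
  show "(%x. v (f x)) \<in> P \<rightarrow> D - {0}" using v(2) PD(2) by auto
  show "f x = f (v (f x))" if "x \<in> P" for x using v(4)[of "f x"] PD(2) that by auto
  show "continuous_on P (%x. x)" by (intro continuous_intros)
  show "(%x. x) \<in> P \<rightarrow> D - {0}" using PD by auto
 qed (use conP x1 x in auto)
 have "isCont f 0" using hol opD D0 holomorphic_on_imp_continuous_on continuous_on_eq_continuous_at by blast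
 hence "(f \<longlongrightarrow> f 0) (at 0)" by (simp add: isCont_def)
 moreover have "isCont v (f 0)" using v(1) r(1) continuous_on_eq_continuous_at[OF open_ball] by (metis centre_in_ball)
 ultimately have "((%x. v (f x)) \<longlongrightarrow> v (f 0)) (at 0)" by (intro isCont_tendsto_compose[of "f 0" v])
 moreover have "\<forall>\<^sub>F x in at 0. v (f x) = x"
 proof -
  have "\<forall>\<^sub>F x in at 0. x \<in> ball (0::complex) s" using s(1) by (intro eventually_at_in_open') auto
  moreover have "\<forall>\<^sub>F x in at (0::complex). x ~= 0" by (rule eventually_neq_at_within)
  ultimately show ?thesis by eventually_elim (rule vf, simp add: P_def)
 qed
 ultimately have "((%x. x) \<longlongrightarrow> v (f 0)) (at (0::complex))" by (rule Lim_transform_eventually)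
 hence "v (f 0) = 0" using tendsto_ident_at tendsto_unique at_neq_bot by metis
 thus False using v(2) r(1) by (metis DiffD2 centre_in_ball image_subset_iff singletonI)
qed

text \<open>The lift is topological at first. It is holomorphic because difference quotients of f v
  = u can be divided by f', which does not vanish off 0. The base point is not 0, since
  \<open>f\<close> is 0 there while \<open>u\<close> is not.\<close>

lemma holomorphic_lift:
 assumes C: "convex C" "open C" and u: "u holomorphic_on C" "!!z. z \<in> C ==> u z ~= 0 \<and> norm (u z) < dm"
  and z: "z0 \<in> C" "x0 \<in> D" "f x0 = u z0"
 shows "\<exists>v. v holomorphic_on C \<and> v ` C \<subseteq> D - {0} \<and> v z0 = x0 \<and> (\<forall>z\<in>C. f (v z) = u z)"
proof -
 have x0: "x0 \<in> D - {0}" using z u(2)[OF z(1)] f_zero by auto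
 have uV: "u ` C \<subseteq> V - {0}" using u(2) ballV by (auto simp: subset_iff)
 obtain v where v: "continuous_on C v" "v ` C \<subseteq> D - {0}" "v z0 = x0" "!!y. y \<in> C ==> f (v y) = u y"
  by (rule covering_convex_lift[OF cov C(1) holomorphic_on_imp_continuous_on[OF u(1)] uV z(1) x0 z(3)]) (rule that)
 have "\<exists>v'. (v has_field_derivative v') (at y)" if y: "y \<in> C" for y
 proof -
  have vy: "v y \<in> D" "v y ~= 0" using v(2) y by auto
  have vl: "(v \<longlongrightarrow> v y) (at y)" using v(1) y C(2) continuous_on_eq_continuous_at by (metis isCont_def)
  have "((%x. (f (v x) - f (v y)) / (x - y)) \<longlongrightarrow> deriv u y) (at y)"
  proof (rule Lim_transform_eventually)
   show "((%x. (u x - u y) / (x - y)) \<longlongrightarrow> deriv u y) (at y)"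
    using holomorphic_derivI[OF u(1) C(2) y] by (simp add: has_field_derivative_iff)
   have "\<forall>\<^sub>F x in at y. x \<in> C" using C(2) y by (intro eventually_at_in_open') auto
   thus "\<forall>\<^sub>F x in at y. (u x - u y) / (x - y) = (f (v x) - f (v y)) / (x - y)"
    by eventually_elim (simp add: v(4) y)
  qed
  from strict_derivative_quotient[OF hol opD vy(1) deriv_f_nonzero[OF vy] vl tendsto_const this]
  show ?thesis unfolding has_field_derivative_iff by blast
 qed
 hence "v holomorphic_on C" using C(2) holomorphic_on_open by blast
 thus ?thesis using v by blast
qed

lemma family: "lifting_family D f dm"
proof unfold_locales
 show "norm (x - y) < dm" if "x \<in> D" "y \<in> D" for x y
  by (rule open_diameter_strict[OF opD dm_pos dist_le that])
 fix C u z0 x0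
 assume "convex C" "open C" "u holomorphic_on C" "!!z. z \<in> C ==> u z ~= 0 \<and> norm (u z) < dm"
  "z0 \<in> C" "x0 \<in> D" "f x0 = u z0"
 from holomorphic_lift[OF this] show "\<exists>v. v holomorphic_on C \<and> v ` C \<subseteq> D \<and> v z0 = x0 \<and> (\<forall>z\<in>C. f (v z) = u z)" by blast
qed (use opD hol in auto)

text \<open>Missing isolated points at which \<open>f\<close> tends to 0, possibly 0 among them.
  Adding them changes neither the closure nor the diameter of \<open>D\<close>.\<close>

definition punct :: "complex set" where
 "punct = {e. e \<notin> D \<and> (\<exists>r>0. ball e r - {e} \<subseteq> D) \<and> (f \<longlongrightarrow> 0) (at e)}"

definition fill :: "complex => complex" where "fill x = (if x \<in> punct then 0 else f x)"

lemma punctE: assumes "e \<in> punct" obtains r where "r > 0" "ball e r - {e} \<subseteq> D" "(f \<longlongrightarrow> 0) (at e)" "e \<notin> D"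
 using assms unfolding punct_def by blast

lemma fill_D [simp]: "x \<in> D ==> fill x = f x" by (auto simp: fill_def punct_def)

lemma fill_open: "open (D \<union> punct)"
 unfolding open_contains_ball
proof
 fix x assume "x \<in> D \<union> punct"
 thus "\<exists>e>0. ball x e \<subseteq> D \<union> punct"
 proof
  assume x: "x \<in> D"
  obtain r where "r > 0" "ball x r \<subseteq> D" by (rule openE[OF opD x])
  thus ?thesis by (intro exI[of _ r]) auto
 next
  assume x: "x \<in> punct"
  then obtain r where "r > 0" "ball x r - {x} \<subseteq> D" by (rule punctE)
  thus ?thesis using x by (intro exI[of _ r]) auto
 qed
qed

lemma fill_removable:
 assumes r: "r > 0" and h: "\<phi> holomorphic_on ball e r - {e}" and l: "(\<phi> \<longlongrightarrow> 0) (at e)" and e: "\<phi> e = 0"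
 shows "\<phi> holomorphic_on ball e r"
proof (rule no_isolated_singularity[of "ball e r" \<phi> "{e}"])
 have "isCont \<phi> z" if z: "z \<in> ball e r" for z
 proof (cases "z = e")
  case True
  thus ?thesis using l e by (simp add: isCont_def)
 next
  case False
  have "open (ball e r - {e})" by (intro open_delete open_ball)
  thus ?thesis using False z holomorphic_on_imp_continuous_on[OF h] continuous_on_eq_continuous_at by blast
 qed
 thus "continuous_on (ball e r) \<phi>" by (simp add: continuous_at_imp_continuous_on)
qed (use h in auto)

lemma fill_holomorphic: "fill holomorphic_on D \<union> punct"
 unfolding holomorphic_on_open[OF fill_open]
proof
 fix x assume "x \<in> D \<union> punct"
 thus "\<exists>f'. (fill has_field_derivative f') (at x)"
 proof
  assume x: "x \<in> D"
  have "fill holomorphic_on D" using hol by (rule holomorphic_transform) simp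
  thus ?thesis using holomorphic_derivI[OF _ opD x] by blast
 next
  assume x: "x \<in> punct"
  obtain r where r: "r > 0" "ball x r - {x} \<subseteq> D" "(f \<longlongrightarrow> 0) (at x)" "x \<notin> D" by (rule punctE[OF x])
  have ev: "\<forall>\<^sub>F y in at x. f y = fill y"
  proof -
   have "\<forall>\<^sub>F y in at x. y \<in> ball x r" using r(1) by (intro eventually_at_in_open') auto
   moreover have "\<forall>\<^sub>F y in at x. y ~= x" by (rule eventually_neq_at_within)
   ultimately show ?thesis by eventually_elim (use r(2) in auto)
  qed
  have "fill holomorphic_on ball x r"
  proof (rule fill_removable[OF r(1)])
   show "fill holomorphic_on ball x r - {x}"
    using holomorphic_on_subset[OF hol r(2)] by (rule holomorphic_transform) (use r(2) in auto)
   show "(fill \<longlongrightarrow> 0) (at x)" by (rule Lim_transform_eventually[OF r(3) ev])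
   show "fill x = 0" using x by (simp add: fill_def)
  qed
  thus ?thesis using holomorphic_derivI[OF _ open_ball, of fill x r x] r(1) by auto
 qed
qed

lemma fill_closure: "D \<union> punct \<subseteq> closure D"
proof
 fix x assume "x \<in> D \<union> punct"
 thus "x \<in> closure D"
 proof
  assume x: "x \<in> punct"
  obtain r where r: "r > 0" "ball x r - {x} \<subseteq> D" by (rule punctE[OF x])
  show ?thesis unfolding closure_approachable
  proof (intro allI impI)
   fix e :: real assume e: "e > 0"
   define y where "y = x + of_real (min e r / 2)"
   have "dist y x = min e r / 2" using e r by (simp add: y_def dist_norm del: of_real_divide)
   moreover have "y ~= x" using e r by (simp add: y_def)
   ultimately show "\<exists>y\<in>D. dist y x < e" using e r by (intro bexI[of _ y] subsetD[OF r(2)]) (auto simp: dist_commute)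
  qed
 qed (use closure_subset in blast)
qed

lemma fill_dist: "x \<in> D \<union> punct ==> y \<in> D \<union> punct ==> norm (x - y) \<le> dm"
proof -
 assume "x \<in> D \<union> punct" "y \<in> D \<union> punct"
 hence "x \<in> closure D" "y \<in> closure D" using fill_closure by auto
 hence "dist x y \<le> diameter (closure D)" by (intro diameter_bounded_bound bounded_closure bdD)
 thus ?thesis by (simp add: diameter_closure bdD dist_norm)
qed

text \<open>Lifts are taken in the original domain, where the covering lives; a base point in
  \<open>punct\<close> cannot occur because \<open>fill\<close> is 0 there. For completeness:
  punctures near \<open>e\<close> are zeros of \<open>fill\<close>, hence isolated, so a smaller
  punctured disc lies in \<open>D\<close> and \<open>e\<close> has been filled already.\<close>

lemma filled_family: "puncture_complete (D \<union> punct) fill dm"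
proof unfold_locales
 show "open (D \<union> punct)" by (rule fill_open)
 show "fill holomorphic_on D \<union> punct" by (rule fill_holomorphic)
 show "norm (x - y) < dm" if "x \<in> D \<union> punct" "y \<in> D \<union> punct" for x y
  by (rule open_diameter_strict[OF fill_open dm_pos fill_dist that])
next
 fix C u z0 x0
 assume A: "convex C" "open C" "u holomorphic_on C" "!!z. z \<in> C ==> u z ~= 0 \<and> norm (u z) < dm"
  "z0 \<in> C" "x0 \<in> D \<union> punct" "fill x0 = u z0"
 have "x0 \<notin> punct" using A(4)[OF A(5)] A(7) by (auto simp: fill_def)
 hence x0: "x0 \<in> D" "f x0 = u z0" using A(6,7) by auto
 from holomorphic_lift[OF A(1-5) x0] obtain v where "v holomorphic_on C" "v ` C \<subseteq> D - {0}" "v z0 = x0" "\<forall>z\<in>C. f (v z) = u z" by blast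
 moreover from this have "\<forall>z\<in>C. fill (v z) = u z" by (auto simp: image_subset_iff)
 ultimately show "\<exists>v. v holomorphic_on C \<and> v ` C \<subseteq> D \<union> punct \<and> v z0 = x0 \<and> (\<forall>z\<in>C. fill (v z) = u z)" by blast
next
 fix e r assume r: "(r :: real) > 0" and sub: "ball e r - {e} \<subseteq> D \<union> punct" and l: "(fill \<longlongrightarrow> 0) (at e)"
 show "e \<in> D \<union> punct"
 proof (rule ccontr)
  assume ne: "e \<notin> D \<union> punct"
  define \<phi> where "\<phi> = (%z. if z = e then 0 else fill z)"
  have ph: "\<phi> holomorphic_on ball e r"
  proof (rule fill_removable[OF r])
   show "\<phi> holomorphic_on ball e r - {e}"
    using holomorphic_on_subset[OF fill_holomorphic sub] by (rule holomorphic_transform) (simp add: \<phi>_def)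
   show "(\<phi> \<longlongrightarrow> 0) (at e)"
    by (rule Lim_transform_eventually[OF l]) (simp add: \<phi>_def eventually_at_filter)
  qed (simp add: \<phi>_def)
  have e0: "e \<in> ball e r" "\<phi> e = 0" using r by (auto simp: \<phi>_def)
  have "\<exists>z\<in>ball e r. \<phi> z ~= 0"
  proof (rule ccontr)
   assume "\<not> ?thesis"
   hence z: "!!z. z \<in> ball e r ==> \<phi> z = 0" by blast
   have "open (ball e r - {e} - {0})" by (intro open_delete open_ball)
   have "infinite (ball e r)" using islimpt_UNIV[of e] r by (simp add: islimpt_eq_infinite_ball)
   hence "infinite (ball e r - {e} - {0})" by simp
   then obtain x where x: "x \<in> ball e r - {e} - {0}" using infinite_imp_nonempty by blast
   hence "x \<in> closure D" using sub fill_closure by auto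
   have "open (ball e r - {e} - {0})" by fact
   with x \<open>x \<in> closure D\<close> obtain y where y: "y \<in> D" "y \<in> ball e r - {e} - {0}"
    using open_Int_closure_eq_empty[of "ball e r - {e} - {0}" D] by blast
   hence "f y = 0" using z[of y] by (simp add: \<phi>_def)
   thus False using f_nonzero[OF y(1)] y(2) by simp
  qed
  then obtain zz where zz: "zz \<in> ball e r" "\<phi> zz ~= 0" by blast
  obtain r' where r': "r' > 0" "ball e r' \<subseteq> ball e r" "!!z. z \<in> ball e r' - {e} ==> \<phi> z ~= 0"
   by (rule isolated_zeros[OF ph open_ball connected_ball e0 zz]) (rule that)
  have rD: "ball e r' - {e} \<subseteq> D"
  proof
   fix z assume z: "z \<in> ball e r' - {e}"
   hence "fill z ~= 0" using r'(3)[OF z] by (simp add: \<phi>_def)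
   moreover have "z \<in> D \<union> punct" using z r'(2) sub by auto
   ultimately show "z \<in> D" by (auto simp: fill_def)
  qed
  have "(f \<longlongrightarrow> 0) (at e)"
  proof (rule Lim_transform_eventually[OF l])
   have "\<forall>\<^sub>F y in at e. y \<in> ball e r'" using r'(1) by (intro eventually_at_in_open') auto
   moreover have "\<forall>\<^sub>F y in at e. y ~= e" by (rule eventually_neq_at_within)
   ultimately show "\<forall>\<^sub>F y in at e. fill y = f y" by eventually_elim (use rD in auto)
  qed
  thus False using ne rD r'(1) by (auto simp: punct_def)
 qed
qed

end

subsection \<open>Transversality\<close>

lemma is_cycle_iterate:
 assumes "is_cycle D g q a" "m < q"
 shows "a (Suc m mod q) = g (a m)" "a m \<in> D"
 using assms by (auto simp: is_cycle_def)

theorem theorem2p1: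
  fixes D V :: "complex set" and f :: "complex \<Rightarrow> complex" and c1 \<kappa> :: complex
    and q :: nat and a :: "nat \<Rightarrow> complex"
  assumes "class_F D V f"
    and "c1 \<in> closure D"
    and "is_cycle D (G f c1) q a"
    and "\<kappa> = multiplier (G f c1) q (a 0)"
    and "attracting \<kappa> \<or> parabolic \<kappa>"
    and "\<kappa> \<noteq> 0"
  shows "(\<forall>n\<ge>1. (G f c1 ^^ (n - 1)) c1 \<in> D)
    \<and> (\<lambda>n. infdist ((G f c1 ^^ (n - 1)) c1) (a ` {..<q})) \<longlonglongrightarrow> 0
    \<and> (\<kappa> \<noteq> 1 \<longrightarrow>
         (\<exists>U \<alpha>. periodic_continuation D f c1 q (a 0) U \<alpha>) \<and>
         (\<forall>U \<alpha>. periodic_continuation D f c1 q (a 0) U \<alpha> \<longrightarrow>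
            deriv (\<lambda>w. multiplier (G f w) q (\<alpha> w)) c1 \<noteq> 0))
    \<and> (\<kappa> = 1 \<longrightarrow> (\<forall>j<q. Q f c1 q (a j) \<noteq> 0))"
proof -
 have q: "q \<ge> 1" and inja: "inj_on a {..<q}" using assms(3) by (auto simp: is_cycle_def)
 have "a 0 \<in> D" using is_cycle_iterate(2)[OF assms(3), of 0] q by simp
 then interpret F: class_F_map D V f by unfold_locales (use assms(1) in auto)
 interpret L: lifting_family D f F.dm by (rule F.family)
 \<comment> \<open>The original family \<open>L\<close> produces the cycles; the filled family
   \<open>P\<close> serves for the final contradiction. Cycles of \<open>L\<close> are cycles of
   \<open>P\<close> because \<open>fill\<close> agrees with \<open>f\<close> on the open set
   \<open>D\<close>.\<close>
 interpret P: puncture_complete "D \<union> F.punct" F.fill F.dm by (rule F.filled_family)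
 define aa where "aa = (%n. a (n mod q))"
 have aaD: "aa n \<in> D" for n unfolding aa_def by (rule is_cycle_iterate(2)[OF assms(3)]) (use q in simp)
 have aaS: "aa (Suc n) = f (aa n) + c1" for n
 proof -
  have "n mod q < q" using q by simp
  from is_cycle_iterate(1)[OF assms(3) this] show ?thesis by (simp add: aa_def G_def mod_Suc_eq)
 qed
 have aaP: "aa (n + q) = aa n" for n by (simp add: aa_def)
 have ita: "L.it c1 j (aa m) = aa (m + j)" for j m
  by (induction j) (auto simp: aaS L.it_Suc simp del: funpow.simps(2))
 have orba: "L.orb c1 n (aa m)" for n m using aaD by (simp add: L.orb_def ita)
 have Dk: "L.Dit c1 q (aa 0) = \<kappa>"
 proof -
  have "aa 0 = a 0" using q by (simp add: aa_def)
  thus ?thesis using L.deriv_it[OF orba[of q 0]] assms(4) by (simp add: multiplier_def)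
 qed
 have injaa: "inj_on aa {..<q}"
 proof (rule inj_onI)
  fix x y assume "x \<in> {..<q}" "y \<in> {..<q}" "aa x = aa y"
  thus "x = y" using inja by (auto simp: aa_def dest: inj_onD)
 qed
 have cy: "L.cyc c1 q aa \<kappa>" using q aaD aaS aaP injaa Dk by (simp add: L.cyc_def)
 have neu: "L.neutral_or_attr \<kappa>"
  using assms(5,6) by (auto simp: L.neutral_or_attr_def attracting_def parabolic_def)
 have aa0: "aa 0 = a 0" using q by (simp add: aa_def)
 have rng: "range aa = a ` {..<q}"
 proof -
  have "aa ` {..<q} = a ` {..<q}" by (intro image_cong) (auto simp: aa_def)
  thus ?thesis using L.cyc_range(1)[OF cy] by simp
 qed
 obtain s where sing: "!!n. L.orb c1 n c1" "(%n. L.it c1 n c1 - aa (n + s)) \<longlonglongrightarrow> 0"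
  by (rule L.singular_orbit[OF assms(2) cy neu]) (rule that)
 have CD: "L.it c1 n c1 \<in> D" for n using sing(1)[of "Suc n"] by (simp add: L.orb_def)
 have conv: "(%n. infdist (L.it c1 n c1) (a ` {..<q})) \<longlonglongrightarrow> 0"
 proof (rule Lim_null_comparison)
  show "\<forall>\<^sub>F n in sequentially. norm (infdist (L.it c1 n c1) (a ` {..<q})) \<le> norm (L.it c1 n c1 - aa (n + s))"
  proof (rule always_eventually, rule allI)
   fix n
   have "aa (n + s) \<in> a ` {..<q}" unfolding rng[symmetric] by (rule rangeI)
   from infdist_le[OF this, of "L.it c1 n c1"]
   show "norm (infdist (L.it c1 n c1) (a ` {..<q})) \<le> norm (L.it c1 n c1 - aa (n + s))"
    by (simp add: infdist_nonneg dist_norm)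
  qed
  show "(%n. norm (L.it c1 n c1 - aa (n + s))) \<longlonglongrightarrow> 0" by (rule tendsto_norm_zero[OF sing(2)])
 qed
 have dfa: "deriv f (aa n) ~= 0" for n
 proof
  assume "deriv f (aa n) = 0"
  hence "L.Dit c1 q (aa n) = 0" using q unfolding L.Dit_def by (intro prod_zero) (auto intro!: bexI[of _ 0])
  thus False using L.cyc_Dit_shift[OF cy, of n] assms(6) by simp
 qed
 \<comment> \<open>A tangent variation yields a disc of parameters having cycles of multiplier
   \<kappa>, and excludes that \<kappa> is attracting; so \<kappa> is a root of unity and
   \<open>no_persistent_cycles\<close> applies.\<close>
 have transversal: False
  if \<beta>: "!!n. \<beta> (n + q) = \<beta> n" "!!n. \<beta> (Suc n) = deriv f (aa n) * \<beta> n + 1"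
   and tg: "\<kappa> = 1 \<or> (\<Sum>j<q. deriv (deriv f) (aa j) / deriv f (aa j) * \<beta> j) = 0" for \<beta>
 proof -
  note T = L.tangent_cycle_persists[OF assms(2) cy neu \<beta> tg]
  obtain r where r: "r > 0" "ball c1 r \<subseteq> L.cycles q \<kappa>" using T(1) by blast
  have "\<exists>p\<ge>1. \<kappa> ^ p = 1" using neu T(2) by (auto simp: L.neutral_or_attr_def)
  then obtain p :: nat where p: "p \<ge> 1" "\<kappa> ^ p = 1" by blast
  have fd: "deriv F.fill x = deriv f x" if "x \<in> D" for x
   by (rule complex_derivative_transform_within_open[OF _ _ F.opD that])
    (use F.hol holomorphic_on_subset[OF F.fill_holomorphic, of D] in auto)
  have "L.cycles q \<kappa> \<subseteq> P.cycles q \<kappa>"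
  proof
   fix w assume "w \<in> L.cycles q \<kappa>"
   then obtain bb where b: "L.cyc w q bb \<kappa>" by (auto simp: L.cycles_def)
   have bD: "bb n \<in> D" "bb (Suc n) = f (bb n) + w" for n using b by (auto simp: L.cyc_def)
   have itP: "P.it w j (bb 0) = bb j" for j
    by (induction j) (auto simp: P.it_Suc bD simp del: funpow.simps(2))
   have "P.Dit w q (bb 0) = L.Dit w q (bb 0)"
    using L.cyc_it[OF b, of _ 0] by (simp add: P.Dit_def L.Dit_def itP fd bD(1))
   hence "P.cyc w q bb \<kappa>" using b bD by (auto simp: L.cyc_def P.cyc_def)
   thus "w \<in> P.cycles q \<kappa>" by (auto simp: P.cycles_def)
  qed
  moreover have "c1 \<in> closure (D \<union> F.punct)" using assms(2) closure_mono[of D "D \<union> F.punct"] by blast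
  ultimately show False using P.no_persistent_cycles[of c1 q \<kappa> p r] q p r by blast
 qed
 show ?thesis
 proof (intro conjI impI allI)
  show "(G f c1 ^^ (n - 1)) c1 \<in> D" for n by (rule CD)
  show "(%n. infdist ((G f c1 ^^ (n - 1)) c1) (a ` {..<q})) \<longlonglongrightarrow> 0"
   using conv by (subst filterlim_sequentially_Suc[symmetric]) simp
 next
  assume k1: "\<kappa> ~= 1"
  have fx: "L.it c1 q (aa 0) = aa 0" using ita[of q 0] aaP[of 0] by simp
  obtain r s' \<alpha> where A: "s' > 0" "\<alpha> holomorphic_on ball c1 s'" "\<alpha> c1 = aa 0"
   "!!w. w \<in> ball c1 s' ==> \<alpha> w \<in> ball (aa 0) r" "!!w z. w \<in> ball c1 s' ==> z \<in> ball (aa 0) r ==> L.orb w q z"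
   "!!w z. w \<in> ball c1 s' ==> z \<in> ball (aa 0) r ==> L.it w q z = z \<longleftrightarrow> z = \<alpha> w"
   by (rule L.cycle_implicit[OF orba fx]) (use Dk k1 in simp, rule that)
  have "(\<forall>j<q. L.it w j (\<alpha> w) \<in> D) \<and> L.it w q (\<alpha> w) = \<alpha> w" if w: "w \<in> ball c1 s'" for w
   using A(5)[OF w A(4)[OF w]] A(6)[OF w A(4)[OF w]] by (simp add: L.orb_def)
  hence "periodic_continuation D f c1 q (a 0) (ball c1 s') \<alpha>"
   using A(1-3) aa0 by (simp add: periodic_continuation_def)
  thus "\<exists>U \<alpha>. periodic_continuation D f c1 q (a 0) U \<alpha>" by blast
  fix U \<alpha> assume pc: "periodic_continuation D f c1 q (a 0) U \<alpha>"
  have U: "open U" "c1 \<in> U" "\<alpha> holomorphic_on U" "\<alpha> c1 = aa 0"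
   and orbU: "!!w. w \<in> U ==> L.orb w q (\<alpha> w)" and fixU: "!!w. w \<in> U ==> L.it w q (\<alpha> w) = \<alpha> w"
   using pc aa0 by (auto simp: periodic_continuation_def L.orb_def)
  show "deriv (%w. multiplier (G f w) q (\<alpha> w)) c1 ~= 0"
  proof
   assume d0: "deriv (%w. multiplier (G f w) q (\<alpha> w)) c1 = 0"
   define \<beta>0 where "\<beta>0 = deriv \<alpha> c1"
   have ad: "(\<alpha> has_field_derivative \<beta>0) (at c1)" unfolding \<beta>0_def by (rule holomorphic_derivI[OF U(3,1,2)])
   have o1: "L.orb c1 n (\<alpha> c1)" for n unfolding U(4) by (rule orba)
   define \<beta> where "\<beta> = L.pder c1 (aa 0) \<beta>0"
   \<comment> \<open>Differentiating the periodicity equation shows that the velocity returns to its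
     initial value after \<open>q\<close> steps, which is the periodicity that
     \<open>tangent\<close> requires.\<close>
   have "((%w. L.it w q (\<alpha> w)) has_field_derivative \<beta> q) (at c1)"
    using L.it_param_deriv[OF o1 ad, of q] by (simp only: U(4) \<beta>_def)
   hence "(\<alpha> has_field_derivative \<beta> q) (at c1)"
    by (rule has_field_derivative_transform_within_open[OF _ U(1,2)]) (rule fixU)
   hence bq: "\<beta> q = \<beta>0" using ad DERIV_unique by blast
   have bper: "\<beta> (n + q) = \<beta> n" for n unfolding \<beta>_def by (rule L.pder_periodic[OF cy bq[unfolded \<beta>_def]])
   have bS: "\<beta> (Suc n) = deriv f (aa n) * \<beta> n + 1" for n using ita[of n 0] by (simp add: \<beta>_def)
   have "((%w. L.Dit w q (\<alpha> w)) has_field_derivative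
     L.Dit c1 q (\<alpha> c1) * (\<Sum>j<q. deriv (deriv f) (L.it c1 j (\<alpha> c1)) / deriv f (L.it c1 j (\<alpha> c1)) * L.pder c1 (\<alpha> c1) \<beta>0 j)) (at c1)"
    by (rule L.Dit_param_deriv[OF o1 ad]) (simp add: U(4) ita dfa)
   hence "((%w. L.Dit w q (\<alpha> w)) has_field_derivative \<kappa> * (\<Sum>j<q. deriv (deriv f) (aa j) / deriv f (aa j) * \<beta> j)) (at c1)"
    by (simp only: U(4) ita Dk \<beta>_def add_0)
   hence "((%w. multiplier (G f w) q (\<alpha> w)) has_field_derivative \<kappa> * (\<Sum>j<q. deriv (deriv f) (aa j) / deriv f (aa j) * \<beta> j)) (at c1)"
    by (rule has_field_derivative_transform_within_open[OF _ U(1,2)]) (simp add: multiplier_def L.deriv_it[OF orbU])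
   hence "\<kappa> * (\<Sum>j<q. deriv (deriv f) (aa j) / deriv f (aa j) * \<beta> j) = 0" using d0 DERIV_imp_deriv by metis
   hence "(\<Sum>j<q. deriv (deriv f) (aa j) / deriv f (aa j) * \<beta> j) = 0" using assms(6) by simp
   with transversal[OF bper bS] show False by blast
  qed
 next
  fix j assume k1: "\<kappa> = 1" and j: "j < q"
  show "Q f c1 q (a j) ~= 0"
  proof
   assume Q0: "Q f c1 q (a j) = 0"
   have aj: "aa j = a j" using j by (simp add: aa_def)
   \<comment> \<open>A fixed starting point has velocity 0, and the vanishing of Q says that the
     velocity is 0 again after one period. This gives a periodic solution of the recursion, based at
     \<open>aa j\<close>.\<close>
   define \<gamma> where "\<gamma> = L.pder c1 (aa j) 0"
   have "((%w. L.it w q ((%_. aa j) w)) has_field_derivative L.pder c1 ((%_. aa j) c1) 0 q) (at c1)"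
    by (rule L.it_param_deriv) (auto intro: orba derivative_intros)
   hence "\<gamma> q = 0" using Q0 by (simp add: Q_def aj \<gamma>_def DERIV_imp_deriv)
   hence gper: "\<gamma> (n + q) = \<gamma> n" for n unfolding \<gamma>_def by (rule L.pder_periodic[OF cy])
   have gS: "\<gamma> (Suc n) = deriv f (aa (j + n)) * \<gamma> n + 1" for n by (simp add: \<gamma>_def ita)
   \<comment> \<open>A shift by - j modulo \<open>q\<close>, written without subtraction, moves the
     base back to \<open>aa 0\<close>.\<close>
   define \<beta> where "\<beta> = (%n. \<gamma> (n + j * (q - 1)))"
   have bper: "\<beta> (n + q) = \<beta> n" for n
   proof -
    have e: "n + q + j * (q - 1) = n + j * (q - 1) + q" by simp
    show ?thesis unfolding \<beta>_def e by (rule gper)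
   qed
   have bS: "\<beta> (Suc n) = deriv f (aa n) * \<beta> n + 1" for n
   proof -
    have e1: "j + (n + j * (q - 1)) = n + j * q" using q by (cases q) auto
    have e2: "aa (n + j * q) = aa n" by (rule periodic_add_mult[of aa q]) (rule aaP)
    show ?thesis by (simp only: \<beta>_def add_Suc gS e1 e2)
   qed
   from transversal[OF bper bS] k1 show False by blast
  qed
 qed
qed

end
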